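(* Given a restriction species $R$, the groupoids $\mathbf{R}_n$ of $R$-structures on finite sets equipped with an $n$-layering, with the structure maps described in the context, form a simplicial groupoid $\mathbf{R}$, which is a decomposition space. Furthermore, a morphism of restriction species $R'\to R$ induces a CULF functor $\mathbf{R}'\to\mathbf{R}$. These assignments define a functor from the category of restriction species to that of decomposition spaces and CULF functors.
   Context: Conventions: functors into groupoids $\mathbf{Grpd}$ (in particular simplicial groupoids $\Delta^{\mathrm{op}}\to\mathbf{Grpd}$) are pseudo-functors, transformations are pseudo-natural, pullbacks are homotopy pullbacks. $\mathbb{I}$ is the category of finite sets and injections. A restriction species is a pseudo-functor $R:\mathbb{I}^{\mathrm{op}}\to\mathbf{Grpd}$ whose values are locally finite groupoids (all automorphism groups finite); morphisms are pseudo-natural transformations. For $B\subset A$ and $X\in R[A]$, $X|B\in R[B]$ is the restriction. $\Delta$ has objects $[n]=\{0,\dots,n\}$. A map $a:[m]\to[n]$ is generic if $a(0)=0$ and $a(m)=n$, and free if $a(i+1)=a(i)+1$ for $0\le i\le m-1$; every map factors uniquely as generic followed by free, and generic and free maps admit pushouts along each other. A decomposition space is a simplicial groupoid sending generic–free pushouts in $\Delta$ to pullbacks. A simplicial map is CULF if its naturality squares on all generic maps are pullbacks. $\underline{\Delta}$ has objects $\underline n=\{1,\dots,n\}$, $n\ge0$, and monotone maps. A generic map $g:[n]\to[m]$ corresponds to $\underline g:\underline m\to\underline n$ sending $j$ to the unique $i$ with $g(i-1)<j\le g(i)$. A free map $f:[n]\to[m]$, $f(i)=i+c$, with $n\ge1$,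 corresponds to $\underline f:\underline n\to\underline m$, $i\mapsto i+c$; every map $[0]\to[m]$ corresponds to $\underline 0\to\underline m$. Given $R$, $\mathbf{R}_n$ is the groupoid of triples $(A,p,X)$ with $A$ a finite set, $p:A\to\underline n$ any function (an $n$-layering) and $X\in R[A]$, with morphisms the isomorphisms of $R$-structures (bijections $A\cong A'$ with an isomorphism of structures over it) whose underlying bijection is over $\underline n$. A generic map $g:[n]\to[m]$ acts by $\mathbf{R}_m\to\mathbf{R}_n$, $(A,p,X)\mapsto(A,\underline g\circ p,X)$; a free map $f:[n]\to[m]$ acts by $\mathbf{R}_m\to\mathbf{R}_n$, $(A,p,X)\mapsto(A',p',X|A')$ where $p':A'\to\underline n$ is the pullback of $p$ along $\underline f$ (so $A'\subset A$). A morphism $\phi:R'\to R$ induces $(A,p,X)\mapsto(A,p,\phi(X))$. *)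

theory Defs
  imports Main "HOL-Library.FuncSet"
begin

section \<open>Categories, functors and groupoids\<close>

text \<open>Categories are given by sets of objects and of arrows inside ambient types.
  \<open>Cmp C g f\<close> is the composite ``first \<open>f\<close>, then \<open>g\<close>''.  Values of the operations outside the
  carriers are unconstrained.\<close>

record ('o, 'm) cat =
  Obj :: "'o set"
  Arr :: "'m set"
  Dom :: "'m \<Rightarrow> 'o"
  Cod :: "'m \<Rightarrow> 'o"
  Ide :: "'o \<Rightarrow> 'm"
  Cmp :: "'m \<Rightarrow> 'm \<Rightarrow> 'm"

definition Hom :: "('o, 'm) cat \<Rightarrow> 'o \<Rightarrow> 'o \<Rightarrow> 'm set" where
  "Hom C x y = {f \<in> Arr C. Dom C f = x \<and> Cod C f = y}"

locale category =
  fixes C :: "('o, 'm) cat"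
  assumes dom_obj: "f \<in> Arr C \<Longrightarrow> Dom C f \<in> Obj C"
    and cod_obj: "f \<in> Arr C \<Longrightarrow> Cod C f \<in> Obj C"
    and ide_hom: "x \<in> Obj C \<Longrightarrow> Ide C x \<in> Hom C x x"
    and cmp_hom: "f \<in> Hom C x y \<Longrightarrow> g \<in> Hom C y z \<Longrightarrow> Cmp C g f \<in> Hom C x z"
    and cmp_ide_right: "f \<in> Hom C x y \<Longrightarrow> Cmp C f (Ide C x) = f"
    and cmp_ide_left: "f \<in> Hom C x y \<Longrightarrow> Cmp C (Ide C y) f = f"
    and cmp_assoc: "f \<in> Hom C w x \<Longrightarrow> g \<in> Hom C x y \<Longrightarrow> h \<in> Hom C y z \<Longrightarrow>
      Cmp C h (Cmp C g f) = Cmp C (Cmp C h g) f"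

definition inverse_arrows :: "('o, 'm) cat \<Rightarrow> 'm \<Rightarrow> 'm \<Rightarrow> bool" where
  "inverse_arrows C f g \<longleftrightarrow>
     f \<in> Arr C \<and> g \<in> Hom C (Cod C f) (Dom C f) \<and>
     Cmp C g f = Ide C (Dom C f) \<and> Cmp C f g = Ide C (Cod C f)"

definition iso :: "('o, 'm) cat \<Rightarrow> 'm \<Rightarrow> bool" where
  "iso C f \<longleftrightarrow> (\<exists>g. inverse_arrows C f g)"

definition inv_arr :: "('o, 'm) cat \<Rightarrow> 'm \<Rightarrow> 'm" where
  "inv_arr C f = (THE g. inverse_arrows C f g)"

locale groupoid = category +
  assumes all_iso: "f \<in> Arr C \<Longrightarrow> iso C f"

definition locally_finite :: "('o, 'm) cat \<Rightarrow> bool" where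
  "locally_finite G \<longleftrightarrow> (\<forall>x \<in> Obj G. finite (Hom G x x))"

text \<open>Functors, and below families of components of transformations, are extensional (equal to
  \<^const>\<open>undefined\<close> outside the carriers), so that HOL equality is equality of functors and of
  transformations.\<close>

record ('o, 'm, 'p, 'q) ftr =
  FO :: "'o \<Rightarrow> 'p"
  FA :: "'m \<Rightarrow> 'q"

definition is_functor :: "('o, 'm) cat \<Rightarrow> ('p, 'q) cat \<Rightarrow> ('o, 'm, 'p, 'q) ftr \<Rightarrow> bool" where
  "is_functor C D F \<longleftrightarrow>
     category C \<and> category D \<and>
     FO F \<in> Obj C \<rightarrow>\<^sub>E Obj D \<and>
     FA F \<in> extensional (Arr C) \<and>
     (\<forall>f \<in> Arr C. FA F f \<in> Hom D (FO F (Dom C f)) (FO F (Cod C f))) \<and>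
     (\<forall>x \<in> Obj C. FA F (Ide C x) = Ide D (FO F x)) \<and>
     (\<forall>f \<in> Arr C. \<forall>g \<in> Arr C. Dom C g = Cod C f \<longrightarrow>
        FA F (Cmp C g f) = Cmp D (FA F g) (FA F f))"

definition id_ftr :: "('o, 'm) cat \<Rightarrow> ('o, 'm, 'o, 'm) ftr" where
  "id_ftr C = \<lparr>FO = (\<lambda>x \<in> Obj C. x), FA = (\<lambda>f \<in> Arr C. f)\<rparr>"

definition comp_ftr ::
  "('o, 'm) cat \<Rightarrow> ('p, 'q, 'r, 's) ftr \<Rightarrow> ('o, 'm, 'p, 'q) ftr \<Rightarrow> ('o, 'm, 'r, 's) ftr" where
  "comp_ftr C G F = \<lparr>FO = compose (Obj C) (FO G) (FO F), FA = compose (Arr C) (FA G) (FA F)\<rparr>"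

definition nat_iso ::
  "('o, 'm) cat \<Rightarrow> ('p, 'q) cat \<Rightarrow> ('o, 'm, 'p, 'q) ftr \<Rightarrow> ('o, 'm, 'p, 'q) ftr \<Rightarrow> ('o \<Rightarrow> 'q) \<Rightarrow> bool"
where
  "nat_iso C D F G \<alpha> \<longleftrightarrow>
     is_functor C D F \<and> is_functor C D G \<and> \<alpha> \<in> extensional (Obj C) \<and>
     (\<forall>x \<in> Obj C. \<alpha> x \<in> Hom D (FO F x) (FO G x) \<and> iso D (\<alpha> x)) \<and>
     (\<forall>f \<in> Arr C. Cmp D (FA G f) (\<alpha> (Dom C f)) = Cmp D (\<alpha> (Cod C f)) (FA F f))"

definition equivalence :: "('o, 'm) cat \<Rightarrow> ('p, 'q) cat \<Rightarrow> ('o, 'm, 'p, 'q) ftr \<Rightarrow> bool" where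
  "equivalence C D F \<longleftrightarrow>
     is_functor C D F \<and>
     (\<exists>G \<eta> \<epsilon>. is_functor D C G \<and>
        nat_iso C C (id_ftr C) (comp_ftr C G F) \<eta> \<and>
        nat_iso D D (comp_ftr D F G) (id_ftr D) \<epsilon>)"

text \<open>An arrow \<open>f\<close> together with its source and target.\<close>

datatype ('x, 'f) arrow = Arrow (src: 'x) (via: 'f) (tgt: 'x)

definition pushout_square :: "('o, 'm) cat \<Rightarrow> 'm \<Rightarrow> 'm \<Rightarrow> 'm \<Rightarrow> 'm \<Rightarrow> bool" where
  "pushout_square C g f f' g' \<longleftrightarrow>
     g \<in> Arr C \<and> f \<in> Arr C \<and> f' \<in> Arr C \<and> g' \<in> Arr C \<and>
     Dom C g = Dom C f \<and> Dom C f' = Cod C g \<and> Dom C g' = Cod C f \<and> Cod C f' = Cod C g' \<and>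
     Cmp C f' g = Cmp C g' f \<and>
     (\<forall>h \<in> Arr C. \<forall>k \<in> Arr C.
        Dom C h = Cod C g \<and> Dom C k = Cod C f \<and> Cod C h = Cod C k \<and> Cmp C h g = Cmp C k f \<longrightarrow>
        (\<exists>!u. u \<in> Hom C (Cod C f') (Cod C h) \<and> Cmp C u f' = h \<and> Cmp C u g' = k))"


section \<open>Homotopy pullbacks of groupoids\<close>

text \<open>The standard homotopy pullback of \<open>F : X \<rightarrow> Z \<leftarrow> Y : G\<close>: objects are triples
  \<open>(x, y, \<zeta> : F x \<rightarrow> G y)\<close>.\<close>

definition iso_comma ::
  "('o1, 'm1) cat \<Rightarrow> ('o2, 'm2) cat \<Rightarrow> ('o3, 'm3) cat \<Rightarrow>
   ('o1, 'm1, 'o3, 'm3) ftr \<Rightarrow> ('o2, 'm2, 'o3, 'm3) ftr \<Rightarrow>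
   ('o1 \<times> 'o2 \<times> 'm3, ('o1 \<times> 'o2 \<times> 'm3, 'm1 \<times> 'm2) arrow) cat" where
  "iso_comma X Y Z F G = (let
     obs = {(x, y, \<zeta>). x \<in> Obj X \<and> y \<in> Obj Y \<and> \<zeta> \<in> Hom Z (FO F x) (FO G y) \<and> iso Z \<zeta>}
   in \<lparr>Obj = obs,
       Arr = {Arrow (x, y, \<zeta>) (a, b) (x', y', \<zeta>') | x y \<zeta> a b x' y' \<zeta>'.
                (x, y, \<zeta>) \<in> obs \<and> (x', y', \<zeta>') \<in> obs \<and> a \<in> Hom X x x' \<and> b \<in> Hom Y y y' \<and>
                Cmp Z \<zeta>' (FA F a) = Cmp Z (FA G b) \<zeta>},
       Dom = src, Cod = tgt,
       Ide = (\<lambda>(x, y, \<zeta>). Arrow (x, y, \<zeta>) (Ide X x, Ide Y y) (x, y, \<zeta>)),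
       Cmp = (\<lambda>v u. Arrow (src u)
                (Cmp X (fst (via v)) (fst (via u)), Cmp Y (snd (via v)) (snd (via u))) (tgt v))\<rparr>)"

definition comparison_ftr ::
  "('o, 'm) cat \<Rightarrow> ('o, 'm, 'o1, 'm1) ftr \<Rightarrow> ('o, 'm, 'o2, 'm2) ftr \<Rightarrow> ('o \<Rightarrow> 'm3) \<Rightarrow>
   ('o, 'm, 'o1 \<times> 'o2 \<times> 'm3, ('o1 \<times> 'o2 \<times> 'm3, 'm1 \<times> 'm2) arrow) ftr" where
  "comparison_ftr P H K \<alpha> = (let ob = (\<lambda>w. (FO H w, FO K w, \<alpha> w)) in
     \<lparr>FO = (\<lambda>w \<in> Obj P. ob w),
      FA = (\<lambda>h \<in> Arr P. Arrow (ob (Dom P h)) (FA H h, FA K h) (ob (Cod P h)))\<rparr>)"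

text \<open>The square with sides \<open>H : P \<rightarrow> X\<close>, \<open>K : P \<rightarrow> Y\<close>, \<open>F : X \<rightarrow> Z\<close>, \<open>G : Y \<rightarrow> Z\<close>, commuting up to
  \<open>\<alpha> : F H \<cong> G K\<close>, is a homotopy pullback.\<close>

definition homotopy_pullback ::
  "('o, 'm) cat \<Rightarrow> ('o1, 'm1) cat \<Rightarrow> ('o2, 'm2) cat \<Rightarrow> ('o3, 'm3) cat \<Rightarrow>
   ('o, 'm, 'o1, 'm1) ftr \<Rightarrow> ('o, 'm, 'o2, 'm2) ftr \<Rightarrow>
   ('o1, 'm1, 'o3, 'm3) ftr \<Rightarrow> ('o2, 'm2, 'o3, 'm3) ftr \<Rightarrow> ('o \<Rightarrow> 'm3) \<Rightarrow> bool" where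
  "homotopy_pullback P X Y Z H K F G \<alpha> \<longleftrightarrow>
     groupoid P \<and> groupoid X \<and> groupoid Y \<and> groupoid Z \<and>
     is_functor P X H \<and> is_functor P Y K \<and> is_functor X Z F \<and> is_functor Y Z G \<and>
     nat_iso P Z (comp_ftr P F H) (comp_ftr P G K) \<alpha> \<and>
     equivalence P (iso_comma X Y Z F G) (comparison_ftr P H K \<alpha>)"


section \<open>Pseudo-functors into groupoids\<close>

text \<open>The data of a pseudo-functor \<open>P\<close> from \<open>C\<^sup>o\<^sup>p\<close> to groupoids.  For \<open>u : b \<rightarrow> c\<close> and \<open>v : c \<rightarrow> d\<close> in
  \<open>C\<close>, \<open>Pull P u\<close> is a functor \<open>Grp P c \<rightarrow> Grp P b\<close>, the unit constraint \<open>Unt P c\<close> goes from the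
  identity to \<open>Pull P (id c)\<close>, and \<open>Cpr P u v x\<close> goes from \<open>Pull P u (Pull P v x)\<close> to
  \<open>Pull P (v u) x\<close>.\<close>

record ('c, 'u, 'o, 'm) psf =
  Grp :: "'c \<Rightarrow> ('o, 'm) cat"
  Pull :: "'u \<Rightarrow> ('o, 'm, 'o, 'm) ftr"
  Unt :: "'c \<Rightarrow> 'o \<Rightarrow> 'm"
  Cpr :: "'u \<Rightarrow> 'u \<Rightarrow> 'o \<Rightarrow> 'm"

locale pseudofunctor = category C
  for C :: "('c, 'u) cat" +
  fixes P :: "('c, 'u, 'o, 'm) psf"
  assumes grp: "c \<in> Obj C \<Longrightarrow> groupoid (Grp P c)"
    and pull: "u \<in> Hom C b c \<Longrightarrow> is_functor (Grp P c) (Grp P b) (Pull P u)"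
    and unt: "c \<in> Obj C \<Longrightarrow>
      nat_iso (Grp P c) (Grp P c) (id_ftr (Grp P c)) (Pull P (Ide C c)) (Unt P c)"
    and cpr: "u \<in> Hom C b c \<Longrightarrow> v \<in> Hom C c d \<Longrightarrow>
      nat_iso (Grp P d) (Grp P b) (comp_ftr (Grp P d) (Pull P u) (Pull P v))
        (Pull P (Cmp C v u)) (Cpr P u v)"
    and unt_left: "u \<in> Hom C b c \<Longrightarrow> x \<in> Obj (Grp P c) \<Longrightarrow>
      Cmp (Grp P b) (Cpr P (Ide C b) u x) (Unt P b (FO (Pull P u) x)) = Ide (Grp P b) (FO (Pull P u) x)"
    and unt_right: "u \<in> Hom C b c \<Longrightarrow> x \<in> Obj (Grp P c) \<Longrightarrow>
      Cmp (Grp P b) (Cpr P u (Ide C c) x) (FA (Pull P u) (Unt P c x)) = Ide (Grp P b) (FO (Pull P u) x)"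
    and cpr_assoc: "u \<in> Hom C b c \<Longrightarrow> v \<in> Hom C c d \<Longrightarrow> w \<in> Hom C d e \<Longrightarrow> x \<in> Obj (Grp P e) \<Longrightarrow>
      Cmp (Grp P b) (Cpr P (Cmp C v u) w x) (Cpr P u v (FO (Pull P w) x)) =
      Cmp (Grp P b) (Cpr P u (Cmp C w v) x) (FA (Pull P u) (Cpr P v w x))"

text \<open>The data of a pseudo-natural transformation \<open>\<phi>\<close> from \<open>P\<close> to \<open>Q\<close>: for \<open>u : b \<rightarrow> c\<close>, the component
  \<open>Cell \<phi> u x\<close> of the naturality isomorphism goes from \<open>\<phi>\<^sub>b (Pull P u x)\<close> to \<open>Pull Q u (\<phi>\<^sub>c x)\<close>.\<close>

record ('c, 'u, 'o, 'm, 'p, 'q) pnt =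
  Cmpt :: "'c \<Rightarrow> ('o, 'm, 'p, 'q) ftr"
  Cell :: "'u \<Rightarrow> 'o \<Rightarrow> 'q"

definition pseudonatural ::
  "('c, 'u) cat \<Rightarrow> ('c, 'u, 'o, 'm) psf \<Rightarrow> ('c, 'u, 'p, 'q) psf \<Rightarrow> ('c, 'u, 'o, 'm, 'p, 'q) pnt \<Rightarrow> bool"
where
  "pseudonatural C P Q \<phi> \<longleftrightarrow>
     pseudofunctor C P \<and> pseudofunctor C Q \<and>
     Cmpt \<phi> \<in> extensional (Obj C) \<and> Cell \<phi> \<in> extensional (Arr C) \<and>
     (\<forall>c \<in> Obj C. is_functor (Grp P c) (Grp Q c) (Cmpt \<phi> c)) \<and>
     (\<forall>b c. \<forall>u \<in> Hom C b c.
        nat_iso (Grp P c) (Grp Q b)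
          (comp_ftr (Grp P c) (Cmpt \<phi> b) (Pull P u)) (comp_ftr (Grp P c) (Pull Q u) (Cmpt \<phi> c))
          (Cell \<phi> u)) \<and>
     (\<forall>c \<in> Obj C. \<forall>x \<in> Obj (Grp P c).
        Cmp (Grp Q c) (Cell \<phi> (Ide C c) x) (FA (Cmpt \<phi> c) (Unt P c x)) =
        Unt Q c (FO (Cmpt \<phi> c) x)) \<and>
     (\<forall>b c d. \<forall>u \<in> Hom C b c. \<forall>v \<in> Hom C c d. \<forall>x \<in> Obj (Grp P d).
        Cmp (Grp Q b) (Cell \<phi> (Cmp C v u) x) (FA (Cmpt \<phi> b) (Cpr P u v x)) =
        Cmp (Grp Q b) (Cpr Q u v (FO (Cmpt \<phi> d) x))
          (Cmp (Grp Q b) (FA (Pull Q u) (Cell \<phi> v x)) (Cell \<phi> u (FO (Pull P v) x))))"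

definition pnt_id :: "('c, 'u) cat \<Rightarrow> ('c, 'u, 'o, 'm) psf \<Rightarrow> ('c, 'u, 'o, 'm, 'o, 'm) pnt" where
  "pnt_id C P =
     \<lparr>Cmpt = (\<lambda>c \<in> Obj C. id_ftr (Grp P c)),
      Cell = (\<lambda>u \<in> Arr C. \<lambda>x \<in> Obj (Grp P (Cod C u)). Ide (Grp P (Dom C u)) (FO (Pull P u) x))\<rparr>"

text \<open>The composite of \<open>\<phi>\<close> from \<open>P\<close> to \<open>Q\<close> with \<open>\<psi>\<close> from \<open>Q\<close> to \<open>S\<close>.\<close>

definition pnt_comp ::
  "('c, 'u) cat \<Rightarrow> ('c, 'u, 'o, 'm) psf \<Rightarrow> ('c, 'u, 'r, 's) psf \<Rightarrow>
   ('c, 'u, 'p, 'q, 'r, 's) pnt \<Rightarrow> ('c, 'u, 'o, 'm, 'p, 'q) pnt \<Rightarrow> ('c, 'u, 'o, 'm, 'r, 's) pnt" where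
  "pnt_comp C P S \<psi> \<phi> =
     \<lparr>Cmpt = (\<lambda>c \<in> Obj C. comp_ftr (Grp P c) (Cmpt \<psi> c) (Cmpt \<phi> c)),
      Cell = (\<lambda>u \<in> Arr C. \<lambda>x \<in> Obj (Grp P (Cod C u)).
        Cmp (Grp S (Dom C u)) (Cell \<psi> u (FO (Cmpt \<phi> (Cod C u)) x))
          (FA (Cmpt \<psi> (Dom C u)) (Cell \<phi> u x)))\<rparr>"

text \<open>The category whose objects are the \<open>P\<close> satisfying \<open>ob\<close> and whose arrows are the \<open>\<phi>\<close>
  satisfying \<open>mor P Q \<phi>\<close>.\<close>

definition psf_cat ::
  "('c, 'u) cat \<Rightarrow> (('c, 'u, 'o, 'm) psf \<Rightarrow> bool) \<Rightarrow>
   (('c, 'u, 'o, 'm) psf \<Rightarrow> ('c, 'u, 'o, 'm) psf \<Rightarrow> ('c, 'u, 'o, 'm, 'o, 'm) pnt \<Rightarrow> bool) \<Rightarrow>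
   (('c, 'u, 'o, 'm) psf, (('c, 'u, 'o, 'm) psf, ('c, 'u, 'o, 'm, 'o, 'm) pnt) arrow) cat" where
  "psf_cat C ob mor =
     \<lparr>Obj = {P. ob P},
      Arr = {Arrow P \<phi> Q | P \<phi> Q. ob P \<and> ob Q \<and> mor P Q \<phi>},
      Dom = src, Cod = tgt,
      Ide = (\<lambda>P. Arrow P (pnt_id C P) P),
      Cmp = (\<lambda>g f. Arrow (src f) (pnt_comp C (src f) (tgt g) (via g) (via f)) (tgt g))\<rparr>"


section \<open>Restriction species\<close>

text \<open>Finite sets and injections.  The finite sets are the finite subsets of an arbitrary ambient
  type \<open>'u\<close>; for infinite \<open>'u\<close> every finite set is isomorphic to one of them.\<close>

definition fin_inj :: "('u set, ('u set, 'u \<Rightarrow> 'u) arrow) cat" where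
  "fin_inj =
     \<lparr>Obj = {A. finite A},
      Arr = {Arrow A f B | A f B. finite A \<and> finite B \<and> f \<in> A \<rightarrow>\<^sub>E B \<and> inj_on f A},
      Dom = src, Cod = tgt,
      Ide = (\<lambda>A. Arrow A (\<lambda>x \<in> A. x) A),
      Cmp = (\<lambda>g f. Arrow (src f) (compose (src f) (via g) (via f)) (tgt g))\<rparr>"

type_synonym ('u, 'o, 'm) species = "('u set, ('u set, 'u \<Rightarrow> 'u) arrow, 'o, 'm) psf"

definition restriction_species :: "('u, 'o, 'm) species \<Rightarrow> bool" where
  "restriction_species R \<longleftrightarrow>
     pseudofunctor fin_inj R \<and> (\<forall>A \<in> Obj fin_inj. locally_finite (Grp R A))"

definition species_morphism ::
  "('u, 'o, 'm) species \<Rightarrow> ('u, 'p, 'q) species \<Rightarrow>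
   ('u set, ('u set, 'u \<Rightarrow> 'u) arrow, 'o, 'm, 'p, 'q) pnt \<Rightarrow> bool" where
  "species_morphism R' R \<phi> \<longleftrightarrow>
     restriction_species R' \<and> restriction_species R \<and> pseudonatural fin_inj R' R \<phi>"

abbreviation RSp ::
  "(('u, 'o, 'm) species,
    (('u, 'o, 'm) species, ('u set, ('u set, 'u \<Rightarrow> 'u) arrow, 'o, 'm, 'o, 'm) pnt) arrow) cat" where
  "RSp \<equiv> psf_cat fin_inj restriction_species species_morphism"

definition incl :: "'u set \<Rightarrow> 'u set \<Rightarrow> ('u set, 'u \<Rightarrow> 'u) arrow" where
  "incl B A = Arrow B (\<lambda>x \<in> B. x) A"


section \<open>Decomposition spaces and CULF maps\<close>

text \<open>The object \<open>[n] = {0,\<dots>,n}\<close> of the simplex category is represented by \<open>n\<close>.\<close>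

type_synonym delta_arr = "(nat, nat \<Rightarrow> nat) arrow"

definition Delta :: "(nat, delta_arr) cat" where
  "Delta =
     \<lparr>Obj = UNIV,
      Arr = {Arrow m a n | m a n. a \<in> {0..m} \<rightarrow>\<^sub>E {0..n} \<and> mono_on {0..m} a},
      Dom = src, Cod = tgt,
      Ide = (\<lambda>n. Arrow n (\<lambda>i \<in> {0..n}. i) n),
      Cmp = (\<lambda>b a. Arrow (src a) (compose {0..src a} (via b) (via a)) (tgt b))\<rparr>"

definition generic :: "delta_arr \<Rightarrow> bool" where
  "generic a \<longleftrightarrow> a \<in> Arr Delta \<and> via a 0 = 0 \<and> via a (src a) = tgt a"

definition free :: "delta_arr \<Rightarrow> bool" where
  "free a \<longleftrightarrow> a \<in> Arr Delta \<and> (\<forall>i < src a. via a (i + 1) = via a i + 1)"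

text \<open>The generic-free factorization of \<open>a\<close> is \<open>Cmp Delta (free_part a) (generic_part a)\<close>.\<close>

definition generic_part :: "delta_arr \<Rightarrow> delta_arr" where
  "generic_part a =
     Arrow (src a) (\<lambda>i \<in> {0..src a}. via a i - via a 0) (via a (src a) - via a 0)"

definition free_part :: "delta_arr \<Rightarrow> delta_arr" where
  "free_part a = (let k = via a (src a) - via a 0 in
     Arrow k (\<lambda>i \<in> {0..k}. i + via a 0) (tgt a))"

type_synonym ('o, 'm) spsf = "(nat, delta_arr, 'o, 'm) psf"

abbreviation simplicial_groupoid :: "('o, 'm) spsf \<Rightarrow> bool" where
  "simplicial_groupoid S \<equiv> pseudofunctor Delta S"

text \<open>If \<open>f' g = g' f\<close>, the canonical isomorphism from \<open>S g (S f' x)\<close> to \<open>S f (S g' x)\<close>.\<close>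

definition square_iso ::
  "('o, 'm) spsf \<Rightarrow> delta_arr \<Rightarrow> delta_arr \<Rightarrow> delta_arr \<Rightarrow> delta_arr \<Rightarrow> 'o \<Rightarrow> 'm" where
  "square_iso S g f f' g' = (\<lambda>x \<in> Obj (Grp S (tgt f')).
     Cmp (Grp S (src g)) (inv_arr (Grp S (src g)) (Cpr S f g' x)) (Cpr S g f' x))"

definition decomposition_space :: "('o, 'm) spsf \<Rightarrow> bool" where
  "decomposition_space S \<longleftrightarrow>
     simplicial_groupoid S \<and>
     (\<forall>g f f' g'. generic g \<and> free f \<and> pushout_square Delta g f f' g' \<longrightarrow>
        homotopy_pullback (Grp S (tgt f')) (Grp S (tgt g)) (Grp S (tgt f)) (Grp S (src g))
          (Pull S f') (Pull S g') (Pull S g) (Pull S f) (square_iso S g f f' g'))"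

definition culf ::
  "('o, 'm) spsf \<Rightarrow> ('p, 'q) spsf \<Rightarrow> (nat, delta_arr, 'o, 'm, 'p, 'q) pnt \<Rightarrow> bool" where
  "culf S T \<phi> \<longleftrightarrow>
     pseudonatural Delta S T \<phi> \<and>
     (\<forall>g. generic g \<longrightarrow>
        homotopy_pullback (Grp S (tgt g)) (Grp S (src g)) (Grp T (tgt g)) (Grp T (src g))
          (Pull S g) (Cmpt \<phi> (tgt g)) (Cmpt \<phi> (src g)) (Pull T g) (Cell \<phi> g))"

abbreviation Dcmp ::
  "(('o, 'm) spsf, (('o, 'm) spsf, (nat, delta_arr, 'o, 'm, 'o, 'm) pnt) arrow) cat" where
  "Dcmp \<equiv> psf_cat Delta decomposition_space culf"


section \<open>The simplicial groupoid of layered structures\<close>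

type_synonym ('u, 'o) lobj = "'u set \<times> ('u \<Rightarrow> nat) \<times> 'o"
type_synonym ('u, 'o, 'm) larr = "(('u, 'o) lobj, ('u \<Rightarrow> 'u) \<times> 'm) arrow"

text \<open>An arrow \<open>(A, p, X) \<rightarrow> (B, q, Y)\<close> is a bijection \<open>\<sigma> : A \<rightarrow> B\<close> over \<open>{1..n}\<close> together with an
  isomorphism \<open>X \<rightarrow> R[\<sigma>] Y\<close> in \<open>R[A]\<close>.\<close>

definition layers :: "('u, 'o, 'm) species \<Rightarrow> nat \<Rightarrow> (('u, 'o) lobj, ('u, 'o, 'm) larr) cat" where
  "layers R n = (let
     obs = {(A, p, X). finite A \<and> p \<in> A \<rightarrow>\<^sub>E {1..n} \<and> X \<in> Obj (Grp R A)}
   in \<lparr>Obj = obs,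
       Arr = {Arrow (A, p, X) (\<sigma>, h) (B, q, Y) | A p X \<sigma> h B q Y.
                (A, p, X) \<in> obs \<and> (B, q, Y) \<in> obs \<and>
                \<sigma> \<in> extensional A \<and> bij_betw \<sigma> A B \<and> (\<forall>x \<in> A. q (\<sigma> x) = p x) \<and>
                h \<in> Hom (Grp R A) X (FO (Pull R (Arrow A \<sigma> B)) Y)},
       Dom = src, Cod = tgt,
       Ide = (\<lambda>(A, p, X). Arrow (A, p, X) (\<lambda>x \<in> A. x, Unt R A X) (A, p, X)),
       Cmp = (\<lambda>v u. case (u, v) of
                (Arrow (A, p, X) (\<sigma>, h) (B, q, Y), Arrow (B', q', Y') (\<tau>, k) (D, r, Z)) \<Rightarrow>
                  Arrow (A, p, X)
                    (compose A \<tau> \<sigma>,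
                     Cmp (Grp R A) (Cpr R (Arrow A \<sigma> B) (Arrow B \<tau> D) Z)
                       (Cmp (Grp R A) (FA (Pull R (Arrow A \<sigma> B)) k) h))
                    (D, r, Z))\<rparr>)"

text \<open>The map \<open>{1..m} \<rightarrow> {1..n}\<close> corresponding to a generic map \<open>g : [n] \<rightarrow> [m]\<close>.\<close>

definition under_generic :: "delta_arr \<Rightarrow> nat \<Rightarrow> nat" where
  "under_generic g j = (THE i. i \<in> {1..src g} \<and> via g (i - 1) < j \<and> j \<le> via g i)"

definition generic_act ::
  "('u, 'o, 'm) species \<Rightarrow> delta_arr \<Rightarrow>
   (('u, 'o) lobj, ('u, 'o, 'm) larr, ('u, 'o) lobj, ('u, 'o, 'm) larr) ftr" where
  "generic_act R g = (let
     ob = (\<lambda>(A, p, X). (A, compose A (under_generic g) p, X))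
   in \<lparr>FO = (\<lambda>x \<in> Obj (layers R (tgt g)). ob x),
       FA = (\<lambda>h \<in> Arr (layers R (tgt g)). Arrow (ob (src h)) (via h) (ob (tgt h)))\<rparr>)"

text \<open>For a free map \<open>f : [n] \<rightarrow> [m]\<close> with underlying map \<open>i \<mapsto> i + f 0\<close> from \<open>{1..n}\<close> to \<open>{1..m}\<close>,
  the pullback of \<open>p : A \<rightarrow> {1..m}\<close>.\<close>

definition free_set :: "delta_arr \<Rightarrow> 'u set \<Rightarrow> ('u \<Rightarrow> nat) \<Rightarrow> 'u set" where
  "free_set f A p = {x \<in> A. \<exists>i \<in> {1..src f}. p x = i + via f 0}"

definition free_layering :: "delta_arr \<Rightarrow> 'u set \<Rightarrow> ('u \<Rightarrow> nat) \<Rightarrow> 'u \<Rightarrow> nat" where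
  "free_layering f A p = (\<lambda>x \<in> free_set f A p. p x - via f 0)"

text \<open>An arrow \<open>(\<sigma>, h) : (A, p, X) \<rightarrow> (B, q, Y)\<close> restricts to
  \<open>(\<sigma>', X|A' \<rightarrow> (R[\<sigma>] Y)|A' \<cong> R[\<sigma>'] (Y|B'))\<close>, where \<open>\<sigma>' : A' \<rightarrow> B'\<close> is the restriction of \<open>\<sigma>\<close>.\<close>

definition free_act ::
  "('u, 'o, 'm) species \<Rightarrow> delta_arr \<Rightarrow>
   (('u, 'o) lobj, ('u, 'o, 'm) larr, ('u, 'o) lobj, ('u, 'o, 'm) larr) ftr" where
  "free_act R f = (let
     ob = (\<lambda>(A, p, X).
       (free_set f A p, free_layering f A p, FO (Pull R (incl (free_set f A p) A)) X))
   in \<lparr>FO = (\<lambda>x \<in> Obj (layers R (tgt f)). ob x),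
       FA = (\<lambda>t \<in> Arr (layers R (tgt f)). case t of
         Arrow (A, p, X) (\<sigma>, h) (B, q, Y) \<Rightarrow> (let
             A' = free_set f A p; B' = free_set f B q; \<sigma>' = restrict \<sigma> A'
           in Arrow (ob (A, p, X))
                (\<sigma>', Cmp (Grp R A') (inv_arr (Grp R A') (Cpr R (Arrow A' \<sigma>' B') (incl B' B) Y))
                       (Cmp (Grp R A') (Cpr R (incl A' A) (Arrow A \<sigma> B) Y)
                         (FA (Pull R (incl A' A)) h)))
                (ob (B, q, Y))))\<rparr>)"

text \<open>An arbitrary map acts through its generic-free factorization.  Generic maps act without
  changing the structure, whereas an identity map regarded as free would replace \<open>X\<close> by the merely
  isomorphic \<open>X|A = R[id] X\<close>; hence the case distinction.\<close>

definition layers_pull ::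
  "('u, 'o, 'm) species \<Rightarrow> delta_arr \<Rightarrow>
   (('u, 'o) lobj, ('u, 'o, 'm) larr, ('u, 'o) lobj, ('u, 'o, 'm) larr) ftr" where
  "layers_pull R a =
     (if generic a then generic_act R a
      else comp_ftr (layers R (tgt a)) (generic_act R (generic_part a)) (free_act R (free_part a)))"

text \<open>An arrow \<open>k : X \<rightarrow> Y\<close> of \<open>R[A]\<close> as an arrow \<open>(A, p, X) \<rightarrow> (A, p, Y)\<close> over the identity.\<close>

definition lift_arr ::
  "('u, 'o, 'm) species \<Rightarrow> 'u set \<Rightarrow> ('u \<Rightarrow> nat) \<Rightarrow> 'o \<Rightarrow> 'm \<Rightarrow> 'o \<Rightarrow> ('u, 'o, 'm) larr" where
  "lift_arr R A p X k Y =
     Arrow (A, p, X) (\<lambda>x \<in> A. x, Cmp (Grp R A) (Unt R A Y) k) (A, p, Y)"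

text \<open>The canonical isomorphism from the structure underlying \<open>layers_pull R a (A, p, X)\<close> to \<open>X|A'\<close>,
  where \<open>A' = free_set (free_part a) A p\<close>.  For generic \<open>a\<close> one has \<open>A' = A\<close>.\<close>

definition to_restriction ::
  "('u, 'o, 'm) species \<Rightarrow> delta_arr \<Rightarrow> ('u, 'o) lobj \<Rightarrow> 'm" where
  "to_restriction R a = (\<lambda>(A, p, X). let A' = free_set (free_part a) A p in
     if generic a then Unt R A X else Ide (Grp R A') (FO (Pull R (incl A' A)) X))"

text \<open>The composition constraint for \<open>a : [l] \<rightarrow> [m]\<close> and \<open>b : [m] \<rightarrow> [n]\<close>: over the identity of the
  common underlying set \<open>A''\<close> it is the isomorphism \<open>X|A'|A'' \<cong> X|A''\<close> of \<open>R\<close>, conjugated by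
  \<^const>\<open>to_restriction\<close>.\<close>

definition layers_cpr ::
  "('u, 'o, 'm) species \<Rightarrow> delta_arr \<Rightarrow> delta_arr \<Rightarrow> ('u, 'o) lobj \<Rightarrow> ('u, 'o, 'm) larr" where
  "layers_cpr R a b = (\<lambda>w \<in> Obj (layers R (tgt b)).
     case (w, FO (layers_pull R b) w, FO (layers_pull R a) (FO (layers_pull R b) w),
           FO (layers_pull R (Cmp Delta b a)) w) of
       ((A, p, X), (A', p', X'), (A'', p'', X''), (_, _, Y)) \<Rightarrow>
         lift_arr R A'' p'' X''
           (Cmp (Grp R A'') (inv_arr (Grp R A'') (to_restriction R (Cmp Delta b a) w))
             (Cmp (Grp R A'') (Cpr R (incl A'' A') (incl A' A) X)
               (Cmp (Grp R A'') (FA (Pull R (incl A'' A')) (to_restriction R b w))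
                 (to_restriction R a (A', p', X')))))
           Y)"

text \<open>Since the identity of \<open>[n]\<close> is generic and acts as the identity, the unit constraint is
  trivial.\<close>

definition layered :: "('u, 'o, 'm) species \<Rightarrow> (('u, 'o) lobj, ('u, 'o, 'm) larr) spsf" where
  "layered R =
     \<lparr>Grp = layers R, Pull = layers_pull R,
      Unt = (\<lambda>n. \<lambda>x \<in> Obj (layers R n). Ide (layers R n) x),
      Cpr = layers_cpr R\<rparr>"

text \<open>The simplicial map induced by \<open>\<phi>\<close>.  Its naturality isomorphisms are identities on generic maps
  and \<open>\<phi> (X|A') \<cong> (\<phi> X)|A'\<close> on the others.\<close>

definition layered_map ::
  "('u, 'o, 'm) species \<Rightarrow> ('u, 'p, 'q) species \<Rightarrow>
   ('u set, ('u set, 'u \<Rightarrow> 'u) arrow, 'o, 'm, 'p, 'q) pnt \<Rightarrow>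
   (nat, delta_arr, ('u, 'o) lobj, ('u, 'o, 'm) larr, ('u, 'p) lobj, ('u, 'p, 'q) larr) pnt" where
  "layered_map R' R \<phi> = (let
     ob = (\<lambda>(A, p, X). (A, p, FO (Cmpt \<phi> A) X))
   in \<lparr>Cmpt = (\<lambda>n.
         \<lparr>FO = (\<lambda>x \<in> Obj (layers R' n). ob x),
          FA = (\<lambda>t \<in> Arr (layers R' n). case t of
            Arrow (A, p, X) (\<sigma>, h) (B, q, Y) \<Rightarrow>
              Arrow (ob (A, p, X))
                (\<sigma>, Cmp (Grp R A) (Cell \<phi> (Arrow A \<sigma> B) Y) (FA (Cmpt \<phi> A) h))
                (ob (B, q, Y)))\<rparr>),
       Cell = (\<lambda>a \<in> Arr Delta. \<lambda>w \<in> Obj (layers R' (tgt a)).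
         case (w, FO (layers_pull R' a) w, FO (layers_pull R a) (ob w)) of
           ((A, p, X), (A', p', X'), (_, _, Y)) \<Rightarrow>
             lift_arr R A' p' (FO (Cmpt \<phi> A') X')
               (if generic a then Ide (Grp R A) (FO (Cmpt \<phi> A) X) else Cell \<phi> (incl A' A) X)
               Y)\<rparr>)"

definition layering_ftr ::
  "(('u, 'o, 'm) species,
    (('u, 'o, 'm) species, ('u set, ('u set, 'u \<Rightarrow> 'u) arrow, 'o, 'm, 'o, 'm) pnt) arrow,
    (('u, 'o) lobj, ('u, 'o, 'm) larr) spsf,
    ((('u, 'o) lobj, ('u, 'o, 'm) larr) spsf,
     (nat, delta_arr, ('u, 'o) lobj, ('u, 'o, 'm) larr, ('u, 'o) lobj, ('u, 'o, 'm) larr) pnt) arrow) ftr"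
where
  "layering_ftr =
     \<lparr>FO = (\<lambda>R \<in> Obj RSp. layered R),
      FA = (\<lambda>h \<in> Arr RSp. Arrow (layered (src h)) (layered_map (src h) (tgt h) (via h)) (layered (tgt h)))\<rparr>"

end

theory Submission
  imports Defs
begin

text \<open>In the Grothendieck construction of a restriction species \<open>R\<close>, a category over finite sets and
  injections, all arrows are cartesian and monic.  The groupoids of layered structures are
  subcategories of it, and for every map \<open>a\<close> of \<open>\<Delta>\<close> the restriction \<open>a\<^sup>* w\<close> of a layered structure
  \<open>w\<close> comes with an arrow \<open>a\<^sup>* w \<rightarrow> w\<close> of it.  Since these arrows are monic, all coherence conditions
  for the simplicial groupoid and for the induced simplicial maps hold by uniqueness of
  factorizations.

  A generic map changes only the layering.  In the square of a generic-free pushout, a layering is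
  therefore determined by its coarsening together with its restriction to the middle layers, which
  gives the decomposition property.  The CULF property holds because a layering can be
  transported along a bijection.\<close>

section \<open>Categories and groupoids\<close>

text \<open>An arrow of the Grothendieck construction \<open>E\<close> is an injection
  \<open>\<sigma> : A \<rightarrow> B\<close> together with an arrow
  \<open>h : X \<rightarrow> R[\<sigma>] Y\<close> of the groupoid \<open>R[A]\<close>. It is monic
  because injections can be cancelled and \<open>h\<close> is invertible; it is cartesian because
  the structure component of a factorization is found by inverting arrows of \<open>R[A]\<close>.
  The obstacle is that generic maps act strictly while other maps act by restriction, so that a
  direct check of coherence would have to distinguish, for each of \<open>a\<close>,
  \<open>b\<close> and \<open>b a\<close>, whether it is generic. The arrow
  \<open>a\<^sup>* w \<rightarrow> w\<close> has \<open>to_restriction\<close> as its structure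
  component and absorbs this distinction; sets and layerings compose strictly. A second obstacle is
  that generic-free pushouts are given only by their universal property, whereas the argument about
  layerings needs formulas for \<open>f'\<close> and \<open>g'\<close>. The pushout is therefore
  computed: the block of \<open>n\<close> layers in the middle of \<open>k\<close> is replaced by
  \<open>m\<close> layers. Homotopy pullbacks are tested by full faithfulness and essential
  surjectivity of the comparison functor, which avoids constructing quasi-inverses case by
  case.\<close>

lemma HomI: "f \<in> Arr C \<Longrightarrow> Dom C f = x \<Longrightarrow> Cod C f = y \<Longrightarrow> f \<in> Hom C x y"
  by (simp add: Hom_def)

lemma HomD:
  assumes "f \<in> Hom C x y"
  shows "f \<in> Arr C" and "Dom C f = x" and "Cod C f = y"
  using assms by (simp_all add: Hom_def)

lemma Arr_in_Hom: "f \<in> Arr C \<Longrightarrow> f \<in> Hom C (Dom C f) (Cod C f)"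
  by (simp add: Hom_def)

context category
begin

lemma Hom_obj:
  assumes "f \<in> Hom C x y"
  shows "x \<in> Obj C" and "y \<in> Obj C"
  using assms dom_obj cod_obj by (auto simp: Hom_def)

lemma cmp_arr:
  assumes "f \<in> Arr C" "g \<in> Arr C" "Dom C g = Cod C f"
  shows "Cmp C g f \<in> Arr C" and "Dom C (Cmp C g f) = Dom C f" and "Cod C (Cmp C g f) = Cod C g"
  using cmp_hom[of f "Dom C f" "Cod C f" g "Cod C g"] assms by (auto simp: Hom_def)

lemma ide_arr:
  assumes "x \<in> Obj C"
  shows "Ide C x \<in> Arr C" and "Dom C (Ide C x) = x" and "Cod C (Ide C x) = x"
  using ide_hom[OF assms] by (auto simp: Hom_def)

lemma assoc:
  assumes "f \<in> Arr C" "g \<in> Arr C" "h \<in> Arr C" "Dom C g = Cod C f" "Dom C h = Cod C g"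
  shows "Cmp C (Cmp C h g) f = Cmp C h (Cmp C g f)"
  by (rule cmp_assoc[symmetric]) (use assms in \<open>auto simp: Hom_def\<close>)

lemma ide_left: "f \<in> Arr C \<Longrightarrow> Cod C f = y \<Longrightarrow> Cmp C (Ide C y) f = f"
  by (rule cmp_ide_left) (auto simp: Hom_def)

lemma ide_right: "f \<in> Arr C \<Longrightarrow> Dom C f = x \<Longrightarrow> Cmp C f (Ide C x) = f"
  by (rule cmp_ide_right) (auto simp: Hom_def)

lemmas arr_simps = cmp_arr ide_arr assoc ide_left ide_right dom_obj cod_obj

text \<open>The chain \<open>g = g (f g') = (g f) g' = g'\<close>. It makes the definite description
  in \<open>inv_arr\<close> denote.\<close>

lemma inverse_arrows_unique:
  assumes "inverse_arrows C f g" "inverse_arrows C f g'"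
  shows "g = g'"
proof -
  have "g = Cmp C g (Cmp C f g')"
    using assms by (auto simp: inverse_arrows_def Hom_def arr_simps)
  also have "\<dots> = Cmp C (Cmp C g f) g'"
    using assms by (intro assoc[symmetric]) (auto simp: inverse_arrows_def Hom_def)
  also have "\<dots> = g'"
    using assms by (auto simp: inverse_arrows_def Hom_def arr_simps)
  finally show ?thesis .
qed

lemma inv_arr_inverse: "iso C f \<Longrightarrow> inverse_arrows C f (inv_arr C f)"
  unfolding iso_def inv_arr_def by (metis inverse_arrows_unique theI)

end

context groupoid
begin

lemma inv_arr:
  assumes "f \<in> Arr C"
  shows "inv_arr C f \<in> Arr C" and "Dom C (inv_arr C f) = Cod C f"
    and "Cod C (inv_arr C f) = Dom C f"
    and "Cmp C (inv_arr C f) f = Ide C (Dom C f)" and "Cmp C f (inv_arr C f) = Ide C (Cod C f)"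
  using inv_arr_inverse[OF all_iso[OF assms]] by (auto simp: inverse_arrows_def Hom_def)

text \<open>Composites are normalised by associating to the right; the cancellation laws have this
  shape so that an inverse disappears next to its arrow inside a longer composite.\<close>

lemma inv_arr_cancel:
  assumes "f \<in> Arr C" "g \<in> Arr C"
  shows "Cod C g = Dom C f \<Longrightarrow> Cmp C (inv_arr C f) (Cmp C f g) = g"
    and "Cod C g = Cod C f \<Longrightarrow> Cmp C f (Cmp C (inv_arr C f) g) = g"
  using assms by (simp_all add: assoc[symmetric] inv_arr ide_left)

lemmas grp_simps = arr_simps inv_arr inv_arr_cancel

lemma inv_hom: "f \<in> Hom C x y \<Longrightarrow> inv_arr C f \<in> Hom C y x"
  by (auto simp: Hom_def inv_arr)

lemma cancel_left:
  assumes "f \<in> Arr C" "g \<in> Arr C" "g' \<in> Arr C" "Cod C g = Dom C f" "Cod C g' = Dom C f"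
    and "Cmp C f g = Cmp C f g'"
  shows "g = g'"
  using assms inv_arr_cancel(1) by metis

lemma cancel_right:
  assumes "f \<in> Arr C" "g \<in> Arr C" "g' \<in> Arr C" "Dom C g = Cod C f" "Dom C g' = Cod C f"
    and "Cmp C g f = Cmp C g' f"
  shows "g = g'"
proof -
  have "Cmp C (Cmp C g f) (inv_arr C f) = Cmp C (Cmp C g' f) (inv_arr C f)"
    using assms by simp
  then show ?thesis using assms(1-5) by (simp add: grp_simps)
qed

end

section \<open>Functors and natural isomorphisms\<close>

lemma functor_cats:
  assumes "is_functor C D F"
  shows "category C" and "category D"
  using assms by (auto simp: is_functor_def)

lemma functor_arr:
  assumes "is_functor C D F"
  shows "x \<in> Obj C \<Longrightarrow> FO F x \<in> Obj D"
    and "f \<in> Arr C \<Longrightarrow> FA F f \<in> Arr D"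
    and "f \<in> Arr C \<Longrightarrow> Dom D (FA F f) = FO F (Dom C f)"
    and "f \<in> Arr C \<Longrightarrow> Cod D (FA F f) = FO F (Cod C f)"
    and "x \<in> Obj C \<Longrightarrow> FA F (Ide C x) = Ide D (FO F x)"
    and "f \<in> Arr C \<Longrightarrow> g \<in> Arr C \<Longrightarrow> Dom C g = Cod C f \<Longrightarrow>
      FA F (Cmp C g f) = Cmp D (FA F g) (FA F f)"
  using assms by (auto simp: is_functor_def Hom_def)

lemma functor_hom: "is_functor C D F \<Longrightarrow> f \<in> Hom C x y \<Longrightarrow> FA F f \<in> Hom D (FO F x) (FO F y)"
  by (auto simp: is_functor_def Hom_def)

lemma functor_ext:
  assumes "is_functor C D F"
  shows "FO F \<in> extensional (Obj C)" "FA F \<in> extensional (Arr C)"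
  using assms by (auto simp: is_functor_def PiE_def)

lemma ftr_eqI: "FO F = FO G \<Longrightarrow> FA F = FA G \<Longrightarrow> F = (G :: ('o, 'm, 'p, 'q) ftr)"
  by (cases F, cases G) simp

lemma functor_eqI:
  assumes "is_functor C D F" "is_functor C D' G"
    and "\<And>x. x \<in> Obj C \<Longrightarrow> FO F x = FO G x" and "\<And>f. f \<in> Arr C \<Longrightarrow> FA F f = FA G f"
  shows "F = G"
  by (rule ftr_eqI; rule extensionalityI)
    (use assms functor_ext[OF assms(1)] functor_ext[OF assms(2)] in auto)

lemma functorI:
  assumes "category C" "category D"
    and "\<And>x. x \<in> Obj C \<Longrightarrow> FO F x \<in> Obj D"
    and "\<And>f x y. f \<in> Hom C x y \<Longrightarrow> FA F f \<in> Hom D (FO F x) (FO F y)"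
    and "\<And>x. x \<in> Obj C \<Longrightarrow> FA F (Ide C x) = Ide D (FO F x)"
    and "\<And>f g x y z. f \<in> Hom C x y \<Longrightarrow> g \<in> Hom C y z \<Longrightarrow>
      FA F (Cmp C g f) = Cmp D (FA F g) (FA F f)"
    and "FO F \<in> extensional (Obj C)" "FA F \<in> extensional (Arr C)"
  shows "is_functor C D F"
  using assms unfolding is_functor_def by (auto simp: Hom_def PiE_def)

lemma id_ftr_simps [simp]:
  "x \<in> Obj C \<Longrightarrow> FO (id_ftr C) x = x" "f \<in> Arr C \<Longrightarrow> FA (id_ftr C) f = f"
  by (simp_all add: id_ftr_def)

lemma comp_ftr_simps [simp]:
  "x \<in> Obj C \<Longrightarrow> FO (comp_ftr C G F) x = FO G (FO F x)"
  "f \<in> Arr C \<Longrightarrow> FA (comp_ftr C G F) f = FA G (FA F f)"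
  by (simp_all add: comp_ftr_def compose_def)

lemma comp_ftr_ext:
  "FO (comp_ftr C G F) \<in> extensional (Obj C)" "FA (comp_ftr C G F) \<in> extensional (Arr C)"
  by (simp_all add: comp_ftr_def)

lemma is_functor_id: "category C \<Longrightarrow> is_functor C C (id_ftr C)"
  by (rule functorI)
    (auto simp: id_ftr_def Hom_def category.arr_simps)

lemma is_functor_comp:
  assumes "is_functor C D F" "is_functor D E G"
  shows "is_functor C E (comp_ftr C G F)"
  using assms(1)[THEN functor_cats(1)] assms(2)[THEN functor_cats(2)]
  by (intro functorI)
    (auto simp: Hom_def category.arr_simps functor_arr[OF assms(1)]
      functor_arr[OF assms(2)] comp_ftr_ext)

lemma nat_iso_arr:
  assumes "nat_iso C D F G \<alpha>"
  shows "x \<in> Obj C \<Longrightarrow> \<alpha> x \<in> Arr D" and "x \<in> Obj C \<Longrightarrow> Dom D (\<alpha> x) = FO F x"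
    and "x \<in> Obj C \<Longrightarrow> Cod D (\<alpha> x) = FO G x"
    and "f \<in> Arr C \<Longrightarrow> Cmp D (FA G f) (\<alpha> (Dom C f)) = Cmp D (\<alpha> (Cod C f)) (FA F f)"
  using assms by (auto simp: nat_iso_def Hom_def)

lemma nat_iso_ext: "nat_iso C D F G \<alpha> \<Longrightarrow> \<alpha> \<in> extensional (Obj C)"
  by (simp add: nat_iso_def)

text \<open>In a groupoid the components are automatically invertible, so only their types and
  naturality remain to be shown.\<close>

lemma nat_isoI:
  assumes "groupoid D" "is_functor C D F" "is_functor C D G" "\<alpha> \<in> extensional (Obj C)"
    and "\<And>x. x \<in> Obj C \<Longrightarrow> \<alpha> x \<in> Hom D (FO F x) (FO G x)"
    and "\<And>f x y. f \<in> Hom C x y \<Longrightarrow> Cmp D (FA G f) (\<alpha> x) = Cmp D (\<alpha> y) (FA F f)"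
  shows "nat_iso C D F G \<alpha>"
  using assms unfolding nat_iso_def
  by (auto simp: Hom_def groupoid.all_iso)

section \<open>Equivalences of groupoids\<close>

lemma nat_iso_iso: "nat_iso C D F G \<alpha> \<Longrightarrow> x \<in> Obj C \<Longrightarrow> iso D (\<alpha> x)"
  by (simp add: nat_iso_def)

text \<open>By naturality \<open>t\<close> is \<open>G (F t)\<close> preceded by
  \<open>\<eta> x\<close> and followed by the inverse of \<open>\<eta> y\<close>, so it is recovered
  from \<open>F t\<close>.\<close>

lemma nat_iso_faithful:
  assumes "category C" "nat_iso C C (id_ftr C) (comp_ftr C G F) \<eta>"
    and t: "t \<in> Hom C x y" "t' \<in> Hom C x y" and eq: "FA F t = FA F t'"
  shows "t = t'"
proof -
  interpret C: category C by fact
  note [simp] = nat_iso_arr(1-3)[OF assms(2)] HomD[OF t(1)] HomD[OF t(2)] C.Hom_obj[OF t(1)]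
  have iso: "iso C (\<eta> y)" by (rule nat_iso_iso[OF assms(2)]) (rule C.Hom_obj[OF t(1)])
  define e where "e = inv_arr C (\<eta> y)"
  have e: "e \<in> Arr C" "Dom C e = Cod C (\<eta> y)" "Cod C e = y" "Cmp C e (\<eta> y) = Ide C y"
    using C.inv_arr_inverse[OF iso] by (simp_all add: e_def inverse_arrows_def Hom_def)
  have *: "Cmp C e (Cmp C (FA G (FA F s)) (\<eta> x)) = s" if s: "s \<in> Hom C x y" for s
  proof -
    have "Cmp C (FA G (FA F s)) (\<eta> x) = Cmp C (\<eta> y) s"
      using nat_iso_arr(4)[OF assms(2), of s] HomD[OF s] by simp
    then show ?thesis using HomD[OF s] e by (simp add: C.assoc[symmetric] C.ide_left)
  qed
  show ?thesis by (metis *[OF t(1)] *[OF t(2)] eq)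
qed

text \<open>The mirror image, with the counit: \<open>t\<close> is recovered from \<open>G t\<close>
  by conjugating \<open>F (G t)\<close> with \<open>\<epsilon>\<close>. This is the faithfulness of
  the quasi-inverse.\<close>

lemma nat_iso_faithful':
  assumes "category C" "nat_iso C C (comp_ftr C F G) (id_ftr C) \<epsilon>"
    and t: "t \<in> Hom C x y" "t' \<in> Hom C x y" and eq: "FA G t = FA G t'"
  shows "t = t'"
proof -
  interpret C: category C by fact
  note [simp] = nat_iso_arr(1-3)[OF assms(2)] HomD[OF t(1)] HomD[OF t(2)] C.Hom_obj[OF t(1)]
  have iso: "iso C (\<epsilon> x)" by (rule nat_iso_iso[OF assms(2)]) (rule C.Hom_obj[OF t(1)])
  define e where "e = inv_arr C (\<epsilon> x)"
  have e: "e \<in> Arr C" "Dom C e = x" "Cod C e = Dom C (\<epsilon> x)" "Cmp C (\<epsilon> x) e = Ide C x"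
    using C.inv_arr_inverse[OF iso] by (simp_all add: e_def inverse_arrows_def Hom_def)
  have *: "Cmp C (Cmp C (\<epsilon> y) (FA F (FA G s))) e = s" if s: "s \<in> Hom C x y" for s
  proof -
    have "Cmp C s (\<epsilon> x) = Cmp C (\<epsilon> y) (FA F (FA G s))"
      using nat_iso_arr(4)[OF assms(2), of s] HomD[OF s] by simp
    then have "Cmp C (Cmp C (\<epsilon> y) (FA F (FA G s))) e = Cmp C (Cmp C s (\<epsilon> x)) e" by simp
    then show ?thesis using HomD[OF s] e by (simp add: C.assoc C.ide_right)
  qed
  show ?thesis by (metis *[OF t(1)] *[OF t(2)] eq)
qed

definition fully_faithful :: "('o, 'm) cat \<Rightarrow> ('p, 'q) cat \<Rightarrow> ('o, 'm, 'p, 'q) ftr \<Rightarrow> bool" where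
  "fully_faithful C D F \<longleftrightarrow> (\<forall>x \<in> Obj C. \<forall>y \<in> Obj C. \<forall>d \<in> Hom D (FO F x) (FO F y).
     \<exists>!t. t \<in> Hom C x y \<and> FA F t = d)"

definition essentially_surjective ::
  "('o, 'm) cat \<Rightarrow> ('p, 'q) cat \<Rightarrow> ('o, 'm, 'p, 'q) ftr \<Rightarrow> bool" where
  "essentially_surjective C D F \<longleftrightarrow> (\<forall>d \<in> Obj D. \<exists>x \<in> Obj C. \<exists>e. e \<in> Hom D (FO F x) d)"

text \<open>The counit supplies the arrows for essential surjectivity. Faithfulness of
  \<open>F\<close> gives uniqueness of lifts, and faithfulness of \<open>G\<close> gives their
  existence.\<close>

lemma equivalence_imp:
  assumes C: "groupoid C" and D: "groupoid D" and eq: "equivalence C D F"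
  shows "fully_faithful C D F" and "essentially_surjective C D F"
proof -
  interpret C: groupoid C by fact
  interpret D: groupoid D by fact
  from eq obtain G \<eta> \<epsilon> where F: "is_functor C D F" and G: "is_functor D C G"
    and \<eta>: "nat_iso C C (id_ftr C) (comp_ftr C G F) \<eta>"
    and \<epsilon>: "nat_iso D D (comp_ftr D F G) (id_ftr D) \<epsilon>"
    by (auto simp: equivalence_def)
  note Fs = functor_arr[OF F] and Gs = functor_arr[OF G]
  show "essentially_surjective C D F" unfolding essentially_surjective_def
  proof
    fix d assume d: "d \<in> Obj D"
    then have "\<epsilon> d \<in> Hom D (FO F (FO G d)) d"
      using nat_iso_arr[OF \<epsilon>] by (auto simp: Hom_def)
    then show "\<exists>x \<in> Obj C. \<exists>e. e \<in> Hom D (FO F x) d" using Gs(1)[OF d] by blast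
  qed
  show "fully_faithful C D F" unfolding fully_faithful_def
  proof (intro ballI)
    fix x y d assume x: "x \<in> Obj C" and y: "y \<in> Obj C" and d: "d \<in> Hom D (FO F x) (FO F y)"
    note ds = HomD[OF d] and \<eta>s = nat_iso_arr(1-3)[OF \<eta>]
    \<comment> \<open>The only candidate allowed by naturality of \<open>\<eta>\<close>. It
      satisfies \<open>G (F t) = G d\<close>, whence \<open>F t = d\<close> because \<open>G\<close>
      is faithful.\<close>
    define t where "t = Cmp C (inv_arr C (\<eta> y)) (Cmp C (FA G d) (\<eta> x))"
    have t: "t \<in> Hom C x y"
      using x y ds by (auto simp: t_def Hom_def C.grp_simps \<eta>s Fs Gs)
    have "Cmp C (FA G (FA F t)) (\<eta> x) = Cmp C (\<eta> y) t"
      using nat_iso_arr(4)[OF \<eta>, of t] HomD[OF t] by simp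
    also have "\<dots> = Cmp C (FA G d) (\<eta> x)"
      using x y ds by (simp add: t_def C.grp_simps \<eta>s Fs Gs)
    finally have *: "Cmp C (FA G (FA F t)) (\<eta> x) = Cmp C (FA G d) (\<eta> x)" .
    have "FA G (FA F t) = FA G d"
      by (rule C.cancel_right[OF _ _ _ _ _ *]) (simp_all add: x y ds HomD[OF t] \<eta>s Fs Gs)
    then have "FA F t = d"
      by (intro nat_iso_faithful'[OF D.category_axioms \<epsilon> functor_hom[OF F t] d])
    then show "\<exists>!t. t \<in> Hom C x y \<and> FA F t = d"
      using t nat_iso_faithful[OF C.category_axioms \<eta>] by metis
  qed
qed

text \<open>A preimage \<open>g d\<close> and an arrow \<open>e d : F (g d) \<rightarrow> d\<close>
  are chosen for every \<open>d\<close>. The quasi-inverse sends an arrow to the unique lift of its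
  conjugate by \<open>e\<close>; every equation about it is checked after applying the faithful
  functor \<open>F\<close>.\<close>

lemma equivalenceI:
  assumes C: "groupoid C" and D: "groupoid D" and F: "is_functor C D F"
    and ff: "fully_faithful C D F" and es: "essentially_surjective C D F"
  shows "equivalence C D F"
proof -
  interpret C: groupoid C by fact
  interpret D: groupoid D by fact
  note Fs = functor_arr[OF F]
  from es obtain g e where g: "\<And>d. d \<in> Obj D \<Longrightarrow> g d \<in> Obj C"
    and e: "\<And>d. d \<in> Obj D \<Longrightarrow> e d \<in> Hom D (FO F (g d)) d"
    unfolding essentially_surjective_def by metis
  note es = HomD[OF e]
  define lft where "lft x y d = (THE t. t \<in> Hom C x y \<and> FA F t = d)" for x y d
  have lft: "lft x y d \<in> Hom C x y" "FA F (lft x y d) = d"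
    if "x \<in> Obj C" "y \<in> Obj C" "d \<in> Hom D (FO F x) (FO F y)" for x y d
    using theI'[of "\<lambda>t. t \<in> Hom C x y \<and> FA F t = d"] ff that
    unfolding fully_faithful_def lft_def by blast+
  have faithful: "t = t'" if "t \<in> Hom C x y" "t' \<in> Hom C x y" "FA F t = FA F t'" for x y t t'
    using ff C.Hom_obj[OF that(1)] functor_hom[OF F that(1)] that
    unfolding fully_faithful_def by metis
  \<comment> \<open>Transports \<open>h : x \<rightarrow> y\<close> along \<open>e\<close> to an
    arrow \<open>F (g x) \<rightarrow> F (g y)\<close>, which full faithfulness can lift.\<close>
  define conj where
    "conj h = Cmp D (inv_arr D (e (Cod D h))) (Cmp D h (e (Dom D h)))" for h
  have conj: "conj h \<in> Hom D (FO F (g x)) (FO F (g y))" if h: "h \<in> Hom D x y" for h x y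
    using HomD[OF h] D.Hom_obj[OF h] by (auto simp: conj_def Hom_def D.grp_simps es)
  define G where
    "G = \<lparr>FO = (\<lambda>d \<in> Obj D. g d), FA = (\<lambda>h \<in> Arr D. lft (g (Dom D h)) (g (Cod D h)) (conj h))\<rparr>"
  have GO: "FO G d = g d" if "d \<in> Obj D" for d using that by (simp add: G_def)
  have GA: "FA G h \<in> Hom C (g x) (g y)" "FA F (FA G h) = conj h" if h: "h \<in> Hom D x y" for h x y
    using lft[OF g g conj[OF h]] HomD[OF h] D.Hom_obj[OF h] by (auto simp: G_def)
  have G: "is_functor D C G"
  proof (rule functorI)
    show "category C" "category D" by unfold_locales
  next
    fix d assume d: "d \<in> Obj D"
    then show "FO G d \<in> Obj C" by (simp add: GO g)
    have "FA F (FA G (Ide D d)) = FA F (Ide C (g d))"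
      using GA(2)[OF D.ide_hom[OF d]] d by (simp add: conj_def D.grp_simps es g Fs)
    then have "FA G (Ide D d) = Ide C (g d)"
      by (intro faithful[OF GA(1)[OF D.ide_hom[OF d]] C.ide_hom[OF g[OF d]]])
    then show "FA G (Ide D d) = Ide C (FO G d)" using d by (simp add: GO)
  next
    fix h x y assume h: "h \<in> Hom D x y"
    then show "FA G h \<in> Hom C (FO G x) (FO G y)" using GA(1)[OF h] D.Hom_obj[OF h] by (simp add: GO)
  next
    fix h k x y z assume h: "h \<in> Hom D x y" and k: "k \<in> Hom D y z"
    note hk = D.cmp_hom[OF h k]
    have "FA F (FA G (Cmp D k h)) = conj (Cmp D k h)" by (rule GA(2)[OF hk])
    also have "\<dots> = Cmp D (conj k) (conj h)"
      using HomD[OF h] HomD[OF k] D.Hom_obj[OF h] D.Hom_obj[OF k]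
      by (simp add: conj_def D.grp_simps es)
    also have "\<dots> = FA F (Cmp C (FA G k) (FA G h))"
      using GA[OF h] GA[OF k] by (simp add: Fs(6) Hom_def)
    finally show "FA G (Cmp D k h) = Cmp C (FA G k) (FA G h)"
      by (intro faithful[OF GA(1)[OF hk] C.cmp_hom[OF GA(1)[OF h] GA(1)[OF k]]])
  qed (auto simp: G_def)
  define \<epsilon> where "\<epsilon> = (\<lambda>d \<in> Obj D. e d)"
  have \<epsilon>: "nat_iso D D (comp_ftr D F G) (id_ftr D) \<epsilon>"
  proof (rule nat_isoI)
    fix h x y assume h: "h \<in> Hom D x y"
    show "Cmp D (FA (id_ftr D) h) (\<epsilon> x) = Cmp D (\<epsilon> y) (FA (comp_ftr D F G) h)"
      using GA[OF h] HomD[OF h] D.Hom_obj[OF h] by (simp add: \<epsilon>_def conj_def D.grp_simps es)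
  qed (auto simp: \<epsilon>_def GO e D D.category_axioms intro: is_functor_comp[OF G F] is_functor_id)
  \<comment> \<open>The unit at \<open>x\<close> must map to the inverse of \<open>e (F x)\<close>
    in order to match the counit \<open>e\<close>, so it is defined as the lift of that
    inverse.\<close>
  define \<eta> where
    "\<eta> = (\<lambda>x \<in> Obj C. lft x (g (FO F x)) (inv_arr D (e (FO F x))))"
  have \<eta>h: "\<eta> x \<in> Hom C x (g (FO F x))" "FA F (\<eta> x) = inv_arr D (e (FO F x))" if x: "x \<in> Obj C"
    for x
    using lft[OF x g D.inv_hom[OF e]] x Fs(1)[OF x] by (auto simp: \<eta>_def)
  have \<eta>: "nat_iso C C (id_ftr C) (comp_ftr C G F) \<eta>"
  proof (rule nat_isoI)
    show "\<eta> x \<in> Hom C (FO (id_ftr C) x) (FO (comp_ftr C G F) x)" if "x \<in> Obj C" for x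
      using \<eta>h(1)[OF that] that by (simp add: GO Fs)
    fix t x y assume t: "t \<in> Hom C x y"
    note ts = HomD[OF t] C.Hom_obj[OF t]
    have GFt: "FA G (FA F t) \<in> Hom C (g (FO F x)) (g (FO F y))"
      "FA F (FA G (FA F t)) = conj (FA F t)"
      using GA[OF functor_hom[OF F t]] by auto
    have "FA F (Cmp C (FA G (FA F t)) (\<eta> x)) = Cmp D (conj (FA F t)) (inv_arr D (e (FO F x)))"
      using GFt \<eta>h[OF ts(4)] by (simp add: Fs(6) Hom_def)
    also have "\<dots> = Cmp D (inv_arr D (e (FO F y))) (FA F t)"
      using ts by (simp add: conj_def D.grp_simps es Fs)
    also have "\<dots> = FA F (Cmp C (\<eta> y) t)"
      using ts \<eta>h[OF ts(5)] by (simp add: Fs(6) Hom_def)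
    finally have "Cmp C (FA G (FA F t)) (\<eta> x) = Cmp C (\<eta> y) t"
      by (intro faithful[OF C.cmp_hom[OF \<eta>h(1)[OF ts(4)] GFt(1)] C.cmp_hom[OF t \<eta>h(1)[OF ts(5)]]])
    then show "Cmp C (FA (comp_ftr C G F) t) (\<eta> x) = Cmp C (\<eta> y) (FA (id_ftr C) t)"
      using ts by simp
  qed (auto simp: \<eta>_def C C.category_axioms intro: is_functor_comp[OF F G] is_functor_id)
  show ?thesis unfolding equivalence_def using F G \<eta> \<epsilon> by blast
qed

section \<open>Homotopy pullbacks\<close>

locale groupoid_cospan =
  X: groupoid X + Y: groupoid Y + Z: groupoid Z
  for X :: "('o1, 'm1) cat" and Y :: "('o2, 'm2) cat" and Z :: "('o3, 'm3) cat" +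
  fixes F G
  assumes F: "is_functor X Z F" and G: "is_functor Y Z G"
begin

abbreviation IC where "IC \<equiv> iso_comma X Y Z F G"

lemmas Fs = functor_arr[OF F] and Gs = functor_arr[OF G]

lemma IC_obj: "(x, y, \<zeta>) \<in> Obj IC \<longleftrightarrow> x \<in> Obj X \<and> y \<in> Obj Y \<and> \<zeta> \<in> Hom Z (FO F x) (FO G y)"
  by (auto simp: iso_comma_def Hom_def Z.all_iso)

lemma IC_hom: "t \<in> Hom IC (x, y, \<zeta>) (x', y', \<zeta>') \<longleftrightarrow>
    (\<exists>a b. t = Arrow (x, y, \<zeta>) (a, b) (x', y', \<zeta>') \<and>
      (x, y, \<zeta>) \<in> Obj IC \<and> (x', y', \<zeta>') \<in> Obj IC \<and> a \<in> Hom X x x' \<and> b \<in> Hom Y y y' \<and>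
      Cmp Z \<zeta>' (FA F a) = Cmp Z (FA G b) \<zeta>)"
  by (auto simp: iso_comma_def Hom_def)

lemma IC_ide: "Ide IC (x, y, \<zeta>) = Arrow (x, y, \<zeta>) (Ide X x, Ide Y y) (x, y, \<zeta>)"
  by (simp add: iso_comma_def)

lemma IC_cmp: "Cmp IC (Arrow w' (a', b') w'') (Arrow w (a, b) w') =
  Arrow w (Cmp X a' a, Cmp Y b' b) w''"
  by (simp add: iso_comma_def)

lemma IC_dom_obj: "t \<in> Hom IC w w' \<Longrightarrow> w \<in> Obj IC \<and> w' \<in> Obj IC"
  by (cases w, cases w') (auto simp: IC_hom)

lemma IC_ide_hom: "w \<in> Obj IC \<Longrightarrow> Ide IC w \<in> Hom IC w w"
  by (cases w) (auto simp: IC_hom IC_obj IC_ide X.ide_hom Y.ide_hom Fs Gs Z.ide_left Z.ide_right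
      HomD)

lemma IC_cmp_hom:
  assumes "t \<in> Hom IC w w'" "t' \<in> Hom IC w' w''"
  shows "Cmp IC t' t \<in> Hom IC w w''"
proof -
  obtain x y \<zeta> where w: "w = (x, y, \<zeta>)" by (metis prod_cases3)
  obtain x' y' \<zeta>' where w': "w' = (x', y', \<zeta>')" by (metis prod_cases3)
  obtain x'' y'' \<zeta>'' where w'': "w'' = (x'', y'', \<zeta>'')" by (metis prod_cases3)
  obtain a b where t: "t = Arrow w (a, b) w'" "w \<in> Obj IC" "w' \<in> Obj IC" "a \<in> Hom X x x'"
      "b \<in> Hom Y y y'" "Cmp Z \<zeta>' (FA F a) = Cmp Z (FA G b) \<zeta>"
    using assms(1) by (auto simp: w w' IC_hom)
  obtain a' b' where t': "t' = Arrow w' (a', b') w''" "w'' \<in> Obj IC" "a' \<in> Hom X x' x''"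
      "b' \<in> Hom Y y' y''" "Cmp Z \<zeta>'' (FA F a') = Cmp Z (FA G b') \<zeta>'"
    using assms(2) by (auto simp: w' w'' IC_hom)
  note arrs = HomD[OF t(4)] HomD[OF t(5)] HomD[OF t'(3)] HomD[OF t'(4)]
  have zs: "\<zeta> \<in> Hom Z (FO F x) (FO G y)" "\<zeta>' \<in> Hom Z (FO F x') (FO G y')"
    "\<zeta>'' \<in> Hom Z (FO F x'') (FO G y'')"
    using t(2,3) t'(2) by (auto simp: w w' w'' IC_obj)
  note zs = zs[THEN HomD(1)] zs[THEN HomD(2)] zs[THEN HomD(3)]
  have "Cmp Z \<zeta>'' (FA F (Cmp X a' a)) = Cmp Z (Cmp Z \<zeta>'' (FA F a')) (FA F a)"
    using arrs zs by (simp add: Fs Z.assoc)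
  also have "\<dots> = Cmp Z (FA G b') (Cmp Z \<zeta>' (FA F a))"
    using arrs zs unfolding t'(5) by (simp add: Fs Gs Z.assoc)
  also have "\<dots> = Cmp Z (FA G (Cmp Y b' b)) \<zeta>"
    using arrs zs unfolding t(6) by (simp add: Gs Z.assoc)
  finally show ?thesis
    using t t' X.cmp_hom Y.cmp_hom unfolding w w' w'' by (auto simp: IC_hom IC_cmp)
qed

sublocale IC: groupoid IC
proof
  fix t assume "t \<in> Arr IC"
  then have t: "t \<in> Hom IC (Dom IC t) (Cod IC t)" by (rule Arr_in_Hom)
  show "Dom IC t \<in> Obj IC" "Cod IC t \<in> Obj IC" using IC_dom_obj[OF t] by auto
  obtain x y \<zeta> x' y' \<zeta>' where w: "Dom IC t = (x, y, \<zeta>)" "Cod IC t = (x', y', \<zeta>')"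
    by (metis prod_cases3)
  obtain a b where ab: "t = Arrow (x, y, \<zeta>) (a, b) (x', y', \<zeta>')" "(x, y, \<zeta>) \<in> Obj IC"
      "(x', y', \<zeta>') \<in> Obj IC" "a \<in> Hom X x x'" "b \<in> Hom Y y y'"
      "Cmp Z \<zeta>' (FA F a) = Cmp Z (FA G b) \<zeta>"
    using t by (auto simp: w IC_hom)
  note arrs = HomD[OF ab(4)] HomD[OF ab(5)]
  have zs: "\<zeta> \<in> Hom Z (FO F x) (FO G y)" "\<zeta>' \<in> Hom Z (FO F x') (FO G y')"
    using ab(2,3) by (auto simp: IC_obj)
  note zs = zs[THEN HomD(1)] zs[THEN HomD(2)] zs[THEN HomD(3)]
  \<comment> \<open>The inverse of \<open>(a, b)\<close> is taken componentwise. What needs proof is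
    its compatibility with the structure arrows: \<open>\<zeta>' F(a) = G(b) \<zeta>\<close> has to
    be turned into the corresponding equation for the inverses of \<open>a\<close> and
    \<open>b\<close>.\<close>
  let ?s = "Arrow (x', y', \<zeta>') (inv_arr X a, inv_arr Y b) (x, y, \<zeta>)"
  note [simp] = arrs zs X.inv_arr Y.inv_arr Z.arr_simps Fs(1-4) Gs(1-4) X.Hom_obj[OF ab(4)]
    Y.Hom_obj[OF ab(5)]
  have inv: "Cmp Z (FA F (inv_arr X a)) (FA F a) = Ide Z (FO F x)"
      "Cmp Z (FA G (inv_arr Y b)) (FA G b) = Ide Z (FO G y)"
    by (simp_all add: Fs(5) Gs(5) flip: Fs(6) Gs(6))
  have "Cmp Z (Cmp Z (FA G b) (Cmp Z \<zeta> (FA F (inv_arr X a)))) (FA F a) =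
      Cmp Z (FA G b) (Cmp Z \<zeta> (Cmp Z (FA F (inv_arr X a)) (FA F a)))"
    by simp
  also have "\<dots> = Cmp Z \<zeta>' (FA F a)" by (simp add: inv ab(6))
  finally have "Cmp Z (FA G b) (Cmp Z \<zeta> (FA F (inv_arr X a))) = \<zeta>'"
    by (rule Z.cancel_right[rotated -1]) simp_all
  then have "Cmp Z (FA G (inv_arr Y b)) \<zeta>' =
      Cmp Z (FA G (inv_arr Y b)) (Cmp Z (FA G b) (Cmp Z \<zeta> (FA F (inv_arr X a))))" by simp
  also have "\<dots> = Cmp Z (Cmp Z (FA G (inv_arr Y b)) (FA G b)) (Cmp Z \<zeta> (FA F (inv_arr X a)))"
    by simp
  also have "\<dots> = Cmp Z \<zeta> (FA F (inv_arr X a))" unfolding inv by simp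
  finally have s: "?s \<in> Hom IC (x', y', \<zeta>') (x, y, \<zeta>)"
    using ab X.inv_hom Y.inv_hom by (auto simp: IC_hom)
  have "Cmp IC ?s t = Ide IC (x, y, \<zeta>)" "Cmp IC t ?s = Ide IC (x', y', \<zeta>')"
    unfolding ab(1) IC_cmp IC_ide by simp_all
  then show "iso IC t"
    unfolding iso_def inverse_arrows_def w using \<open>t \<in> Arr IC\<close> s by blast
next
  show "Ide IC w \<in> Hom IC w w" if "w \<in> Obj IC" for w using that by (rule IC_ide_hom)
  show "Cmp IC t' t \<in> Hom IC w w''" if "t \<in> Hom IC w w'" "t' \<in> Hom IC w' w''" for t t' w w' w''
    using that by (rule IC_cmp_hom)
  show "Cmp IC t (Ide IC w) = t" "Cmp IC (Ide IC w') t = t" if t: "t \<in> Hom IC w w'" for t w w'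
    using t by (cases w; cases w'; clarsimp simp: IC_hom IC_ide IC_cmp X.cmp_ide_right
        X.cmp_ide_left Y.cmp_ide_right Y.cmp_ide_left)+
  show "Cmp IC t'' (Cmp IC t' t) = Cmp IC (Cmp IC t'' t') t"
    if t: "t \<in> Hom IC w w'" "t' \<in> Hom IC w' w''" "t'' \<in> Hom IC w'' w'''" for t t' t'' w w' w'' w'''
    using t by (cases w; cases w'; cases w''; cases w''';
        clarsimp simp: IC_hom IC_cmp X.cmp_assoc Y.cmp_assoc)
qed

end

text \<open>The first clause says that the comparison functor to the iso-comma groupoid is fully faithful,
  the second that it is essentially surjective.\<close>

definition pullback_conditions ::
  "('o, 'm) cat \<Rightarrow> ('o1, 'm1) cat \<Rightarrow> ('o2, 'm2) cat \<Rightarrow> ('o3, 'm3) cat \<Rightarrow>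
   ('o, 'm, 'o1, 'm1) ftr \<Rightarrow> ('o, 'm, 'o2, 'm2) ftr \<Rightarrow>
   ('o1, 'm1, 'o3, 'm3) ftr \<Rightarrow> ('o2, 'm2, 'o3, 'm3) ftr \<Rightarrow> ('o \<Rightarrow> 'm3) \<Rightarrow> bool" where
  "pullback_conditions P X Y Z H K F G \<alpha> \<longleftrightarrow>
     (\<forall>w \<in> Obj P. \<forall>w' \<in> Obj P. \<forall>a \<in> Hom X (FO H w) (FO H w'). \<forall>b \<in> Hom Y (FO K w) (FO K w').
        Cmp Z (\<alpha> w') (FA F a) = Cmp Z (FA G b) (\<alpha> w) \<longrightarrow>
        (\<exists>!t. t \<in> Hom P w w' \<and> FA H t = a \<and> FA K t = b)) \<and>
     (\<forall>x \<in> Obj X. \<forall>y \<in> Obj Y. \<forall>\<zeta> \<in> Hom Z (FO F x) (FO G y).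
        \<exists>w \<in> Obj P. \<exists>a \<in> Hom X (FO H w) x. \<exists>b \<in> Hom Y (FO K w) y.
          Cmp Z \<zeta> (FA F a) = Cmp Z (FA G b) (\<alpha> w))"

text \<open>An arrow of the iso-comma groupoid between two comparison objects is a pair
  \<open>(a, b)\<close> compatible with \<open>\<alpha>\<close>, so full faithfulness unfolds to the
  first condition. An arrow from a comparison object to \<open>(x, y, \<zeta>)\<close> unfolds to
  the second.\<close>

lemma homotopy_pullback_iff:
  assumes P: "groupoid P" and X: "groupoid X" and Y: "groupoid Y" and Z: "groupoid Z"
    and H: "is_functor P X H" and K: "is_functor P Y K"
    and F: "is_functor X Z F" and G: "is_functor Y Z G"
    and \<alpha>: "nat_iso P Z (comp_ftr P F H) (comp_ftr P G K) \<alpha>"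
  shows "homotopy_pullback P X Y Z H K F G \<alpha> \<longleftrightarrow> pullback_conditions P X Y Z H K F G \<alpha>"
proof -
  interpret P: groupoid P by fact
  interpret groupoid_cospan X Y Z F G
    using X Y Z F G by (intro groupoid_cospan.intro groupoid_cospan_axioms.intro)
  let ?M = "comparison_ftr P H K \<alpha>"
  note Hs = functor_arr[OF H] and Ks = functor_arr[OF K] and \<alpha>s = nat_iso_arr[OF \<alpha>]
  have \<alpha>h: "\<alpha> w \<in> Hom Z (FO F (FO H w)) (FO G (FO K w))" if "w \<in> Obj P" for w
    using \<alpha>s that by (auto simp: Hom_def)
  have MO: "FO ?M w = (FO H w, FO K w, \<alpha> w)" if "w \<in> Obj P" for w
    using that by (simp add: comparison_ftr_def)
  have MA: "FA ?M t = Arrow (FO ?M w) (FA H t, FA K t) (FO ?M w')" if "t \<in> Hom P w w'" for t w w'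
    using HomD[OF that] P.Hom_obj[OF that] by (simp add: comparison_ftr_def Let_def)
  have M: "is_functor P IC ?M"
  proof (rule functorI)
    show "category P" "category IC" by unfold_locales
    show MOo: "FO ?M w \<in> Obj IC" if "w \<in> Obj P" for w
      using that \<alpha>h[OF that] by (simp add: MO IC_obj Hs Ks)
    show "FA ?M t \<in> Hom IC (FO ?M w) (FO ?M w')" if t: "t \<in> Hom P w w'" for t w w'
      using MOo[of w] MOo[of w'] \<alpha>s(4)[of t] P.Hom_obj[OF t] HomD[OF t]
        functor_hom[OF H t] functor_hom[OF K t]
      by (simp add: MA[OF t] MO IC_hom)
    show "FA ?M (Ide P w) = Ide IC (FO ?M w)" if w: "w \<in> Obj P" for w
      using MA[OF P.ide_hom[OF w]] w by (simp add: MO IC_ide Hs Ks)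
    show "FA ?M (Cmp P t' t) = Cmp IC (FA ?M t') (FA ?M t)"
      if t: "t \<in> Hom P w w'" and t': "t' \<in> Hom P w' w''" for t t' w w' w''
      using MA[OF P.cmp_hom[OF t t']] MA[OF t] MA[OF t'] HomD[OF t] HomD[OF t']
      by (simp add: IC_cmp Hs(6) Ks(6))
  qed (auto simp: comparison_ftr_def Let_def)
  have ff: "fully_faithful P IC ?M \<longleftrightarrow>
     (\<forall>w \<in> Obj P. \<forall>w' \<in> Obj P. \<forall>a \<in> Hom X (FO H w) (FO H w'). \<forall>b \<in> Hom Y (FO K w) (FO K w').
        Cmp Z (\<alpha> w') (FA F a) = Cmp Z (FA G b) (\<alpha> w) \<longrightarrow>
        (\<exists>!t. t \<in> Hom P w w' \<and> FA H t = a \<and> FA K t = b))"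
    unfolding fully_faithful_def
  proof (intro ball_cong refl)
    fix w w' assume w: "w \<in> Obj P" and w': "w' \<in> Obj P"
    have arr: "(t \<in> Hom P w w' \<and> FA ?M t = Arrow (FO ?M w) (a, b) (FO ?M w')) \<longleftrightarrow>
        (t \<in> Hom P w w' \<and> FA H t = a \<and> FA K t = b)" for t a b
      using MA[of t w w'] by auto
    have hom: "d \<in> Hom IC (FO ?M w) (FO ?M w') \<longleftrightarrow>
       (\<exists>a b. d = Arrow (FO ?M w) (a, b) (FO ?M w') \<and> a \<in> Hom X (FO H w) (FO H w') \<and>
         b \<in> Hom Y (FO K w) (FO K w') \<and> Cmp Z (\<alpha> w') (FA F a) = Cmp Z (FA G b) (\<alpha> w))" for d
      using functor_arr(1)[OF M w] functor_arr(1)[OF M w'] by (auto simp: MO w w' IC_hom)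
    have *: "(\<forall>d \<in> Hom IC (FO ?M w) (FO ?M w'). U d) \<longleftrightarrow>
        (\<forall>a \<in> Hom X (FO H w) (FO H w'). \<forall>b \<in> Hom Y (FO K w) (FO K w').
          Cmp Z (\<alpha> w') (FA F a) = Cmp Z (FA G b) (\<alpha> w) \<longrightarrow> U (Arrow (FO ?M w) (a, b) (FO ?M w')))"
      for U unfolding Ball_def hom by metis
    show "(\<forall>d \<in> Hom IC (FO ?M w) (FO ?M w'). \<exists>!t. t \<in> Hom P w w' \<and> FA ?M t = d) \<longleftrightarrow>
      (\<forall>a \<in> Hom X (FO H w) (FO H w'). \<forall>b \<in> Hom Y (FO K w) (FO K w').
        Cmp Z (\<alpha> w') (FA F a) = Cmp Z (FA G b) (\<alpha> w) \<longrightarrow>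
        (\<exists>!t. t \<in> Hom P w w' \<and> FA H t = a \<and> FA K t = b))"
      unfolding * arr ..
  qed
  have es: "essentially_surjective P IC ?M \<longleftrightarrow>
     (\<forall>x \<in> Obj X. \<forall>y \<in> Obj Y. \<forall>\<zeta> \<in> Hom Z (FO F x) (FO G y).
        \<exists>w \<in> Obj P. \<exists>a \<in> Hom X (FO H w) x. \<exists>b \<in> Hom Y (FO K w) y.
          Cmp Z \<zeta> (FA F a) = Cmp Z (FA G b) (\<alpha> w))" (is "?L \<longleftrightarrow> ?R")
  proof -
    have *: "(\<exists>w \<in> Obj P. \<exists>e. e \<in> Hom IC (FO ?M w) (x, y, \<zeta>)) \<longleftrightarrow>
        (\<exists>w \<in> Obj P. \<exists>a \<in> Hom X (FO H w) x. \<exists>b \<in> Hom Y (FO K w) y.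
          Cmp Z \<zeta> (FA F a) = Cmp Z (FA G b) (\<alpha> w))" if "(x, y, \<zeta>) \<in> Obj IC" for x y \<zeta>
      using that functor_arr(1)[OF M] by (intro bex_cong refl) (auto simp: MO IC_hom)
    have "?L \<longleftrightarrow> (\<forall>x y \<zeta>. (x, y, \<zeta>) \<in> Obj IC \<longrightarrow>
        (\<exists>w \<in> Obj P. \<exists>a \<in> Hom X (FO H w) x. \<exists>b \<in> Hom Y (FO K w) y.
          Cmp Z \<zeta> (FA F a) = Cmp Z (FA G b) (\<alpha> w)))"
      unfolding essentially_surjective_def Ball_def split_paired_All
      by (intro all_cong1 imp_cong refl *)
    also have "\<dots> \<longleftrightarrow> ?R" by (auto simp: IC_obj)
    finally show ?thesis .
  qed
  have "equivalence P IC ?M \<longleftrightarrow> fully_faithful P IC ?M \<and> essentially_surjective P IC ?M"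
    using equivalence_imp[OF P IC.groupoid_axioms] equivalenceI[OF P IC.groupoid_axioms M] by blast
  then show ?thesis
    by (simp only: homotopy_pullback_def pullback_conditions_def assms ff es simp_thms)
qed

section \<open>Pseudo-functors and pseudo-natural transformations\<close>

lemma pnt_eqI: "Cmpt \<phi> = Cmpt \<psi> \<Longrightarrow> Cell \<phi> = Cell \<psi> \<Longrightarrow>
    \<phi> = (\<psi> :: ('c, 'u, 'o, 'm, 'p, 'q) pnt)"
  by (cases \<phi>, cases \<psi>) simp

lemma
  assumes "pseudonatural C P Q \<phi>"
  shows pseudonatural_source: "pseudofunctor C P"
    and pseudonatural_target: "pseudofunctor C Q"
    and pseudonatural_ext: "Cmpt \<phi> \<in> extensional (Obj C)" "Cell \<phi> \<in> extensional (Arr C)"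
    and pseudonatural_cmpt: "c \<in> Obj C \<Longrightarrow> is_functor (Grp P c) (Grp Q c) (Cmpt \<phi> c)"
    and pseudonatural_cell: "u \<in> Hom C b c \<Longrightarrow> nat_iso (Grp P c) (Grp Q b)
      (comp_ftr (Grp P c) (Cmpt \<phi> b) (Pull P u)) (comp_ftr (Grp P c) (Pull Q u) (Cmpt \<phi> c))
        (Cell \<phi> u)"
    and pseudonatural_unt: "c \<in> Obj C \<Longrightarrow> x \<in> Obj (Grp P c) \<Longrightarrow>
      Cmp (Grp Q c) (Cell \<phi> (Ide C c) x) (FA (Cmpt \<phi> c) (Unt P c x)) = Unt Q c (FO (Cmpt \<phi> c) x)"
    and pseudonatural_cpr: "u \<in> Hom C b c \<Longrightarrow> v \<in> Hom C c d \<Longrightarrow> x \<in> Obj (Grp P d) \<Longrightarrow>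
      Cmp (Grp Q b) (Cell \<phi> (Cmp C v u) x) (FA (Cmpt \<phi> b) (Cpr P u v x)) =
      Cmp (Grp Q b) (Cpr Q u v (FO (Cmpt \<phi> d) x))
        (Cmp (Grp Q b) (FA (Pull Q u) (Cell \<phi> v x)) (Cell \<phi> u (FO (Pull P v) x)))"
  using assms unfolding pseudonatural_def by blast+

lemma pseudonaturalI:
  assumes "pseudofunctor C P" "pseudofunctor C Q"
    and "Cmpt \<phi> \<in> extensional (Obj C)" "Cell \<phi> \<in> extensional (Arr C)"
    and "\<And>c. c \<in> Obj C \<Longrightarrow> is_functor (Grp P c) (Grp Q c) (Cmpt \<phi> c)"
    and "\<And>b c u. u \<in> Hom C b c \<Longrightarrow> nat_iso (Grp P c) (Grp Q b)
      (comp_ftr (Grp P c) (Cmpt \<phi> b) (Pull P u)) (comp_ftr (Grp P c) (Pull Q u) (Cmpt \<phi> c))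
        (Cell \<phi> u)"
    and "\<And>c x. c \<in> Obj C \<Longrightarrow> x \<in> Obj (Grp P c) \<Longrightarrow>
      Cmp (Grp Q c) (Cell \<phi> (Ide C c) x) (FA (Cmpt \<phi> c) (Unt P c x)) = Unt Q c (FO (Cmpt \<phi> c) x)"
    and "\<And>b c d u v x. u \<in> Hom C b c \<Longrightarrow> v \<in> Hom C c d \<Longrightarrow> x \<in> Obj (Grp P d) \<Longrightarrow>
      Cmp (Grp Q b) (Cell \<phi> (Cmp C v u) x) (FA (Cmpt \<phi> b) (Cpr P u v x)) =
      Cmp (Grp Q b) (Cpr Q u v (FO (Cmpt \<phi> d) x))
        (Cmp (Grp Q b) (FA (Pull Q u) (Cell \<phi> v x)) (Cell \<phi> u (FO (Pull P v) x)))"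
  shows "pseudonatural C P Q \<phi>"
  using assms unfolding pseudonatural_def by blast

context pseudofunctor
begin

lemma pull_ide: "c \<in> Obj C \<Longrightarrow> is_functor (Grp P c) (Grp P c) (Pull P (Ide C c))"
  by (rule pull) (rule ide_hom)

lemma unt_arr:
  assumes "c \<in> Obj C" "x \<in> Obj (Grp P c)"
  shows "Unt P c x \<in> Arr (Grp P c)" "Dom (Grp P c) (Unt P c x) = x"
    "Cod (Grp P c) (Unt P c x) = FO (Pull P (Ide C c)) x"
  using nat_iso_arr(1-3)[OF unt[OF assms(1)] assms(2)] assms(2) by simp_all

lemma cpr_arr:
  assumes "u \<in> Hom C b c" "v \<in> Hom C c d" "x \<in> Obj (Grp P d)"
  shows "Cpr P u v x \<in> Arr (Grp P b)"
    "Dom (Grp P b) (Cpr P u v x) = FO (Pull P u) (FO (Pull P v) x)"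
    "Cod (Grp P b) (Cpr P u v x) = FO (Pull P (Cmp C v u)) x"
  using nat_iso_arr(1-3)[OF cpr[OF assms(1,2)] assms(3)] assms(3) by simp_all

lemma cpr_nat:
  assumes "u \<in> Hom C b c" "v \<in> Hom C c d" "f \<in> Hom (Grp P d) x y"
  shows "Cmp (Grp P b) (FA (Pull P (Cmp C v u)) f) (Cpr P u v x) =
    Cmp (Grp P b) (Cpr P u v y) (FA (Pull P u) (FA (Pull P v) f))"
  using nat_iso_arr(4)[OF cpr[OF assms(1,2)] HomD(1)[OF assms(3)]] HomD[OF assms(3)] by simp

lemma unt_nat:
  assumes "c \<in> Obj C" "f \<in> Hom (Grp P c) x y"
  shows "Cmp (Grp P c) (FA (Pull P (Ide C c)) f) (Unt P c x) = Cmp (Grp P c) (Unt P c y) f"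
  using nat_iso_arr(4)[OF unt[OF assms(1)] HomD(1)[OF assms(2)]] HomD[OF assms(2)] by simp

end

lemma cell_arr:
  assumes "pseudonatural C P Q \<phi>" "u \<in> Hom C b c" "x \<in> Obj (Grp P c)"
  shows "Cell \<phi> u x \<in> Arr (Grp Q b)"
    "Dom (Grp Q b) (Cell \<phi> u x) = FO (Cmpt \<phi> b) (FO (Pull P u) x)"
    "Cod (Grp Q b) (Cell \<phi> u x) = FO (Pull Q u) (FO (Cmpt \<phi> c) x)"
  using nat_iso_arr(1-3)[OF pseudonatural_cell[OF assms(1,2)] assms(3)] assms(3) by simp_all

lemma cell_nat:
  assumes "pseudonatural C P Q \<phi>" "u \<in> Hom C b c" "f \<in> Hom (Grp P c) x y"
  shows "Cmp (Grp Q b) (FA (Pull Q u) (FA (Cmpt \<phi> c) f)) (Cell \<phi> u x) =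
    Cmp (Grp Q b) (Cell \<phi> u y) (FA (Cmpt \<phi> b) (FA (Pull P u) f))"
  using nat_iso_arr(4)[OF pseudonatural_cell[OF assms(1,2)] HomD(1)[OF assms(3)]]
    HomD[OF assms(3)] by simp

section \<open>Identities and composites of pseudo-natural transformations\<close>

lemma pnt_id_simps:
  "c \<in> Obj C \<Longrightarrow> Cmpt (pnt_id C P) c = id_ftr (Grp P c)"
  "u \<in> Hom C b c \<Longrightarrow> x \<in> Obj (Grp P c) \<Longrightarrow>
    Cell (pnt_id C P) u x = Ide (Grp P b) (FO (Pull P u) x)"
  by (simp_all add: pnt_id_def Hom_def)

lemma pseudonatural_id:
  assumes "pseudofunctor C P"
  shows "pseudonatural C P P (pnt_id C P)"
proof -
  interpret pseudofunctor C P by fact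
  show ?thesis
  proof (rule pseudonaturalI[OF assms assms])
    show "Cmpt (pnt_id C P) \<in> extensional (Obj C)" "Cell (pnt_id C P) \<in> extensional (Arr C)"
      by (simp_all add: pnt_id_def)
    show "is_functor (Grp P c) (Grp P c) (Cmpt (pnt_id C P) c)" if c: "c \<in> Obj C" for c
      unfolding pnt_id_simps(1)[OF c] by (rule is_functor_id[OF groupoid.axioms(1)[OF grp[OF c]]])
  next
    fix b c u assume u: "u \<in> Hom C b c"
    note bc = Hom_obj[OF u]
    interpret Pb: groupoid "Grp P b" by (rule grp[OF bc(1)])
    interpret Pc: groupoid "Grp P c" by (rule grp[OF bc(2)])
    note us = functor_arr[OF pull[OF u]]
    show "nat_iso (Grp P c) (Grp P b) (comp_ftr (Grp P c) (Cmpt (pnt_id C P) b) (Pull P u))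
        (comp_ftr (Grp P c) (Pull P u) (Cmpt (pnt_id C P) c)) (Cell (pnt_id C P) u)"
      unfolding pnt_id_simps(1)[OF bc(1)] pnt_id_simps(1)[OF bc(2)]
    proof (rule nat_isoI[OF Pb.groupoid_axioms])
      show "is_functor (Grp P c) (Grp P b) (comp_ftr (Grp P c) (id_ftr (Grp P b)) (Pull P u))"
        by (rule is_functor_comp[OF pull[OF u] is_functor_id[OF Pb.category_axioms]])
      show "is_functor (Grp P c) (Grp P b) (comp_ftr (Grp P c) (Pull P u) (id_ftr (Grp P c)))"
        by (rule is_functor_comp[OF is_functor_id[OF Pc.category_axioms] pull[OF u]])
      show "Cell (pnt_id C P) u \<in> extensional (Obj (Grp P c))"
        using HomD[OF u] by (simp add: pnt_id_def)
      show "Cell (pnt_id C P) u x \<in> Hom (Grp P b)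
        (FO (comp_ftr (Grp P c) (id_ftr (Grp P b)) (Pull P u)) x)
          (FO (comp_ftr (Grp P c) (Pull P u) (id_ftr (Grp P c))) x)" if x: "x \<in> Obj (Grp P c)" for x
        using Pb.ide_hom us(1)[OF x] x by (simp add: pnt_id_simps(2)[OF u])
      show "Cmp (Grp P b) (FA (comp_ftr (Grp P c) (Pull P u) (id_ftr (Grp P c))) f)
        (Cell (pnt_id C P) u x) =
          Cmp (Grp P b) (Cell (pnt_id C P) u y)
            (FA (comp_ftr (Grp P c) (id_ftr (Grp P b)) (Pull P u)) f)"
        if f: "f \<in> Hom (Grp P c) x y" for f x y
        using HomD[OF f] Pc.Hom_obj[OF f] by (simp add: pnt_id_simps(2)[OF u] us Pb.arr_simps)
    qed
  next
    fix c x assume c: "c \<in> Obj C" and x: "x \<in> Obj (Grp P c)"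
    interpret Pc: groupoid "Grp P c" by (rule grp[OF c])
    show "Cmp (Grp P c) (Cell (pnt_id C P) (Ide C c) x) (FA (Cmpt (pnt_id C P) c) (Unt P c x)) =
        Unt P c (FO (Cmpt (pnt_id C P) c) x)"
      using x by (simp add: pnt_id_simps(1)[OF c] pnt_id_simps(2)[OF ide_hom[OF c]] unt_arr[OF c]
          Pc.arr_simps)
  next
    fix b c d u v x assume u: "u \<in> Hom C b c" and v: "v \<in> Hom C c d" and x: "x \<in> Obj (Grp P d)"
    note uv = Hom_obj[OF u] Hom_obj[OF v]
    interpret Pb: groupoid "Grp P b" by (rule grp[OF uv(1)])
    interpret Pc: groupoid "Grp P c" by (rule grp[OF uv(2)])
    note vx = functor_arr(1)[OF pull[OF v] x]
    have uvx: "FO (Pull P u) (FO (Pull P v) x) \<in> Obj (Grp P b)"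
      by (rule functor_arr(1)[OF pull[OF u] vx])
    show "Cmp (Grp P b) (Cell (pnt_id C P) (Cmp C v u) x) (FA (Cmpt (pnt_id C P) b) (Cpr P u v x)) =
        Cmp (Grp P b) (Cpr P u v (FO (Cmpt (pnt_id C P) d) x))
          (Cmp (Grp P b) (FA (Pull P u) (Cell (pnt_id C P) v x))
            (Cell (pnt_id C P) u (FO (Pull P v) x)))"
      using x vx uvx functor_arr(1)[OF pull[OF cmp_hom[OF u v]] x]
      by (simp add: pnt_id_simps(1) uv pnt_id_simps(2)[OF cmp_hom[OF u v]] pnt_id_simps(2)[OF u]
          pnt_id_simps(2)[OF v] cpr_arr[OF u v x] functor_arr(5)[OF pull[OF u]] Pb.arr_simps)
  qed
qed

lemma pnt_comp_simps:
  "c \<in> Obj C \<Longrightarrow> Cmpt (pnt_comp C P S \<psi> \<phi>) c = comp_ftr (Grp P c) (Cmpt \<psi> c) (Cmpt \<phi> c)"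
  "u \<in> Hom C b c \<Longrightarrow> x \<in> Obj (Grp P c) \<Longrightarrow> Cell (pnt_comp C P S \<psi> \<phi>) u x =
    Cmp (Grp S b) (Cell \<psi> u (FO (Cmpt \<phi> c) x)) (FA (Cmpt \<psi> b) (Cell \<phi> u x))"
  by (simp_all add: pnt_comp_def Hom_def)

text \<open>The cells are pasted: first the image under \<psi> of the cell of \<phi>, then the cell
  of \<psi>. Each law for the composite follows from the law for \<psi>, the image under \<psi> of
  the law for \<phi>, and naturality of the cells of \<psi> to exchange the two.\<close>

lemma pseudonatural_comp:
  assumes \<phi>: "pseudonatural C P Q \<phi>" and \<psi>: "pseudonatural C Q S \<psi>"
  shows "pseudonatural C P S (pnt_comp C P S \<psi> \<phi>)"
proof -
  interpret P: pseudofunctor C P by (rule pseudonatural_source[OF \<phi>])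
  interpret Q: pseudofunctor C Q by (rule pseudonatural_target[OF \<phi>])
  interpret S: pseudofunctor C S by (rule pseudonatural_target[OF \<psi>])
  let ?c = "pnt_comp C P S \<psi> \<phi>"
  note ftr\<phi> = pseudonatural_cmpt[OF \<phi>] and ftr\<psi> = pseudonatural_cmpt[OF \<psi>]
  have cell: "Cell ?c u x \<in> Hom (Grp S b) (FO (Cmpt \<psi> b) (FO (Cmpt \<phi> b) (FO (Pull P u) x)))
      (FO (Pull S u) (FO (Cmpt \<psi> c) (FO (Cmpt \<phi> c) x)))"
    if u: "u \<in> Hom C b c" and x: "x \<in> Obj (Grp P c)" for u b c x
  proof -
    note bc = P.Hom_obj[OF u]
    interpret Sb: groupoid "Grp S b" by (rule S.grp[OF bc(1)])
    show ?thesis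
      using x unfolding pnt_comp_simps(2)[OF u x]
      by (intro HomI) (simp_all add: Sb.arr_simps cell_arr[OF \<phi> u] cell_arr[OF \<psi> u]
          functor_arr[OF ftr\<phi>] functor_arr[OF ftr\<psi>] bc)
  qed
  show ?thesis
  proof (rule pseudonaturalI)
    show "pseudofunctor C P" "pseudofunctor C S" by unfold_locales
    show "Cmpt ?c \<in> extensional (Obj C)" "Cell ?c \<in> extensional (Arr C)"
      by (simp_all add: pnt_comp_def)
    show ftr: "is_functor (Grp P c) (Grp S c) (Cmpt ?c c)" if c: "c \<in> Obj C" for c
      unfolding pnt_comp_simps(1)[OF c] by (rule is_functor_comp[OF ftr\<phi>[OF c] ftr\<psi>[OF c]])
    show "nat_iso (Grp P c) (Grp S b) (comp_ftr (Grp P c) (Cmpt ?c b) (Pull P u))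
        (comp_ftr (Grp P c) (Pull S u) (Cmpt ?c c)) (Cell ?c u)" if u: "u \<in> Hom C b c" for u b c
    proof (rule nat_isoI)
      note bc = P.Hom_obj[OF u]
      show "groupoid (Grp S b)" by (rule S.grp[OF bc(1)])
      interpret Sb: groupoid "Grp S b" by fact
      interpret Pb: groupoid "Grp P b" by (rule P.grp[OF bc(1)])
      interpret Pc: groupoid "Grp P c" by (rule P.grp[OF bc(2)])
      show "is_functor (Grp P c) (Grp S b) (comp_ftr (Grp P c) (Cmpt ?c b) (Pull P u))"
        by (rule is_functor_comp[OF P.pull[OF u] ftr[OF bc(1)]])
      show "is_functor (Grp P c) (Grp S b) (comp_ftr (Grp P c) (Pull S u) (Cmpt ?c c))"
        by (rule is_functor_comp[OF ftr[OF bc(2)] S.pull[OF u]])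
      show "Cell ?c u \<in> extensional (Obj (Grp P c))"
        using HomD[OF u] by (simp add: pnt_comp_def)
      note \<phi>b = functor_arr[OF ftr\<phi>[OF bc(1)]] and \<phi>c = functor_arr[OF ftr\<phi>[OF bc(2)]]
        and \<psi>b = functor_arr[OF ftr\<psi>[OF bc(1)]] and \<psi>c = functor_arr[OF ftr\<psi>[OF bc(2)]]
        and uP = functor_arr[OF P.pull[OF u]] and uQ = functor_arr[OF Q.pull[OF u]]
        and uS = functor_arr[OF S.pull[OF u]]
      show "Cell ?c u x \<in> Hom (Grp S b) (FO (comp_ftr (Grp P c) (Cmpt ?c b) (Pull P u)) x)
          (FO (comp_ftr (Grp P c) (Pull S u) (Cmpt ?c c)) x)" if x: "x \<in> Obj (Grp P c)" for x
        using cell[OF u x] x by (simp add: pnt_comp_simps(1) bc uP)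
      show "Cmp (Grp S b) (FA (comp_ftr (Grp P c) (Pull S u) (Cmpt ?c c)) f) (Cell ?c u x) =
          Cmp (Grp S b) (Cell ?c u y) (FA (comp_ftr (Grp P c) (Cmpt ?c b) (Pull P u)) f)"
        if f: "f \<in> Hom (Grp P c) x y" for f x y
      proof -
        note fs = HomD[OF f] Pc.Hom_obj[OF f]
        note simps = Sb.arr_simps(1-6) fs \<phi>b(1-4) \<phi>c(1-4) \<psi>b(1-4) \<psi>c(1-4) uP(1-4) uQ(1-4) uS(1-4)
          cell_arr[OF \<phi> u] cell_arr[OF \<psi> u]
        have n\<psi>: "Cmp (Grp S b) (FA (Pull S u) (FA (Cmpt \<psi> c) (FA (Cmpt \<phi> c) f)))
          (Cell \<psi> u (FO (Cmpt \<phi> c) x)) =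
          Cmp (Grp S b) (Cell \<psi> u (FO (Cmpt \<phi> c) y))
            (FA (Cmpt \<psi> b) (FA (Pull Q u) (FA (Cmpt \<phi> c) f)))"
          by (rule cell_nat[OF \<psi> u functor_hom[OF ftr\<phi>[OF bc(2)] f]])
        have n\<phi>: "Cmp (Grp S b) (FA (Cmpt \<psi> b) (FA (Pull Q u) (FA (Cmpt \<phi> c) f)))
          (FA (Cmpt \<psi> b) (Cell \<phi> u x)) =
          Cmp (Grp S b) (FA (Cmpt \<psi> b) (Cell \<phi> u y))
            (FA (Cmpt \<psi> b) (FA (Cmpt \<phi> b) (FA (Pull P u) f)))"
          using cell_nat[OF \<phi> u f] by (simp add: simps flip: \<psi>b(6))
        have "Cmp (Grp S b) (FA (Pull S u) (FA (Cmpt \<psi> c) (FA (Cmpt \<phi> c) f))) (Cell ?c u x) =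
          Cmp (Grp S b) (Cmp (Grp S b) (FA (Pull S u) (FA (Cmpt \<psi> c) (FA (Cmpt \<phi> c) f)))
            (Cell \<psi> u (FO (Cmpt \<phi> c) x))) (FA (Cmpt \<psi> b) (Cell \<phi> u x))"
          unfolding pnt_comp_simps(2)[OF u fs(4)] by (simp add: simps Sb.assoc)
        also have "\<dots> = Cmp (Grp S b) (Cell \<psi> u (FO (Cmpt \<phi> c) y))
          (Cmp (Grp S b) (FA (Cmpt \<psi> b) (FA (Pull Q u) (FA (Cmpt \<phi> c) f)))
            (FA (Cmpt \<psi> b) (Cell \<phi> u x)))"
          unfolding n\<psi> by (simp add: simps Sb.assoc)
        also have "\<dots> = Cmp (Grp S b) (Cell ?c u y)
          (FA (Cmpt \<psi> b) (FA (Cmpt \<phi> b) (FA (Pull P u) f)))"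
          unfolding n\<phi> pnt_comp_simps(2)[OF u fs(5)] by (simp add: simps Sb.assoc)
        finally show ?thesis
          using fs by (simp add: pnt_comp_simps(1) bc uP)
      qed
    qed
  next
    fix c x assume c: "c \<in> Obj C" and x: "x \<in> Obj (Grp P c)"
    interpret Sc: groupoid "Grp S c" by (rule S.grp[OF c])
    note id = P.ide_hom[OF c]
    note \<phi>c = functor_arr[OF ftr\<phi>[OF c]] and \<psi>c = functor_arr[OF ftr\<psi>[OF c]]
    note simps = \<phi>c(1-4) \<psi>c(1-4) x P.unt_arr[OF c] functor_arr(1)[OF P.pull_ide[OF c]]
      cell_arr[OF \<phi> id] cell_arr[OF \<psi> id]
    have "FA (Cmpt \<psi> c) (Cmp (Grp Q c) (Cell \<phi> (Ide C c) x) (FA (Cmpt \<phi> c) (Unt P c x))) =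
      Cmp (Grp S c) (FA (Cmpt \<psi> c) (Cell \<phi> (Ide C c) x))
        (FA (Cmpt \<psi> c) (FA (Cmpt \<phi> c) (Unt P c x)))"
      by (rule \<psi>c(6)) (simp_all add: simps)
    then have "Cmp (Grp S c) (Cell ?c (Ide C c) x) (FA (Cmpt \<psi> c) (FA (Cmpt \<phi> c) (Unt P c x))) =
      Cmp (Grp S c) (Cell \<psi> (Ide C c) (FO (Cmpt \<phi> c) x))
        (FA (Cmpt \<psi> c) (Unt Q c (FO (Cmpt \<phi> c) x)))"
      unfolding pnt_comp_simps(2)[OF id x] pseudonatural_unt[OF \<phi> c x]
      by (simp add: simps Sc.assoc)
    also have "\<dots> = Unt S c (FO (Cmpt \<psi> c) (FO (Cmpt \<phi> c) x))"
      by (rule pseudonatural_unt[OF \<psi> c \<phi>c(1)[OF x]])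
    finally show "Cmp (Grp S c) (Cell ?c (Ide C c) x) (FA (Cmpt ?c c) (Unt P c x)) =
        Unt S c (FO (Cmpt ?c c) x)"
      using x by (simp add: pnt_comp_simps(1) c P.unt_arr)
  next
    fix b c d u v x assume u: "u \<in> Hom C b c" and v: "v \<in> Hom C c d" and x: "x \<in> Obj (Grp P d)"
    note vu = P.cmp_hom[OF u v]
    note uv = P.Hom_obj[OF u] P.Hom_obj[OF v]
    interpret Sb: groupoid "Grp S b" by (rule S.grp[OF uv(1)])
    interpret Sc: groupoid "Grp S c" by (rule S.grp[OF uv(2)])
    interpret Qb: groupoid "Grp Q b" by (rule Q.grp[OF uv(1)])
    note \<phi>b = functor_arr[OF ftr\<phi>[OF uv(1)]] and \<phi>c = functor_arr[OF ftr\<phi>[OF uv(2)]]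
      and \<phi>d = functor_arr[OF ftr\<phi>[OF uv(4)]]
      and \<psi>b = functor_arr[OF ftr\<psi>[OF uv(1)]] and \<psi>c = functor_arr[OF ftr\<psi>[OF uv(2)]]
      and \<psi>d = functor_arr[OF ftr\<psi>[OF uv(4)]]
      and uP = functor_arr[OF P.pull[OF u]] and uQ = functor_arr[OF Q.pull[OF u]]
      and uS = functor_arr[OF S.pull[OF u]]
      and vP = functor_arr[OF P.pull[OF v]] and vQ = functor_arr[OF Q.pull[OF v]]
      and vS = functor_arr[OF S.pull[OF v]]
    note simps = Sb.arr_simps(1-6) Sc.arr_simps(1-6) Qb.arr_simps(1-6) x
      \<phi>b(1-4) \<phi>c(1-4) \<phi>d(1-4) \<psi>b(1-4) \<psi>c(1-4) \<psi>d(1-4) uP(1-4) uQ(1-4) uS(1-4) vP(1-4) vQ(1-4)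
        vS(1-4)
      cell_arr[OF \<phi> u] cell_arr[OF \<psi> u] cell_arr[OF \<phi> v] cell_arr[OF \<psi> v]
      cell_arr[OF \<phi> vu] cell_arr[OF \<psi> vu] P.cpr_arr[OF u v] Q.cpr_arr[OF u v] S.cpr_arr[OF u v]
    let ?C = "Cmp (Grp S b)"
    \<comment> \<open>The eleven arrows of the coherence diagram are named, so that from here on it
      is treated as a diagram of opaque arrows, with only their sources and targets and three
      commuting regions known.\<close>
    define a where "a = Cell \<psi> (Cmp C v u) (FO (Cmpt \<phi> d) x)"
    define k where "k = FA (Cmpt \<psi> b) (Cell \<phi> (Cmp C v u) x)"
    define p where "p = FA (Cmpt \<psi> b) (FA (Cmpt \<phi> b) (Cpr P u v x))"
    define q where "q = FA (Cmpt \<psi> b) (Cpr Q u v (FO (Cmpt \<phi> d) x))"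
    define r where "r = FA (Cmpt \<psi> b) (FA (Pull Q u) (Cell \<phi> v x))"
    define s where "s = FA (Cmpt \<psi> b) (Cell \<phi> u (FO (Pull P v) x))"
    define t where "t = Cpr S u v (FO (Cmpt \<psi> d) (FO (Cmpt \<phi> d) x))"
    define w where "w = FA (Pull S u) (Cell \<psi> v (FO (Cmpt \<phi> d) x))"
    define y where "y = Cell \<psi> u (FO (Pull Q v) (FO (Cmpt \<phi> d) x))"
    define z where "z = FA (Pull S u) (FA (Cmpt \<psi> c) (Cell \<phi> v x))"
    define y' where "y' = Cell \<psi> u (FO (Cmpt \<phi> c) (FO (Pull P v) x))"
    note defs = a_def k_def p_def q_def r_def s_def t_def w_def y_def z_def y'_def
    have *: "a \<in> Arr (Grp S b)" "k \<in> Arr (Grp S b)" "p \<in> Arr (Grp S b)" "q \<in> Arr (Grp S b)"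
      "r \<in> Arr (Grp S b)" "s \<in> Arr (Grp S b)" "t \<in> Arr (Grp S b)" "w \<in> Arr (Grp S b)"
      "y \<in> Arr (Grp S b)" "z \<in> Arr (Grp S b)" "y' \<in> Arr (Grp S b)"
      "Dom (Grp S b) a = Cod (Grp S b) k" "Dom (Grp S b) k = Cod (Grp S b) p"
      "Cod (Grp S b) q = Dom (Grp S b) a" "Cod (Grp S b) r = Dom (Grp S b) q"
      "Cod (Grp S b) s = Dom (Grp S b) r" "Cod (Grp S b) w = Dom (Grp S b) t"
      "Cod (Grp S b) y = Dom (Grp S b) w" "Cod (Grp S b) z = Dom (Grp S b) w"
      "Cod (Grp S b) y' = Dom (Grp S b) z" "Cod (Grp S b) s = Dom (Grp S b) y'"
      "Cod (Grp S b) r = Dom (Grp S b) y"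
      unfolding defs by (simp_all add: simps)
    \<comment> \<open>The three regions: coherence of \<psi> at the image of \<open>x\<close>, the
      image under \<psi> of the coherence of \<phi>, and naturality of the cell of \<psi> at
      \<open>u\<close> with respect to the cell of \<phi> at \<open>v\<close>.\<close>
    have E1: "?C a q = ?C t (?C w y)"
      unfolding defs by (rule pseudonatural_cpr[OF \<psi> u v \<phi>d(1)[OF x]])
    have E2: "?C k p = ?C q (?C r s)"
      using arg_cong[OF pseudonatural_cpr[OF \<phi> u v x], of "FA (Cmpt \<psi> b)"]
      unfolding defs by (simp add: simps \<psi>b(6))
    have E3: "?C z y' = ?C y r"
      unfolding defs by (rule cell_nat[OF \<psi> u HomI]) (simp_all add: simps)
    have "?C (?C a k) p = ?C (?C a q) (?C r s)" using * by (simp add: Sb.arr_simps E2)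
    also have "\<dots> = ?C t (?C w (?C (?C y r) s))" unfolding E1 using * by (simp add: Sb.arr_simps)
    also have "\<dots> = ?C t (?C (?C w z) (?C y' s))"
      unfolding E3[symmetric] using * by (simp add: Sb.arr_simps)
    also have "?C w z = FA (Pull S u) (Cell ?c v x)"
      unfolding pnt_comp_simps(2)[OF v x] defs by (subst uS(6)) (simp_all add: simps)
    finally show "?C (Cell ?c (Cmp C v u) x) (FA (Cmpt ?c b) (Cpr P u v x)) =
        ?C (Cpr S u v (FO (Cmpt ?c d) x))
          (?C (FA (Pull S u) (Cell ?c v x)) (Cell ?c u (FO (Pull P v) x)))"
      unfolding defs
      by (simp add: pnt_comp_simps(1) uv pnt_comp_simps(2)[OF u] pnt_comp_simps(2)[OF vu] simps)
  qed
qed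

text \<open>Component families, cell families and their values are all extensional, so agreement on
  the carriers gives HOL equality. The category laws and the functor laws below rest on
  this.\<close>

lemma pseudonatural_eqI:
  assumes \<phi>: "pseudonatural C P Q \<phi>" and \<psi>: "pseudonatural C P Q \<psi>"
    and FO: "\<And>c x. c \<in> Obj C \<Longrightarrow> x \<in> Obj (Grp P c) \<Longrightarrow> FO (Cmpt \<phi> c) x = FO (Cmpt \<psi> c) x"
    and FA: "\<And>c f. c \<in> Obj C \<Longrightarrow> f \<in> Arr (Grp P c) \<Longrightarrow> FA (Cmpt \<phi> c) f = FA (Cmpt \<psi> c) f"
    and Cell: "\<And>b c u x. u \<in> Hom C b c \<Longrightarrow> x \<in> Obj (Grp P c) \<Longrightarrow> Cell \<phi> u x = Cell \<psi> u x"
  shows "\<phi> = \<psi>"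
proof (rule pnt_eqI)
  show "Cmpt \<phi> = Cmpt \<psi>"
  proof (rule extensionalityI[OF pseudonatural_ext(1)[OF \<phi>] pseudonatural_ext(1)[OF \<psi>]])
    show "Cmpt \<phi> c = Cmpt \<psi> c" if c: "c \<in> Obj C" for c
      using functor_eqI[OF pseudonatural_cmpt[OF \<phi> c] pseudonatural_cmpt[OF \<psi> c] FO[OF c] FA[OF c]]
          .
  qed
  show "Cell \<phi> = Cell \<psi>"
  proof (rule extensionalityI[OF pseudonatural_ext(2)[OF \<phi>] pseudonatural_ext(2)[OF \<psi>]])
    fix u assume "u \<in> Arr C"
    then have u: "u \<in> Hom C (Dom C u) (Cod C u)" by (rule Arr_in_Hom)
    show "Cell \<phi> u = Cell \<psi> u"
      by (rule extensionalityI[OF nat_iso_ext[OF pseudonatural_cell[OF \<phi> u]]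
            nat_iso_ext[OF pseudonatural_cell[OF \<psi> u]] Cell[OF u]])
  qed
qed

lemma pnt_comp_id_right:
  assumes \<phi>: "pseudonatural C P Q \<phi>"
  shows "pnt_comp C P Q \<phi> (pnt_id C P) = \<phi>"
proof (rule pseudonatural_eqI[OF pseudonatural_comp[OF
  pseudonatural_id[OF pseudonatural_source[OF \<phi>]] \<phi>] \<phi>])
  interpret P: pseudofunctor C P by (rule pseudonatural_source[OF \<phi>])
  interpret Q: pseudofunctor C Q by (rule pseudonatural_target[OF \<phi>])
  fix b c u x assume u: "u \<in> Hom C b c" and x: "x \<in> Obj (Grp P c)"
  note bc = P.Hom_obj[OF u]
  interpret Qb: groupoid "Grp Q b" by (rule Q.grp[OF bc(1)])
  show "Cell (pnt_comp C P Q \<phi> (pnt_id C P)) u x = Cell \<phi> u x"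
    using x by (simp add: pnt_comp_simps(2)[OF u x] pnt_id_simps bc pnt_id_simps(2)[OF u]
      functor_arr[OF pseudonatural_cmpt[OF \<phi> bc(1)]] functor_arr[OF P.pull[OF u]]
      Qb.arr_simps cell_arr[OF \<phi> u])
qed (simp_all add: pnt_comp_simps(1) pnt_id_simps(1))

lemma pnt_comp_id_left:
  assumes \<phi>: "pseudonatural C P Q \<phi>"
  shows "pnt_comp C P Q (pnt_id C Q) \<phi> = \<phi>"
proof (rule pseudonatural_eqI[OF pseudonatural_comp[OF \<phi>
  pseudonatural_id[OF pseudonatural_target[OF \<phi>]]] \<phi>])
  interpret P: pseudofunctor C P by (rule pseudonatural_source[OF \<phi>])
  interpret Q: pseudofunctor C Q by (rule pseudonatural_target[OF \<phi>])
  fix b c u x assume u: "u \<in> Hom C b c" and x: "x \<in> Obj (Grp P c)"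
  note bc = P.Hom_obj[OF u]
  interpret Qb: groupoid "Grp Q b" by (rule Q.grp[OF bc(1)])
  show "Cell (pnt_comp C P Q (pnt_id C Q) \<phi>) u x = Cell \<phi> u x"
    using x by (simp add: pnt_comp_simps(2)[OF u x] pnt_id_simps bc pnt_id_simps(2)[OF u]
      functor_arr[OF pseudonatural_cmpt[OF \<phi> bc(2)]] functor_arr[OF P.pull[OF u]]
      functor_arr[OF Q.pull[OF u]] Qb.arr_simps cell_arr[OF \<phi> u])
qed (simp_all add: pnt_comp_simps(1) pnt_id_simps(1) functor_arr[OF pseudonatural_cmpt[OF \<phi>]])

lemma pnt_comp_assoc:
  assumes \<phi>: "pseudonatural C P Q \<phi>" and \<psi>: "pseudonatural C Q S \<psi>" and \<chi>: "pseudonatural C S T \<chi>"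
  shows "pnt_comp C P T \<chi> (pnt_comp C P S \<psi> \<phi>) = pnt_comp C P T (pnt_comp C Q T \<chi> \<psi>) \<phi>"
proof (rule pseudonatural_eqI[OF pseudonatural_comp[OF pseudonatural_comp[OF \<phi> \<psi>] \<chi>]
      pseudonatural_comp[OF \<phi> pseudonatural_comp[OF \<psi> \<chi>]]])
  interpret P: pseudofunctor C P by (rule pseudonatural_source[OF \<phi>])
  interpret Q: pseudofunctor C Q by (rule pseudonatural_target[OF \<phi>])
  interpret S: pseudofunctor C S by (rule pseudonatural_target[OF \<psi>])
  interpret T: pseudofunctor C T by (rule pseudonatural_target[OF \<chi>])
  fix b c u x assume u: "u \<in> Hom C b c" and x: "x \<in> Obj (Grp P c)"
  note bc = P.Hom_obj[OF u]
  interpret Sb: groupoid "Grp S b" by (rule S.grp[OF bc(1)])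
  interpret Tb: groupoid "Grp T b" by (rule T.grp[OF bc(1)])
  note f = functor_arr[OF pseudonatural_cmpt[OF \<phi> bc(1)]]
    functor_arr[OF pseudonatural_cmpt[OF \<phi> bc(2)]]
    functor_arr[OF pseudonatural_cmpt[OF \<psi> bc(1)]] functor_arr[OF pseudonatural_cmpt[OF \<psi> bc(2)]]
    functor_arr[OF pseudonatural_cmpt[OF \<chi> bc(1)]] functor_arr[OF pseudonatural_cmpt[OF \<chi> bc(2)]]
    functor_arr[OF P.pull[OF u]] functor_arr[OF Q.pull[OF u]] functor_arr[OF S.pull[OF u]]
  show "Cell (pnt_comp C P T \<chi> (pnt_comp C P S \<psi> \<phi>)) u x =
      Cell (pnt_comp C P T (pnt_comp C Q T \<chi> \<psi>) \<phi>) u x"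
    using x by (simp add: pnt_comp_simps(2)[OF u] pnt_comp_simps(1) bc f
      Tb.arr_simps Sb.arr_simps cell_arr[OF \<phi> u] cell_arr[OF \<psi> u] cell_arr[OF \<chi> u])
next
  interpret P: pseudofunctor C P by (rule pseudonatural_source[OF \<phi>])
  fix c f assume c: "c \<in> Obj C" and f: "f \<in> Arr (Grp P c)"
  then show "FA (Cmpt (pnt_comp C P T \<chi> (pnt_comp C P S \<psi> \<phi>)) c) f =
      FA (Cmpt (pnt_comp C P T (pnt_comp C Q T \<chi> \<psi>) \<phi>) c) f"
    by (simp add: pnt_comp_simps(1) functor_arr[OF pseudonatural_cmpt[OF \<phi> c]])
qed (simp add: pnt_comp_simps(1) functor_arr[OF pseudonatural_cmpt[OF \<phi>]])

text \<open>The category laws hold for all pseudo-natural transformations; a class of morphisms only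
  has to contain the identities and be closed under composition. The lemma is used for restriction
  species and for decomposition spaces.\<close>

lemma category_psf_cat:
  assumes mor: "\<And>P Q \<phi>. mor P Q \<phi> \<Longrightarrow> pseudonatural C P Q \<phi>"
    and ident: "\<And>P. ob P \<Longrightarrow> mor P P (pnt_id C P)"
    and comp: "\<And>P Q S \<phi> \<psi>. mor P Q \<phi> \<Longrightarrow> mor Q S \<psi> \<Longrightarrow> mor P S (pnt_comp C P S \<psi> \<phi>)"
  shows "category (psf_cat C ob mor)"
proof -
  let ?D = "psf_cat C ob mor"
  have hom: "h \<in> Hom ?D P Q \<longleftrightarrow> (\<exists>\<phi>. h = Arrow P \<phi> Q \<and> ob P \<and> ob Q \<and> mor P Q \<phi>)" for h P Q
    by (auto simp: psf_cat_def Hom_def)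
  have cmp: "Cmp ?D (Arrow Q \<psi> S) (Arrow P \<phi> Q) = Arrow P (pnt_comp C P S \<psi> \<phi>) S" for P Q S \<phi> \<psi>
    by (simp add: psf_cat_def)
  have ide: "Ide ?D P = Arrow P (pnt_id C P) P" for P
    by (simp add: psf_cat_def)
  show ?thesis
  proof
    show "Dom ?D h \<in> Obj ?D" "Cod ?D h \<in> Obj ?D" if "h \<in> Arr ?D" for h
      using that by (auto simp: psf_cat_def)
    show "Ide ?D P \<in> Hom ?D P P" if "P \<in> Obj ?D" for P
      using that ident by (simp add: hom ide) (simp add: psf_cat_def)
    show "Cmp ?D k h \<in> Hom ?D P S" if "h \<in> Hom ?D P Q" "k \<in> Hom ?D Q S" for h k P Q S
      using that comp by (fastforce simp: hom cmp)
    show "Cmp ?D h (Ide ?D P) = h" "Cmp ?D (Ide ?D Q) h = h" if "h \<in> Hom ?D P Q" for h P Q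
      using that by (auto simp: hom cmp ide pnt_comp_id_right[OF mor] pnt_comp_id_left[OF mor])
    show "Cmp ?D l (Cmp ?D k h) = Cmp ?D (Cmp ?D l k) h"
      if "h \<in> Hom ?D P Q" "k \<in> Hom ?D Q S" "l \<in> Hom ?D S T" for h k l P Q S T
      using that by (auto simp: hom cmp pnt_comp_assoc[OF mor mor mor])
  qed
qed

section \<open>CULF maps\<close>

lemma generic_hom: "generic g \<Longrightarrow> g \<in> Hom Delta (src g) (tgt g)"
  by (simp add: generic_def Delta_def Hom_def)

lemma culf_iff:
  assumes \<phi>: "pseudonatural Delta S T \<phi>"
  shows "culf S T \<phi> \<longleftrightarrow> (\<forall>g. generic g \<longrightarrow> pullback_conditions (Grp S (tgt g)) (Grp S (src g))
    (Grp T (tgt g)) (Grp T (src g)) (Pull S g) (Cmpt \<phi> (tgt g)) (Cmpt \<phi> (src g)) (Pull T g)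
      (Cell \<phi> g))"
proof -
  interpret S: pseudofunctor Delta S by (rule pseudonatural_source[OF \<phi>])
  interpret T: pseudofunctor Delta T by (rule pseudonatural_target[OF \<phi>])
  have "homotopy_pullback (Grp S (tgt g)) (Grp S (src g)) (Grp T (tgt g)) (Grp T (src g))
      (Pull S g) (Cmpt \<phi> (tgt g)) (Cmpt \<phi> (src g)) (Pull T g) (Cell \<phi> g) \<longleftrightarrow>
    pullback_conditions (Grp S (tgt g)) (Grp S (src g)) (Grp T (tgt g)) (Grp T (src g))
      (Pull S g) (Cmpt \<phi> (tgt g)) (Cmpt \<phi> (src g)) (Pull T g) (Cell \<phi> g)"
    if "generic g" for g
  proof -
    note g = generic_hom[OF that]
    note objs = S.Hom_obj[OF g]
    show ?thesis
      by (intro homotopy_pullback_iff S.grp T.grp objs S.pull[OF g] T.pull[OF g]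
          pseudonatural_cmpt[OF \<phi>] pseudonatural_cell[OF \<phi> g])
  qed
  then show ?thesis unfolding culf_def using \<phi> by blast
qed

text \<open>The naturality cells are identities. A compatible pair \<open>(a, b)\<close> therefore
  has \<open>a\<close> equal to the pullback of \<open>b\<close>, so that \<open>b\<close> is its
  unique lift, and \<open>(x, y, \<zeta>)\<close> is reached from \<open>y\<close> by the inverse of
  \<open>\<zeta>\<close> and an identity.\<close>

lemma culf_id:
  assumes "simplicial_groupoid S"
  shows "culf S S (pnt_id Delta S)"
  unfolding culf_iff[OF pseudonatural_id[OF assms]]
proof (intro allI impI)
  interpret S: pseudofunctor Delta S by fact
  fix g assume "generic g"
  then have g: "g \<in> Hom Delta (src g) (tgt g)" by (rule generic_hom)
  note objs = S.Hom_obj[OF g]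
  interpret Sm: groupoid "Grp S (tgt g)" by (rule S.grp[OF objs(2)])
  interpret Sn: groupoid "Grp S (src g)" by (rule S.grp[OF objs(1)])
  note gs = functor_arr[OF S.pull[OF g]]
  note id = pnt_id_simps(1)[OF objs(1)] pnt_id_simps(1)[OF objs(2)] pnt_id_simps(2)[OF g]
  show "pullback_conditions (Grp S (tgt g)) (Grp S (src g)) (Grp S (tgt g)) (Grp S (src g))
    (Pull S g)
      (Cmpt (pnt_id Delta S) (tgt g)) (Cmpt (pnt_id Delta S) (src g)) (Pull S g)
        (Cell (pnt_id Delta S) g)"
    unfolding pullback_conditions_def
  proof (intro conjI ballI impI)
    fix w w' a b
    assume w: "w \<in> Obj (Grp S (tgt g))" "w' \<in> Obj (Grp S (tgt g))"
      and a: "a \<in> Hom (Grp S (src g)) (FO (Pull S g) w) (FO (Pull S g) w')"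
      and b: "b \<in> Hom (Grp S (tgt g)) (FO (Cmpt (pnt_id Delta S) (tgt g)) w)
          (FO (Cmpt (pnt_id Delta S) (tgt g)) w')"
      and eq: "Cmp (Grp S (src g)) (Cell (pnt_id Delta S) g w')
        (FA (Cmpt (pnt_id Delta S) (src g)) a) =
          Cmp (Grp S (src g)) (FA (Pull S g) b) (Cell (pnt_id Delta S) g w)"
    have b: "b \<in> Hom (Grp S (tgt g)) w w'" using b w by (simp add: id)
    have "FA (Pull S g) b = a"
      using eq w HomD[OF a] HomD[OF b] by (simp add: id gs Sn.arr_simps)
    moreover have "FA (Cmpt (pnt_id Delta S) (tgt g)) t = t" if "t \<in> Hom (Grp S (tgt g)) w w'" for t
      using HomD(1)[OF that] by (simp add: id)
    ultimately show "\<exists>!t. t \<in> Hom (Grp S (tgt g)) w w' \<and> FA (Pull S g) t = a \<and>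
        FA (Cmpt (pnt_id Delta S) (tgt g)) t = b"
      using b by metis
  next
    fix x y \<zeta>
    assume x: "x \<in> Obj (Grp S (src g))" and y: "y \<in> Obj (Grp S (tgt g))"
      and \<zeta>: "\<zeta> \<in> Hom (Grp S (src g)) (FO (Cmpt (pnt_id Delta S) (src g)) x) (FO (Pull S g) y)"
    have \<zeta>: "\<zeta> \<in> Hom (Grp S (src g)) x (FO (Pull S g) y)" using \<zeta> x by (simp add: id)
    note inv = Sn.inv_hom[OF \<zeta>]
    show "\<exists>w\<in>Obj (Grp S (tgt g)). \<exists>a\<in>Hom (Grp S (src g)) (FO (Pull S g) w) x.
        \<exists>b\<in>Hom (Grp S (tgt g)) (FO (Cmpt (pnt_id Delta S) (tgt g)) w) y.
          Cmp (Grp S (src g)) \<zeta> (FA (Cmpt (pnt_id Delta S) (src g)) a) =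
          Cmp (Grp S (src g)) (FA (Pull S g) b) (Cell (pnt_id Delta S) g w)"
    proof (rule bexI[OF _ y], rule bexI[OF _ inv], rule bexI)
      show "Ide (Grp S (tgt g)) y \<in> Hom (Grp S (tgt g)) (FO (Cmpt (pnt_id Delta S) (tgt g)) y) y"
        using y Sm.ide_hom by (simp add: id)
      show "Cmp (Grp S (src g)) \<zeta> (FA (Cmpt (pnt_id Delta S) (src g)) (inv_arr (Grp S (src g)) \<zeta>)) =
          Cmp (Grp S (src g)) (FA (Pull S g) (Ide (Grp S (tgt g)) y)) (Cell (pnt_id Delta S) g y)"
        using y HomD[OF \<zeta>] HomD[OF inv] by (simp add: id gs Sn.grp_simps)
    qed
  qed
qed

text \<open>Pasting of homotopy pullbacks. A compatible pair is lifted first through the square of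
  \<psi> and then through the square of \<phi>; essential surjectivity is composed in the same
  order.\<close>

lemma culf_comp:
  assumes culf: "culf S T \<phi>" "culf T U \<psi>"
  shows "culf S U (pnt_comp Delta S U \<psi> \<phi>)"
proof -
  have \<phi>: "pseudonatural Delta S T \<phi>" and \<psi>: "pseudonatural Delta T U \<psi>"
    using culf by (simp_all add: culf_def)
  let ?c = "pnt_comp Delta S U \<psi> \<phi>"
  interpret S: pseudofunctor Delta S by (rule pseudonatural_source[OF \<phi>])
  interpret T: pseudofunctor Delta T by (rule pseudonatural_target[OF \<phi>])
  interpret U: pseudofunctor Delta U by (rule pseudonatural_target[OF \<psi>])
  show ?thesis
    unfolding culf_iff[OF pseudonatural_comp[OF \<phi> \<psi>]]
  proof (intro allI impI)
    fix g assume gen: "generic g"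
    define n m where "n = src g" and "m = tgt g"
    have g: "g \<in> Hom Delta n m" unfolding n_def m_def by (rule generic_hom[OF gen])
    note objs = S.Hom_obj[OF g]
    interpret Tn: groupoid "Grp T n" by (rule T.grp[OF objs(1)])
    interpret Un: groupoid "Grp U n" by (rule U.grp[OF objs(1)])
    interpret Um: groupoid "Grp U m" by (rule U.grp[OF objs(2)])
    let ?F = "Cmpt \<phi>" and ?G = "Cmpt \<psi>"
    note gS = functor_arr[OF S.pull[OF g]] and gT = functor_arr[OF T.pull[OF g]]
      and gU = functor_arr[OF U.pull[OF g]]
      and Fn = functor_arr[OF pseudonatural_cmpt[OF \<phi> objs(1)]]
      and Fm = functor_arr[OF pseudonatural_cmpt[OF \<phi> objs(2)]]
      and Gn = functor_arr[OF pseudonatural_cmpt[OF \<psi> objs(1)]]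
      and Gm = functor_arr[OF pseudonatural_cmpt[OF \<psi> objs(2)]]
    note simps = gS(1-4) gT(1-4) gU(1-4) Fn(1-4) Fm(1-4) Gn(1-4) Gm(1-4) Tn.arr_simps(1-6)
      Un.arr_simps(1-6) cell_arr[OF \<phi> g] cell_arr[OF \<psi> g]
    have pb\<phi>: "pullback_conditions (Grp S m) (Grp S n) (Grp T m) (Grp T n) (Pull S g)
        (?F m) (?F n) (Pull T g) (Cell \<phi> g)"
      using culf(1) gen unfolding culf_iff[OF \<phi>] n_def m_def by blast
    have pb\<psi>: "pullback_conditions (Grp T m) (Grp T n) (Grp U m) (Grp U n) (Pull T g)
        (?G m) (?G n) (Pull U g) (Cell \<psi> g)"
      using culf(2) gen unfolding culf_iff[OF \<psi>] n_def m_def by blast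
    note cmpt = pnt_comp_simps(1)[OF objs(1)] pnt_comp_simps(1)[OF objs(2)]
    have "pullback_conditions (Grp S m) (Grp S n) (Grp U m) (Grp U n) (Pull S g)
        (Cmpt ?c m) (Cmpt ?c n) (Pull U g) (Cell ?c g)"
      unfolding pullback_conditions_def
    proof (intro conjI ballI impI)
      fix w w' a b
      assume w: "w \<in> Obj (Grp S m)" and w': "w' \<in> Obj (Grp S m)"
        and a: "a \<in> Hom (Grp S n) (FO (Pull S g) w) (FO (Pull S g) w')"
        and b: "b \<in> Hom (Grp U m) (FO (Cmpt ?c m) w) (FO (Cmpt ?c m) w')"
        and eq: "Cmp (Grp U n) (Cell ?c g w') (FA (Cmpt ?c n) a) =
            Cmp (Grp U n) (FA (Pull U g) b) (Cell ?c g w)"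
      have b: "b \<in> Hom (Grp U m) (FO (?G m) (FO (?F m) w)) (FO (?G m) (FO (?F m) w'))"
        using b w w' by (simp add: cmpt)
      note ab = HomD[OF a] HomD[OF b]
      define \<gamma> \<gamma>' where "\<gamma> = Cell \<phi> g w" and "\<gamma>' = Cell \<phi> g w'"
      have \<gamma>: "\<gamma> \<in> Arr (Grp T n)" "Dom (Grp T n) \<gamma> = FO (?F n) (FO (Pull S g) w)"
        "Cod (Grp T n) \<gamma> = FO (Pull T g) (FO (?F m) w)"
        unfolding \<gamma>_def using w by (simp_all add: simps)
      have \<gamma>': "\<gamma>' \<in> Arr (Grp T n)" "Dom (Grp T n) \<gamma>' = FO (?F n) (FO (Pull S g) w')"
        "Cod (Grp T n) \<gamma>' = FO (Pull T g) (FO (?F m) w')"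
        unfolding \<gamma>'_def using w' by (simp_all add: simps)
      \<comment> \<open>The image of \<open>a\<close> under \<phi>, conjugated by the cells of
        \<phi>. By naturality this is the pullback along \<open>g\<close> of the image of any lift
        of \<open>a\<close>, so it is the first coordinate to use in the square of \<psi>.\<close>
      define a' where "a' = Cmp (Grp T n) (Cmp (Grp T n) \<gamma>' (FA (?F n) a)) (inv_arr (Grp T n) \<gamma>)"
      have a': "a' \<in> Hom (Grp T n) (FO (Pull T g) (FO (?F m) w)) (FO (Pull T g) (FO (?F m) w'))"
        unfolding a'_def by (intro HomI) (simp_all add: simps ab \<gamma> \<gamma>' Tn.inv_arr)
      have a'\<gamma>: "Cmp (Grp T n) \<gamma>' (FA (?F n) a) = Cmp (Grp T n) a' \<gamma>"
        unfolding a'_def by (simp add: simps ab \<gamma> \<gamma>' Tn.grp_simps)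
      have a'_unique: "s = a'" if "s \<in> Hom (Grp T n) (FO (Pull T g) (FO (?F m) w))
        (FO (Pull T g) (FO (?F m) w'))"
        "Cmp (Grp T n) \<gamma>' (FA (?F n) a) = Cmp (Grp T n) s \<gamma>" for s
        by (rule Tn.cancel_right[of \<gamma>]) (simp_all add: \<gamma> HomD[OF that(1)] HomD[OF a'] a'\<gamma> flip:
            that(2))
      have G\<gamma>: "Cmp (Grp U n) (FA (?G n) \<gamma>') (FA (?G n) (FA (?F n) a)) =
          Cmp (Grp U n) (FA (?G n) a') (FA (?G n) \<gamma>)"
        using arg_cong[OF a'\<gamma>, of "FA (?G n)"] by (simp add: Gn(6) \<gamma> \<gamma>' ab Fn HomD[OF a'])
      have "Cmp (Grp U n) (Cmp (Grp U n) (Cell \<psi> g (FO (?F m) w')) (FA (?G n) a')) (FA (?G n) \<gamma>) =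
          Cmp (Grp U n) (Cell ?c g w') (FA (Cmpt ?c n) a)"
        using w w' ab \<gamma> \<gamma>' HomD[OF a']
        by (simp add: pnt_comp_simps(2)[OF g] cmpt simps Un.assoc G\<gamma> flip: \<gamma>'_def)
      also have "\<dots> = Cmp (Grp U n) (Cmp (Grp U n) (FA (Pull U g) b) (Cell \<psi> g (FO (?F m) w)))
        (FA (?G n) \<gamma>)"
        unfolding eq using w w' ab \<gamma> \<gamma>'
        by (simp add: pnt_comp_simps(2)[OF g] simps Un.assoc flip: \<gamma>_def)
      finally have eq\<psi>: "Cmp (Grp U n) (Cell \<psi> g (FO (?F m) w')) (FA (?G n) a') =
          Cmp (Grp U n) (FA (Pull U g) b) (Cell \<psi> g (FO (?F m) w))"
        by (rule Un.cancel_right[rotated -1]) (simp_all add: simps w w' ab \<gamma> \<gamma>' HomD[OF a'])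
      have Fw: "FO (?F m) w \<in> Obj (Grp T m)" "FO (?F m) w' \<in> Obj (Grp T m)"
        using w w' by (simp_all add: Fm)
      have ex': "\<exists>!t'. t' \<in> Hom (Grp T m) (FO (?F m) w) (FO (?F m) w') \<and> FA (Pull T g) t' = a' \<and>
        FA (?G m) t' = b"
        using pb\<psi> Fw a' b eq\<psi> unfolding pullback_conditions_def by blast
      then obtain t' where t': "t' \<in> Hom (Grp T m) (FO (?F m) w) (FO (?F m) w')"
        "FA (Pull T g) t' = a'" "FA (?G m) t' = b" by blast
      have ex: "\<exists>!t. t \<in> Hom (Grp S m) w w' \<and> FA (Pull S g) t = a \<and> FA (?F m) t = t'"
        using pb\<phi> w w' a t'(1) a'\<gamma>[unfolded \<gamma>_def \<gamma>'_def, folded t'(2)]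
        unfolding pullback_conditions_def by blast
      \<comment> \<open>Uniqueness passes through the middle object: the image of \<open>t\<close>
        under \<phi> satisfies the conditions that determine \<open>t'\<close>.\<close>
      have "FA (?F m) t = t'" if t: "t \<in> Hom (Grp S m) w w'" "FA (Pull S g) t =
        a" "FA (?G m) (FA (?F m) t) = b" for t
      proof -
        have Ft: "FA (?F m) t \<in> Hom (Grp T m) (FO (?F m) w) (FO (?F m) w')"
          by (rule functor_hom[OF pseudonatural_cmpt[OF \<phi> objs(2)] t(1)])
        have "Cmp (Grp T n) \<gamma>' (FA (?F n) a) = Cmp (Grp T n) (FA (Pull T g) (FA (?F m) t)) \<gamma>"
          unfolding \<gamma>_def \<gamma>'_def t(2)[symmetric] by (rule cell_nat[OF \<phi> g t(1), symmetric])
        then have "FA (Pull T g) (FA (?F m) t) = a'"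
          by (rule a'_unique[OF functor_hom[OF T.pull[OF g] Ft]])
        then show ?thesis using ex' Ft t' t(3) by blast
      qed
      moreover have "FA (Cmpt ?c m) t = FA (?G m) (FA (?F m) t)" if "t \<in> Hom (Grp S m) w w'" for t
        using HomD[OF that] by (simp add: cmpt)
      ultimately show "\<exists>!t. t \<in> Hom (Grp S m) w w' \<and> FA (Pull S g) t = a \<and> FA (Cmpt ?c m) t = b"
        using ex t'(3) by metis
    next
      fix x y \<zeta>
      assume x: "x \<in> Obj (Grp S n)" and y: "y \<in> Obj (Grp U m)"
        and \<zeta>: "\<zeta> \<in> Hom (Grp U n) (FO (Cmpt ?c n) x) (FO (Pull U g) y)"
      have \<zeta>: "\<zeta> \<in> Hom (Grp U n) (FO (?G n) (FO (?F n) x)) (FO (Pull U g) y)"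
        using \<zeta> x by (simp add: cmpt)
      obtain v a b where v: "v \<in> Obj (Grp T m)"
        and a: "a \<in> Hom (Grp T n) (FO (Pull T g) v) (FO (?F n) x)"
        and b: "b \<in> Hom (Grp U m) (FO (?G m) v) y"
        and ab: "Cmp (Grp U n) \<zeta> (FA (?G n) a) = Cmp (Grp U n) (FA (Pull U g) b) (Cell \<psi> g v)"
        using pb\<psi> Fn(1)[OF x] y \<zeta> unfolding pullback_conditions_def by blast
      \<comment> \<open>The square of \<phi> asks for an arrow from the image of \<open>x\<close> to
        the pullback of \<open>v\<close>; the arrow \<open>a\<close> runs the other way, hence its
        inverse.\<close>
      obtain w a2 b2 where w: "w \<in> Obj (Grp S m)" and a2: "a2 \<in> Hom (Grp S n) (FO (Pull S g) w) x"
        and b2: "b2 \<in> Hom (Grp T m) (FO (?F m) w) v"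
        and ab2: "Cmp (Grp T n) (inv_arr (Grp T n) a) (FA (?F n) a2) =
          Cmp (Grp T n) (FA (Pull T g) b2) (Cell \<phi> g w)"
        using pb\<phi> x v Tn.inv_hom[OF a] unfolding pullback_conditions_def by blast
      note arrs = HomD[OF \<zeta>] HomD[OF a] HomD[OF b] HomD[OF a2] HomD[OF b2] x y v w
      have "FA (?F n) a2 = Cmp (Grp T n) a (Cmp (Grp T n) (inv_arr (Grp T n) a) (FA (?F n) a2))"
        using arrs by (simp add: Tn.grp_simps simps)
      then have Fa2: "FA (?F n) a2 = Cmp (Grp T n) a
        (Cmp (Grp T n) (FA (Pull T g) b2) (Cell \<phi> g w))"
        unfolding ab2 .
      have "Cmp (Grp U n) \<zeta> (FA (?G n) (FA (?F n) a2)) =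
        Cmp (Grp U n) (Cmp (Grp U n) \<zeta> (FA (?G n) a))
          (Cmp (Grp U n) (FA (?G n) (FA (Pull T g) b2)) (FA (?G n) (Cell \<phi> g w)))"
        unfolding Fa2 using arrs by (simp add: Un.assoc simps Gn(6))
      also have "\<dots> = Cmp (Grp U n) (FA (Pull U g) b)
          (Cmp (Grp U n) (Cmp (Grp U n) (Cell \<psi> g v) (FA (?G n) (FA (Pull T g) b2)))
            (FA (?G n) (Cell \<phi> g w)))"
        unfolding ab using arrs by (simp add: Un.assoc simps)
      also have "\<dots> = Cmp (Grp U n) (FA (Pull U g) (Cmp (Grp U m) b (FA (?G m) b2))) (Cell ?c g w)"
        unfolding cell_nat[OF \<psi> g b2, symmetric] using arrs
        by (simp add: Un.assoc simps gU(6) pnt_comp_simps(2)[OF g])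
      finally have eq: "Cmp (Grp U n) \<zeta> (FA (?G n) (FA (?F n) a2)) =
        Cmp (Grp U n) (FA (Pull U g) (Cmp (Grp U m) b (FA (?G m) b2))) (Cell ?c g w)" .
      show "\<exists>w\<in>Obj (Grp S m). \<exists>a\<in>Hom (Grp S n) (FO (Pull S g) w) x.
          \<exists>b\<in>Hom (Grp U m) (FO (Cmpt ?c m) w) y.
            Cmp (Grp U n) \<zeta> (FA (Cmpt ?c n) a) = Cmp (Grp U n) (FA (Pull U g) b) (Cell ?c g w)"
      proof (rule bexI[OF _ w], rule bexI[OF _ a2], rule bexI)
        show "Cmp (Grp U n) \<zeta> (FA (Cmpt ?c n) a2) =
            Cmp (Grp U n) (FA (Pull U g) (Cmp (Grp U m) b (FA (?G m) b2))) (Cell ?c g w)"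
          using eq arrs by (simp add: cmpt)
        show "Cmp (Grp U m) b (FA (?G m) b2) \<in> Hom (Grp U m) (FO (Cmpt ?c m) w) y"
          using arrs by (intro HomI) (simp_all add: cmpt Um.arr_simps simps)
      qed
    qed
    then show "pullback_conditions (Grp S (tgt g)) (Grp S (src g)) (Grp U (tgt g)) (Grp U (src g))
      (Pull S g)
        (Cmpt ?c (tgt g)) (Cmpt ?c (src g)) (Pull U g) (Cell ?c g)"
      by (simp add: n_def m_def)
  qed
qed

lemma category_RSp: "category RSp"
  by (rule category_psf_cat)
    (auto simp: species_morphism_def restriction_species_def intro:
      pseudonatural_id pseudonatural_comp)

lemma category_Dcmp: "category Dcmp"
proof (rule category_psf_cat)
  show "pseudonatural Delta P Q \<phi>" if "culf P Q \<phi>" for P Q \<phi> using that by (simp add: culf_def)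
  show "culf P P (pnt_id Delta P)" if "decomposition_space P" for P
    using that by (intro culf_id) (simp add: decomposition_space_def)
qed (rule culf_comp)

section \<open>The canonical isomorphism of a commuting square\<close>

lemma square_iso_simp:
  assumes S: "pseudofunctor Delta S" and g: "g \<in> Hom Delta n m" and f': "f' \<in> Hom Delta m q"
    and x: "x \<in> Obj (Grp S q)"
  shows "square_iso S g f f' g' x = Cmp (Grp S n) (inv_arr (Grp S n) (Cpr S f g' x)) (Cpr S g f' x)"
  using x HomD(2)[OF g] HomD(3)[OF f'] by (simp add: square_iso_def Delta_def)

text \<open>Both composition constraints end at the action of the same map
  \<open>f' g = g' f\<close>. Their naturality squares are joined along it, and
  \<open>Cpr S f g' y\<close> is cancelled on the left.\<close>

lemma nat_iso_square_iso:
  assumes S: "pseudofunctor Delta S"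
    and g: "g \<in> Hom Delta n m" and f: "f \<in> Hom Delta n k"
    and f': "f' \<in> Hom Delta m q" and g': "g' \<in> Hom Delta k q"
    and eq: "Cmp Delta f' g = Cmp Delta g' f"
  shows "nat_iso (Grp S q) (Grp S n) (comp_ftr (Grp S q) (Pull S g) (Pull S f'))
    (comp_ftr (Grp S q) (Pull S f) (Pull S g')) (square_iso S g f f' g')"
proof (rule nat_isoI)
  interpret pseudofunctor Delta S by fact
  note objs = Hom_obj[OF f] Hom_obj[OF g']
  show "groupoid (Grp S n)" by (rule grp[OF objs(1)])
  interpret Sn: groupoid "Grp S n" by fact
  interpret Sq: groupoid "Grp S q" by (rule grp[OF objs(4)])
  show "is_functor (Grp S q) (Grp S n) (comp_ftr (Grp S q) (Pull S g) (Pull S f'))"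
    by (rule is_functor_comp[OF pull[OF f'] pull[OF g]])
  show "is_functor (Grp S q) (Grp S n) (comp_ftr (Grp S q) (Pull S f) (Pull S g'))"
    by (rule is_functor_comp[OF pull[OF g'] pull[OF f]])
  show "square_iso S g f f' g' \<in> extensional (Obj (Grp S q))"
    using HomD(3)[OF f'] by (simp add: square_iso_def Delta_def)
  note sq = square_iso_simp[OF S g f']
  note c1 = cpr_arr[OF g f'] and c2 = cpr_arr[OF f g']
  show "square_iso S g f f' g' x \<in> Hom (Grp S n) (FO (comp_ftr (Grp S q) (Pull S g) (Pull S f')) x)
      (FO (comp_ftr (Grp S q) (Pull S f) (Pull S g')) x)" if x: "x \<in> Obj (Grp S q)" for x
    using x by (intro HomI) (simp_all add: sq Sn.grp_simps c1 c2 eq)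
  fix t x y assume t: "t \<in> Hom (Grp S q) x y"
  note ts = HomD[OF t] Sq.Hom_obj[OF t]
  note fs = functor_arr(1-4)[OF pull[OF g]] functor_arr(1-4)[OF pull[OF f]]
    functor_arr(1-4)[OF pull[OF g']] functor_arr(1-4)[OF pull[OF f']]
    functor_arr(1-4)[OF pull[OF cmp_hom[OF f g']]] c1 c2 eq
  let ?C = "Cmp (Grp S n)" and ?i = "inv_arr (Grp S n)"
  have "?C (Cpr S f g' y) (?C (FA (Pull S f) (FA (Pull S g') t))
    (?C (?i (Cpr S f g' x)) (Cpr S g f' x))) =
      ?C (?C (Cpr S f g' y) (FA (Pull S f) (FA (Pull S g') t)))
        (?C (?i (Cpr S f g' x)) (Cpr S g f' x))"
    using ts by (simp add: Sn.arr_simps Sn.inv_arr fs)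
  also have "\<dots> = ?C (FA (Pull S (Cmp Delta f' g)) t) (Cpr S g f' x)"
    unfolding cpr_nat[OF f g' t, symmetric] using ts by (simp add: Sn.grp_simps fs)
  also have "\<dots> = ?C (Cpr S f g' y) (?C (?i (Cpr S f g' y))
    (?C (Cpr S g f' y) (FA (Pull S g) (FA (Pull S f') t))))"
    unfolding cpr_nat[OF g f' t] using ts by (simp add: Sn.grp_simps fs)
  finally have "?C (FA (Pull S f) (FA (Pull S g') t)) (?C (?i (Cpr S f g' x)) (Cpr S g f' x)) =
      ?C (?i (Cpr S f g' y)) (?C (Cpr S g f' y) (FA (Pull S g) (FA (Pull S f') t)))"
    by (rule Sn.cancel_left[rotated -1]) (use ts in \<open>simp_all add: Sn.grp_simps fs\<close>)
  then show "?C (FA (comp_ftr (Grp S q) (Pull S f) (Pull S g')) t) (square_iso S g f f' g' x) =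
      ?C (square_iso S g f f' g' y) (FA (comp_ftr (Grp S q) (Pull S g) (Pull S f')) t)"
    using ts by (simp add: sq Sn.grp_simps fs)
qed

section \<open>The simplex category\<close>

lemma Delta_hom: "a \<in> Hom Delta l m \<longleftrightarrow>
    (\<exists>h. a = Arrow l h m \<and> h \<in> {0..l} \<rightarrow>\<^sub>E {0..m} \<and> mono_on {0..l} h)"
  by (auto simp: Delta_def Hom_def)

lemma Delta_simps [simp]:
  "Obj Delta = UNIV" "Dom Delta = src" "Cod Delta = tgt"
  "src (Cmp Delta b a) = src a" "tgt (Cmp Delta b a) = tgt b"
  "src (Ide Delta n) = n" "tgt (Ide Delta n) = n"
  "i \<le> src a \<Longrightarrow> via (Cmp Delta b a) i = via b (via a i)"
  "i \<le> n \<Longrightarrow> via (Ide Delta n) i = i"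
  by (auto simp: Delta_def compose_def)

lemma Delta_homI:
  assumes "src a = l" "tgt a = m" "via a \<in> extensional {0..l}"
    and "\<And>i. i \<le> l \<Longrightarrow> via a i \<le> m" "\<And>i j. i \<le> j \<Longrightarrow> j \<le> l \<Longrightarrow> via a i \<le> via a j"
  shows "a \<in> Hom Delta l m"
  using assms by (cases a) (auto simp: Delta_hom PiE_def mono_on_def)

lemma Delta_homD:
  assumes "a \<in> Hom Delta l m"
  shows "src a = l" "tgt a = m" "via a \<in> extensional {0..l}"
    and "i \<le> l \<Longrightarrow> via a i \<le> m" "i \<le> j \<Longrightarrow> j \<le> l \<Longrightarrow> via a i \<le> via a j"
  using assms by (auto simp: Delta_hom PiE_def mono_on_def Pi_def)

lemma Delta_eqI:
  assumes "a \<in> Hom Delta l m" "b \<in> Hom Delta l m" "\<And>i. i \<le> l \<Longrightarrow> via a i = via b i"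
  shows "a = b"
proof -
  have "via a = via b"
    by (rule extensionalityI[OF Delta_homD(3)[OF assms(1)] Delta_homD(3)[OF assms(2)]])
      (use assms(3) in simp)
  then show ?thesis
    using Delta_homD(1,2)[OF assms(1)] Delta_homD(1,2)[OF assms(2)] by (simp add: arrow.expand)
qed

lemma Delta_ide_hom: "Ide Delta n \<in> Hom Delta n n"
  by (auto simp: Delta_def Hom_def mono_on_def)

lemma Delta_cmp_hom:
  assumes "a \<in> Hom Delta l m" "b \<in> Hom Delta m n"
  shows "Cmp Delta b a \<in> Hom Delta l n"
proof (rule Delta_homI)
  show "via (Cmp Delta b a) \<in> extensional {0..l}"
    using Delta_homD(1)[OF assms(1)] by (simp add: Delta_def)
qed (simp_all add: Delta_homD[OF assms(1)] Delta_homD[OF assms(2)])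

lemma category_Delta: "category Delta"
proof
  show "Ide Delta n \<in> Hom Delta n n" for n by (rule Delta_ide_hom)
  show "Cmp Delta b a \<in> Hom Delta l n" if "a \<in> Hom Delta l m" "b \<in> Hom Delta m n" for a b l m n
    using that by (rule Delta_cmp_hom)
  show "Cmp Delta a (Ide Delta l) = a" if a: "a \<in> Hom Delta l m" for a l m
    by (rule Delta_eqI[OF Delta_cmp_hom[OF Delta_ide_hom a] a]) simp
  show "Cmp Delta (Ide Delta m) a = a" if a: "a \<in> Hom Delta l m" for a l m
    by (rule Delta_eqI[OF Delta_cmp_hom[OF a Delta_ide_hom] a]) (simp add: Delta_homD[OF a])
  show "Cmp Delta c (Cmp Delta b a) = Cmp Delta (Cmp Delta c b) a"
    if a: "a \<in> Hom Delta k l" and b: "b \<in> Hom Delta l m" and c: "c \<in> Hom Delta m n"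
      for a b c k l m n
    by (rule Delta_eqI[OF Delta_cmp_hom[OF Delta_cmp_hom[OF a b] c]
        Delta_cmp_hom[OF a Delta_cmp_hom[OF b c]]])
      (simp add: Delta_homD[OF a] Delta_homD[OF b])
qed simp_all

section \<open>Maps of layers underlying maps of the simplex category\<close>

lemma generic_iff: "a \<in> Hom Delta l m \<Longrightarrow> generic a \<longleftrightarrow> via a 0 = 0 \<and> via a l = m"
  by (auto simp: generic_def Hom_def)

text \<open>The index is the least \<open>i\<close> with \<open>j \<le> a i\<close>, and
  \<open>a 0 < j\<close> keeps it positive. Stating this for every map, with \<open>j\<close>
  confined to the interval between \<open>a 0\<close> and \<open>a l\<close>, lets one formula
  describe generic, free and mixed maps.\<close>

lemma under_generic_ex1:
  assumes a: "a \<in> Hom Delta l m" and j: "via a 0 < j" "j \<le> via a l"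
  shows "\<exists>!i. i \<in> {1..l} \<and> via a (i - 1) < j \<and> j \<le> via a i"
proof (rule ex_ex1I)
  define i where "i = (LEAST i. j \<le> via a i)"
  have i: "j \<le> via a i" "i \<le> l" unfolding i_def using j(2) by (auto intro: LeastI Least_le)
  then have "i \<noteq> 0" using j(1) by (auto intro: gr0I)
  then have "\<not> j \<le> via a (i - 1)" unfolding i_def by (intro not_less_Least) simp
  then show "\<exists>i. i \<in> {1..l} \<and> via a (i - 1) < j \<and> j \<le> via a i"
    using i \<open>i \<noteq> 0\<close> by (intro exI[of _ i]) auto
next
  have le: "i \<le> i'" if "i \<in> {1..l}" "via a (i - 1) < j" "i' \<in> {1..l}" "j \<le> via a i'" for i i'
  proof (rule ccontr)
    assume "\<not> i \<le> i'"
    then have "via a i' \<le> via a (i - 1)" using that by (intro Delta_homD(5)[OF a]) auto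
    with that show False by simp
  qed
  show "i = i'" if "i \<in> {1..l} \<and> via a (i - 1) < j \<and> j \<le> via a i"
    "i' \<in> {1..l} \<and> via a (i' - 1) < j \<and> j \<le> via a i'" for i i'
    using le[of i i'] le[of i' i] that by simp
qed

lemma under_generic:
  assumes a: "a \<in> Hom Delta l m" and j: "via a 0 < j" "j \<le> via a l"
  shows "under_generic a j \<in> {1..l}" "via a (under_generic a j - 1) < j" "j \<le> via a
    (under_generic a j)"
  using theI'[OF under_generic_ex1[OF assms]]
  by (simp_all add: under_generic_def Delta_homD(1)[OF a])

text \<open>On \<open>{a 0 + 1..a l}\<close>, the map \<^const>\<open>under_generic\<close> is left adjoint to \<open>a\<close>.\<close>

lemma under_generic_le_iff:
  assumes a: "a \<in> Hom Delta l m" and j: "via a 0 < j" "j \<le> via a l" and i: "i \<le> l"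
  shows "under_generic a j \<le> i \<longleftrightarrow> j \<le> via a i"
proof
  note u = under_generic[OF a j]
  show "j \<le> via a i" if "under_generic a j \<le> i"
    using u(3) Delta_homD(5)[OF a that i] by simp
  show "under_generic a j \<le> i" if "j \<le> via a i"
  proof (rule ccontr)
    assume "\<not> under_generic a j \<le> i"
    then have "via a i \<le> via a (under_generic a j - 1)" using u(1)
      by (intro Delta_homD(5)[OF a]) auto
    with u(2) that show False by simp
  qed
qed

lemma under_generic_eqI:
  assumes a: "a \<in> Hom Delta l m" and "i \<in> {1..l}" "via a (i - 1) < j" "j \<le> via a i"
  shows "under_generic a j = i"
proof -
  have "via a 0 \<le> via a (i - 1)" "via a i \<le> via a l"
    using assms(2) by (auto intro: Delta_homD(5)[OF a])
  then have "via a 0 < j" "j \<le> via a l" using assms(3,4) by simp_all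
  then show ?thesis using under_generic_ex1[OF a] under_generic[OF a] assms(2-4) by blast
qed

lemma under_generic_ide: "j \<in> {1..n} \<Longrightarrow> under_generic (Ide Delta n) j = j"
  by (rule under_generic_eqI[OF Delta_ide_hom]) auto

text \<open>By the adjunction, \<open>under_generic b j \<le> a i\<close> means
  \<open>j \<le> b (a i)\<close>; the case \<open>i = 0\<close>, negated, and the case
  \<open>i = l\<close> give the two bounds. On layers: passing through \<open>b\<close> and then
  \<open>a\<close> leaves the same elements as passing through \<open>b a\<close>.\<close>

lemma under_generic_range:
  assumes a: "a \<in> Hom Delta l m" and b: "b \<in> Hom Delta m n" and j: "via b 0 < j" "j \<le> via b m"
  shows "via a 0 < under_generic b j \<and> under_generic b j \<le> via a l \<longleftrightarrow>
    via b (via a 0) < j \<and> j \<le> via b (via a l)"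
  using under_generic_le_iff[OF b j] Delta_homD(4)[OF a] by (metis le_refl linorder_not_le zero_le)

text \<open>Contravariant functoriality of the underlying maps. The defining inequalities of the
  index for \<open>a\<close> are carried through \<open>b\<close> by the adjunction, and the index
  for \<open>b a\<close> is unique.\<close>

lemma under_generic_cmp:
  assumes a: "a \<in> Hom Delta l m" and b: "b \<in> Hom Delta m n"
    and j: "via b (via a 0) < j" "j \<le> via b (via a l)"
  shows "under_generic (Cmp Delta b a) j = under_generic a (under_generic b j)"
proof (rule under_generic_eqI[OF Delta_cmp_hom[OF a b]])
  have "via b 0 < j" "j \<le> via b m"
    using j Delta_homD(5)[OF b, of 0 "via a 0"] Delta_homD(5)[OF b, of "via a l" m]
      Delta_homD(4)[OF a, of 0] Delta_homD(4)[OF a, of l] by auto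
  note bj = under_generic_le_iff[OF b this]
  define i where "i = under_generic b j"
  have i: "via a 0 < i" "i \<le> via a l"
    using under_generic_range[OF a b \<open>via b 0 < j\<close> \<open>j \<le> via b m\<close>] j by (auto simp: i_def)
  note ai = under_generic[OF a i]
  have r: "under_generic a i \<le> l" "under_generic a i - 1 \<le> l" using ai(1) by auto
  show "under_generic a (under_generic b j) \<in> {1..l}" using ai(1) by (simp add: i_def)
  show "via (Cmp Delta b a) (under_generic a (under_generic b j) - 1) < j"
    using ai(2) r bj[OF Delta_homD(4)[OF a r(2)]] by (simp add: Delta_homD(1)[OF a] flip: i_def)
  show "j \<le> via (Cmp Delta b a) (under_generic a (under_generic b j))"
    using ai(3) r bj[OF Delta_homD(4)[OF a r(1)]] by (simp add: Delta_homD(1)[OF a] flip: i_def)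
qed

subsection \<open>Generic-free pushouts\<close>

lemma free_via:
  assumes "free f" "i \<le> src f"
  shows "via f i = i + via f 0"
  using assms(2) by (induction i) (use assms(1) in \<open>auto simp: free_def\<close>)

text \<open>Such a map is strictly increasing, so it lies above the identity. Applied to both of two
  mutually inverse monotone maps, this forces them to be identities.\<close>

lemma mono_left_inverse_ge:
  fixes u v :: "nat \<Rightarrow> nat"
  assumes "\<And>i j. i \<le> j \<Longrightarrow> j \<le> q \<Longrightarrow> u i \<le> u j" and "\<And>i. i \<le> q \<Longrightarrow> v (u i) = i" and "i \<le> q"
  shows "i \<le> u i"
  using assms(3)
proof (induction i)
  case (Suc i)
  have "u i \<noteq> u (Suc i)" using assms(2)[of i] assms(2)[of "Suc i"] Suc.prems by auto
  then have "u i < u (Suc i)" using assms(1)[of i "Suc i"] Suc.prems by simp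
  then show ?case using Suc by simp
qed simp

text \<open>An explicit cocone \<open>F\<close>, \<open>G\<close> is compared with the given
  pushout. The universal property supplies \<open>u\<close> from the pushout to the explicit object,
  a map \<open>v\<close> back is glued by hand, and the two are mutually inverse. Finite ordinals
  have no nontrivial monotone automorphisms, so the formulas hold on the nose and not only up to
  isomorphism.\<close>

lemma generic_free_pushout:
  assumes gen: "generic g" and fr: "free f" and po: "pushout_square Delta g f f' g'"
    and hom: "g \<in> Hom Delta n m" "f \<in> Hom Delta n k" and c: "c = via f 0"
  shows "n + c \<le> k" "f' \<in> Hom Delta m (k - n + m)" "g' \<in> Hom Delta k (k - n + m)"
    and "Cmp Delta f' g = Cmp Delta g' f"
    and "\<And>i. i \<le> m \<Longrightarrow> via f' i = i + c"
    and "\<And>j. j \<le> k \<Longrightarrow> via g' j = (if j \<le> c then j else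
      if j \<le> c + n then via g (j - c) + c else j - n + m)"
proof -
  note g = Delta_homD[OF hom(1)] and f = Delta_homD[OF hom(2)]
  have fi: "via f i = i + c" if "i \<le> n" for i using free_via[OF fr, of i] that by (simp add: f(1) c)
  show nck: "n + c \<le> k" using f(4)[of n] fi[of n] by simp
  have g0: "via g 0 = 0" "via g n = m" using gen generic_iff[OF hom(1)] by auto
  define q where "q = tgt f'"
  have f': "f' \<in> Hom Delta m q" and g': "g' \<in> Hom Delta k q"
    and comm: "Cmp Delta f' g = Cmp Delta g' f"
    using po by (auto simp: pushout_square_def Hom_def g(2) f(2) q_def)
  note f's = Delta_homD[OF f'] and g's = Delta_homD[OF g']
  have univ: "\<exists>!u. u \<in> Hom Delta q z \<and> Cmp Delta u f' = h \<and> Cmp Delta u g' = h'"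
    if "h \<in> Hom Delta m z" "h' \<in> Hom Delta k z" "Cmp Delta h g = Cmp Delta h' f" for h h' z
  proof -
    have "h \<in> Arr Delta" "h' \<in> Arr Delta" "src h = m" "src h' = k" "tgt h = z" "tgt h' = z"
      using that by (auto simp: Hom_def)
    moreover have "\<forall>h \<in> Arr Delta. \<forall>h' \<in> Arr Delta. src h = m \<and> src h' = k \<and> tgt h = tgt h' \<and>
        Cmp Delta h g = Cmp Delta h' f \<longrightarrow>
        (\<exists>!u. u \<in> Hom Delta q (tgt h) \<and> Cmp Delta u f' = h \<and> Cmp Delta u g' = h')"
      using po unfolding pushout_square_def Delta_simps g(2) f(2) q_def by blast
    ultimately show ?thesis using that(3) by metis
  qed
  \<comment> \<open>The block of length \<open>n\<close> in \<open>[k]\<close> becomes one of length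
    \<open>m\<close>. The subtraction is exact because \<open>n + c \<le> k\<close>.\<close>
  define q0 where "q0 = k - n + m"
  define F where "F = Arrow m (\<lambda>i \<in> {0..m}. i + c) q0"
  \<comment> \<open>Identity up to \<open>c\<close>, a shifted copy of \<open>g\<close> on the
    middle block, a shift above it. The last branch has \<open>j > c + n\<close>, so its subtraction
    is exact, and at the ends of the middle block neighbouring formulas agree since
    \<open>g 0 = 0\<close> and \<open>g n = m\<close>.\<close>
  define G where "G = Arrow k (\<lambda>j \<in> {0..k}. if j \<le> c then j else if j \<le> c + n then via g (j - c) + c
    else j - n + m) q0"
  have F: "F \<in> Hom Delta m q0" using nck by (intro Delta_homI) (auto simp: F_def q0_def)
  have Fi: "via F i = i + c" if "i \<le> m" for i using that by (simp add: F_def)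
  have Gi: "via G j = (if j \<le> c then j else if j \<le> c + n then via g (j - c) + c else j - n + m)"
    if "j \<le> k" for j using that by (simp add: G_def)
  have gm: "via g i \<le> m" if "i \<le> n" for i using g(4) that .
  have G: "G \<in> Hom Delta k q0"
  proof (rule Delta_homI)
    show "via G j \<le> q0" if j: "j \<le> k" for j
    proof -
      have "via g (j - c) \<le> m" if "j \<le> c + n" using that by (intro gm) simp
      then show ?thesis using j nck by (auto simp: Gi q0_def)
    qed
    show "via G i \<le> via G j" if ij: "i \<le> j" "j \<le> k" for i j
    proof -
      have "via g (i - c) \<le> via g (j - c)" if "j \<le> c + n" using ij that by (intro g(5)) auto
      moreover have "via g (i - c) \<le> m" if "i \<le> c + n" using that by (intro gm) simp
      ultimately show ?thesis using ij nck by (auto simp: Gi)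
    qed
  qed (auto simp: G_def)
  have FG: "Cmp Delta F g = Cmp Delta G f"
  proof (rule Delta_eqI[OF Delta_cmp_hom[OF hom(1) F] Delta_cmp_hom[OF hom(2) G]])
    show "via (Cmp Delta F g) i = via (Cmp Delta G f) i" if "i \<le> n" for i
      using that nck g0 gm[OF that] by (auto simp: g(1) f(1) fi Fi Gi)
  qed
  obtain u where u: "u \<in> Hom Delta q q0" "Cmp Delta u f' = F" "Cmp Delta u g' = G"
    using univ[OF F G FG] by blast
  note us = Delta_homD[OF u(1)]
  have uf': "via u (via f' i) = i + c" if "i \<le> m" for i
    using arg_cong[OF u(2), of "\<lambda>a. via a i"] that by (simp add: f's(1) Fi)
  have ug': "via u (via g' j) = via G j" if "j \<le> k" for j
    using arg_cong[OF u(3), of "\<lambda>a. via a j"] that by (simp add: g's(1))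
  have fg: "via f' (via g i) = via g' (i + c)" if "i \<le> n" for i
    using arg_cong[OF comm, of "\<lambda>a. via a i"] that by (simp add: f(1) g(1) fi)
  \<comment> \<open>The glued map \<open>v\<close> changes from \<open>g'\<close> to
    \<open>f'\<close> at \<open>c\<close> and back to \<open>g'\<close> at \<open>c + m\<close>;
    these two equations make it monotone there.\<close>
  have join: "via f' 0 = via g' c" "via f' m = via g' (c + n)"
    using fg[of 0] fg[of n] by (simp_all add: g0 add.commute)
  define v where "v = Arrow q0 (\<lambda>i \<in> {0..q0}. if i \<le> c then via g' i else
    if i \<le> c + m then via f' (i - c)
    else via g' (i + n - m)) q"
  have vi: "via v i = (if i \<le> c then via g' i else if i \<le> c + m then via f' (i - c)
    else via g' (i + n - m))" if "i \<le> q0" for i using that by (simp add: v_def)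
  have v: "v \<in> Hom Delta q0 q"
  proof (rule Delta_homI)
    show "via v i \<le> q" if "i \<le> q0" for i
      using that nck by (auto simp: vi q0_def intro!: g's(4) f's(4))
    show "via v i \<le> via v j" if ij: "i \<le> j" "j \<le> q0" for i j
    proof -
      have 1: "via g' i \<le> via f' (j - c)" if "i \<le> c" "j \<le> c + m"
      proof -
        have "via g' i \<le> via g' c" using that nck by (intro g's(5)) auto
        also have "\<dots> \<le> via f' (j - c)" unfolding join(1)[symmetric] using that
          by (intro f's(5)) auto
        finally show ?thesis .
      qed
      have 2: "via f' i' \<le> via g' (j + n - m)" if "i' \<le> m" "c + m < j" for i'
      proof -
        have "via f' i' \<le> via f' m" using that by (intro f's(5)) auto
        also have "\<dots> \<le> via g' (j + n - m)"
          unfolding join(2) using that ij nck by (intro g's(5)) (auto simp: q0_def)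
        finally show ?thesis .
      qed
      have 3: "via g' i \<le> via g' (j + n - m)" if "i \<le> c" "c + m < j"
        using that ij nck by (intro g's(5)) (auto simp: q0_def)
      have 4: "via g' (i + n - m) \<le> via g' (j + n - m)" if "c + m < i"
        using that ij nck by (intro g's(5)) (auto simp: q0_def)
      have 5: "via g' i \<le> via g' j" if "j \<le> c" using that ij nck by (intro g's(5)) auto
      have 6: "via f' (i - c) \<le> via f' (j - c)" if "j \<le> c + m"
        using that ij by (intro f's(5)) auto
      show ?thesis using ij 1 2[of "i - c"] 3 4 5 6 by (auto simp: vi)
    qed
  qed (auto simp: v_def)
  note vs = Delta_homD[OF v]
  have vF: "Cmp Delta v F = f'"
  proof (rule Delta_eqI[OF Delta_cmp_hom[OF F v] f'])
    show "via (Cmp Delta v F) i = via f' i" if "i \<le> m" for i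
    proof -
      have "i + c \<le> q0" using that nck by (simp add: q0_def)
      then show ?thesis using that join(1) Delta_homD(1)[OF F] by (simp add: Fi vi)
    qed
  qed
  have vG: "Cmp Delta v G = g'"
  proof (rule Delta_eqI[OF Delta_cmp_hom[OF G v] g'])
    show "via (Cmp Delta v G) j = via g' j" if "j \<le> k" for j
    proof -
      have Gq: "via G j \<le> q0" using Delta_homD(4)[OF G] that .
      consider "j \<le> c" | "c < j" "j \<le> c + n" | "c + n < j" by linarith
      then have "via v (via G j) = via g' j"
      proof cases
        case 1
        then show ?thesis using that Gq by (simp add: Gi vi)
      next
        case 2
        then have "via f' (via g (j - c)) = via g' j" using fg[of "j - c"] by simp
        moreover have "via G j = via g (j - c) + c" using 2 that by (simp add: Gi)
        moreover have "via f' 0 = via g' c" by (rule join(1))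
        ultimately show ?thesis using Gq gm[of "j - c"] 2 by (auto simp: vi)
      next
        case 3
        then show ?thesis using that Gq nck by (auto simp: Gi vi)
      qed
      then show ?thesis using that Delta_homD(1)[OF G] by simp
    qed
  qed
  \<comment> \<open>Both \<open>v u\<close> and the identity are maps under the cocone
    \<open>f'\<close>, \<open>g'\<close>, so the universal property identifies them.\<close>
  have vu: "Cmp Delta v u = Ide Delta q"
  proof -
    have "Cmp Delta (Cmp Delta v u) f' = f'" "Cmp Delta (Cmp Delta v u) g' = g'"
      using category.cmp_assoc[OF category_Delta f' u(1) v]
          category.cmp_assoc[OF category_Delta g' u(1) v]
      by (simp_all add: u vF vG)
    moreover have "Cmp Delta (Ide Delta q) f' = f'" "Cmp Delta (Ide Delta q) g' = g'"
      using category.cmp_ide_left[OF category_Delta] f' g' by auto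
    ultimately show ?thesis
      using univ[OF f' g' comm] Delta_cmp_hom[OF u(1) v] Delta_ide_hom by blast
  qed
  have vui: "via v (via u i) = i" if "i \<le> q" for i
    using arg_cong[OF vu, of "\<lambda>a. via a i"] that by (simp add: us(1))
  \<comment> \<open>The other composite is evaluated branch by branch, since no universal property
    of the explicit cocone has been established.\<close>
  have uvi: "via u (via v i) = i" if "i \<le> q0" for i
  proof -
    consider "i \<le> c" | "c < i" "i \<le> c + m" | "c + m < i" by linarith
    then show ?thesis
    proof cases
      case 1
      then show ?thesis using that nck by (simp add: vi ug' Gi)
    next
      case 2
      then show ?thesis using that by (simp add: vi uf')
    next
      case 3
      then have "i + n - m \<le> k" using that nck by (simp add: q0_def)
      moreover have "c + n < i + n - m" using 3 by simp
      ultimately show ?thesis using 3 that by (simp add: vi ug' Gi)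
    qed
  qed
  \<comment> \<open>Since \<open>u\<close> and \<open>v\<close> both lie above the identity and are
    mutually inverse, \<open>u\<close> fixes every point, and comparing last elements gives
    \<open>q = q0\<close>.\<close>
  have u_ge: "i \<le> via u i" if "i \<le> q" for i using mono_left_inverse_ge[of q "via u" "via v"] us(5)
    vui that by blast
  have v_ge: "i \<le> via v i" if "i \<le> q0" for i using mono_left_inverse_ge[of q0 "via v" "via u"] vs(5)
    uvi that by blast
  have ui: "via u i = i" if "i \<le> q" for i
    using u_ge[OF that] v_ge[OF us(4)[OF that]] vui[OF that] by simp
  have q: "q = q0"
    using u_ge[of q] us(4)[of q] v_ge[of q0] vs(4)[of q0] by simp
  show "f' \<in> Hom Delta m (k - n + m)" "g' \<in> Hom Delta k (k - n + m)" "Cmp Delta f' g =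
    Cmp Delta g' f"
    using f' g' comm by (simp_all add: q q0_def)
  show "via f' i = i + c" if "i \<le> m" for i
    using uf'[OF that] ui[OF f's(4)[OF that]] by simp
  show "via g' j = (if j \<le> c then j else if j \<le> c + n then via g (j - c) + c else j - n + m)"
    if "j \<le> k" for j
    using ug'[OF that] ui[OF g's(4)[OF that]] Gi[OF that] by simp
qed

section \<open>Pseudo-functors from monic restriction arrows\<close>

text \<open>All values of \<open>P\<close> are subcategories of one category \<open>E\<close> of monomorphisms, and \<open>\<iota> u x\<close> is an
  arrow of \<open>E\<close> from the pullback of \<open>x\<close> along \<open>u\<close> to \<open>x\<close>.  The coherence conditions hold because
  any two arrows that agree after composition with some \<open>\<iota> u x\<close> are equal.\<close>

locale restriction_system = C: category C + E: category E
  for C :: "('c, 'u) cat" and E :: "('o, 'm) cat" +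
  fixes P :: "('c, 'u, 'o, 'm) psf" and \<iota> :: "'u \<Rightarrow> 'o \<Rightarrow> 'm"
  assumes mono: "e \<in> Hom E y z \<Longrightarrow> f \<in> Hom E x y \<Longrightarrow> g \<in> Hom E x y \<Longrightarrow>
      Cmp E e f = Cmp E e g \<Longrightarrow> f = g"
    and grp: "c \<in> Obj C \<Longrightarrow> groupoid (Grp P c)"
    and sub_hom: "c \<in> Obj C \<Longrightarrow> f \<in> Hom (Grp P c) x y \<Longrightarrow> f \<in> Hom E x y"
    and sub_ops: "c \<in> Obj C \<Longrightarrow> Cmp (Grp P c) = Cmp E" "c \<in> Obj C \<Longrightarrow> Ide (Grp P c) = Ide E"
    and pull_obj: "u \<in> Hom C b c \<Longrightarrow> x \<in> Obj (Grp P c) \<Longrightarrow> FO (Pull P u) x \<in> Obj (Grp P b)"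
    and \<iota>: "u \<in> Hom C b c \<Longrightarrow> x \<in> Obj (Grp P c) \<Longrightarrow> \<iota> u x \<in> Hom E (FO (Pull P u) x) x"
    and pull_hom: "u \<in> Hom C b c \<Longrightarrow> f \<in> Hom (Grp P c) x y \<Longrightarrow>
      FA (Pull P u) f \<in> Hom (Grp P b) (FO (Pull P u) x) (FO (Pull P u) y)"
    and pull_\<iota>: "u \<in> Hom C b c \<Longrightarrow> f \<in> Hom (Grp P c) x y \<Longrightarrow>
      Cmp E (\<iota> u y) (FA (Pull P u) f) = Cmp E f (\<iota> u x)"
    and pull_ext: "u \<in> Hom C b c \<Longrightarrow> FO (Pull P u) \<in> extensional (Obj (Grp P c))"
      "u \<in> Hom C b c \<Longrightarrow> FA (Pull P u) \<in> extensional (Arr (Grp P c))"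
    and pull_ide: "c \<in> Obj C \<Longrightarrow> x \<in> Obj (Grp P c) \<Longrightarrow> FO (Pull P (Ide C c)) x = x"
      "c \<in> Obj C \<Longrightarrow> x \<in> Obj (Grp P c) \<Longrightarrow> \<iota> (Ide C c) x = Ide E x"
    and unt_eq: "c \<in> Obj C \<Longrightarrow> Unt P c = (\<lambda>x \<in> Obj (Grp P c). Ide E x)"
    and cpr_ext: "u \<in> Hom C b c \<Longrightarrow> v \<in> Hom C c d \<Longrightarrow> Cpr P u v \<in> extensional (Obj (Grp P d))"
    and cpr_hom: "u \<in> Hom C b c \<Longrightarrow> v \<in> Hom C c d \<Longrightarrow> x \<in> Obj (Grp P d) \<Longrightarrow>
      Cpr P u v x \<in> Hom (Grp P b) (FO (Pull P u) (FO (Pull P v) x)) (FO (Pull P (Cmp C v u)) x)"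
    and cpr_\<iota>: "u \<in> Hom C b c \<Longrightarrow> v \<in> Hom C c d \<Longrightarrow> x \<in> Obj (Grp P d) \<Longrightarrow>
      Cmp E (\<iota> (Cmp C v u) x) (Cpr P u v x) = Cmp E (\<iota> v x) (\<iota> u (FO (Pull P v) x))"
begin

lemma \<iota>_eqI:
  assumes u: "u \<in> Hom C b c" and x: "x \<in> Obj (Grp P c)"
    and f: "f \<in> Hom (Grp P b) w (FO (Pull P u) x)" and g: "g \<in> Hom (Grp P b) w (FO (Pull P u) x)"
    and eq: "Cmp E (\<iota> u x) f = Cmp E (\<iota> u x) g"
  shows "f = g"
  using mono[OF \<iota>[OF u x] sub_hom[OF _ f] sub_hom[OF _ g] eq] C.Hom_obj[OF u] by blast

lemma sub_obj: "c \<in> Obj C \<Longrightarrow> x \<in> Obj (Grp P c) \<Longrightarrow> x \<in> Obj E"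
  using sub_hom[OF _ category.ide_hom[OF groupoid.axioms(1)[OF grp]]] E.Hom_obj by blast

text \<open>Followed by \<open>\<iota> u z\<close>, both sides of the composition law become
  \<open>g\<close>, \<open>f\<close> and \<open>\<iota> u x\<close> composed; the identity law is
  tested in the same way.\<close>

lemma is_functor_pull:
  assumes u: "u \<in> Hom C b c"
  shows "is_functor (Grp P c) (Grp P b) (Pull P u)"
proof (rule functorI)
  note bc = C.Hom_obj[OF u]
  interpret b: groupoid "Grp P b" by (rule grp[OF bc(1)])
  interpret c: groupoid "Grp P c" by (rule grp[OF bc(2)])
  show "category (Grp P c)" "category (Grp P b)" by unfold_locales
  show "FA (Pull P u) (Ide (Grp P c) x) = Ide (Grp P b) (FO (Pull P u) x)" if x: "x \<in> Obj (Grp P c)"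
    for x
  proof (rule \<iota>_eqI[OF u x pull_hom[OF u c.ide_hom[OF x]] b.ide_hom[OF pull_obj[OF u x]]])
    show "Cmp E (\<iota> u x) (FA (Pull P u) (Ide (Grp P c) x)) =
      Cmp E (\<iota> u x) (Ide (Grp P b) (FO (Pull P u) x))"
      using pull_\<iota>[OF u c.ide_hom[OF x]] E.cmp_ide_left[OF \<iota>[OF u x]] E.cmp_ide_right[OF \<iota>[OF u x]]
      by (simp add: sub_ops bc)
  qed
  show "FA (Pull P u) (Cmp (Grp P c) g f) = Cmp (Grp P b) (FA (Pull P u) g) (FA (Pull P u) f)"
    if f: "f \<in> Hom (Grp P c) x y" and g: "g \<in> Hom (Grp P c) y z" for f g x y z
  proof (rule \<iota>_eqI[OF u c.Hom_obj(2)[OF g] pull_hom[OF u c.cmp_hom[OF f g]]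
        b.cmp_hom[OF pull_hom[OF u f] pull_hom[OF u g]]])
    note f' = sub_hom[OF bc(2) f] and g' = sub_hom[OF bc(2) g]
    note uf = sub_hom[OF bc(1) pull_hom[OF u f]] and ug = sub_hom[OF bc(1) pull_hom[OF u g]]
    note \<iota>x = \<iota>[OF u c.Hom_obj(1)[OF f]] and \<iota>y = \<iota>[OF u c.Hom_obj(2)[OF f]]
      and \<iota>z = \<iota>[OF u c.Hom_obj(2)[OF g]]
    have "Cmp E (\<iota> u z) (FA (Pull P u) (Cmp (Grp P c) g f)) = Cmp E (Cmp E g f) (\<iota> u x)"
      using pull_\<iota>[OF u c.cmp_hom[OF f g]] by (simp add: sub_ops bc)
    also have "\<dots> = Cmp E g (Cmp E (\<iota> u y) (FA (Pull P u) f))"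
      by (simp add: E.cmp_assoc[OF \<iota>x f' g', symmetric] pull_\<iota>[OF u f])
    also have "\<dots> = Cmp E (\<iota> u z) (Cmp E (FA (Pull P u) g) (FA (Pull P u) f))"
      by (simp add: E.cmp_assoc[OF uf \<iota>y g'] E.cmp_assoc[OF uf ug \<iota>z] pull_\<iota>[OF u g])
    finally show "Cmp E (\<iota> u z) (FA (Pull P u) (Cmp (Grp P c) g f)) =
        Cmp E (\<iota> u z) (Cmp (Grp P b) (FA (Pull P u) g) (FA (Pull P u) f))"
      by (simp add: sub_ops bc)
  qed
qed (use u in \<open>simp_all add: pull_obj pull_hom pull_ext\<close>)

lemma pull_ide_arr:
  assumes c: "c \<in> Obj C" and f: "f \<in> Hom (Grp P c) x y"
  shows "FA (Pull P (Ide C c)) f = f"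
proof -
  interpret c: groupoid "Grp P c" by (rule grp[OF c])
  note xy = c.Hom_obj[OF f]
  note id = C.ide_hom[OF c]
  have "Cmp E (Ide E y) (FA (Pull P (Ide C c)) f) = Cmp E f (Ide E x)"
    using pull_\<iota>[OF id f] by (simp add: pull_ide c xy)
  moreover have "FA (Pull P (Ide C c)) f \<in> Hom E x y"
    using sub_hom[OF c pull_hom[OF id f]] by (simp add: pull_ide c xy)
  ultimately show ?thesis
    using E.cmp_ide_left E.cmp_ide_right[OF sub_hom[OF c f]] by metis
qed

lemma pull_ide_ftr: "c \<in> Obj C \<Longrightarrow> Pull P (Ide C c) = id_ftr (Grp P c)"
proof (rule functor_eqI)
  assume c: "c \<in> Obj C"
  show "is_functor (Grp P c) (Grp P c) (Pull P (Ide C c))"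
    by (rule is_functor_pull[OF C.ide_hom[OF c]])
  show "is_functor (Grp P c) (Grp P c) (id_ftr (Grp P c))"
    by (rule is_functor_id[OF groupoid.axioms(1)[OF grp[OF c]]])
  show "FO (Pull P (Ide C c)) x = FO (id_ftr (Grp P c)) x" if "x \<in> Obj (Grp P c)" for x
    using that c by (simp add: pull_ide)
  show "FA (Pull P (Ide C c)) f = FA (id_ftr (Grp P c)) f" if "f \<in> Arr (Grp P c)" for f
    using pull_ide_arr[OF c Arr_in_Hom[OF that]] that by simp
qed

text \<open>Followed by \<open>\<iota>\<close> at the composite map, both sides become the path that
  goes from the double pullback of \<open>x\<close> down to \<open>x\<close> and then along
  \<open>f\<close>.\<close>

lemma cpr_nat_iso:
  assumes u: "u \<in> Hom C b c" and v: "v \<in> Hom C c d"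
  shows "nat_iso (Grp P d) (Grp P b) (comp_ftr (Grp P d) (Pull P u) (Pull P v))
    (Pull P (Cmp C v u)) (Cpr P u v)"
proof (rule nat_isoI)
  note objs = C.Hom_obj[OF u] C.Hom_obj[OF v] and vu = C.cmp_hom[OF u v]
  show "groupoid (Grp P b)" by (rule grp[OF objs(1)])
  interpret b: groupoid "Grp P b" by fact
  interpret d: groupoid "Grp P d" by (rule grp[OF objs(4)])
  show "is_functor (Grp P d) (Grp P b) (comp_ftr (Grp P d) (Pull P u) (Pull P v))"
    by (rule is_functor_comp[OF is_functor_pull[OF v] is_functor_pull[OF u]])
  show "is_functor (Grp P d) (Grp P b) (Pull P (Cmp C v u))" by (rule is_functor_pull[OF vu])
  show "Cpr P u v \<in> extensional (Obj (Grp P d))" by (rule cpr_ext[OF u v])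
  show "Cpr P u v x \<in> Hom (Grp P b) (FO (comp_ftr (Grp P d) (Pull P u) (Pull P v)) x)
      (FO (Pull P (Cmp C v u)) x)" if "x \<in> Obj (Grp P d)" for x
    using cpr_hom[OF u v that] that by simp
  fix f x y assume f: "f \<in> Hom (Grp P d) x y"
  note xy = d.Hom_obj[OF f]
  note vf = pull_hom[OF v f]
  note uvf = pull_hom[OF u vf]
  note vuf = pull_hom[OF vu f]
  note cx = cpr_hom[OF u v xy(1)] and cy = cpr_hom[OF u v xy(2)]
  note \<iota>ux = \<iota>[OF u pull_obj[OF v xy(1)]] and \<iota>uy = \<iota>[OF u pull_obj[OF v xy(2)]]
  note \<iota>vx = \<iota>[OF v xy(1)] and \<iota>vy = \<iota>[OF v xy(2)]
  note \<iota>vux = \<iota>[OF vu xy(1)] and \<iota>vuy = \<iota>[OF vu xy(2)]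
  note E = sub_hom[OF objs(4) f] sub_hom[OF objs(3) vf] sub_hom[OF objs(1) uvf]
    sub_hom[OF objs(1) vuf] sub_hom[OF objs(1) cx] sub_hom[OF objs(1) cy]
  have "Cmp E (\<iota> (Cmp C v u) y) (Cmp E (FA (Pull P (Cmp C v u)) f) (Cpr P u v x)) =
      Cmp E f (Cmp E (\<iota> (Cmp C v u) x) (Cpr P u v x))"
    by (simp add: E.cmp_assoc[OF E(5) E(4) \<iota>vuy] pull_\<iota>[OF vu f] E.cmp_assoc[OF E(5) \<iota>vux E(1)])
  also have "\<dots> = Cmp E (\<iota> v y) (Cmp E (FA (Pull P v) f) (\<iota> u (FO (Pull P v) x)))"
    by (simp add: cpr_\<iota>[OF u v xy(1)] E.cmp_assoc[OF \<iota>ux \<iota>vx E(1)] E.cmp_assoc[OF \<iota>ux E(2) \<iota>vy]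
        pull_\<iota>[OF v f])
  also have "\<dots> = Cmp E (\<iota> v y) (Cmp E (\<iota> u (FO (Pull P v) y)) (FA (Pull P u) (FA (Pull P v) f)))"
    by (simp add: pull_\<iota>[OF u vf])
  also have "\<dots> = Cmp E (\<iota> (Cmp C v u) y) (Cmp E (Cpr P u v y) (FA (Pull P u) (FA (Pull P v) f)))"
    by (simp add: E.cmp_assoc[OF E(3) \<iota>uy \<iota>vy] E.cmp_assoc[OF E(3) E(6) \<iota>vuy] cpr_\<iota>[OF u v xy(2)])
  finally have "Cmp (Grp P b) (FA (Pull P (Cmp C v u)) f) (Cpr P u v x) =
      Cmp (Grp P b) (Cpr P u v y) (FA (Pull P u) (FA (Pull P v) f))"
    by (intro \<iota>_eqI[OF vu xy(2) b.cmp_hom[OF cx vuf] b.cmp_hom[OF uvf cy]]) (simp add: sub_ops objs)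
  then show "Cmp (Grp P b) (FA (Pull P (Cmp C v u)) f) (Cpr P u v x) =
      Cmp (Grp P b) (Cpr P u v y) (FA (comp_ftr (Grp P d) (Pull P u) (Pull P v)) f)"
    using HomD[OF f] by simp
qed

text \<open>For associativity, both sides followed by \<open>\<iota>\<close> at the triple composite
  become the path through the three successive inclusions for \<open>u\<close>, \<open>v\<close> and
  \<open>w\<close>. In the unit laws all constraints are identities, because an identity map acts
  strictly.\<close>

lemma pseudofunctor: "pseudofunctor C P"
proof (intro pseudofunctor.intro pseudofunctor_axioms.intro C.category_axioms)
  show "groupoid (Grp P c)" if "c \<in> Obj C" for c using that by (rule grp)
  show "is_functor (Grp P c) (Grp P b) (Pull P u)" if "u \<in> Hom C b c" for u b c
    using that by (rule is_functor_pull)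
  show "nat_iso (Grp P d) (Grp P b) (comp_ftr (Grp P d) (Pull P u) (Pull P v))
      (Pull P (Cmp C v u)) (Cpr P u v)" if "u \<in> Hom C b c" "v \<in> Hom C c d" for u v b c d
    using that by (rule cpr_nat_iso)
next
  fix c assume c: "c \<in> Obj C"
  interpret c: groupoid "Grp P c" by (rule grp[OF c])
  show "nat_iso (Grp P c) (Grp P c) (id_ftr (Grp P c)) (Pull P (Ide C c)) (Unt P c)"
  proof (rule nat_isoI)
    show "groupoid (Grp P c)" by (rule grp[OF c])
    show "is_functor (Grp P c) (Grp P c) (id_ftr (Grp P c))"
      by (rule is_functor_id[OF c.category_axioms])
    then show "is_functor (Grp P c) (Grp P c) (Pull P (Ide C c))" by (simp add: pull_ide_ftr c)
    show "Unt P c \<in> extensional (Obj (Grp P c))" by (simp add: unt_eq c)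
    show "Unt P c x \<in> Hom (Grp P c) (FO (id_ftr (Grp P c)) x) (FO (Pull P (Ide C c)) x)"
      if "x \<in> Obj (Grp P c)" for x
      using c.ide_hom[OF that] that by (simp add: pull_ide_ftr c unt_eq sub_ops)
    show "Cmp (Grp P c) (FA (Pull P (Ide C c)) f) (Unt P c x) =
      Cmp (Grp P c) (Unt P c y) (FA (id_ftr (Grp P c)) f)"
      if f: "f \<in> Hom (Grp P c) x y" for f x y
      using c.cmp_ide_right[OF f] c.cmp_ide_left[OF f] HomD[OF f] c.Hom_obj[OF f]
      by (simp add: pull_ide_ftr c unt_eq sub_ops)
  qed
next
  fix b c u x assume u: "u \<in> Hom C b c" and x: "x \<in> Obj (Grp P c)"
  note bc = C.Hom_obj[OF u]
  interpret b: groupoid "Grp P b" by (rule grp[OF bc(1)])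
  interpret c: groupoid "Grp P c" by (rule grp[OF bc(2)])
  note ux = pull_obj[OF u x]
  note idb = C.ide_hom[OF bc(1)] and idc = C.ide_hom[OF bc(2)]
  have \<iota>ide: "Cmp E (\<iota> u x) (Ide E (FO (Pull P u) x)) = \<iota> u x" "Cmp E (Ide E x) (\<iota> u x) = \<iota> u x"
    using E.cmp_ide_left[OF \<iota>[OF u x]] E.cmp_ide_right[OF \<iota>[OF u x]] by auto
  have cl: "Cpr P (Ide C b) u x \<in> Hom (Grp P b) (FO (Pull P u) x) (FO (Pull P u) x)"
    using cpr_hom[OF idb u x] by (simp add: pull_ide bc ux C.cmp_ide_right[OF u])
  have "Cpr P (Ide C b) u x = Ide (Grp P b) (FO (Pull P u) x)"
    using cpr_\<iota>[OF idb u x]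
    by (intro \<iota>_eqI[OF u x cl b.ide_hom[OF ux]])
      (simp add: pull_ide bc ux C.cmp_ide_right[OF u] sub_ops \<iota>ide)
  then show "Cmp (Grp P b) (Cpr P (Ide C b) u x) (Unt P b (FO (Pull P u) x)) =
    Ide (Grp P b) (FO (Pull P u) x)"
    using ux b.cmp_ide_left[OF b.ide_hom[OF ux]] by (simp add: unt_eq bc sub_ops)
  have cr: "Cpr P u (Ide C c) x \<in> Hom (Grp P b) (FO (Pull P u) x) (FO (Pull P u) x)"
    using cpr_hom[OF u idc x] by (simp add: pull_ide bc x C.cmp_ide_left[OF u])
  have "Cpr P u (Ide C c) x = Ide (Grp P b) (FO (Pull P u) x)"
    using cpr_\<iota>[OF u idc x]
    by (intro \<iota>_eqI[OF u x cr b.ide_hom[OF ux]])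
      (simp add: pull_ide bc x C.cmp_ide_left[OF u] sub_ops \<iota>ide)
  moreover have "FA (Pull P u) (Unt P c x) = Ide (Grp P b) (FO (Pull P u) x)"
    using functor_arr(5)[OF is_functor_pull[OF u] x] x by (simp add: unt_eq bc sub_ops)
  ultimately show "Cmp (Grp P b) (Cpr P u (Ide C c) x) (FA (Pull P u) (Unt P c x)) =
    Ide (Grp P b) (FO (Pull P u) x)"
    using b.cmp_ide_left[OF b.ide_hom[OF ux]] by simp
next
  fix b c d e u v w x
  assume u: "u \<in> Hom C b c" and v: "v \<in> Hom C c d" and w: "w \<in> Hom C d e" and x: "x \<in> Obj (Grp P e)"
  note objs = C.Hom_obj[OF u] C.Hom_obj[OF v] C.Hom_obj[OF w]
  interpret b: groupoid "Grp P b" by (rule grp[OF objs(1)])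
  note vu = C.cmp_hom[OF u v] and wv = C.cmp_hom[OF v w]
  note wvu = C.cmp_hom[OF u wv]
  note assoc = C.cmp_assoc[OF u v w]
  note wx = pull_obj[OF w x]
  note vwx = pull_obj[OF v wx]
  note c1 = cpr_hom[OF vu w x, unfolded assoc] and c2 = cpr_hom[OF u v wx]
  note c3 = cpr_hom[OF u wv x] and c4 = cpr_hom[OF v w x]
  note c5 = pull_hom[OF u c4]
  note E = sub_hom[OF objs(1) c1] sub_hom[OF objs(1) c2] sub_hom[OF objs(1) c3]
    sub_hom[OF objs(3) c4] sub_hom[OF objs(1) c5]
  note \<iota>w = \<iota>[OF w x] and \<iota>v = \<iota>[OF v wx] and \<iota>u = \<iota>[OF u vwx] and \<iota>wvu = \<iota>[OF wvu x]
    and \<iota>vu = \<iota>[OF vu wx] and \<iota>wv = \<iota>[OF wv x] and \<iota>u' = \<iota>[OF u pull_obj[OF wv x]]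
  have "Cmp E (\<iota> (Cmp C (Cmp C w v) u) x) (Cmp E (Cpr P (Cmp C v u) w x)
    (Cpr P u v (FO (Pull P w) x))) =
      Cmp E (\<iota> w x) (Cmp E (\<iota> (Cmp C v u) (FO (Pull P w) x)) (Cpr P u v (FO (Pull P w) x)))"
    by (simp add: E.cmp_assoc[OF E(2) E(1) \<iota>wvu] cpr_\<iota>[OF vu w x, unfolded assoc]
        E.cmp_assoc[OF E(2) \<iota>vu \<iota>w])
  also have "\<dots> = Cmp E (Cmp E (\<iota> w x) (\<iota> v (FO (Pull P w) x)))
    (\<iota> u (FO (Pull P v) (FO (Pull P w) x)))"
    by (simp add: cpr_\<iota>[OF u v wx] E.cmp_assoc[OF \<iota>u \<iota>v \<iota>w])
  also have "\<dots> = Cmp E (\<iota> (Cmp C w v) x) (Cmp E (\<iota> u (FO (Pull P (Cmp C w v)) x))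
    (FA (Pull P u) (Cpr P v w x)))"
    by (simp add: cpr_\<iota>[OF v w x, symmetric] E.cmp_assoc[OF \<iota>u E(4) \<iota>wv, symmetric] pull_\<iota>[OF u c4])
  also have "\<dots> = Cmp E (Cmp E (\<iota> (Cmp C (Cmp C w v) u) x) (Cpr P u (Cmp C w v) x))
    (FA (Pull P u) (Cpr P v w x))"
    by (simp add: E.cmp_assoc[OF E(5) \<iota>u' \<iota>wv] cpr_\<iota>[OF u wv x])
  also have "\<dots> = Cmp E (\<iota> (Cmp C (Cmp C w v) u) x)
    (Cmp E (Cpr P u (Cmp C w v) x) (FA (Pull P u) (Cpr P v w x)))"
    by (simp add: E.cmp_assoc[OF E(5) E(3) \<iota>wvu])
  finally show "Cmp (Grp P b) (Cpr P (Cmp C v u) w x) (Cpr P u v (FO (Pull P w) x)) =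
      Cmp (Grp P b) (Cpr P u (Cmp C w v) x) (FA (Pull P u) (Cpr P v w x))"
    by (intro \<iota>_eqI[OF wvu x b.cmp_hom[OF c2 c1] b.cmp_hom[OF c5 c3]])
      (simp add: sub_ops objs)
qed

end

text \<open>The components are restrictions of one functor \<open>\<Phi>\<close> between the ambient
  categories, and the cell at \<open>u\<close> is the factorization of
  \<open>\<Phi> (\<iota> u x)\<close> through \<open>\<kappa> u (\<Phi> x)\<close>. The latter is
  monic, so this equation determines the cell; naturality and coherence follow from it.\<close>

locale restriction_transformation =
  P: restriction_system C E P \<iota> + Q: restriction_system C E' Q \<kappa>
  for C :: "('c, 'u) cat" and E :: "('o, 'm) cat" and P and \<iota>
    and E' :: "('p, 'q) cat" and Q and \<kappa> +
  fixes \<Phi> :: "('o, 'm, 'p, 'q) ftr" and \<phi> :: "('c, 'u, 'o, 'm, 'p, 'q) pnt"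
  assumes \<Phi>: "is_functor E E' \<Phi>"
    and ext: "Cmpt \<phi> \<in> extensional (Obj C)" "Cell \<phi> \<in> extensional (Arr C)"
    and cmpt_obj: "c \<in> Obj C \<Longrightarrow> x \<in> Obj (Grp P c) \<Longrightarrow>
      FO (Cmpt \<phi> c) x = FO \<Phi> x \<and> FO \<Phi> x \<in> Obj (Grp Q c)"
    and cmpt_hom: "c \<in> Obj C \<Longrightarrow> f \<in> Hom (Grp P c) x y \<Longrightarrow>
      FA (Cmpt \<phi> c) f = FA \<Phi> f \<and> FA \<Phi> f \<in> Hom (Grp Q c) (FO \<Phi> x) (FO \<Phi> y)"
    and cmpt_ext: "c \<in> Obj C \<Longrightarrow> FO (Cmpt \<phi> c) \<in> extensional (Obj (Grp P c))"
      "c \<in> Obj C \<Longrightarrow> FA (Cmpt \<phi> c) \<in> extensional (Arr (Grp P c))"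
    and cell_ext: "u \<in> Hom C b c \<Longrightarrow> Cell \<phi> u \<in> extensional (Obj (Grp P c))"
    and cell_hom: "u \<in> Hom C b c \<Longrightarrow> x \<in> Obj (Grp P c) \<Longrightarrow>
      Cell \<phi> u x \<in> Hom (Grp Q b) (FO \<Phi> (FO (Pull P u) x)) (FO (Pull Q u) (FO \<Phi> x))"
    and cell_\<iota>: "u \<in> Hom C b c \<Longrightarrow> x \<in> Obj (Grp P c) \<Longrightarrow>
      Cmp E' (\<kappa> u (FO \<Phi> x)) (Cell \<phi> u x) = FA \<Phi> (\<iota> u x)"
begin

lemma \<Phi>_cmp: "f \<in> Hom E x y \<Longrightarrow> g \<in> Hom E y z \<Longrightarrow> FA \<Phi> (Cmp E g f) = Cmp E' (FA \<Phi> g) (FA \<Phi> f)"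
  using functor_arr(6)[OF \<Phi>] by (simp add: Hom_def)

lemma is_functor_cmpt:
  assumes c: "c \<in> Obj C"
  shows "is_functor (Grp P c) (Grp Q c) (Cmpt \<phi> c)"
proof (rule functorI)
  interpret Pc: groupoid "Grp P c" by (rule P.grp[OF c])
  interpret Qc: groupoid "Grp Q c" by (rule Q.grp[OF c])
  show "category (Grp P c)" "category (Grp Q c)" by unfold_locales
  show "FO (Cmpt \<phi> c) x \<in> Obj (Grp Q c)" if "x \<in> Obj (Grp P c)" for x
    using cmpt_obj[OF c that] by simp
  show "FA (Cmpt \<phi> c) f \<in> Hom (Grp Q c) (FO (Cmpt \<phi> c) x) (FO (Cmpt \<phi> c) y)"
    if f: "f \<in> Hom (Grp P c) x y" for f x y
    using cmpt_hom[OF c f] cmpt_obj[OF c] Pc.Hom_obj[OF f] by simp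
  show "FA (Cmpt \<phi> c) (Ide (Grp P c) x) = Ide (Grp Q c) (FO (Cmpt \<phi> c) x)" if x: "x \<in> Obj (Grp P c)"
    for x
    using cmpt_hom[OF c Pc.ide_hom[OF x]] cmpt_obj[OF c x] functor_arr(5)[OF \<Phi> P.sub_obj[OF c x]]
    by (simp add: P.sub_ops Q.sub_ops c)
  show "FA (Cmpt \<phi> c) (Cmp (Grp P c) g f) = Cmp (Grp Q c) (FA (Cmpt \<phi> c) g) (FA (Cmpt \<phi> c) f)"
    if f: "f \<in> Hom (Grp P c) x y" and g: "g \<in> Hom (Grp P c) y z" for f g x y z
    using cmpt_hom[OF c f] cmpt_hom[OF c g] cmpt_hom[OF c Pc.cmp_hom[OF f g]]
      \<Phi>_cmp[OF P.sub_hom[OF c f] P.sub_hom[OF c g]]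
    by (simp add: P.sub_ops Q.sub_ops c)
qed (simp_all add: cmpt_ext c)

lemma cell_nat_iso:
  assumes u: "u \<in> Hom C b c"
  shows "nat_iso (Grp P c) (Grp Q b) (comp_ftr (Grp P c) (Cmpt \<phi> b) (Pull P u))
    (comp_ftr (Grp P c) (Pull Q u) (Cmpt \<phi> c)) (Cell \<phi> u)"
proof (rule nat_isoI)
  note bc = P.C.Hom_obj[OF u]
  show "groupoid (Grp Q b)" by (rule Q.grp[OF bc(1)])
  interpret Qb: groupoid "Grp Q b" by fact
  interpret Pc: groupoid "Grp P c" by (rule P.grp[OF bc(2)])
  interpret Pb: groupoid "Grp P b" by (rule P.grp[OF bc(1)])
  show "is_functor (Grp P c) (Grp Q b) (comp_ftr (Grp P c) (Cmpt \<phi> b) (Pull P u))"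
    by (rule is_functor_comp[OF P.is_functor_pull[OF u] is_functor_cmpt[OF bc(1)]])
  show "is_functor (Grp P c) (Grp Q b) (comp_ftr (Grp P c) (Pull Q u) (Cmpt \<phi> c))"
    by (rule is_functor_comp[OF is_functor_cmpt[OF bc(2)] Q.is_functor_pull[OF u]])
  show "Cell \<phi> u \<in> extensional (Obj (Grp P c))" by (rule cell_ext[OF u])
  show "Cell \<phi> u x \<in> Hom (Grp Q b) (FO (comp_ftr (Grp P c) (Cmpt \<phi> b) (Pull P u)) x)
      (FO (comp_ftr (Grp P c) (Pull Q u) (Cmpt \<phi> c)) x)" if x: "x \<in> Obj (Grp P c)" for x
    using cell_hom[OF u x] cmpt_obj[OF bc(2) x] cmpt_obj[OF bc(1) P.pull_obj[OF u x]] x by simp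
  fix f x y assume f: "f \<in> Hom (Grp P c) x y"
  note xy = Pc.Hom_obj[OF f]
  have \<Phi>f: "FA \<Phi> f \<in> Hom (Grp Q c) (FO \<Phi> x) (FO \<Phi> y)" using cmpt_hom[OF bc(2) f] by simp
  have \<Phi>xy: "FO \<Phi> x \<in> Obj (Grp Q c)" "FO \<Phi> y \<in> Obj (Grp Q c)" using cmpt_obj[OF bc(2)] xy by auto
  note uf = P.pull_hom[OF u f]
  have \<Phi>uf: "FA \<Phi> (FA (Pull P u) f) \<in> Hom (Grp Q b) (FO \<Phi> (FO (Pull P u) x))
    (FO \<Phi> (FO (Pull P u) y))"
    using cmpt_hom[OF bc(1) uf] by simp
  note u\<Phi>f = Q.pull_hom[OF u \<Phi>f]
  note cx = cell_hom[OF u xy(1)] and cy = cell_hom[OF u xy(2)]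
  note E = Q.sub_hom[OF bc(1) \<Phi>uf] Q.sub_hom[OF bc(1) u\<Phi>f] Q.sub_hom[OF bc(1) cx]
    Q.sub_hom[OF bc(1) cy]
    Q.sub_hom[OF bc(2) \<Phi>f]
  note \<kappa>x = Q.\<iota>[OF u \<Phi>xy(1)] and \<kappa>y = Q.\<iota>[OF u \<Phi>xy(2)]
  have "Cmp E' (\<kappa> u (FO \<Phi> y)) (Cmp E' (FA (Pull Q u) (FA \<Phi> f)) (Cell \<phi> u x)) =
      Cmp E' (FA \<Phi> f) (FA \<Phi> (\<iota> u x))"
    by (simp add: Q.E.cmp_assoc[OF E(3) E(2) \<kappa>y] Q.pull_\<iota>[OF u \<Phi>f]
        Q.E.cmp_assoc[OF E(3) \<kappa>x E(5), symmetric] cell_\<iota>[OF u xy(1)])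
  also have "\<dots> = Cmp E' (FA \<Phi> (\<iota> u y)) (FA \<Phi> (FA (Pull P u) f))"
    using \<Phi>_cmp[OF P.\<iota>[OF u xy(1)] P.sub_hom[OF bc(2) f]]
      \<Phi>_cmp[OF P.sub_hom[OF bc(1) uf] P.\<iota>[OF u xy(2)]] by (simp add: P.pull_\<iota>[OF u f])
  also have "\<dots> = Cmp E' (\<kappa> u (FO \<Phi> y)) (Cmp E' (Cell \<phi> u y) (FA \<Phi> (FA (Pull P u) f)))"
    by (simp add: Q.E.cmp_assoc[OF E(1) E(4) \<kappa>y] cell_\<iota>[OF u xy(2)])
  finally have "Cmp (Grp Q b) (FA (Pull Q u) (FA \<Phi> f)) (Cell \<phi> u x) =
      Cmp (Grp Q b) (Cell \<phi> u y) (FA \<Phi> (FA (Pull P u) f))"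
    by (intro Q.\<iota>_eqI[OF u \<Phi>xy(2) Qb.cmp_hom[OF cx u\<Phi>f] Qb.cmp_hom[OF \<Phi>uf cy]])
      (simp add: Q.sub_ops bc)
  then show "Cmp (Grp Q b) (FA (comp_ftr (Grp P c) (Pull Q u) (Cmpt \<phi> c)) f) (Cell \<phi> u x) =
      Cmp (Grp Q b) (Cell \<phi> u y) (FA (comp_ftr (Grp P c) (Cmpt \<phi> b) (Pull P u)) f)"
    using cmpt_hom[OF bc(2) f] cmpt_hom[OF bc(1) uf] HomD[OF f] by simp
qed

text \<open>At an identity map both inclusions are identities, and so is the cell. At a composite
  \<open>v u\<close>, both sides followed by the inclusion \<open>\<kappa>\<close> become the image
  under \<open>\<Phi>\<close> of the two successive inclusions for \<open>u\<close> and
  \<open>v\<close>.\<close>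

lemma pseudonatural: "pseudonatural C P Q \<phi>"
proof (rule pseudonaturalI)
  show "pseudofunctor C P" "pseudofunctor C Q" by (rule P.pseudofunctor Q.pseudofunctor)+
  show "Cmpt \<phi> \<in> extensional (Obj C)" "Cell \<phi> \<in> extensional (Arr C)" by (rule ext)+
  show "is_functor (Grp P c) (Grp Q c) (Cmpt \<phi> c)" if "c \<in> Obj C" for c
    using that by (rule is_functor_cmpt)
  show "nat_iso (Grp P c) (Grp Q b) (comp_ftr (Grp P c) (Cmpt \<phi> b) (Pull P u))
      (comp_ftr (Grp P c) (Pull Q u) (Cmpt \<phi> c)) (Cell \<phi> u)" if "u \<in> Hom C b c" for u b c
    using that by (rule cell_nat_iso)
next
  fix c x assume c: "c \<in> Obj C" and x: "x \<in> Obj (Grp P c)"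
  interpret Pc: groupoid "Grp P c" by (rule P.grp[OF c])
  interpret Qc: groupoid "Grp Q c" by (rule Q.grp[OF c])
  note id = P.C.ide_hom[OF c]
  have \<Phi>x: "FO \<Phi> x \<in> Obj (Grp Q c)" "FO (Cmpt \<phi> c) x = FO \<Phi> x" using cmpt_obj[OF c x] by auto
  have cell: "Cell \<phi> (Ide C c) x \<in> Hom (Grp Q c) (FO \<Phi> x) (FO \<Phi> x)"
    using cell_hom[OF id x] by (simp add: P.pull_ide Q.pull_ide c x \<Phi>x)
  have "Cell \<phi> (Ide C c) x = Ide E' (FO \<Phi> x)"
    using cell_\<iota>[OF id x] Q.E.cmp_ide_left[OF Q.sub_hom[OF c cell]]
        functor_arr(5)[OF \<Phi> P.sub_obj[OF c x]]
    by (simp add: P.pull_ide Q.pull_ide c x \<Phi>x)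
  moreover have "FA (Cmpt \<phi> c) (Unt P c x) = Ide E' (FO \<Phi> x)"
    using functor_arr(5)[OF is_functor_cmpt[OF c] x] \<Phi>x x
    by (simp add: P.unt_eq c P.sub_ops Q.sub_ops)
  ultimately show "Cmp (Grp Q c) (Cell \<phi> (Ide C c) x) (FA (Cmpt \<phi> c) (Unt P c x)) =
      Unt Q c (FO (Cmpt \<phi> c) x)"
    using Qc.cmp_ide_left[OF Qc.ide_hom[OF \<Phi>x(1)]] \<Phi>x by (simp add: Q.unt_eq c Q.sub_ops)
next
  fix b c d u v x assume u: "u \<in> Hom C b c" and v: "v \<in> Hom C c d" and x: "x \<in> Obj (Grp P d)"
  note objs = P.C.Hom_obj[OF u] P.C.Hom_obj[OF v] and vu = P.C.cmp_hom[OF u v]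
  interpret Qb: groupoid "Grp Q b" by (rule Q.grp[OF objs(1)])
  have \<Phi>x: "FO \<Phi> x \<in> Obj (Grp Q d)" "FO (Cmpt \<phi> d) x = FO \<Phi> x" using cmpt_obj[OF objs(4) x] by auto
  note vx = P.pull_obj[OF v x]
  have \<Phi>vx: "FO \<Phi> (FO (Pull P v) x) \<in> Obj (Grp Q c)" using cmpt_obj[OF objs(3) vx] by auto
  note c1 = cell_hom[OF vu x] and c2 = P.cpr_hom[OF u v x]
  have c2': "FA (Cmpt \<phi> b) (Cpr P u v x) = FA \<Phi> (Cpr P u v x)"
    "FA \<Phi> (Cpr P u v x) \<in> Hom (Grp Q b) (FO \<Phi> (FO (Pull P u) (FO (Pull P v) x)))
      (FO \<Phi> (FO (Pull P (Cmp C v u)) x))"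
    using cmpt_hom[OF objs(1) c2] by auto
  note c3 = Q.cpr_hom[OF u v \<Phi>x(1)] and c4 = cell_hom[OF v x] and c5 = cell_hom[OF u vx]
  note c4' = Q.pull_hom[OF u c4]
  note c45 = Qb.cmp_hom[OF c5 c4']
  note E = Q.sub_hom[OF objs(1) c1] Q.sub_hom[OF objs(1) c2'(2)] Q.sub_hom[OF objs(1) c3]
    Q.sub_hom[OF objs(3) c4] Q.sub_hom[OF objs(1) c5] Q.sub_hom[OF objs(1) c4']
    Q.sub_hom[OF objs(1) c45, unfolded Q.sub_ops(1)[OF objs(1)]]
  note \<kappa>vu = Q.\<iota>[OF vu \<Phi>x(1)] and \<kappa>v = Q.\<iota>[OF v \<Phi>x(1)] and \<kappa>u = Q.\<iota>[OF u Q.pull_obj[OF v \<Phi>x(1)]]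
    and \<kappa>u' = Q.\<iota>[OF u \<Phi>vx]
  have "Cmp E' (\<kappa> (Cmp C v u) (FO \<Phi> x)) (Cmp E' (Cell \<phi> (Cmp C v u) x) (FA \<Phi> (Cpr P u v x))) =
      FA \<Phi> (Cmp E (\<iota> (Cmp C v u) x) (Cpr P u v x))"
    by (simp add: Q.E.cmp_assoc[OF E(2) E(1) \<kappa>vu] cell_\<iota>[OF vu x]
        \<Phi>_cmp[OF P.sub_hom[OF objs(1) c2] P.\<iota>[OF vu x]])
  also have "\<dots> = Cmp E' (FA \<Phi> (\<iota> v x)) (FA \<Phi> (\<iota> u (FO (Pull P v) x)))"
    by (simp add: P.cpr_\<iota>[OF u v x] \<Phi>_cmp[OF P.\<iota>[OF u vx] P.\<iota>[OF v x]])
  also have "\<dots> = Cmp E' (\<kappa> v (FO \<Phi> x)) (Cmp E' (Cmp E' (Cell \<phi> v x) (\<kappa> u (FO \<Phi> (FO (Pull P v) x))))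
      (Cell \<phi> u (FO (Pull P v) x)))"
    using Q.E.cmp_assoc[OF Q.E.cmp_hom[OF E(5) \<kappa>u'] E(4) \<kappa>v]
    by (simp add: cell_\<iota>[OF v x] cell_\<iota>[OF u vx] Q.E.cmp_assoc[OF E(5) \<kappa>u' E(4), symmetric])
  also have "\<dots> = Cmp E' (\<kappa> v (FO \<Phi> x)) (Cmp E' (\<kappa> u (FO (Pull Q v) (FO \<Phi> x)))
      (Cmp E' (FA (Pull Q u) (Cell \<phi> v x)) (Cell \<phi> u (FO (Pull P v) x))))"
    by (simp add: Q.pull_\<iota>[OF u c4, symmetric] Q.E.cmp_assoc[OF E(5) E(6) \<kappa>u])
  also have "\<dots> = Cmp E' (\<kappa> (Cmp C v u) (FO \<Phi> x)) (Cmp E' (Cpr Q u v (FO \<Phi> x))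
      (Cmp E' (FA (Pull Q u) (Cell \<phi> v x)) (Cell \<phi> u (FO (Pull P v) x))))"
    by (simp add: Q.E.cmp_assoc[OF E(7) \<kappa>u \<kappa>v] Q.E.cmp_assoc[OF E(7) E(3) \<kappa>vu]
        Q.cpr_\<iota>[OF u v \<Phi>x(1)])
  finally have "Cmp (Grp Q b) (Cell \<phi> (Cmp C v u) x) (FA \<Phi> (Cpr P u v x)) =
      Cmp (Grp Q b) (Cpr Q u v (FO \<Phi> x))
        (Cmp (Grp Q b) (FA (Pull Q u) (Cell \<phi> v x)) (Cell \<phi> u (FO (Pull P v) x)))"
    by (intro Q.\<iota>_eqI[OF vu \<Phi>x(1) Qb.cmp_hom[OF c2'(2) c1] Qb.cmp_hom[OF c45 c3]]) (simp add:
        Q.sub_ops objs)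
  then show "Cmp (Grp Q b) (Cell \<phi> (Cmp C v u) x) (FA (Cmpt \<phi> b) (Cpr P u v x)) =
      Cmp (Grp Q b) (Cpr Q u v (FO (Cmpt \<phi> d) x))
        (Cmp (Grp Q b) (FA (Pull Q u) (Cell \<phi> v x)) (Cell \<phi> u (FO (Pull P v) x)))"
    by (simp add: \<Phi>x c2')
qed

end

section \<open>The total category of a restriction species\<close>

lemma fin_inj_hom: "s \<in> Hom fin_inj A B \<longleftrightarrow>
    (\<exists>f. s = Arrow A f B \<and> finite A \<and> finite B \<and> f \<in> A \<rightarrow>\<^sub>E B \<and> inj_on f A)"
  by (auto simp: fin_inj_def Hom_def)

lemma fin_inj_homI:
  "finite A \<Longrightarrow> finite B \<Longrightarrow> f \<in> A \<rightarrow>\<^sub>E B \<Longrightarrow> inj_on f A \<Longrightarrow> Arrow A f B \<in> Hom fin_inj A B"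
  by (simp add: fin_inj_hom)

lemma fin_inj_cmp [simp]:
  "Cmp fin_inj (Arrow B \<tau> D) (Arrow A \<sigma> B) = Arrow A (compose A \<tau> \<sigma>) D"
  by (simp add: fin_inj_def)

lemma fin_inj_ide [simp]: "Ide fin_inj A = Arrow A (\<lambda>x \<in> A. x) A"
  by (simp add: fin_inj_def)

lemma fin_inj_obj [simp]: "A \<in> Obj fin_inj \<longleftrightarrow> finite A"
  by (simp add: fin_inj_def)

text \<open>The Grothendieck construction of \<open>R\<close>.  The second component of an object plays no role; it
  is there to make each \<^term>\<open>layers R n\<close> a subcategory.\<close>

definition total :: "('u, 'o, 'm) species \<Rightarrow> (('u, 'o) lobj, ('u, 'o, 'm) larr) cat" where
  "total R =
     \<lparr>Obj = {(A, p, X). finite A \<and> X \<in> Obj (Grp R A)},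
      Arr = {Arrow (A, p, X) (\<sigma>, h) (B, q, Y) | A p X \<sigma> h B q Y.
               Arrow A \<sigma> B \<in> Hom fin_inj A B \<and> X \<in> Obj (Grp R A) \<and> Y \<in> Obj (Grp R B) \<and>
               h \<in> Hom (Grp R A) X (FO (Pull R (Arrow A \<sigma> B)) Y)},
      Dom = src, Cod = tgt, Ide = Ide (layers R 0), Cmp = Cmp (layers R 0)\<rparr>"

abbreviation base :: "('u, 'o, 'm) larr \<Rightarrow> 'u \<Rightarrow> 'u" where
  "base t \<equiv> fst (via t)"

lemma total_obj: "(A, p, X) \<in> Obj (total R) \<longleftrightarrow> finite A \<and> X \<in> Obj (Grp R A)"
  by (simp add: total_def)

lemma total_hom: "t \<in> Hom (total R) (A, p, X) (B, q, Y) \<longleftrightarrow>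
    (\<exists>\<sigma> h. t = Arrow (A, p, X) (\<sigma>, h) (B, q, Y) \<and> Arrow A \<sigma> B \<in> Hom fin_inj A B \<and>
      X \<in> Obj (Grp R A) \<and> Y \<in> Obj (Grp R B) \<and> h \<in> Hom (Grp R A) X (FO (Pull R (Arrow A \<sigma> B)) Y))"
  by (auto simp: total_def Hom_def)

lemma total_homD:
  assumes "t \<in> Hom (total R) x y"
  shows "src t = x" "tgt t = y" "t = Arrow x (via t) y"
  using assms by (auto simp: total_def Hom_def)

lemma total_ide: "Ide (total R) (A, p, X) = Arrow (A, p, X) (\<lambda>x \<in> A. x, Unt R A X) (A, p, X)"
  by (simp add: total_def layers_def)

lemma total_cmp:
  "Cmp (total R) (Arrow (B', q', Y') (\<tau>, k) (D, r, Z)) (Arrow (A, p, X) (\<sigma>, h) (B, q, Y)) =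
     Arrow (A, p, X)
       (compose A \<tau> \<sigma>,
        Cmp (Grp R A) (Cpr R (Arrow A \<sigma> B) (Arrow B \<tau> D) Z)
          (Cmp (Grp R A) (FA (Pull R (Arrow A \<sigma> B)) k) h))
       (D, r, Z)"
  by (simp add: total_def layers_def)

lemma base_cmp:
  assumes "t \<in> Hom (total R) x y" "u \<in> Hom (total R) y z"
  shows "base (Cmp (total R) u t) = compose (fst x) (base u) (base t)"
  using assms by (cases x; cases y; cases z) (auto simp: total_hom total_cmp)

lemma base_funcset:
  assumes "t \<in> Hom (total R) x y"
  shows "base t \<in> fst x \<rightarrow>\<^sub>E fst y" "inj_on (base t) (fst x)"
  using assms by (cases x; cases y; auto simp: total_hom fin_inj_hom)+

section \<open>Category laws, monicity and cartesian arrows of the total category\<close>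

locale species = pseudofunctor fin_inj R for R :: "('u, 'o, 'm) species"
begin

abbreviation E where "E \<equiv> total R"

lemma groupoid_at: "finite A \<Longrightarrow> groupoid (Grp R A)"
  by (rule grp) simp

lemma total_homE:
  assumes "t \<in> Hom E (A, p, X) (B, q, Y)"
  obtains \<sigma> h where "t = Arrow (A, p, X) (\<sigma>, h) (B, q, Y)" "Arrow A \<sigma> B \<in> Hom fin_inj A B"
    "finite A" "finite B" "X \<in> Obj (Grp R A)" "Y \<in> Obj (Grp R B)"
    "h \<in> Hom (Grp R A) X (FO (Pull R (Arrow A \<sigma> B)) Y)"
  using assms that by (auto simp: total_hom fin_inj_hom)

lemma unt_hom: "finite A \<Longrightarrow> X \<in> Obj (Grp R A) \<Longrightarrow>
    Unt R A X \<in> Hom (Grp R A) X (FO (Pull R (Arrow A (\<lambda>x \<in> A. x) A)) X)"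
  using unt_arr[of A X] by (auto simp: Hom_def)

text \<open>Naturality of the unit moves \<open>h\<close> past it; what is left is the law
  \<open>unt_left\<close> of the pseudo-functor. The sides are exchanged because \<open>R\<close> is
  contravariant.\<close>

lemma total_cmp_ide_right:
  assumes "t \<in> Hom E x y"
  shows "Cmp E t (Ide E x) = t"
proof -
  obtain A p X B q Y where x: "x = (A, p, X)" and y: "y = (B, q, Y)" by (metis prod_cases3)
  obtain \<sigma> h where t: "t = Arrow (A, p, X) (\<sigma>, h) (B, q, Y)" "Arrow A \<sigma> B \<in> Hom fin_inj A B"
      "finite A" "finite B" and X: "X \<in> Obj (Grp R A)" and Y: "Y \<in> Obj (Grp R B)"
      and h: "h \<in> Hom (Grp R A) X (FO (Pull R (Arrow A \<sigma> B)) Y)"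
    using assms by (auto simp: x y elim: total_homE)
  interpret A: groupoid "Grp R A" by (rule groupoid_at[OF t(3)])
  have id: "Arrow A (\<lambda>x \<in> A. x) A \<in> Hom fin_inj A A" using ide_hom[of A] t(3) by simp
  have c: "compose A \<sigma> (\<lambda>x \<in> A. x) = \<sigma>"
    using t(2) cmp_ide_right[OF t(2)] by simp
  note \<sigma>Y = functor_arr(1)[OF pull[OF t(2)] Y]
  have "Cmp (Grp R A) (Cpr R (Arrow A (\<lambda>x \<in> A. x) A) (Arrow A \<sigma> B) Y)
      (Cmp (Grp R A) (FA (Pull R (Arrow A (\<lambda>x \<in> A. x) A)) h) (Unt R A X)) =
    Cmp (Grp R A) (Cpr R (Arrow A (\<lambda>x \<in> A. x) A) (Arrow A \<sigma> B) Y)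
      (Cmp (Grp R A) (Unt R A (FO (Pull R (Arrow A \<sigma> B)) Y)) h)"
    using unt_nat[OF _ h] t(3) by simp
  also have "\<dots> = Cmp (Grp R A) (Ide (Grp R A) (FO (Pull R (Arrow A \<sigma> B)) Y)) h"
    using A.cmp_assoc[OF h unt_hom[OF t(3) \<sigma>Y]]
      cpr_arr[OF id t(2) Y] unt_left[OF t(2) Y] by (simp add: Hom_def)
  also have "\<dots> = h" by (rule A.cmp_ide_left[OF h])
  finally show ?thesis by (simp add: x t(1) total_ide total_cmp c)
qed

lemma total_cmp_ide_left:
  assumes "t \<in> Hom E x y"
  shows "Cmp E (Ide E y) t = t"
proof -
  obtain A p X B q Y where x: "x = (A, p, X)" and y: "y = (B, q, Y)" by (metis prod_cases3)
  obtain \<sigma> h where t: "t = Arrow (A, p, X) (\<sigma>, h) (B, q, Y)" "Arrow A \<sigma> B \<in> Hom fin_inj A B"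
      "finite A" "finite B" and X: "X \<in> Obj (Grp R A)" and Y: "Y \<in> Obj (Grp R B)"
      and h: "h \<in> Hom (Grp R A) X (FO (Pull R (Arrow A \<sigma> B)) Y)"
    using assms by (auto simp: x y elim: total_homE)
  interpret A: groupoid "Grp R A" by (rule groupoid_at[OF t(3)])
  have id: "Arrow B (\<lambda>x \<in> B. x) B \<in> Hom fin_inj B B" using ide_hom[of B] t(4) by simp
  have c: "compose A (\<lambda>x \<in> B. x) \<sigma> = \<sigma>"
    using t(2) cmp_ide_left[OF t(2)] by simp
  have "Cmp (Grp R A) (Cpr R (Arrow A \<sigma> B) (Arrow B (\<lambda>x \<in> B. x) B) Y)
      (Cmp (Grp R A) (FA (Pull R (Arrow A \<sigma> B)) (Unt R B Y)) h) =
      Cmp (Grp R A) (Ide (Grp R A) (FO (Pull R (Arrow A \<sigma> B)) Y)) h"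
    using A.cmp_assoc[OF h functor_hom[OF pull[OF t(2)] unt_hom[OF t(4) Y]]]
      cpr_arr[OF t(2) id Y] unt_right[OF t(2) Y] by (simp add: Hom_def)
  also have "\<dots> = h" by (rule A.cmp_ide_left[OF h])
  finally show ?thesis by (simp add: y t(1) total_ide total_cmp c)
qed

lemma total_cmp_hom:
  assumes "t \<in> Hom E x y" "u \<in> Hom E y z"
  shows "Cmp E u t \<in> Hom E x z"
proof -
  obtain A p X B q Y D r Z where x: "x = (A, p, X)" and y: "y = (B, q, Y)" and z: "z = (D, r, Z)"
    by (metis prod_cases3)
  obtain \<sigma> h where t: "t = Arrow (A, p, X) (\<sigma>, h) (B, q, Y)" "Arrow A \<sigma> B \<in> Hom fin_inj A B"
      "finite A" "finite B" and X: "X \<in> Obj (Grp R A)" and Y: "Y \<in> Obj (Grp R B)"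
      and h: "h \<in> Hom (Grp R A) X (FO (Pull R (Arrow A \<sigma> B)) Y)"
    using assms(1) by (auto simp: x y elim: total_homE)
  obtain \<tau> k where u: "u = Arrow (B, q, Y) (\<tau>, k) (D, r, Z)" "Arrow B \<tau> D \<in> Hom fin_inj B D"
      and Z: "Z \<in> Obj (Grp R D)" and k: "k \<in> Hom (Grp R B) Y (FO (Pull R (Arrow B \<tau> D)) Z)"
    using assms(2) by (auto simp: y z elim: total_homE)
  interpret A: groupoid "Grp R A" by (rule groupoid_at[OF t(3)])
  have "Cpr R (Arrow A \<sigma> B) (Arrow B \<tau> D) Z \<in>
      Hom (Grp R A) (FO (Pull R (Arrow A \<sigma> B)) (FO (Pull R (Arrow B \<tau> D)) Z))
        (FO (Pull R (Arrow A (compose A \<tau> \<sigma>) D)) Z)"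
    using cpr_arr[OF t(2) u(2) Z] by (simp add: Hom_def)
  note A.cmp_hom[OF A.cmp_hom[OF h functor_hom[OF pull[OF t(2)] k]] this]
  then show ?thesis
    using cmp_hom[OF t(2) u(2)] X Z by (simp add: t u x z total_cmp total_hom)
qed

text \<open>Naturality of the composition constraint at \<open>l\<close> brings both sides to a form
  in which they differ by the associativity law of the constraints of \<open>R\<close>.\<close>

lemma total_cmp_assoc:
  assumes "t \<in> Hom E w x" "u \<in> Hom E x y" "v \<in> Hom E y z"
  shows "Cmp E v (Cmp E u t) = Cmp E (Cmp E v u) t"
proof -
  obtain A p X B q Y D r Z F s W where w: "w = (A, p, X)" and x: "x = (B, q, Y)"
    and y: "y = (D, r, Z)"
    and z: "z = (F, s, W)" by (metis prod_cases3)
  obtain \<sigma> h where t: "t = Arrow (A, p, X) (\<sigma>, h) (B, q, Y)" "Arrow A \<sigma> B \<in> Hom fin_inj A B"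
      "finite A" "finite B" and X: "X \<in> Obj (Grp R A)" and Y: "Y \<in> Obj (Grp R B)"
      and h: "h \<in> Hom (Grp R A) X (FO (Pull R (Arrow A \<sigma> B)) Y)"
    using assms(1) by (auto simp: w x elim: total_homE)
  obtain \<tau> k where u: "u = Arrow (B, q, Y) (\<tau>, k) (D, r, Z)" "Arrow B \<tau> D \<in> Hom fin_inj B D"
      "finite D" and Z: "Z \<in> Obj (Grp R D)" and k:
        "k \<in> Hom (Grp R B) Y (FO (Pull R (Arrow B \<tau> D)) Z)"
    using assms(2) by (auto simp: x y elim: total_homE)
  obtain \<rho> l where v: "v = Arrow (D, r, Z) (\<rho>, l) (F, s, W)" "Arrow D \<rho> F \<in> Hom fin_inj D F"
      and W: "W \<in> Obj (Grp R F)" and l: "l \<in> Hom (Grp R D) Z (FO (Pull R (Arrow D \<rho> F)) W)"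
    using assms(3) by (auto simp: y z elim: total_homE)
  interpret A: groupoid "Grp R A" by (rule groupoid_at[OF t(3)])
  interpret B: groupoid "Grp R B" by (rule groupoid_at[OF t(4)])
  let ?s = "Arrow A \<sigma> B" and ?t = "Arrow B \<tau> D" and ?r = "Arrow D \<rho> F"
  let ?C = "Cmp (Grp R A)"
  have c: "compose A \<rho> (compose A \<tau> \<sigma>) = compose A (compose B \<rho> \<tau>) \<sigma>"
    using cmp_assoc[OF t(2) u(2) v(2)] by simp
  note ts = cmp_hom[OF t(2) u(2), simplified] and rt = cmp_hom[OF u(2) v(2), simplified]
  note fs = functor_arr(1-4)[OF pull[OF t(2)]] functor_arr(1-4)[OF pull[OF u(2)]]
    functor_arr(1-4)[OF pull[OF v(2)]] functor_arr(1-4)[OF pull[OF ts]]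
      functor_arr(1-4)[OF pull[OF rt]]
    HomD[OF h] HomD[OF k] HomD[OF l] W Z
    cpr_arr[OF t(2) u(2), simplified] cpr_arr[OF u(2) v(2), simplified]
    cpr_arr[OF t(2) rt, simplified] cpr_arr[OF ts v(2), simplified]
  note rW = functor_arr(1)[OF pull[OF v(2)] W]
  have "?C (Cpr R (Arrow A (compose A \<tau> \<sigma>) D) ?r W)
      (?C (FA (Pull R (Arrow A (compose A \<tau> \<sigma>) D)) l)
        (?C (Cpr R ?s ?t Z) (?C (FA (Pull R ?s) k) h))) =
    ?C (Cpr R (Arrow A (compose A \<tau> \<sigma>) D) ?r W)
      (?C (?C (FA (Pull R (Arrow A (compose A \<tau> \<sigma>) D)) l) (Cpr R ?s ?t Z))
        (?C (FA (Pull R ?s) k) h))"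
    by (simp add: A.arr_simps fs)
  also have "\<dots> = ?C (?C (Cpr R (Arrow A (compose A \<tau> \<sigma>) D) ?r W) (Cpr R ?s ?t (FO (Pull R ?r) W)))
      (?C (FA (Pull R ?s) (FA (Pull R ?t) l)) (?C (FA (Pull R ?s) k) h))"
    using cpr_nat[OF t(2) u(2) l] by (simp add: A.arr_simps fs)
  also have "\<dots> = ?C (Cpr R ?s (Arrow B (compose B \<rho> \<tau>) F) W)
      (?C (?C (FA (Pull R ?s) (Cpr R ?t ?r W))
        (?C (FA (Pull R ?s) (FA (Pull R ?t) l)) (FA (Pull R ?s) k))) h)"
    using cpr_assoc[OF t(2) u(2) v(2) W] by (simp add: A.arr_simps fs)
  also have "?C (FA (Pull R ?s) (Cpr R ?t ?r W))
    (?C (FA (Pull R ?s) (FA (Pull R ?t) l)) (FA (Pull R ?s) k)) =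
      FA (Pull R ?s) (Cmp (Grp R B) (Cpr R ?t ?r W) (Cmp (Grp R B) (FA (Pull R ?t) l) k))"
    by (simp add: functor_arr(6)[OF pull[OF t(2)]] B.arr_simps fs)
  finally show ?thesis by (simp add: t u v total_cmp c)
qed

lemma total_ide_hom: "x \<in> Obj E \<Longrightarrow> Ide E x \<in> Hom E x x"
  using ide_hom by (cases x) (auto simp: total_obj total_ide total_hom unt_hom)

sublocale total: category E
proof
  fix t assume "t \<in> Arr E"
  then show "Dom E t \<in> Obj E" "Cod E t \<in> Obj E"
    by (auto simp: total_def fin_inj_hom)
qed (fact total_ide_hom total_cmp_hom total_cmp_ide_right total_cmp_ide_left total_cmp_assoc)+

text \<open>The underlying injection of \<open>e\<close> identifies the underlying maps. The
  structure components are then compared in one groupoid, where the constraint of \<open>R\<close>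
  and the image of \<open>k\<close> are cancelled in turn.\<close>

lemma total_mono:
  assumes e: "e \<in> Hom E y z" and t: "t \<in> Hom E x y" "t' \<in> Hom E x y"
    and eq: "Cmp E e t = Cmp E e t'"
  shows "t = t'"
proof -
  obtain A p X B q Y D r Z where x: "x = (A, p, X)" and y: "y = (B, q, Y)" and z: "z = (D, r, Z)"
    by (metis prod_cases3)
  obtain \<sigma> h where t1: "t = Arrow (A, p, X) (\<sigma>, h) (B, q, Y)" and \<sigma>: "Arrow A \<sigma> B \<in> Hom fin_inj A B"
      and A: "finite A" and h: "h \<in> Hom (Grp R A) X (FO (Pull R (Arrow A \<sigma> B)) Y)"
    using t(1) by (auto simp: x y elim: total_homE)
  obtain \<sigma>' h' where t2: "t' = Arrow (A, p, X) (\<sigma>', h') (B, q, Y)"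
    and \<sigma>': "Arrow A \<sigma>' B \<in> Hom fin_inj A B"
      and h': "h' \<in> Hom (Grp R A) X (FO (Pull R (Arrow A \<sigma>' B)) Y)"
    using t(2) by (auto simp: x y elim: total_homE)
  obtain \<tau> k where e1: "e = Arrow (B, q, Y) (\<tau>, k) (D, r, Z)" and \<tau>: "Arrow B \<tau> D \<in> Hom fin_inj B D"
      and Z: "Z \<in> Obj (Grp R D)" and k: "k \<in> Hom (Grp R B) Y (FO (Pull R (Arrow B \<tau> D)) Z)"
    using e by (auto simp: y z elim: total_homE)
  interpret A: groupoid "Grp R A" by (rule groupoid_at[OF A])
  have eqs: "compose A \<tau> \<sigma> = compose A \<tau> \<sigma>'"
    "Cmp (Grp R A) (Cpr R (Arrow A \<sigma> B) (Arrow B \<tau> D) Z)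
      (Cmp (Grp R A) (FA (Pull R (Arrow A \<sigma> B)) k) h) =
     Cmp (Grp R A) (Cpr R (Arrow A \<sigma>' B) (Arrow B \<tau> D) Z)
       (Cmp (Grp R A) (FA (Pull R (Arrow A \<sigma>' B)) k) h')"
    using eq by (simp_all add: t1 t2 e1 total_cmp)
  have "\<sigma> = \<sigma>'"
  proof (rule extensionalityI[of _ A])
    show "\<sigma> \<in> extensional A" "\<sigma>' \<in> extensional A" using \<sigma> \<sigma>' by (auto simp: fin_inj_hom PiE_def)
    fix a assume a: "a \<in> A"
    have "\<tau> (\<sigma> a) = \<tau> (\<sigma>' a)" using fun_cong[OF eqs(1), of a] a by (simp add: compose_def)
    then show "\<sigma> a = \<sigma>' a" using \<sigma> \<sigma>' \<tau> a by (auto simp: fin_inj_hom inj_on_def PiE_def Pi_def)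
  qed
  note h' = h'[folded this] and eq2 = eqs(2)[folded this]
  note fs = functor_arr(1-4)[OF pull[OF \<sigma>]] functor_arr(1)[OF pull[OF \<tau>]]
    cpr_arr[OF \<sigma> \<tau> Z, simplified] HomD[OF h]
    HomD[OF h'] HomD[OF k] Z
  have "Cmp (Grp R A) (FA (Pull R (Arrow A \<sigma> B)) k) h =
    Cmp (Grp R A) (FA (Pull R (Arrow A \<sigma> B)) k) h'"
    by (rule A.cancel_left[OF _ _ _ _ _ eq2]) (simp_all add: A.arr_simps fs)
  then have "h = h'"
    by (rule A.cancel_left[rotated -1]) (simp_all add: A.arr_simps fs)
  then show ?thesis using \<open>\<sigma> = \<sigma>'\<close> by (simp add: t1 t2)
qed

text \<open>The given \<open>f\<close> is injective because its composite with \<tau> is the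
  injection \<rho>. The structure component is forced to be \<open>l\<close> followed by the inverse
  of the constraint composed with the image of \<open>k\<close>, which exists in a groupoid.\<close>

lemma total_cartesian:
  assumes v: "v \<in> Hom E y z" and w: "w \<in> Hom E x z" and f: "f \<in> fst x \<rightarrow>\<^sub>E fst y"
    and vf: "\<And>a. a \<in> fst x \<Longrightarrow> base v (f a) = base w a"
  shows "\<exists>u \<in> Hom E x y. base u = f \<and> Cmp E v u = w"
proof -
  obtain A p X B q Y D r Z where x: "x = (A, p, X)" and y: "y = (B, q, Y)" and z: "z = (D, r, Z)"
    by (metis prod_cases3)
  obtain \<tau> k where v1: "v = Arrow (B, q, Y) (\<tau>, k) (D, r, Z)" and \<tau>: "Arrow B \<tau> D \<in> Hom fin_inj B D"
      and B: "finite B" and Y: "Y \<in> Obj (Grp R B)"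
      and Z: "Z \<in> Obj (Grp R D)" and k: "k \<in> Hom (Grp R B) Y (FO (Pull R (Arrow B \<tau> D)) Z)"
    using v by (auto simp: y z elim: total_homE)
  obtain \<rho> l where w1: "w = Arrow (A, p, X) (\<rho>, l) (D, r, Z)" and \<rho>: "Arrow A \<rho> D \<in> Hom fin_inj A D"
      and A: "finite A" and X: "X \<in> Obj (Grp R A)"
        and l: "l \<in> Hom (Grp R A) X (FO (Pull R (Arrow A \<rho> D)) Z)"
    using w by (auto simp: x z elim: total_homE)
  interpret A: groupoid "Grp R A" by (rule groupoid_at[OF A])
  have fAB: "f \<in> A \<rightarrow>\<^sub>E B" using f by (simp add: x y)
  have \<tau>f: "\<tau> (f a) = \<rho> a" if "a \<in> A" for a using vf[of a] that by (simp add: v1 w1 x)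
  have comp: "compose A \<tau> f = \<rho>"
    by (rule extensionalityI[of _ A]) (use \<rho> \<tau>f in \<open>auto simp: fin_inj_hom PiE_def compose_def\<close>)
  have "inj_on f A"
  proof (rule inj_onI)
    fix a b assume "a \<in> A" "b \<in> A" "f a = f b"
    then have "\<rho> a = \<rho> b" using \<tau>f by metis
    then show "a = b" using \<rho> \<open>a \<in> A\<close> \<open>b \<in> A\<close> by (auto simp: fin_inj_hom inj_on_def)
  qed
  then have f1: "Arrow A f B \<in> Hom fin_inj A B" using A B fAB by (simp add: fin_inj_hom)
  note fs = functor_arr(1-4)[OF pull[OF f1]] functor_arr(1)[OF pull[OF \<tau>]]
    cpr_arr[OF f1 \<tau> Z, simplified comp fin_inj_cmp]
    HomD[OF k] HomD[OF l] Z Y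
  let ?e = "Cmp (Grp R A) (Cpr R (Arrow A f B) (Arrow B \<tau> D) Z) (FA (Pull R (Arrow A f B)) k)"
  define h where "h = Cmp (Grp R A) (inv_arr (Grp R A) ?e) l"
  have h: "h \<in> Hom (Grp R A) X (FO (Pull R (Arrow A f B)) Y)"
    unfolding h_def by (intro HomI) (simp_all add: A.grp_simps fs)
  have "Cmp (Grp R A) ?e h = l"
    unfolding h_def by (rule A.inv_arr_cancel(2)) (simp_all add: A.arr_simps fs)
  then have "Cmp (Grp R A) (Cpr R (Arrow A f B) (Arrow B \<tau> D) Z)
      (Cmp (Grp R A) (FA (Pull R (Arrow A f B)) k) h) = l"
    by (simp add: A.arr_simps fs HomD[OF h])
  then show ?thesis
    using f1 X Y h by (intro bexI[of _ "Arrow (A, p, X) (f, h) (B, q, Y)"])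
      (simp_all add: v1 w1 x y total_cmp comp total_hom)
qed

text \<open>Arrows of \<open>E\<close> do not see layerings. Generic maps act on arrows by such a
  relabelling.\<close>

lemma relabel_hom:
  assumes "t \<in> Hom E (A, p, X) (B, q, Y)"
  shows "Arrow (A, p', X) (via t) (B, q', Y) \<in> Hom E (A, p', X) (B, q', Y)"
  using assms by (auto simp: total_hom)

text \<open>The arrow with the unit as structure component is an identity with relabelled source, so
  the identity law of \<open>E\<close> applies to its \<open>via\<close> part. Inclusions belonging
  to generic maps have this form.\<close>

lemma cmp_unit_right:
  assumes t: "t \<in> Hom E (A, p, X) (B, q, Y)"
  shows "Cmp E t (Arrow (A, p', X) (\<lambda>x \<in> A. x, Unt R A X) (A, p, X)) =
    Arrow (A, p', X) (via t) (B, q, Y)"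
proof -
  obtain \<sigma> h where t1: "t = Arrow (A, p, X) (\<sigma>, h) (B, q, Y)"
    using t by (auto simp: total_hom)
  show ?thesis
    using total_cmp_ide_right[OF t] by (simp add: t1 total_ide total_cmp)
qed

lemma cmp_unit_left:
  assumes t: "t \<in> Hom E (A, p, X) (B, q, Y)"
  shows "Cmp E (Arrow (B, q, Y) (\<lambda>x \<in> B. x, Unt R B Y) (B, q', Y)) t =
    Arrow (A, p, X) (via t) (B, q', Y)"
proof -
  obtain \<sigma> h where t1: "t = Arrow (A, p, X) (\<sigma>, h) (B, q, Y)"
    using t by (auto simp: total_hom)
  show ?thesis
    using total_cmp_ide_left[OF t] by (simp add: t1 total_ide total_cmp)
qed

subsection \<open>Layered structures\<close>

lemma layers_obj: "(A, p, X) \<in> Obj (layers R n) \<longleftrightarrow> finite A \<and> p \<in> A \<rightarrow>\<^sub>E {1..n} \<and> X \<in> Obj (Grp R A)"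
  by (simp add: layers_def)

lemma layers_total_obj: "x \<in> Obj (layers R n) \<Longrightarrow> x \<in> Obj E"
  by (cases x) (simp add: layers_obj total_obj)

lemma layers_ops: "Cmp (layers R n) = Cmp E" "Ide (layers R n) = Ide E"
  "Dom (layers R n) = src" "Cod (layers R n) = tgt"
  by (simp_all add: layers_def total_def)

lemma layers_hom: "t \<in> Hom (layers R n) (A, p, X) (B, q, Y) \<longleftrightarrow>
    (A, p, X) \<in> Obj (layers R n) \<and> (B, q, Y) \<in> Obj (layers R n) \<and>
    t \<in> Hom E (A, p, X) (B, q, Y) \<and> bij_betw (base t) A B \<and> (\<forall>a \<in> A. q (base t a) = p a)"
  (is "?L \<longleftrightarrow> ?R")
proof -
  have "?L \<longleftrightarrow> (\<exists>\<sigma> h. t = Arrow (A, p, X) (\<sigma>, h) (B, q, Y) \<and>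
      (A, p, X) \<in> Obj (layers R n) \<and> (B, q, Y) \<in> Obj (layers R n) \<and>
      \<sigma> \<in> extensional A \<and> bij_betw \<sigma> A B \<and> (\<forall>x \<in> A. q (\<sigma> x) = p x) \<and>
      h \<in> Hom (Grp R A) X (FO (Pull R (Arrow A \<sigma> B)) Y))"
    by (auto simp: layers_def Hom_def)
  also have "\<dots> \<longleftrightarrow> ?R"
    by (auto simp: total_hom layers_obj fin_inj_hom bij_betw_def PiE_def)
  finally show ?thesis .
qed

lemma layers_arr_hom: "t \<in> Arr (layers R n) \<Longrightarrow> t \<in> Hom (layers R n) (src t) (tgt t)"
  by (drule Arr_in_Hom) (simp add: layers_ops)

lemma layers_homD:
  assumes "t \<in> Hom (layers R n) x y"
  shows "x \<in> Obj (layers R n)" "y \<in> Obj (layers R n)" "t \<in> Hom E x y"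
    "bij_betw (base t) (fst x) (fst y)" "a \<in> fst x \<Longrightarrow> fst (snd y) (base t a) = fst (snd x) a"
  using assms by (cases x; cases y; simp add: layers_hom)+

lemma layers_homI:
  assumes "x \<in> Obj (layers R n)" "y \<in> Obj (layers R n)" "t \<in> Hom E x y"
    "bij_betw (base t) (fst x) (fst y)" "\<And>a. a \<in> fst x \<Longrightarrow> fst (snd y) (base t a) = fst (snd x) a"
  shows "t \<in> Hom (layers R n) x y"
  using assms by (cases x; cases y; simp add: layers_hom)

text \<open>The inverse of an arrow \<open>t\<close> is obtained by factoring the identity of its
  target through the cartesian arrow \<open>t\<close>, over the inverse bijection. This is a right
  inverse, and monicity makes it two-sided.\<close>

lemma groupoid_layers: "groupoid (layers R n)"
proof
  let ?L = "layers R n"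
  fix t assume t: "t \<in> Arr ?L"
  note th = layers_arr_hom[OF t]
  note ts = layers_homD[OF th]
  show "Dom ?L t \<in> Obj ?L" "Cod ?L t \<in> Obj ?L" using ts by (simp_all add: layers_ops)
  define \<sigma> where "\<sigma> = base t"
  define A B where "A = fst (src t)" and "B = fst (tgt t)"
  have bij: "bij_betw \<sigma> A B" using ts(4) by (simp add: A_def B_def \<sigma>_def)
  define f where "f = (\<lambda>b \<in> B. the_inv_into A \<sigma> b)"
  have f: "f \<in> fst (tgt t) \<rightarrow>\<^sub>E fst (src t)"
    using bij_betw_the_inv_into[OF bij] by (auto simp: f_def bij_betw_def simp flip: A_def B_def)
  have \<sigma>f: "\<sigma> (f b) = b" if "b \<in> B" for b
    using that f_the_inv_into_f_bij_betw[OF bij] by (simp add: f_def)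
  note ide = total_ide_hom[OF layers_total_obj[OF ts(2)]]
    total_ide_hom[OF layers_total_obj[OF ts(1)]]
  have "base (Ide E (tgt t)) b = b" if "b \<in> B" for b
    using that by (cases "tgt t") (simp add: total_ide B_def)
  then obtain s where s: "s \<in> Hom E (tgt t) (src t)" "base s = f" "Cmp E t s = Ide E (tgt t)"
    using total_cartesian[OF ts(3) ide(1) f] \<sigma>f by (metis B_def \<sigma>_def)
  have sl: "s \<in> Hom ?L (tgt t) (src t)"
  proof (rule layers_homI[OF ts(2,1) s(1)])
    show "bij_betw (base s) (fst (tgt t)) (fst (src t))"
      unfolding s(2) using bij_betw_the_inv_into[OF bij]
      by (subst bij_betw_cong[of _ _ "the_inv_into A \<sigma>"]) (simp_all add: f_def A_def B_def)
    fix b assume b: "b \<in> fst (tgt t)"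
    then have "f b \<in> fst (src t)" using f by (auto simp: PiE_def Pi_def)
    then show "fst (snd (src t)) (base s b) = fst (snd (tgt t)) b"
      using ts(5)[of "f b"] \<sigma>f[of b] b by (simp add: s(2) B_def \<sigma>_def)
  qed
  \<comment> \<open>Both sides equal \<open>t\<close>; cancelling the mono \<open>t\<close> gives
    the remaining inverse law.\<close>
  have "Cmp E t (Cmp E s t) = Cmp E t (Ide E (src t))"
    using total_cmp_assoc[OF ts(3) s(1) ts(3)] total_cmp_ide_left[OF ts(3)]
        total_cmp_ide_right[OF ts(3)]
    by (simp add: s(3))
  then have "Cmp E s t = Ide E (src t)"
    by (rule total_mono[OF ts(3) total_cmp_hom[OF ts(3) s(1)] ide(2)])
  then show "iso ?L t"
    unfolding iso_def inverse_arrows_def using t s sl by (auto simp: layers_ops)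
next
  let ?L = "layers R n"
  show "Ide ?L x \<in> Hom ?L x x" if x: "x \<in> Obj ?L" for x
  proof -
    obtain A p X where A: "x = (A, p, X)" by (metis prod_cases3)
    have "bij_betw (\<lambda>x \<in> A. x) A A" by (rule bij_betwI[of _ _ _ "\<lambda>x. x"]) auto
    then show ?thesis
      using total_ide_hom[OF layers_total_obj[OF x]] x unfolding A layers_hom layers_ops
      by (simp add: total_ide)
  qed
  show "Cmp ?L u t \<in> Hom ?L x z" if t: "t \<in> Hom ?L x y" and u: "u \<in> Hom ?L y z" for t u x y z
  proof (unfold layers_ops, rule layers_homI)
    note ts = layers_homD[OF t] and us = layers_homD[OF u]
    show "x \<in> Obj ?L" "z \<in> Obj ?L" "Cmp E u t \<in> Hom E x z"
      using ts us total_cmp_hom by blast+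
    have base: "base (Cmp E u t) a = base u (base t a)" if "a \<in> fst x" for a
      using that by (simp add: base_cmp[OF ts(3) us(3)] compose_def)
    show "bij_betw (base (Cmp E u t)) (fst x) (fst z)"
      using bij_betw_trans[OF ts(4) us(4)] base
      by (subst bij_betw_cong[of _ _ "base u \<circ> base t"]) simp_all
    show "fst (snd z) (base (Cmp E u t) a) = fst (snd x) a" if a: "a \<in> fst x" for a
      using ts(5)[OF a] us(5)[of "base t a"] bij_betwE[OF ts(4)] a by (simp add: base)
  qed
  show "Cmp ?L t (Ide ?L x) = t" "Cmp ?L (Ide ?L y) t = t" if "t \<in> Hom ?L x y" for t x y
    using total_cmp_ide_left total_cmp_ide_right layers_homD(3)[OF that]
    by (simp_all add: layers_ops)
  show "Cmp ?L v (Cmp ?L u t) = Cmp ?L (Cmp ?L v u) t"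
    if "t \<in> Hom ?L w x" "u \<in> Hom ?L x y" "v \<in> Hom ?L y z" for t u v w x y z
    using total_cmp_assoc that[THEN layers_homD(3)] by (simp add: layers_ops)
qed

end

subsection \<open>Pullback of layerings\<close>

text \<open>The layers that survive \<open>a\<close> are those strictly above \<open>a 0\<close> and
  at most the last value of \<open>a\<close>. The formula needs no generic-free factorization: it
  gives all of \<open>A\<close> for a generic map and \<open>free_set\<close> for the free
  part.\<close>

definition layer_set :: "delta_arr \<Rightarrow> 'u set \<Rightarrow> ('u \<Rightarrow> nat) \<Rightarrow> 'u set" where
  "layer_set a A p = {x \<in> A. via a 0 < p x \<and> p x \<le> via a (src a)}"

definition layer_map :: "delta_arr \<Rightarrow> 'u set \<Rightarrow> ('u \<Rightarrow> nat) \<Rightarrow> 'u \<Rightarrow> nat" where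
  "layer_map a A p = (\<lambda>x \<in> layer_set a A p. under_generic a (p x))"

lemma layer_set_subset: "layer_set a A p \<subseteq> A"
  by (auto simp: layer_set_def)

lemma layer_set_generic: "generic a \<Longrightarrow> p \<in> A \<rightarrow>\<^sub>E {1..tgt a} \<Longrightarrow> layer_set a A p = A"
proof -
  assume gen: "generic a" and p: "p \<in> A \<rightarrow>\<^sub>E {1..tgt a}"
  have "p x \<in> {1..tgt a}" if "x \<in> A" for x by (rule PiE_mem[OF p that])
  then show ?thesis using gen by (force simp: layer_set_def generic_def)
qed

lemma layer_map_funcset: "a \<in> Hom Delta m n \<Longrightarrow> layer_map a A p \<in> layer_set a A p \<rightarrow>\<^sub>E {1..m}"
proof -
  assume a: "a \<in> Hom Delta m n"
  have "under_generic a (p x) \<in> {1..m}" if "x \<in> layer_set a A p" for x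
    using that by (intro under_generic(1)[OF a]) (simp_all add: layer_set_def Delta_homD(1)[OF a])
  then show ?thesis unfolding layer_map_def by (simp only: restrict_PiE_iff) blast
qed

text \<open>The pointwise content is \<open>under_generic_range\<close>; monotonicity of
  \<open>b\<close> makes the condition for surviving \<open>b\<close> a consequence of the one for
  \<open>b a\<close>. The equality of sets is strict, so the composition constraints can lie over
  identity maps.\<close>

lemma layer_set_cmp:
  assumes a: "a \<in> Hom Delta l m" and b: "b \<in> Hom Delta m n"
  shows "layer_set a (layer_set b A p) (layer_map b A p) = layer_set (Cmp Delta b a) A p"
proof (rule set_eqI)
  fix x
  note as = Delta_homD[OF a] and bs = Delta_homD[OF b]
  have "via b 0 < p x \<and> p x \<le> via b m" if "via b (via a 0) < p x" "p x \<le> via b (via a l)"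
    using that bs(5)[of 0 "via a 0"] bs(5)[of "via a l" m] as(4)[of 0] as(4)[of l] by auto
  note range = this
  have mem: "x \<in> layer_set b A p \<longleftrightarrow> x \<in> A \<and> via b 0 < p x \<and> p x \<le> via b m"
    by (simp add: layer_set_def bs(1))
  have "x \<in> layer_set a (layer_set b A p) (layer_map b A p) \<longleftrightarrow>
      x \<in> layer_set b A p \<and> via a 0 < under_generic b (p x) \<and> under_generic b (p x) \<le> via a l"
    by (simp add: layer_set_def[of a] layer_map_def as(1) cong: conj_cong)
  also have "\<dots> \<longleftrightarrow> x \<in> A \<and> via b (via a 0) < p x \<and> p x \<le> via b (via a l)"
    unfolding mem using under_generic_range[OF a b] range by blast
  also have "\<dots> \<longleftrightarrow> x \<in> layer_set (Cmp Delta b a) A p"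
    by (simp add: layer_set_def as(1))
  finally show "x \<in> layer_set a (layer_set b A p) (layer_map b A p) \<longleftrightarrow>
    x \<in> layer_set (Cmp Delta b a) A p" .
qed

text \<open>With the preceding equality, layered sets form a strict presheaf on the simplex
  category. All failure of strictness comes from the structures.\<close>

lemma layer_map_cmp:
  assumes a: "a \<in> Hom Delta l m" and b: "b \<in> Hom Delta m n"
  shows "layer_map a (layer_set b A p) (layer_map b A p) = layer_map (Cmp Delta b a) A p"
proof -
  have "layer_map a (layer_set b A p) (layer_map b A p) x = layer_map (Cmp Delta b a) A p x" for x
  proof (cases "x \<in> layer_set (Cmp Delta b a) A p")
    case True
    then have "under_generic (Cmp Delta b a) (p x) = under_generic a (under_generic b (p x))"
      using under_generic_cmp[OF a b, of "p x"] by (simp add: layer_set_def Delta_homD(1)[OF a])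
    moreover have "x \<in> layer_set b A p"
      by (rule subsetD[OF layer_set_subset]) (rule True[folded layer_set_cmp[OF a b]])
    then have "layer_map b A p x = under_generic b (p x)" by (simp add: layer_map_def)
    moreover have "layer_map a (layer_set b A p) (layer_map b A p) x =
      under_generic a (layer_map b A p x)"
      unfolding layer_map_def[of a] layer_set_cmp[OF a b] by (rule restrict_apply'[OF True])
    moreover have "layer_map (Cmp Delta b a) A p x = under_generic (Cmp Delta b a) (p x)"
      unfolding layer_map_def by (rule restrict_apply'[OF True])
    ultimately show ?thesis by (simp only:)
  next
    case False
    then show ?thesis
      unfolding layer_map_def[of a] layer_map_def[of "Cmp Delta b a"] layer_set_cmp[OF a b]
      by (simp only: restrict_apply if_False)
  qed
  then show ?thesis by (rule ext)
qed

section \<open>Agreement with the generic-free factorization\<close>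

lemma free_part_simps: "src (free_part a) = via a (src a) - via a 0" "tgt (free_part a) = tgt a"
  "via (free_part a) 0 = via a 0"
  by (simp_all add: free_part_def Let_def)

lemma free_set_free_part: "free_set (free_part a) A p = layer_set a A p"
proof -
  have "(\<exists>i \<in> {1..via a (src a) - via a 0}. p x = i + via a 0) \<longleftrightarrow> via a 0 < p x \<and>
    p x \<le> via a (src a)" for x
    by (auto intro!: bexI[of _ "p x - via a 0"])
  then show ?thesis by (simp add: free_set_def layer_set_def free_part_simps)
qed

text \<open>Subtracting \<open>a 0\<close> from \<open>j\<close> and from the values of
  \<open>a\<close> leaves the index unchanged. The truncated subtraction is harmless because
  \<open>j\<close> exceeds \<open>a 0\<close> and all values of \<open>a\<close> are at least
  \<open>a 0\<close>.\<close>

lemma under_generic_part: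
  assumes a: "a \<in> Hom Delta m n" and j: "via a 0 < j"
  shows "under_generic (generic_part a) (j - via a 0) = under_generic a j"
proof -
  have "i \<in> {1..m} \<and> via (generic_part a) (i - 1) < j - via a 0 \<and>
    j - via a 0 \<le> via (generic_part a) i \<longleftrightarrow>
      i \<in> {1..m} \<and> via a (i - 1) < j \<and> j \<le> via a i" for i
  proof (cases "i \<in> {1..m}")
    case True
    then have "i - 1 \<le> m" "i \<le> m" by auto
    then have "via a 0 \<le> via a i" "via a 0 \<le> via a (i - 1)" by (auto intro: Delta_homD(5)[OF a])
    then show ?thesis using True j by (auto simp: generic_part_def Delta_homD(1)[OF a])
  qed auto
  then show ?thesis
    by (simp add: under_generic_def generic_part_def[of a] Delta_homD(1)[OF a] cong: conj_cong)
qed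

lemma incl_hom: "finite A \<Longrightarrow> B \<subseteq> A \<Longrightarrow> incl B A \<in> Hom fin_inj B A"
  unfolding incl_def by (rule fin_inj_homI) (auto simp: inj_on_def dest: finite_subset)

definition layer_str :: "('u, 'o, 'm) species \<Rightarrow> delta_arr \<Rightarrow> 'u set \<Rightarrow> ('u \<Rightarrow> nat) \<Rightarrow> 'o \<Rightarrow> 'o" where
  "layer_str R a A p X = (if generic a then X else FO (Pull R (incl (layer_set a A p) A)) X)"

text \<open>The arrow from the restriction of \<open>w\<close> along \<open>a\<close> to
  \<open>w\<close> in the total category. For generic \<open>a\<close> its structure component is
  the unit of \<open>R\<close>, otherwise an identity, so later arguments need not distinguish the
  two ways in which \<open>layers_pull\<close> acts.\<close>

definition inclusion :: "('u, 'o, 'm) species \<Rightarrow> delta_arr \<Rightarrow> ('u, 'o) lobj \<Rightarrow> ('u, 'o, 'm) larr" where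
  "inclusion R a w = Arrow (FO (layers_pull R a) w)
     (\<lambda>x \<in> fst (FO (layers_pull R a) w). x, to_restriction R a w) w"

context species
begin

text \<open>The arrow constructed in \<open>free_act\<close> is the one that makes the square with
  the two inclusions commute: \<open>h'\<close> solves the equation of structure components. The
  layerings \<open>p'\<close> and \<open>q'\<close> are left arbitrary so that the statement applies
  both before and after the generic part has acted.\<close>

lemma restrict_arr:
  assumes t: "Arrow (A, p, X) (\<sigma>, h) (B, q, Y) \<in> Hom E (A, p, X) (B, q, Y)"
    and A': "A' \<subseteq> A" and B': "B' \<subseteq> B" and \<sigma>': "\<And>a. a \<in> A' \<Longrightarrow> \<sigma> a \<in> B'"
  defines "h' \<equiv> Cmp (Grp R A') (inv_arr (Grp R A')
    (Cpr R (Arrow A' (restrict \<sigma> A') B') (incl B' B) Y))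
      (Cmp (Grp R A') (Cpr R (incl A' A) (Arrow A \<sigma> B) Y) (FA (Pull R (incl A' A)) h))"
  defines "X' \<equiv> FO (Pull R (incl A' A)) X" and "Y' \<equiv> FO (Pull R (incl B' B)) Y"
  shows "Arrow (A', p', X') (restrict \<sigma> A', h') (B', q', Y') \<in> Hom E (A', p', X') (B', q', Y')"
    and "Cmp E (Arrow (B', q', Y') (\<lambda>x \<in> B'. x, Ide (Grp R B') Y') (B, q, Y))
        (Arrow (A', p', X') (restrict \<sigma> A', h') (B', q', Y')) =
      Cmp E (Arrow (A, p, X) (\<sigma>, h) (B, q, Y))
        (Arrow (A', p', X') (\<lambda>x \<in> A'. x, Ide (Grp R A') X') (A, p, X))"
proof -
  let ?r = "restrict \<sigma> A'"
  have s: "Arrow A \<sigma> B \<in> Hom fin_inj A B" and X: "X \<in> Obj (Grp R A)" and Y: "Y \<in> Obj (Grp R B)"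
    and h: "h \<in> Hom (Grp R A) X (FO (Pull R (Arrow A \<sigma> B)) Y)" and fin: "finite A" "finite B"
    using t by (auto simp: total_hom fin_inj_hom)
  note iA = incl_hom[OF fin(1) A'] and iB = incl_hom[OF fin(2) B']
  have finA': "finite A'" and finB': "finite B'" using A' B' fin finite_subset by auto
  have r: "Arrow A' ?r B' \<in> Hom fin_inj A' B'"
  proof (rule fin_inj_homI[OF finA' finB'])
    show "?r \<in> A' \<rightarrow>\<^sub>E B'" using \<sigma>' by (simp add: restrict_PiE_iff)
    have "inj_on \<sigma> A" using s by (simp add: fin_inj_hom)
    then show "inj_on ?r A'" using A' by (simp add: inj_on_restrict_eq inj_on_subset)
  qed
  \<comment> \<open>Both paths are the injection of \<open>A'\<close> into \<open>B\<close> by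
    \<sigma>. Hence the two constraints in \<open>h'\<close> have the same target, and one can be
    composed with the inverse of the other.\<close>
  have comm: "Cmp fin_inj (incl B' B) (Arrow A' ?r B') = Cmp fin_inj (Arrow A \<sigma> B) (incl A' A)"
  proof -
    have "compose A' (\<lambda>x \<in> B'. x) ?r = compose A' \<sigma> (\<lambda>x \<in> A'. x)"
      using \<sigma>' by (simp add: compose_def fun_eq_iff)
    then show ?thesis by (simp add: incl_def)
  qed
  interpret A': groupoid "Grp R A'" by (rule groupoid_at[OF finA'])
  note fA = functor_arr[OF pull[OF iA]] and fB = functor_arr[OF pull[OF iB]]
    and fs = functor_arr[OF pull[OF s]]
    and fr = functor_arr[OF pull[OF r]]
  note c1 = cpr_arr[OF r iB Y] and c2 = cpr_arr[OF iA s Y]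
  note hs = HomD[OF h]
  have h': "h' \<in> Hom (Grp R A') X' (FO (Pull R (Arrow A' ?r B')) Y')"
    unfolding h'_def X'_def Y'_def
    by (intro HomI) (simp_all add: A'.grp_simps c1 c2 fA hs comm)
  have X': "X' \<in> Obj (Grp R A')" and Y': "Y' \<in> Obj (Grp R B')"
    using X Y by (simp_all add: X'_def Y'_def fA fB)
  show "Arrow (A', p', X') (?r, h') (B', q', Y') \<in> Hom E (A', p', X') (B', q', Y')"
    using r X' Y' h' by (simp add: total_hom)
  have "Cmp (Grp R A') (Cpr R (Arrow A' ?r B') (incl B' B) Y)
      (Cmp (Grp R A') (FA (Pull R (Arrow A' ?r B')) (Ide (Grp R B') Y')) h') =
    Cmp (Grp R A') (Cpr R (Arrow A' ?r B') (incl B' B) Y) h'"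
    using HomD[OF h'] Y' by (simp add: fr A'.arr_simps)
  also have "\<dots> = Cmp (Grp R A') (Cpr R (incl A' A) (Arrow A \<sigma> B) Y) (FA (Pull R (incl A' A)) h)"
    unfolding h'_def by (rule A'.inv_arr_cancel(2)) (simp_all add: A'.arr_simps c1 c2 fA hs comm)
  also have "\<dots> = Cmp (Grp R A') (Cpr R (incl A' A) (Arrow A \<sigma> B) Y)
      (Cmp (Grp R A') (FA (Pull R (incl A' A)) h) (Ide (Grp R A') X'))"
    using X' by (simp add: A'.arr_simps fA hs X'_def)
  finally show "Cmp E (Arrow (B', q', Y') (\<lambda>x \<in> B'. x, Ide (Grp R B') Y') (B, q, Y))
        (Arrow (A', p', X') (?r, h') (B', q', Y')) =
      Cmp E (Arrow (A, p, X) (\<sigma>, h) (B, q, Y))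
        (Arrow (A', p', X') (\<lambda>x \<in> A'. x, Ide (Grp R A') X') (A, p, X))"
    using comm by (simp add: total_cmp incl_def)
qed

lemma layer_set_generic_obj:
  assumes "generic a" "a \<in> Hom Delta m n" "(A, p, X) \<in> Obj (layers R n)"
  shows "layer_set a A p = A"
proof (rule layer_set_generic[OF assms(1)])
  show "p \<in> A \<rightarrow>\<^sub>E {1..tgt a}"
    using assms(3) unfolding layers_obj Delta_homD(2)[OF assms(2)] by (elim conjE)
qed

lemma layer_str_obj:
  assumes "finite A" "X \<in> Obj (Grp R A)" "generic a \<Longrightarrow> layer_set a A p = A"
  shows "layer_str R a A p X \<in> Obj (Grp R (layer_set a A p))"
  using functor_arr(1)[OF pull[OF incl_hom[OF assms(1) layer_set_subset]] assms(2)] assms(2,3)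
  by (simp add: layer_str_def)

lemma free_act_obj:
  assumes a: "a \<in> Hom Delta m n" and w: "(A, p, X) \<in> Obj (layers R n)"
  shows "FO (free_act R (free_part a)) (A, p, X) =
      (layer_set a A p, \<lambda>x \<in> layer_set a A p. p x - via a 0, FO (Pull R (incl (layer_set a A p) A))
        X)"
    and "FO (free_act R (free_part a)) (A, p, X) \<in> Obj (layers R (via a m - via a 0))"
proof -
  show *: "FO (free_act R (free_part a)) (A, p, X) =
      (layer_set a A p, \<lambda>x \<in> layer_set a A p. p x - via a 0, FO (Pull R (incl (layer_set a A p) A))
        X)"
    using w by (simp add: free_act_def Let_def free_part_simps Delta_homD(2)[OF a]
        free_set_free_part free_layering_def)
  have "finite A" "X \<in> Obj (Grp R A)" using w by (auto simp: layers_obj)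
  then have "FO (Pull R (incl (layer_set a A p) A)) X \<in> Obj (Grp R (layer_set a A p))"
    by (intro functor_arr(1)[OF pull[OF incl_hom[OF _ layer_set_subset]]])
  then show "FO (free_act R (free_part a)) (A, p, X) \<in> Obj (layers R (via a m - via a 0))"
    unfolding * layers_obj restrict_PiE_iff using \<open>finite A\<close>
    by (auto simp: layer_set_def Delta_homD(1)[OF a])
qed

lemma generic_part_simps: "src (generic_part a) = src a" "tgt (generic_part a) =
  via a (src a) - via a 0"
  by (simp_all add: generic_part_def)

text \<open>A description of set and layering that is uniform in \<open>a\<close>; the case
  distinction survives only in the structure component \<open>layer_str\<close>.\<close>

lemma layers_pull_obj:
  assumes a: "a \<in> Hom Delta m n" and w: "(A, p, X) \<in> Obj (layers R n)"
  shows "FO (layers_pull R a) (A, p, X) = (layer_set a A p, layer_map a A p, layer_str R a A p X)"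
proof (cases "generic a")
  case True
  have "compose A (under_generic a) p = layer_map a A p"
    by (simp add: layer_map_def compose_def layer_set_generic_obj[OF True a w])
  then show ?thesis
    using True w
    by (simp add: layers_pull_def generic_act_def Let_def Delta_homD(2)[OF a] layer_str_def
        layer_set_generic_obj[OF True a w])
next
  case False
  have "compose (layer_set a A p) (under_generic (generic_part a))
    (\<lambda>x \<in> layer_set a A p. p x - via a 0) =
      layer_map a A p"
    by (auto simp: layer_map_def compose_def fun_eq_iff layer_set_def intro!:
        under_generic_part[OF a])
  then show ?thesis
    using False w free_act_obj[OF a w]
    by (simp add: layers_pull_def Delta_homD(2)[OF a] generic_act_def Let_def generic_part_simps
        Delta_homD(1)[OF a] layer_str_def)
qed

lemma layers_pull_in_layers:
  assumes a: "a \<in> Hom Delta m n" and w: "w \<in> Obj (layers R n)"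
  shows "FO (layers_pull R a) w \<in> Obj (layers R m)"
proof -
  obtain A p X where w': "w = (A, p, X)" by (metis prod_cases3)
  note w = w[unfolded w']
  have fin: "finite A" and X: "X \<in> Obj (Grp R A)" using w by (simp_all add: layers_obj)
  show ?thesis
    unfolding w' layers_pull_obj[OF a w] layers_obj
    by (intro conjI layer_map_funcset[OF a] finite_subset[OF layer_set_subset fin]
        layer_str_obj[OF fin X] layer_set_generic_obj[OF _ a w])
qed

lemma to_restriction_hom:
  assumes a: "a \<in> Hom Delta m n" and w: "(A, p, X) \<in> Obj (layers R n)"
  shows "to_restriction R a (A, p, X) \<in> Hom (Grp R (layer_set a A p)) (layer_str R a A p X)
    (FO (Pull R (incl (layer_set a A p) A)) X)"
proof -
  have fin: "finite A" and X: "X \<in> Obj (Grp R A)" using w by (auto simp: layers_obj)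
  interpret A': groupoid "Grp R (layer_set a A p)"
    by (rule groupoid_at[OF finite_subset[OF layer_set_subset fin]])
  have X': "FO (Pull R (incl (layer_set a A p) A)) X \<in> Obj (Grp R (layer_set a A p))"
    by (rule functor_arr(1)[OF pull[OF incl_hom[OF fin layer_set_subset]] X])
  show ?thesis
    using unt_hom[OF fin X] A'.ide_hom[OF X'] layer_set_generic_obj[OF _ a w]
    by (simp add: to_restriction_def layer_str_def free_set_free_part incl_def Let_def)
qed

lemma inclusion_eq:
  assumes a: "a \<in> Hom Delta m n" and w: "(A, p, X) \<in> Obj (layers R n)"
  shows "inclusion R a (A, p, X) = Arrow (layer_set a A p, layer_map a A p, layer_str R a A p X)
    (\<lambda>x \<in> layer_set a A p. x, to_restriction R a (A, p, X)) (A, p, X)"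
  by (simp add: inclusion_def layers_pull_obj[OF a w])

lemma inclusion_hom:
  assumes a: "a \<in> Hom Delta m n" and w: "w \<in> Obj (layers R n)"
  shows "inclusion R a w \<in> Hom E (FO (layers_pull R a) w) w"
proof -
  obtain A p X where w': "w = (A, p, X)" by (metis prod_cases3)
  note w = w[unfolded w']
  have fin: "finite A" and X: "X \<in> Obj (Grp R A)" using w by (auto simp: layers_obj)
  have X': "layer_str R a A p X \<in> Obj (Grp R (layer_set a A p))"
    using layers_pull_in_layers[OF a w] by (simp add: layers_pull_obj[OF a w] layers_obj)
  show ?thesis
    using incl_hom[OF fin layer_set_subset, of a p] to_restriction_hom[OF a w] X X'
    by (simp add: w' inclusion_eq[OF a w] layers_pull_obj[OF a w] total_hom incl_def)
qed

lemma base_inclusion: "x \<in> fst (FO (layers_pull R a) w) \<Longrightarrow> base (inclusion R a w) x = x"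
  by (simp add: inclusion_def)

text \<open>The commuting square with the inclusions characterises the action on arrows. For generic
  maps both composites are relabellings of \<open>t\<close>; for other maps the square is the one of
  \<open>restrict_arr\<close>.\<close>

lemma layers_pull_arr:
  assumes a: "a \<in> Hom Delta m n" and t: "t \<in> Hom (layers R n) w w'"
  shows "FA (layers_pull R a) t \<in> Hom E (FO (layers_pull R a) w) (FO (layers_pull R a) w')"
    and "Cmp E (inclusion R a w') (FA (layers_pull R a) t) = Cmp E t (inclusion R a w)"
proof -
  note ts = layers_homD[OF t]
  obtain A p X B q Y where w: "w = (A, p, X)" and w': "w' = (B, q, Y)" by (metis prod_cases3)
  have wl: "(A, p, X) \<in> Obj (layers R n)" "(B, q, Y) \<in> Obj (layers R n)" using ts(1,2)
    by (simp_all add: w w')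
  have tE: "t \<in> Hom E (A, p, X) (B, q, Y)" using ts(3) by (simp add: w w')
  have tarr: "t \<in> Arr (layers R n)" by (rule HomD[OF t])
  note po = layers_pull_obj[OF a wl(1)] layers_pull_obj[OF a wl(2)]
  note io = inclusion_eq[OF a wl(1)] inclusion_eq[OF a wl(2)]
  have "FA (layers_pull R a) t \<in> Hom E (FO (layers_pull R a) w) (FO (layers_pull R a) w') \<and>
      Cmp E (inclusion R a w') (FA (layers_pull R a) t) = Cmp E t (inclusion R a w)"
  proof (cases "generic a")
    case True
    have sets: "layer_set a A p = A" "layer_set a B q = B"
      using wl layer_set_generic_obj[OF True a] by auto
    have str: "layer_str R a A p X = X" "layer_str R a B q Y = Y" using True
      by (simp_all add: layer_str_def)
    have res: "to_restriction R a (A, p, X) = Unt R A X" "to_restriction R a (B, q, Y) = Unt R B Y"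
      using True by (simp_all add: to_restriction_def)
    have "FA (layers_pull R a) t = Arrow (FO (layers_pull R a) w) (via t) (FO (layers_pull R a) w')"
      using True tarr wl total_homD[OF ts(3)]
      by (simp add: layers_pull_def generic_act_def Let_def Delta_homD(2)[OF a] w w')
    moreover note relabel_hom[OF tE]
    moreover have "Cmp E (inclusion R a w') (Arrow (FO (layers_pull R a) w) (via t)
      (FO (layers_pull R a) w')) =
        Arrow (FO (layers_pull R a) w) (via t) w'"
      using cmp_unit_left[OF relabel_hom[OF tE]] by (simp add: w w' po io sets str res)
    moreover have "Cmp E t (inclusion R a w) = Arrow (FO (layers_pull R a) w) (via t) w'"
      using cmp_unit_right[OF tE] by (simp add: w w' po io sets str res)
    ultimately show ?thesis by (simp add: w w' po sets str)
  next
    case False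
    obtain \<sigma> h where t1: "t = Arrow (A, p, X) (\<sigma>, h) (B, q, Y)" using tE by (auto simp: total_hom)
    have str: "layer_str R a A p X = FO (Pull R (incl (layer_set a A p) A)) X"
      "layer_str R a B q Y = FO (Pull R (incl (layer_set a B q) B)) Y" using False
        by (simp_all add: layer_str_def)
    have \<sigma>: "\<And>x. x \<in> A \<Longrightarrow> q (\<sigma> x) = p x" "bij_betw \<sigma> A B" using ts(4,5) by (simp_all add: w w' t1)
    have \<sigma>': "\<sigma> x \<in> layer_set a B q" if "x \<in> layer_set a A p" for x
      using that \<sigma> by (auto simp: layer_set_def bij_betw_def)
    note ra = restrict_arr[where A' = "layer_set a A p" and B' = "layer_set a B q",
      OF tE[unfolded t1] layer_set_subset layer_set_subset \<sigma>']
    \<comment> \<open>The arrow after the free part has acted. Before the generic part, which only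
      relabels, can be applied, it has to be recognised as an arrow of the intermediate groupoid of
      layers.\<close>
    define tf where "tf = FA (free_act R (free_part a)) t"
    have tf: "tf = Arrow (FO (free_act R (free_part a)) w)
       (restrict \<sigma> (layer_set a A p),
        Cmp (Grp R (layer_set a A p))
          (inv_arr (Grp R (layer_set a A p))
            (Cpr R (Arrow (layer_set a A p) (restrict \<sigma> (layer_set a A p)) (layer_set a B q))
              (incl (layer_set a B q) B) Y))
          (Cmp (Grp R (layer_set a A p)) (Cpr R (incl (layer_set a A p) A) (Arrow A \<sigma> B) Y)
            (FA (Pull R (incl (layer_set a A p) A)) h))) (FO (free_act R (free_part a)) w')"
      using tarr wl unfolding tf_def
      by (simp add: free_act_def Let_def t1 free_part_simps Delta_homD(2)[OF a] free_set_free_part w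
          w')
    have tfE: "tf \<in> Hom E (FO (free_act R (free_part a)) w) (FO (free_act R (free_part a)) w')"
      unfolding tf unfolding w w' free_act_obj(1)[OF a wl(1)] free_act_obj(1)[OF a wl(2)]
      by (rule ra(1))
    have "tf \<in> Hom (layers R (via a m - via a 0)) (FO (free_act R (free_part a)) w)
      (FO (free_act R (free_part a)) w')"
    proof (rule layers_homI[OF _ _ tfE])
      show "FO (free_act R (free_part a)) w \<in> Obj (layers R (via a m - via a 0))"
        "FO (free_act R (free_part a)) w' \<in> Obj (layers R (via a m - via a 0))"
        unfolding w w' by (rule free_act_obj(2)[OF a wl(1)] free_act_obj(2)[OF a wl(2)])+
      show "fst (snd (FO (free_act R (free_part a)) w')) (base tf x) =
        fst (snd (FO (free_act R (free_part a)) w)) x"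
        if x: "x \<in> fst (FO (free_act R (free_part a)) w)" for x
        using x \<sigma>(1)[of x] \<sigma>'[of x] layer_set_subset[of a A p]
        unfolding tf unfolding w w' free_act_obj(1)[OF a wl(1)] free_act_obj(1)[OF a wl(2)] by auto
      have "bij_betw \<sigma> (layer_set a A p) (layer_set a B q)"
        using \<sigma> unfolding bij_betw_def by (auto simp: layer_set_def inj_on_def image_iff)
      then have "bij_betw (restrict \<sigma> (layer_set a A p)) (layer_set a A p) (layer_set a B q)"
        by (subst bij_betw_cong[of _ _ \<sigma>]) simp_all
      then show "bij_betw (base tf) (fst (FO (free_act R (free_part a)) w))
        (fst (FO (free_act R (free_part a)) w'))"
        unfolding tf unfolding w w' free_act_obj(1)[OF a wl(1)] free_act_obj(1)[OF a wl(2)] by simp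
    qed
    then have tfl: "tf \<in> Arr (layers R (via a m - via a 0))" by (rule HomD)
    have "FA (layers_pull R a) t = Arrow (FO (layers_pull R a) w) (via tf)
      (FO (layers_pull R a) w')"
      using False tarr tfl wl free_act_obj[OF a wl(1)] free_act_obj[OF a wl(2)] total_homD[OF tfE]
      by (simp add: layers_pull_def generic_act_def Let_def Delta_homD(1,2)[OF a] generic_part_simps
          w w' flip: tf_def)
    then show ?thesis
      using ra[where p' = "layer_map a A p" and q' = "layer_map a B q"] False
      by (simp add: w w' po io str t1 tf to_restriction_def free_set_free_part Let_def)
  qed
  then show "FA (layers_pull R a) t \<in> Hom E (FO (layers_pull R a) w) (FO (layers_pull R a) w')"
    "Cmp E (inclusion R a w') (FA (layers_pull R a) t) = Cmp E t (inclusion R a w)" by auto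
qed

lemma base_layers_pull:
  assumes a: "a \<in> Hom Delta m n" and t: "t \<in> Hom (layers R n) w w'"
    and x: "x \<in> fst (FO (layers_pull R a) w)"
  shows "base (FA (layers_pull R a) t) x = base t x"
proof -
  note ts = layers_homD[OF t]
  note at = layers_pull_arr[OF a t]
  note iw = inclusion_hom[OF a ts(1)] and iw' = inclusion_hom[OF a ts(2)]
  have "base (FA (layers_pull R a) t) x \<in> fst (FO (layers_pull R a) w')"
    using base_funcset(1)[OF at(1)] x by (auto simp: PiE_def Pi_def)
  then show ?thesis
    using arg_cong[OF at(2), of "\<lambda>t. base t x"] x
    by (simp add: base_cmp[OF at(1) iw'] base_cmp[OF iw ts(3)] compose_def base_inclusion)
qed

lemma layers_pull_hom:
  assumes a: "a \<in> Hom Delta m n" and t: "t \<in> Hom (layers R n) w w'"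
  shows "FA (layers_pull R a) t \<in> Hom (layers R m) (FO (layers_pull R a) w)
    (FO (layers_pull R a) w')"
proof (rule layers_homI[OF _ _ layers_pull_arr(1)[OF a t]])
  note ts = layers_homD[OF t]
  show "FO (layers_pull R a) w \<in> Obj (layers R m)" "FO (layers_pull R a) w' \<in> Obj (layers R m)"
    by (rule layers_pull_in_layers[OF a ts(1)] layers_pull_in_layers[OF a ts(2)])+
  obtain A p X B q Y where w: "w = (A, p, X)" and w': "w' = (B, q, Y)" by (metis prod_cases3)
  note po = layers_pull_obj[OF a ts(1)[unfolded w], folded w]
    layers_pull_obj[OF a ts(2)[unfolded w'], folded w']
  let ?\<sigma> = "base t"
  have \<sigma>: "\<And>x. x \<in> A \<Longrightarrow> q (?\<sigma> x) = p x" "bij_betw ?\<sigma> A B" using ts(4,5) by (simp_all add: w w')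
  have bij: "bij_betw ?\<sigma> (layer_set a A p) (layer_set a B q)"
    using \<sigma> unfolding bij_betw_def by (auto simp: layer_set_def inj_on_def image_iff)
  then show "bij_betw (base (FA (layers_pull R a) t)) (fst (FO (layers_pull R a) w))
    (fst (FO (layers_pull R a) w'))"
    using base_layers_pull[OF a t] by (subst bij_betw_cong[of _ _ ?\<sigma>]) (simp_all add: po)
  show "fst (snd (FO (layers_pull R a) w')) (base (FA (layers_pull R a) t) x) =
    fst (snd (FO (layers_pull R a) w)) x"
    if x: "x \<in> fst (FO (layers_pull R a) w)" for x
    using base_layers_pull[OF a t x] x \<sigma>(1)[of x] bij_betwE[OF bij] layer_set_subset[of a A p]
    by (auto simp: po layer_map_def)
qed

lemma layers_pull_ext:
  assumes "a \<in> Hom Delta m n"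
  shows "FO (layers_pull R a) \<in> extensional (Obj (layers R n))" "FA (layers_pull R a) \<in> extensional
    (Arr (layers R n))"
  using Delta_homD(2)[OF assms] by (simp_all add:
      layers_pull_def generic_act_def Let_def comp_ftr_ext)

lemma generic_ide: "generic (Ide Delta n)"
  using generic_iff[OF Delta_ide_hom] by simp

text \<open>The identity counts as generic and acts strictly; this justifies the trivial unit
  constraint of \<open>layered\<close>.\<close>

lemma layers_pull_ide:
  assumes w: "w \<in> Obj (layers R n)"
  shows "FO (layers_pull R (Ide Delta n)) w = w" "inclusion R (Ide Delta n) w = Ide E w"
proof -
  obtain A p X where w': "w = (A, p, X)" by (metis prod_cases3)
  have p: "p \<in> A \<rightarrow>\<^sub>E {1..n}" using w by (simp add: w' layers_obj)
  have set: "layer_set (Ide Delta n) A p = A"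
    using layer_set_generic_obj[OF generic_ide Delta_ide_hom w[unfolded w']] .
  have lm: "layer_map (Ide Delta n) A p = p"
  proof (rule extensionalityI[of _ A])
    show "layer_map (Ide Delta n) A p \<in> extensional A" using set by (simp add: layer_map_def)
    show "p \<in> extensional A" using p by (simp add: PiE_def)
    show "layer_map (Ide Delta n) A p x = p x" if x: "x \<in> A" for x
      using x under_generic_ide[OF PiE_mem[OF p x]] by (simp add: layer_map_def set)
  qed
  note po = layers_pull_obj[OF Delta_ide_hom w[unfolded w']]
  show "FO (layers_pull R (Ide Delta n)) w = w"
    by (simp add: w' po set lm layer_str_def generic_ide)
  show "inclusion R (Ide Delta n) w = Ide E w"
    using generic_ide by (simp add: w' inclusion_eq[OF Delta_ide_hom w[unfolded w']] set lm
        layer_str_def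
        to_restriction_def total_ide)
qed

lemma lift_arr_hom:
  assumes "finite A" and k: "k \<in> Hom (Grp R A) X Y"
  shows "lift_arr R A p X k Y \<in> Hom E (A, p, X) (A, p, Y)"
proof -
  interpret A: groupoid "Grp R A" by (rule groupoid_at[OF assms(1)])
  show ?thesis
    using A.Hom_obj[OF k] A.cmp_hom[OF k unt_hom[OF assms(1)]] ide_hom[of A] assms(1)
    by (simp add: lift_arr_def total_hom)
qed

lemma lift_arr_layers:
  assumes p: "p \<in> A \<rightarrow>\<^sub>E {1..n}" and fin: "finite A" and k: "k \<in> Hom (Grp R A) X Y"
  shows "lift_arr R A p X k Y \<in> Hom (layers R n) (A, p, X) (A, p, Y)"
proof -
  interpret A: groupoid "Grp R A" by (rule groupoid_at[OF fin])
  have "bij_betw (\<lambda>x \<in> A. x) A A" by (rule bij_betwI[of _ _ _ "\<lambda>x. x"]) auto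
  then show ?thesis
    using lift_arr_hom[OF fin k] A.Hom_obj[OF k] p fin
    by (simp add: layers_hom layers_obj) (simp add: lift_arr_def)
qed

text \<open>A lifted arrow is \<open>k\<close> followed by the unit, and the unit is absorbed as in
  the identity law of \<open>E\<close>. Composition with it is therefore composition of structure
  components in \<open>R[A]\<close>.\<close>

lemma cmp_lift_arr:
  assumes fin: "finite A" and k: "k \<in> Hom (Grp R A) X Y"
    and t: "Arrow (A, p, Y) (\<sigma>, h) (B, q, Z) \<in> Hom E (A, p, Y) (B, q, Z)"
  shows "Cmp E (Arrow (A, p, Y) (\<sigma>, h) (B, q, Z)) (lift_arr R A p X k Y) =
    Arrow (A, p, X) (\<sigma>, Cmp (Grp R A) h k) (B, q, Z)"
proof -
  interpret A: groupoid "Grp R A" by (rule groupoid_at[OF fin])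
  let ?i = "Arrow A (\<lambda>x \<in> A. x) A"
  have s: "Arrow A \<sigma> B \<in> Hom fin_inj A B" and Z: "Z \<in> Obj (Grp R B)"
    and h: "h \<in> Hom (Grp R A) Y (FO (Pull R (Arrow A \<sigma> B)) Z)"
    using t by (auto simp: total_hom)
  have i: "?i \<in> Hom fin_inj A A" using ide_hom[of A] fin by simp
  note Y = A.Hom_obj(2)[OF k]
  have eqs: "compose A \<sigma> (\<lambda>x \<in> A. x) = \<sigma>"
    "Cmp (Grp R A) (Cpr R ?i (Arrow A \<sigma> B) Z) (Cmp (Grp R A) (FA (Pull R ?i) h) (Unt R A Y)) = h"
    using total_cmp_ide_right[OF t] by (simp_all add: total_ide total_cmp)
  have "Cmp (Grp R A) (Cpr R ?i (Arrow A \<sigma> B) Z)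
    (Cmp (Grp R A) (FA (Pull R ?i) h) (Cmp (Grp R A) (Unt R A Y) k)) =
      Cmp (Grp R A) (Cmp (Grp R A) (Cpr R ?i (Arrow A \<sigma> B) Z)
        (Cmp (Grp R A) (FA (Pull R ?i) h) (Unt R A Y))) k"
    using HomD[OF h] HomD[OF k] HomD[OF unt_hom[OF fin Y]]
    by (simp add: A.arr_simps functor_arr[OF pull[OF i]] cpr_arr[OF i s Z])
  then show ?thesis by (simp add: lift_arr_def total_cmp eqs)
qed

text \<open>The structure component of the constraint ends with the inverse of
  \<open>to_restriction\<close> for \<open>b a\<close>. The inclusion for \<open>b a\<close> cancels
  this inverse, and what remains is the structure component of the composite of the inclusions for
  \<open>a\<close> and \<open>b\<close>.\<close>

lemma layers_cpr:
  assumes a: "a \<in> Hom Delta l m" and b: "b \<in> Hom Delta m n" and w: "w \<in> Obj (layers R n)"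
  shows "layers_cpr R a b w \<in> Hom (layers R l) (FO (layers_pull R a) (FO (layers_pull R b) w))
      (FO (layers_pull R (Cmp Delta b a)) w)"
    and "Cmp E (inclusion R (Cmp Delta b a) w) (layers_cpr R a b w) =
      Cmp E (inclusion R b w) (inclusion R a (FO (layers_pull R b) w))"
proof -
  obtain A p X where w': "w = (A, p, X)" by (metis prod_cases3)
  note w = w[unfolded w']
  note ba = Delta_cmp_hom[OF a b]
  define A' p' X' where "A' = layer_set b A p" and "p' = layer_map b A p"
    and "X' = layer_str R b A p X"
  have bw: "FO (layers_pull R b) (A, p, X) = (A', p', X')"
    unfolding A'_def p'_def X'_def by (rule layers_pull_obj[OF b w])
  have bwl: "(A', p', X') \<in> Obj (layers R m)" using layers_pull_in_layers[OF b w] by (simp add: bw)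
  define A2 p2 X2 where "A2 = layer_set a A' p'" and "p2 = layer_map a A' p'"
    and "X2 = layer_str R a A' p' X'"
  have abw: "FO (layers_pull R a) (A', p', X') = (A2, p2, X2)"
    unfolding A2_def p2_def X2_def by (rule layers_pull_obj[OF a bwl])
  define Y where "Y = layer_str R (Cmp Delta b a) A p X"
  have A2: "A2 = layer_set (Cmp Delta b a) A p" and p2: "p2 = layer_map (Cmp Delta b a) A p"
    by (simp_all add: A2_def p2_def A'_def p'_def layer_set_cmp[OF a b] layer_map_cmp[OF a b])
  have baw: "FO (layers_pull R (Cmp Delta b a)) (A, p, X) = (A2, p2, Y)"
    unfolding A2 p2 Y_def by (rule layers_pull_obj[OF ba w])
  have fin: "finite A" "finite A'" "finite A2"
    using w bwl layers_pull_in_layers[OF a bwl] by (simp_all add: abw layers_obj)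
  have sub: "A2 \<subseteq> A'" "A' \<subseteq> A" unfolding A2_def A'_def by (rule layer_set_subset)+
  note i1 = incl_hom[OF fin(2) sub(1)] and i2 = incl_hom[OF fin(1) sub(2)]
  interpret G: groupoid "Grp R A2" by (rule groupoid_at[OF fin(3)])
  have X: "X \<in> Obj (Grp R A)" using w by (simp add: layers_obj)
  define rba rb ra where "rba = to_restriction R (Cmp Delta b a) (A, p, X)"
    and "rb = to_restriction R b (A, p, X)" and "ra = to_restriction R a (A', p', X')"
  have rba: "rba \<in> Hom (Grp R A2) Y (FO (Pull R (incl A2 A)) X)"
    using to_restriction_hom[OF ba w] by (simp add: rba_def Y_def A2)
  have rb: "rb \<in> Hom (Grp R A') X' (FO (Pull R (incl A' A)) X)"
    using to_restriction_hom[OF b w] by (simp add: rb_def X'_def A'_def)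
  have ra: "ra \<in> Hom (Grp R A2) X2 (FO (Pull R (incl A2 A')) X')"
    using to_restriction_hom[OF a bwl] by (simp add: ra_def X2_def A2_def)
  \<comment> \<open>The nested inclusions compose strictly, so the constraint of \<open>R\<close>
    ends at the restriction of \<open>X\<close> to \<open>A2\<close>.\<close>
  have comp: "Cmp fin_inj (incl A' A) (incl A2 A') = incl A2 A"
    using sub by (auto simp: incl_def compose_def fun_eq_iff)
  have "Cpr R (incl A2 A') (incl A' A) X \<in> Hom (Grp R A2)
    (FO (Pull R (incl A2 A')) (FO (Pull R (incl A' A)) X))
      (FO (Pull R (incl A2 A)) X)"
    using cpr_arr[OF i1 i2 X] by (simp add: Hom_def comp)
  note c = G.cmp_hom[OF G.cmp_hom[OF ra functor_hom[OF pull[OF i1] rb]] this]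
  let ?c = "Cmp (Grp R A2) (Cpr R (incl A2 A') (incl A' A) X)
    (Cmp (Grp R A2) (FA (Pull R (incl A2 A')) rb) ra)"
  let ?k = "Cmp (Grp R A2) (inv_arr (Grp R A2) rba) ?c"
  have k: "?k \<in> Hom (Grp R A2) X2 Y" by (rule G.cmp_hom[OF c G.inv_hom[OF rba]])
  have cpr: "layers_cpr R a b w = lift_arr R A2 p2 X2 ?k Y"
    using w by (simp add: layers_cpr_def w' Delta_homD(2)[OF b] bw abw baw rba_def rb_def ra_def)
  have "p2 \<in> A2 \<rightarrow>\<^sub>E {1..l}" using layer_map_funcset[OF ba, of A p] by (simp add: A2 p2)
  then show "layers_cpr R a b w \<in> Hom (layers R l) (FO (layers_pull R a) (FO (layers_pull R b) w))
      (FO (layers_pull R (Cmp Delta b a)) w)"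
    unfolding w' cpr[unfolded w'] bw abw baw by (rule lift_arr_layers[OF _ fin(3) k])
  have iba: "inclusion R (Cmp Delta b a) (A, p, X) = Arrow (A2, p2, Y) (\<lambda>x \<in> A2. x, rba) (A, p, X)"
    by (simp add: inclusion_def baw rba_def)
  have "Cmp E (inclusion R (Cmp Delta b a) w) (layers_cpr R a b w) =
      Arrow (A2, p2, X2) (\<lambda>x \<in> A2. x, Cmp (Grp R A2) rba ?k) (A, p, X)"
    unfolding w' cpr[unfolded w'] iba
    by (rule cmp_lift_arr[OF fin(3) k]) (use inclusion_hom[OF ba w] in \<open>simp add: iba baw\<close>)
  also have "Cmp (Grp R A2) rba ?k = ?c"
    using HomD[OF rba] HomD[OF c] by (intro G.inv_arr_cancel(2)) simp_all
  also have "Arrow (A2, p2, X2) (\<lambda>x \<in> A2. x, ?c) (A, p, X) =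
      Cmp E (inclusion R b w) (inclusion R a (FO (layers_pull R b) w))"
    using comp by (simp add: w' bw inclusion_def abw total_cmp incl_def rb_def ra_def)
  finally show "Cmp E (inclusion R (Cmp Delta b a) w) (layers_cpr R a b w) =
      Cmp E (inclusion R b w) (inclusion R a (FO (layers_pull R b) w))" .
qed

lemma layered_simps: "Grp (layered R) = layers R" "Pull (layered R) = layers_pull R"
  "Cpr (layered R) = layers_cpr R"
  by (simp_all add: layered_def)

sublocale layered: restriction_system Delta E "layered R" "inclusion R"
proof (intro restriction_system.intro restriction_system_axioms.intro category_Delta
  total.category_axioms,
    unfold layered_simps)
  show "f = g" if "e \<in> Hom E y z" "f \<in> Hom E x y" "g \<in> Hom E x y" "Cmp E e f = Cmp E e g"
    for e f g x y z
    using that by (rule total_mono)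
  show "groupoid (layers R c)" for c by (rule groupoid_layers)
  show "Cmp (layers R c) = Cmp E" "Ide (layers R c) = Ide E" for c by (simp_all add: layers_ops)
  show "layers_cpr R u v \<in> extensional (Obj (layers R d))" if "v \<in> Hom Delta c d" for u v c d
    using Delta_homD(2)[OF that] by (simp add: layers_cpr_def)
  show "f \<in> Hom E x y" if "f \<in> Hom (layers R c) x y" for c f x y
    using that by (rule layers_homD(3))
  show "Unt (layered R) c = (\<lambda>x \<in> Obj (layers R c). Ide E x)" for c
    by (simp add: layered_def layers_ops)
qed (rule layers_pull_in_layers inclusion_hom layers_pull_hom layers_pull_arr(2) layers_pull_ext
    layers_pull_ide layers_cpr; assumption)+

end

section \<open>Layered structures form a decomposition space\<close>

context species
begin

lemmas inclusion_eqI = layered.\<iota>_eqI[unfolded layered_simps]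

lemma generic_pull_obj:
  assumes "generic a" "a \<in> Hom Delta m n" "(A, p, X) \<in> Obj (layers R n)"
  shows "FO (layers_pull R a) (A, p, X) = (A, layer_map a A p, X)"
  using assms(1) by (simp add: layers_pull_obj[OF assms(2,3)] layer_set_generic_obj[OF assms]
      layer_str_def)

lemma generic_inclusion:
  assumes "generic a" "a \<in> Hom Delta m n" "(A, p, X) \<in> Obj (layers R n)"
  shows "inclusion R a (A, p, X) = Arrow (A, layer_map a A p, X) (\<lambda>x \<in> A. x, Unt R A X) (A, p, X)"
  using assms(1) by (simp add: inclusion_eq[OF assms(2,3)] layer_set_generic_obj[OF assms]
      layer_str_def
      to_restriction_def)

lemma generic_pull_arr:
  assumes a: "generic a" "a \<in> Hom Delta m n" and t: "t \<in> Hom (layers R n) w w'"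
  shows "FA (layers_pull R a) t = Arrow (FO (layers_pull R a) w) (via t) (FO (layers_pull R a) w')"
  using a(1) HomD(1)[OF t] layers_homD[OF t] total_homD[OF layers_homD(3)[OF t]]
  by (simp add: layers_pull_def generic_act_def Let_def Delta_homD(2)[OF a(2)])

lemma cmp_generic_inclusion_right:
  assumes a: "generic a" "a \<in> Hom Delta m n" and w: "w \<in> Obj (layers R n)" and u: "u \<in> Hom E w z"
  shows "Cmp E u (inclusion R a w) = Arrow (FO (layers_pull R a) w) (via u) z"
proof -
  obtain A p X D r Z where w': "w = (A, p, X)" and z: "z = (D, r, Z)" by (metis prod_cases3)
  show ?thesis
    unfolding w' z generic_inclusion[OF a w[unfolded w']] generic_pull_obj[OF a w[unfolded w']]
    by (rule cmp_unit_right[OF u[unfolded w' z]])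
qed

lemma cmp_generic_inclusion_left:
  assumes a: "generic a" "a \<in> Hom Delta m n" and w: "w \<in> Obj (layers R n)"
    and u: "u \<in> Hom E z (FO (layers_pull R a) w)"
  shows "Cmp E (inclusion R a w) u = Arrow z (via u) w"
proof -
  obtain A p X D r Z where w': "w = (A, p, X)" and z: "z = (D, r, Z)" by (metis prod_cases3)
  show ?thesis
    unfolding w' z generic_inclusion[OF a w[unfolded w']]
    by (rule cmp_unit_left[OF u[unfolded w' z generic_pull_obj[OF a w[unfolded w']]]])
qed

text \<open>Precomposition with a generic inclusion only changes the label of the source, so
  \<open>via u\<close> can be read off the composite. Generic inclusions are thus epi as well as
  mono.\<close>

lemma generic_inclusion_epi:
  assumes a: "generic a" "a \<in> Hom Delta m n" and w: "w \<in> Obj (layers R n)"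
    and u: "u \<in> Hom E w z" "u' \<in> Hom E w z"
    and eq: "Cmp E u (inclusion R a w) = Cmp E u' (inclusion R a w)"
  shows "u = u'"
  using eq total_homD(3)[OF u(1)] total_homD(3)[OF u(2)]
  unfolding cmp_generic_inclusion_right[OF a w u(1)] cmp_generic_inclusion_right[OF a w u(2)]
  by simp

text \<open>Both constraints are characterised by the inclusion for the common composite. Hence the
  comparison isomorphism factors the inclusion path through \<open>f'\<close> and \<open>g\<close>
  through the path along \<open>g'\<close> and \<open>f\<close>, and as all these arrows are monic
  this equation replaces its definition.\<close>

lemma square_iso_inclusion:
  assumes g: "g \<in> Hom Delta n m" and f: "f \<in> Hom Delta n k" and f': "f' \<in> Hom Delta m q"
    and g': "g' \<in> Hom Delta k q" and comm: "Cmp Delta f' g = Cmp Delta g' f"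
      and w: "w \<in> Obj (layers R q)"
  shows "square_iso (layered R) g f f' g' w \<in>
      Hom (layers R n) (FO (layers_pull R g) (FO (layers_pull R f') w))
        (FO (layers_pull R f) (FO (layers_pull R g') w))"
    and "Cmp E (Cmp E (inclusion R g' w) (inclusion R f (FO (layers_pull R g') w)))
      (square_iso (layered R) g f f' g' w) =
      Cmp E (inclusion R f' w) (inclusion R g (FO (layers_pull R f') w))"
proof -
  interpret L: groupoid "layers R n" by (rule groupoid_layers)
  note w1 = layers_pull_in_layers[OF f' w] and w2 = layers_pull_in_layers[OF g' w]
  note c1 = layers_cpr[OF g f' w, unfolded comm] and c2 = layers_cpr[OF f g' w]
  note inv = L.inv_hom[OF c2(1)]
  let ?c1 = "layers_cpr R g f' w" and ?c2 = "layers_cpr R f g' w"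
  have sq: "square_iso (layered R) g f f' g' w = Cmp (layers R n) (inv_arr (layers R n) ?c2) ?c1"
    using square_iso_simp[OF layered.pseudofunctor g f', of w f g'] w by (simp add: layered_simps)
  show hom: "square_iso (layered R) g f f' g' w \<in>
      Hom (layers R n) (FO (layers_pull R g) (FO (layers_pull R f') w))
        (FO (layers_pull R f) (FO (layers_pull R g') w))"
    unfolding sq by (rule L.cmp_hom[OF c1(1) inv])
  note I = inclusion_hom[OF Delta_cmp_hom[OF f g'] w]
  have "Cmp E (Cmp E (inclusion R (Cmp Delta g' f) w) ?c2) (square_iso (layered R) g f f' g' w) =
      Cmp E (inclusion R (Cmp Delta g' f) w) (Cmp (layers R n) ?c2
        (square_iso (layered R) g f f' g' w))"
    using total_cmp_assoc[OF layers_homD(3)[OF hom] layers_homD(3)[OF c2(1)] I]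
    by (simp add: layers_ops)
  also have "Cmp (layers R n) ?c2 (square_iso (layered R) g f f' g' w) = ?c1"
    unfolding sq using HomD[OF c2(1)] HomD[OF c1(1)] by (intro L.inv_arr_cancel(2)) simp_all
  finally show "Cmp E (Cmp E (inclusion R g' w) (inclusion R f (FO (layers_pull R g') w)))
    (square_iso (layered R) g f f' g' w) =
      Cmp E (inclusion R f' w) (inclusion R g (FO (layers_pull R f') w))"
    by (simp add: c1(2) c2(2))
qed

end

section \<open>The square of a generic-free pushout\<close>

locale generic_free_square = species R for R :: "('u, 'o, 'm) species" +
  fixes g f f' g' :: delta_arr and n m k q c :: nat
  assumes gen: "generic g" and fr: "free f" and po: "pushout_square Delta g f f' g'"
    and g: "g \<in> Hom Delta n m" and f: "f \<in> Hom Delta n k"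
    and c: "c = via f 0" and q: "q = k - n + m"
begin

lemma nc: "n + c \<le> k" and f': "f' \<in> Hom Delta m q" and g': "g' \<in> Hom Delta k q"
  and comm: "Cmp Delta f' g = Cmp Delta g' f"
  and f'_via: "i \<le> m \<Longrightarrow> via f' i = i + c"
  and g'_via: "j \<le> k \<Longrightarrow> via g' j = (if j \<le> c then j else
    if j \<le> c + n then via g (j - c) + c else j - n + m)"
  using generic_free_pushout[OF gen fr po g f c] by (simp_all add: q)

lemma f_via: "i \<le> n \<Longrightarrow> via f i = i + c"
  using free_via[OF fr, of i] by (simp add: Delta_homD(1)[OF f] c)

lemma g_via: "via g 0 = 0" "via g n = m"
  using gen generic_iff[OF g] by auto

lemma g'_generic: "generic g'"
proof -
  \<comment> \<open>The value \<open>g' k\<close> depends on the branch of \<open>g'_via\<close>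
    into which \<open>k\<close> falls. For \<open>n = 0\<close> genericity of \<open>g\<close>
    forces \<open>m = 0\<close>.\<close>
  consider "n = 0" "k = c" | "k \<noteq> c" "k = c + n" | "c + n < k" using nc by linarith
  then have "via g' k = q"
    using g_via g'_via[of k] by cases (auto simp: q)
  then show ?thesis using generic_iff[OF g'] g'_via[of 0] g_via by simp
qed

lemma under_f: "c < j \<Longrightarrow> j \<le> c + n \<Longrightarrow> under_generic f j = j - c"
  by (rule under_generic_eqI[OF f]) (auto simp: f_via)

lemma under_f': "c < j \<Longrightarrow> j \<le> c + m \<Longrightarrow> under_generic f' j = j - c"
  by (rule under_generic_eqI[OF f']) (auto simp: f'_via)

text \<open>The layers of \<open>[q]\<close> form a low block up to \<open>c\<close>, a middle block
  of length \<open>m\<close>, and a high block. The underlying map of \<open>g'\<close> is the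
  identity on the first, a shifted copy of that of \<open>g\<close> on the second, and a shift on
  the third. It collapses layers only in the middle block, where \<open>f'\<close> records the exact
  layer.\<close>

lemma under_g'_low: "0 < j \<Longrightarrow> j \<le> c \<Longrightarrow> under_generic g' j = j"
  using nc by (intro under_generic_eqI[OF g']) (simp_all add: g'_via)

lemma under_g'_mid:
  assumes "0 < i" "i \<le> m"
  shows "under_generic g' (i + c) = under_generic g i + c"
proof (rule under_generic_eqI[OF g'])
  have i: "via g 0 < i" "i \<le> via g n" using assms by (simp_all add: g_via)
  note u = under_generic[OF g i]
  show "under_generic g i + c \<in> {1..k}" using u(1) nc by auto
  show "via g' (under_generic g i + c - 1) < i + c"
  \<comment> \<open>If the index is 1, its predecessor in \<open>[k]\<close> is \<open>c\<close>,
    which belongs to the low branch of \<open>g'\<close> and not to the middle one.\<close>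
  proof (cases "under_generic g i = 1")
    case True
    then show ?thesis using nc assms by (simp add: g'_via)
  next
    case False
    have *: "under_generic g i + c - 1 = under_generic g i - 1 + c" using u(1) by auto
    have "via g' (under_generic g i - 1 + c) = via g (under_generic g i - 1) + c"
      using False u(1) nc by (subst g'_via) auto
    then show ?thesis unfolding * using u(2) by simp
  qed
  show "i + c \<le> via g' (under_generic g i + c)"
    using u(1,3) nc by (simp add: g'_via)
qed

lemma under_g'_high: 
  assumes "c + m < j" "j \<le> q"
  shows "under_generic g' j = j - m + n"
proof (rule under_generic_eqI[OF g'])
  have j: "j - m + n \<le> k" "c + n < j - m + n" using assms nc by (auto simp: q)
  then show "j - m + n \<in> {1..k}" by simp
  show "j \<le> via g' (j - m + n)" using j assms by (simp add: g'_via)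
  show "via g' (j - m + n - 1) < j"
  \<comment> \<open>The predecessor of the first high index is \<open>c + n\<close>, which still
    belongs to the middle block.\<close>
  proof (cases "c + n < j - m + n - 1")
    case True
    then show ?thesis using j assms by (simp add: g'_via)
  next
    case False
    then have *: "j - m + n - 1 = c + n" using j by simp
    have "via g' (c + n) = c + m" using nc g_via by (auto simp: g'_via)
    then show ?thesis unfolding * using assms(1) by simp
  qed
qed

lemma layer_set_f': "layer_set f' A r = {x \<in> A. c < r x \<and> r x \<le> c + m}"
  by (simp add: layer_set_def Delta_homD(1)[OF f'] f'_via add.commute)

lemma layer_set_f: "layer_set f A s = {x \<in> A. c < s x \<and> s x \<le> c + n}"
  by (simp add: layer_set_def Delta_homD(1)[OF f] f_via add.commute)

text \<open>As \<open>g'\<close> is generic, a lift must be \<open>b\<close> with its original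
  layerings restored. Compatibility shows that this arrow restricts to \<open>a\<close>. It
  preserves layers because \<open>a\<close> controls the middle block and \<open>b\<close> the other
  two.\<close>

lemma full_faithful:
  assumes w: "w \<in> Obj (layers R q)" and w': "w' \<in> Obj (layers R q)"
    and a: "a \<in> Hom (layers R m) (FO (layers_pull R f') w) (FO (layers_pull R f') w')"
    and b: "b \<in> Hom (layers R k) (FO (layers_pull R g') w) (FO (layers_pull R g') w')"
    and eq: "Cmp (layers R n) (square_iso (layered R) g f f' g' w') (FA (layers_pull R g) a) =
      Cmp (layers R n) (FA (layers_pull R f) b) (square_iso (layered R) g f f' g' w)"
  shows "\<exists>!t. t \<in> Hom (layers R q) w w' \<and> FA (layers_pull R f') t = a \<and> FA (layers_pull R g') t = b"
proof -
  let ?\<alpha> = "square_iso (layered R) g f f' g'"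
  note sw = square_iso_inclusion[OF g f f' g' comm w]
    and sw' = square_iso_inclusion[OF g f f' g' comm w']
  obtain C r W C' r' W' where ww: "w = (C, r, W)" "w' = (C', r', W')" by (metis prod_cases3)
  note gw = generic_pull_obj[OF g'_generic g' w[unfolded ww]]
    generic_pull_obj[OF g'_generic g' w'[unfolded ww]]
  note fw = layers_pull_obj[OF f' w[unfolded ww]] layers_pull_obj[OF f' w'[unfolded ww]]
  note aE = layers_homD(3)[OF a] and bE = layers_homD(3)[OF b]
  \<comment> \<open>Forced by the condition for \<open>g'\<close>, which acts on arrows by
    relabelling only.\<close>
  define t where "t = Arrow w (via b) w'"
  have tE: "t \<in> Hom E w w'"
    using relabel_hom[OF bE[unfolded ww gw]] by (simp add: t_def ww)
  note If = inclusion_hom[OF f' w] and If' = inclusion_hom[OF f' w']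
  note Ig = inclusion_hom[OF g' w] and Ig' = inclusion_hom[OF g' w']
  note fo = layers_pull_in_layers[OF f' w] layers_pull_in_layers[OF f' w']
    layers_pull_in_layers[OF g' w] layers_pull_in_layers[OF g' w']
  note Igf = inclusion_hom[OF g fo(1)] and Igf' = inclusion_hom[OF g fo(2)]
  note Ifg = inclusion_hom[OF f fo(3)] and Ifg' = inclusion_hom[OF f fo(4)]
  note ga = layers_pull_arr[OF g a] and fb = layers_pull_arr[OF f b]
  note sE = layers_homD(3)[OF sw(1)] and sE' = layers_homD(3)[OF sw'(1)]
  have tb: "Cmp E t (inclusion R g' w) = Cmp E (inclusion R g' w') b"
    unfolding cmp_generic_inclusion_right[OF g'_generic g' w tE]
      cmp_generic_inclusion_left[OF g'_generic g' w' bE] by (simp add: t_def)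
  \<comment> \<open>The equation \<open>eq\<close> lives over the smallest object of the square. It
    is pushed along the inclusions to an equation of arrows into \<open>w'\<close>; the generic
    inclusion for \<open>g\<close>, which stands in front on both sides, is then cancelled as an
    epi.\<close>
  have "Cmp E (Cmp E (inclusion R f' w') a) (inclusion R g (FO (layers_pull R f') w)) =
      Cmp E (Cmp E (inclusion R f' w') (inclusion R g (FO (layers_pull R f') w')))
        (FA (layers_pull R g) a)"
    by (simp add: total_cmp_assoc[OF Igf aE If', symmetric]
        total_cmp_assoc[OF ga(1) Igf' If', symmetric] ga(2))
  also have "\<dots> = Cmp E (Cmp E (inclusion R g' w') (inclusion R f (FO (layers_pull R g') w')))
      (Cmp (layers R n) (?\<alpha> w') (FA (layers_pull R g) a))"
    by (simp add: sw'(2)[symmetric] layers_ops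
        total_cmp_assoc[OF ga(1) sE' total_cmp_hom[OF Ifg' Ig']])
  also have "\<dots> = Cmp E (Cmp E (Cmp E (inclusion R g' w') (inclusion R f (FO (layers_pull R g') w')))
      (FA (layers_pull R f) b)) (?\<alpha> w)"
    unfolding eq by (simp add: layers_ops total_cmp_assoc[OF sE fb(1) total_cmp_hom[OF Ifg' Ig']])
  also have "\<dots> = Cmp E (Cmp E (Cmp E (inclusion R g' w') b)
    (inclusion R f (FO (layers_pull R g') w))) (?\<alpha> w)"
    by (simp add: total_cmp_assoc[OF fb(1) Ifg' Ig', symmetric] fb(2)
        total_cmp_assoc[OF Ifg bE Ig'])
  also have "\<dots> = Cmp E t (Cmp E (Cmp E (inclusion R g' w) (inclusion R f (FO (layers_pull R g') w)))
    (?\<alpha> w))"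
    by (simp add: tb[symmetric] total_cmp_assoc[OF Ifg Ig tE, symmetric]
        total_cmp_assoc[OF sE total_cmp_hom[OF Ifg Ig] tE])
  also have "\<dots> = Cmp E (Cmp E t (inclusion R f' w)) (inclusion R g (FO (layers_pull R f') w))"
    by (simp add: sw(2) total_cmp_assoc[OF Igf If tE])
  finally have ta: "Cmp E (inclusion R f' w') a = Cmp E t (inclusion R f' w)"
    by (rule generic_inclusion_epi[OF gen g fo(1) total_cmp_hom[OF aE If'] total_cmp_hom[OF If tE]])
  have bijb: "bij_betw (base t) C C'" and laymap: "\<And>x. x \<in> C \<Longrightarrow> layer_map g' C' r' (base t x) =
    layer_map g' C r x"
    using layers_homD(4,5)[OF b] by (simp_all add: ww gw t_def)
  have bija: "bij_betw (base a) (layer_set f' C r) (layer_set f' C' r')"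
    and lma: "\<And>x. x \<in> layer_set f' C r \<Longrightarrow> layer_map f' C' r' (base a x) = layer_map f' C r x"
    using layers_homD(4,5)[OF a] by (simp_all add: ww fw)
  have ab: "base a x = base t x" if x: "x \<in> layer_set f' C r" for x
  proof -
    have "base a x \<in> layer_set f' C' r'" using bij_betwE[OF bija] x by blast
    then show ?thesis
      using arg_cong[OF ta, of "\<lambda>t. base t x"] x
      unfolding base_cmp[OF aE If'] base_cmp[OF If tE]
      by (simp add: compose_def ww fw base_inclusion)
  qed
  have layer: "r' (base t x) = r x" if x: "x \<in> C" for x
  proof -
    have xC': "base t x \<in> C'" using bij_betwE[OF bijb] x by blast
    have rng: "r x \<in> {1..q}" "r' (base t x) \<in> {1..q}"
      using w w' x xC' by (auto simp: ww layers_obj intro: PiE_mem)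
    have "layer_set g' C r = C" "layer_set g' C' r' = C'"
      using layer_set_generic_obj[OF g'_generic g'] w w' ww by auto
    then have ug: "under_generic g' (r' (base t x)) = under_generic g' (r x)"
      using laymap[OF x] x xC' by (simp add: layer_map_def)
    \<comment> \<open>Since \<open>a\<close> is a bijection of the middle blocks and agrees with
      \<open>t\<close> there, while \<open>t\<close> is injective, \<open>t\<close> also preserves
      the complement of the middle block.\<close>
    have mem: "base t x \<in> layer_set f' C' r' \<longleftrightarrow> x \<in> layer_set f' C r"
    proof
      show "base t x \<in> layer_set f' C' r'" if "x \<in> layer_set f' C r"
        using bij_betwE[OF bija] that ab[OF that] by auto
      assume "base t x \<in> layer_set f' C' r'"
      then obtain z where z: "z \<in> layer_set f' C r" "base t x = base a z"
        using bija by (auto simp: bij_betw_def)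
      then have "base t x = base t z" "z \<in> C" using ab[OF z(1)] subsetD[OF layer_set_subset z(1)]
        by auto
      then have "x = z" using bijb x by (auto simp: bij_betw_def dest: inj_onD)
      then show "x \<in> layer_set f' C r" using z(1) by simp
    qed
    show ?thesis
    \<comment> \<open>In the middle block \<open>f'\<close> only shifts layers, so \<open>a\<close>
      determines the layer. Outside it the underlying map of \<open>g'\<close> is injective and
      separates low from high, so equality under \<open>g'\<close> suffices.\<close>
    proof (cases "x \<in> layer_set f' C r")
      case True
      then have "under_generic f' (r' (base t x)) = under_generic f' (r x)"
        using lma[OF True] mem by (simp add: layer_map_def ab[OF True])
      then show ?thesis
        using True mem by (auto simp: layer_set_f' under_f')
    next
      case False
      then have "r x \<le> c \<or> c + m < r x" "r' (base t x) \<le> c \<or> c + m < r' (base t x)"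
        using mem x xC' by (auto simp: layer_set_f')
      then show ?thesis
        using ug rng under_g'_low[of "r x"] under_g'_low[of "r' (base t x)"]
          under_g'_high[of "r x"] under_g'_high[of "r' (base t x)"] by auto
    qed
  qed
  have tl: "t \<in> Hom (layers R q) w w'"
    using layers_homI[OF w w' tE] bijb layer by (simp add: ww)
  have "FA (layers_pull R f') t = a"
    by (rule inclusion_eqI[OF f' w' layers_pull_hom[OF f' tl] a]) (simp add:
        layers_pull_arr(2)[OF f' tl] ta)
  moreover have "FA (layers_pull R g') t = b"
    unfolding generic_pull_arr[OF g'_generic g' tl]
    by (simp add: t_def total_homD(3)[OF bE, symmetric])
  moreover have "t' = t" if "t' \<in> Hom (layers R q) w w'" "FA (layers_pull R g') t' = b" for t'
    using that(2) total_homD(3)[OF layers_homD(3)[OF that(1)]]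
    unfolding generic_pull_arr[OF g'_generic g' that(1)] t_def by (metis arrow.sel(2))
  ultimately show ?thesis using tl by blast
qed

text \<open>The set and structure of \<open>y\<close> are kept, and only its layering is refined, by
  transporting that of \<open>x\<close> to the middle block along \<open>\<zeta>\<close>. The result
  restricts to \<open>y\<close> exactly and to \<open>x\<close> up to an isomorphism over the
  bijection underlying \<open>\<zeta>\<close>.\<close>

lemma ess_surj:
  assumes x: "x \<in> Obj (layers R m)" and y: "y \<in> Obj (layers R k)"
    and \<zeta>: "\<zeta> \<in> Hom (layers R n) (FO (layers_pull R g) x) (FO (layers_pull R f) y)"
  shows "\<exists>w \<in> Obj (layers R q). \<exists>a \<in> Hom (layers R m) (FO (layers_pull R f') w) x.
    \<exists>b \<in> Hom (layers R k) (FO (layers_pull R g') w) y.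
      Cmp (layers R n) \<zeta> (FA (layers_pull R g) a) =
      Cmp (layers R n) (FA (layers_pull R f) b) (square_iso (layered R) g f f' g' w)"
proof -
  let ?\<alpha> = "square_iso (layered R) g f f' g'"
  obtain A p X B s Y where xy: "x = (A, p, X)" "y = (B, s, Y)" by (metis prod_cases3)
  note gx = generic_pull_obj[OF gen g x[unfolded xy]]
  note fy = layers_pull_obj[OF f y[unfolded xy]]
  note \<zeta>E = layers_homD(3)[OF \<zeta>]
  define \<sigma> where "\<sigma> = base \<zeta>"
  define B' where "B' = layer_set f B s"
  have bij: "bij_betw \<sigma> A B'" using layers_homD(4)[OF \<zeta>] by (simp add: xy gx fy \<sigma>_def B'_def)
  have p: "p a \<in> {1..m}" if "a \<in> A" for a
    using x that by (auto simp: xy layers_obj intro: PiE_mem)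
  have s: "s b \<in> {1..k}" if "b \<in> B" for b
    using y that by (auto simp: xy layers_obj intro: PiE_mem)
  have B': "b \<in> B' \<longleftrightarrow> b \<in> B \<and> c < s b \<and> s b \<le> c + n" for b by (simp add: B'_def layer_set_f)
  \<comment> \<open>Since \<open>\<zeta>\<close> respects layers, the coarse layer of the image of
    \<open>a\<close> is the shifted coarsening of its fine layer. This makes the refinement below
    compatible with \<open>s\<close>.\<close>
  have s\<sigma>: "s (\<sigma> a) = under_generic g (p a) + c" if a: "a \<in> A" for a
  proof -
    have \<sigma>a: "\<sigma> a \<in> B'" using bij_betwE[OF bij] a by blast
    have "layer_map f B s (\<sigma> a) = layer_map g A p a"
      using layers_homD(5)[OF \<zeta>, of a] a by (simp add: xy gx fy \<sigma>_def)
    then have "under_generic f (s (\<sigma> a)) = under_generic g (p a)"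
      using \<sigma>a a layer_set_generic_obj[OF gen g x[unfolded xy]] by (simp add: layer_map_def B'_def)
    then show ?thesis using \<sigma>a under_f[of "s (\<sigma> a)"] by (auto simp: B')
  qed
  \<comment> \<open>The refinement: layers of \<open>x\<close>, shifted by \<open>c\<close>, in the
    middle block; unchanged layers below; and above, a shift making room for \<open>m\<close> layers
    in place of \<open>n\<close>. The high case has \<open>s b > c + n\<close>, so the subtraction
    is exact.\<close>
  define r where "r = (\<lambda>b \<in> B. if b \<in> B' then p (the_inv_into A \<sigma> b) + c else
    if s b \<le> c then s b else s b - n + m)"
  have r\<sigma>: "r (\<sigma> a) = p a + c" if a: "a \<in> A" for a
  proof -
    have "\<sigma> a \<in> B'" "the_inv_into A \<sigma> (\<sigma> a) = a"
      using bij_betwE[OF bij] a the_inv_into_f_f[OF bij_betw_imp_inj_on[OF bij] a] by auto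
    then show ?thesis by (simp add: r_def B')
  qed
  have B'_ex: "\<exists>a \<in> A. b = \<sigma> a" if "b \<in> B'" for b using bij that by (auto simp: bij_betw_def)
  have r_out: "r b = (if s b \<le> c then s b else s b - n + m)" "s b \<le> c \<or> c + n < s b"
    if "b \<in> B" "b \<notin> B'" for b
    using that by (auto simp: r_def B')
  have r_range: "r b \<in> {1..q}" if b: "b \<in> B" for b
  proof (cases "b \<in> B'")
    case True
    then obtain a where a: "a \<in> A" "b = \<sigma> a" using B'_ex by blast
    then show ?thesis using r\<sigma>[OF a(1)] p[OF a(1)] nc by (auto simp: q)
  next
    case False
    then show ?thesis using r_out[OF b False] s[OF b] nc by (auto simp: q)
  qed
  define w where "w = (B, r, Y)"
  have "r \<in> B \<rightarrow>\<^sub>E {1..q}"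
  proof (rule PiE_I)
    show "r b = undefined" if "b \<notin> B" for b using that by (simp add: r_def)
  qed (rule r_range)
  then have w: "w \<in> Obj (layers R q)" using y unfolding w_def xy layers_obj by blast
  note w0 = w[unfolded w_def]
  have set_g': "layer_set g' B r = B" by (rule layer_set_generic_obj[OF g'_generic g' w0])
  have "layer_map g' B r = s"
  proof (rule extensionalityI[of _ B])
    show "layer_map g' B r \<in> extensional B" by (simp add: layer_map_def set_g')
    show "s \<in> extensional B" using y by (simp add: xy layers_obj PiE_def)
    fix b assume b: "b \<in> B"
    have "under_generic g' (r b) = s b"
    proof (cases "b \<in> B'")
      case True
      then obtain a where a: "a \<in> A" "b = \<sigma> a" using B'_ex by blast
      then show ?thesis using under_g'_mid[of "p a"] p[OF a(1)] by (simp add: r\<sigma> s\<sigma>)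
    next
      case False
      show ?thesis
      proof (cases "s b \<le> c")
        case True
        then show ?thesis using r_out(1)[OF b False] s[OF b] under_g'_low by simp
      next
        case gt: False
        then have "c + n < s b" using r_out(2)[OF b False] by simp
        moreover have "c + m < s b - n + m" "s b - n + m \<le> q" using s[OF b] calculation
          by (auto simp: q)
        ultimately show ?thesis using r_out(1)[OF b False] gt under_g'_high[of "s b - n + m"]
          by simp
      qed
    qed
    then show "layer_map g' B r b = s b" using b by (simp add: layer_map_def set_g')
  qed
  then have gw: "FO (layers_pull R g') w = y"
    by (simp add: w_def xy generic_pull_obj[OF g'_generic g' w0])
  have set_f': "layer_set f' B r = B'"
  proof -
    have "c < r b \<and> r b \<le> c + m \<longleftrightarrow> b \<in> B'" if b: "b \<in> B" for b
    proof (cases "b \<in> B'")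
      case True
      then obtain a where a: "a \<in> A" "b = \<sigma> a" using B'_ex by blast
      then show ?thesis using True p[OF a(1)] by (simp add: r\<sigma>)
    next
      case False
      then show ?thesis using r_out[OF b False] by auto
    qed
    then show ?thesis using B' by (auto simp: layer_set_f')
  qed
  note fw = layers_pull_obj[OF f' w0, folded w_def, unfolded set_f']
  have fwl: "FO (layers_pull R f') w \<in> Obj (layers R m)" by (rule layers_pull_in_layers[OF f' w])
  note Ify = inclusion_hom[OF f y] and If'w = inclusion_hom[OF f' w] and Igx = inclusion_hom[OF g x]
    and Ig'w = inclusion_hom[OF g' w, unfolded gw]
  note If\<zeta> = total_cmp_hom[OF \<zeta>E Ify]
  \<comment> \<open>The composite of \<open>\<zeta>\<close> with the inclusion into
    \<open>y\<close>, relabelled to run from \<open>x\<close> to \<open>w\<close>. Factoring it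
    through the cartesian inclusion for \<open>f'\<close> produces the isomorphism
    \<open>u\<close>.\<close>
  define j where "j = Arrow x (via (Cmp E (inclusion R f y) \<zeta>)) w"
  have jE: "j \<in> Hom E x w"
    using relabel_hom[OF If\<zeta>[unfolded xy gx]] by (simp add: j_def xy w_def)
  have \<sigma>B': "\<sigma> \<in> A \<rightarrow>\<^sub>E B'"
    using base_funcset(1)[OF \<zeta>E] by (simp add: \<sigma>_def xy gx fy B'_def)
  have base_j: "base j a = \<sigma> a" if a: "a \<in> A" for a
  proof -
    have "base j a = base (Cmp E (inclusion R f y) \<zeta>) a" by (simp add: j_def)
    also have "\<dots> = \<sigma> a"
      unfolding base_cmp[OF \<zeta>E Ify] using a PiE_mem[OF \<sigma>B' a]
      by (simp add: compose_def xy gx fy B'_def \<sigma>_def base_inclusion)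
    finally show ?thesis .
  qed
  have "\<exists>u \<in> Hom E x (FO (layers_pull R f') w). base u = \<sigma> \<and> Cmp E (inclusion R f' w) u = j"
  proof (rule total_cartesian[OF If'w jE])
    show "\<sigma> \<in> fst x \<rightarrow>\<^sub>E fst (FO (layers_pull R f') w)" using \<sigma>B' by (simp add: xy fw)
    show "base (inclusion R f' w) (\<sigma> a) = base j a" if "a \<in> fst x" for a
      using that PiE_mem[OF \<sigma>B', of a] by (simp add: base_j xy base_inclusion fw)
  qed
  then obtain u where uE: "u \<in> Hom E x (FO (layers_pull R f') w)"
    and u: "base u = \<sigma>" "Cmp E (inclusion R f' w) u = j"
    by blast
  have ul: "u \<in> Hom (layers R m) x (FO (layers_pull R f') w)"
  proof (rule layers_homI[OF x fwl uE])
    show "bij_betw (base u) (fst x) (fst (FO (layers_pull R f') w))" using bij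
      by (simp add: u xy fw)
    show "fst (snd (FO (layers_pull R f') w)) (base u a) = fst (snd x) a" if a: "a \<in> fst x" for a
    proof -
      have a: "a \<in> A" using a by (simp add: xy)
      have "layer_map f' B r (\<sigma> a) = under_generic f' (p a + c)"
        using PiE_mem[OF \<sigma>B' a] by (simp add: layer_map_def set_f' r\<sigma>[OF a])
      also have "\<dots> = p a" using p[OF a] by (simp add: under_f')
      finally show ?thesis by (simp add: u xy fw)
    qed
  qed
  interpret Lm: groupoid "layers R m" by (rule groupoid_layers)
  interpret Ln: groupoid "layers R n" by (rule groupoid_layers)
  interpret Lk: groupoid "layers R k" by (rule groupoid_layers)
  note sq = square_iso_inclusion[OF g f f' g' comm w, unfolded gw]
  note sE = layers_homD(3)[OF sq(1)]
  note gu = layers_pull_hom[OF g ul]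
  note guE = layers_pull_arr[OF g ul]
  note Igfw = inclusion_hom[OF g fwl]
  \<comment> \<open>To identify \<open>\<zeta>\<close> with the comparison isomorphism after the
    pullback of \<open>u\<close>, both are followed by the inclusions into \<open>w\<close>. Each
    becomes \<open>j\<close> with the source relabelled, and the composite inclusion is
    monic.\<close>
  have "Cmp E (Cmp E (inclusion R g' w) (inclusion R f y)) (Cmp E (?\<alpha> w) (FA (layers_pull R g) u)) =
      Cmp E (Cmp E (inclusion R f' w) (inclusion R g (FO (layers_pull R f') w)))
        (FA (layers_pull R g) u)"
    by (simp add: total_cmp_assoc[OF guE(1) sE total_cmp_hom[OF Ify Ig'w]] sq(2))
  also have "\<dots> = Cmp E j (inclusion R g x)"
    by (simp add: total_cmp_assoc[OF guE(1) Igfw If'w, symmetric] guE(2)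
        total_cmp_assoc[OF Igx uE If'w] u(2))
  also have "\<dots> = Arrow (FO (layers_pull R g) x) (via (Cmp E (inclusion R f y) \<zeta>)) w"
    unfolding cmp_generic_inclusion_right[OF gen g x jE] by (simp add: j_def)
  also have "\<dots> = Cmp E (inclusion R g' w) (Cmp E (inclusion R f y) \<zeta>)"
    by (rule cmp_generic_inclusion_left[OF g'_generic g' w If\<zeta>[folded gw], symmetric, unfolded gw])
  also have "\<dots> = Cmp E (Cmp E (inclusion R g' w) (inclusion R f y)) \<zeta>"
    by (rule total_cmp_assoc[OF \<zeta>E Ify Ig'w])
  finally have "Cmp E (?\<alpha> w) (FA (layers_pull R g) u) = \<zeta>"
    by (rule total_mono[OF total_cmp_hom[OF Ify Ig'w] total_cmp_hom[OF guE(1) sE] \<zeta>E])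
  then have \<zeta>_eq: "\<zeta> = Cmp (layers R n) (?\<alpha> w) (FA (layers_pull R g) u)" by (simp add: layers_ops)
  \<comment> \<open>The comparison requires an arrow into \<open>x\<close>, whereas \<open>u\<close>
    starts at \<open>x\<close>; the other coordinate is the identity of \<open>y\<close>.\<close>
  define a where "a = inv_arr (layers R m) u"
  have a: "a \<in> Hom (layers R m) (FO (layers_pull R f') w) x" unfolding a_def
    by (rule Lm.inv_hom[OF ul])
  note Gf = functor_arr[OF layered.is_functor_pull[OF g, unfolded layered_simps]]
    and Ff = functor_arr[OF layered.is_functor_pull[OF f, unfolded layered_simps]]
  note us = HomD[OF ul] and as = HomD[OF a] and ss = HomD[OF sq(1)]
  have "Cmp (layers R n) \<zeta> (FA (layers_pull R g) a) =
      Cmp (layers R n) (?\<alpha> w) (Cmp (layers R n) (FA (layers_pull R g) u) (FA (layers_pull R g) a))"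
    unfolding \<zeta>_eq using us as ss by (simp add: Ln.assoc Gf)
  also have "Cmp (layers R n) (FA (layers_pull R g) u) (FA (layers_pull R g) a) =
      FA (layers_pull R g) (Cmp (layers R m) u a)"
    using us as by (simp add: Gf(6))
  also have "Cmp (layers R m) u a = Ide (layers R m) (FO (layers_pull R f') w)"
    unfolding a_def using us by (simp add: Lm.inv_arr)
  also have "Cmp (layers R n) (?\<alpha> w) (FA (layers_pull R g)
    (Ide (layers R m) (FO (layers_pull R f') w))) = ?\<alpha> w"
    using ss fwl by (simp add: Gf(5) Ln.ide_right)
  also have "\<dots> = Cmp (layers R n) (FA (layers_pull R f) (Ide (layers R k) y)) (?\<alpha> w)"
    using ss y by (simp add: Ff(5) Ln.ide_left)
  finally have eq: "Cmp (layers R n) \<zeta> (FA (layers_pull R g) a) =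
      Cmp (layers R n) (FA (layers_pull R f) (Ide (layers R k) y)) (?\<alpha> w)" .
  have "Ide (layers R k) y \<in> Hom (layers R k) (FO (layers_pull R g') w) y"
    unfolding gw by (rule Lk.ide_hom[OF y])
  then show ?thesis using w a eq by blast
qed

lemma square_pullback:
  "homotopy_pullback (layers R q) (layers R m) (layers R k) (layers R n)
    (layers_pull R f') (layers_pull R g') (layers_pull R g) (layers_pull R f)
      (square_iso (layered R) g f f' g')"
proof -
  note ftr = layered.is_functor_pull[unfolded layered_simps]
  have "nat_iso (layers R q) (layers R n) (comp_ftr (layers R q) (layers_pull R g)
    (layers_pull R f'))
      (comp_ftr (layers R q) (layers_pull R f) (layers_pull R g'))
        (square_iso (layered R) g f f' g')"
    using nat_iso_square_iso[OF layered.pseudofunctor g f f' g' comm] by (simp only: layered_simps)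
  note iff = homotopy_pullback_iff[OF groupoid_layers groupoid_layers groupoid_layers
    groupoid_layers
      ftr[OF f'] ftr[OF g'] ftr[OF g] ftr[OF f] this]
  show ?thesis
    unfolding iff pullback_conditions_def
    by (intro conjI ballI impI full_faithful ess_surj)
qed

end

context species
begin

lemma decomposition_space_layered: "decomposition_space (layered R)"
  unfolding decomposition_space_def
proof (intro conjI allI impI)
  show "simplicial_groupoid (layered R)" by (rule layered.pseudofunctor)
  fix g f f' g' assume *: "generic g \<and> free f \<and> pushout_square Delta g f f' g'"
  then have gf: "g \<in> Hom Delta (src g) (tgt g)" "f \<in> Hom Delta (src g) (tgt f)"
    by (auto simp: pushout_square_def Hom_def)
  interpret generic_free_square R g f f' g' "src g" "tgt g" "tgt f" "tgt f - src g + tgt g" "via f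
    0"
    by unfold_locales (use * gf in auto)
  show "homotopy_pullback (Grp (layered R) (tgt f')) (Grp (layered R) (tgt g))
    (Grp (layered R) (tgt f))
      (Grp (layered R) (src g)) (Pull (layered R) f') (Pull (layered R) g') (Pull (layered R) g)
      (Pull (layered R) f) (square_iso (layered R) g f f' g')"
    using square_pullback by (simp only: layered_simps Delta_homD(2)[OF f'])
qed

end

section \<open>Morphisms of restriction species\<close>

text \<open>The functor between Grothendieck constructions induced by \<phi>: the cell of \<phi>
  corrects the target of the image of \<open>h\<close>. Domains are restricted to the carriers to
  make it extensional.\<close>

definition total_map ::
  "('u, 'p, 'q) species \<Rightarrow> ('u, 'o, 'm) species \<Rightarrow>
   ('u set, ('u set, 'u \<Rightarrow> 'u) arrow, 'p, 'q, 'o, 'm) pnt \<Rightarrow>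
   (('u, 'p) lobj, ('u, 'p, 'q) larr, ('u, 'o) lobj, ('u, 'o, 'm) larr) ftr" where
  "total_map R' R \<phi> =
     \<lparr>FO = (\<lambda>(A, p, X) \<in> Obj (total R'). (A, p, FO (Cmpt \<phi> A) X)),
      FA = (\<lambda>t \<in> Arr (total R'). case t of Arrow (A, p, X) (\<sigma>, h) (B, q, Y) \<Rightarrow>
        Arrow (A, p, FO (Cmpt \<phi> A) X)
          (\<sigma>, Cmp (Grp R A) (Cell \<phi> (Arrow A \<sigma> B) Y) (FA (Cmpt \<phi> A) h))
          (B, q, FO (Cmpt \<phi> B) Y))\<rparr>"

locale species_map = S: species R' + T: species R
  for R' :: "('u, 'p, 'q) species" and R :: "('u, 'o, 'm) species" +
  fixes \<phi> :: "('u set, ('u set, 'u \<Rightarrow> 'u) arrow, 'p, 'q, 'o, 'm) pnt"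
  assumes \<phi>: "pseudonatural fin_inj R' R \<phi>"
begin

abbreviation \<Phi> where "\<Phi> \<equiv> total_map R' R \<phi>"

lemma ftr\<phi>: "finite A \<Longrightarrow> is_functor (Grp R' A) (Grp R A) (Cmpt \<phi> A)"
  by (rule pseudonatural_cmpt[OF \<phi>]) simp

lemma map_obj: "(A, p, X) \<in> Obj (total R') \<Longrightarrow> FO \<Phi> (A, p, X) = (A, p, FO (Cmpt \<phi> A) X)"
  by (simp add: total_map_def)

lemma map_arr: "Arrow (A, p, X) (\<sigma>, h) (B, q, Y) \<in> Arr (total R') \<Longrightarrow>
    FA \<Phi> (Arrow (A, p, X) (\<sigma>, h) (B, q, Y)) = Arrow (A, p, FO (Cmpt \<phi> A) X)
      (\<sigma>, Cmp (Grp R A) (Cell \<phi> (Arrow A \<sigma> B) Y) (FA (Cmpt \<phi> A) h)) (B, q, FO (Cmpt \<phi> B) Y)"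
  by (simp add: total_map_def)

lemma map_in_total: "x \<in> Obj (total R') \<Longrightarrow> FO \<Phi> x \<in> Obj (total R)"
  using functor_arr(1)[OF ftr\<phi>] by (cases x) (simp add: map_obj total_obj)

lemma map_hom:
  assumes "t \<in> Hom (total R') x y"
  shows "FA \<Phi> t \<in> Hom (total R) (FO \<Phi> x) (FO \<Phi> y)" "base (FA \<Phi> t) = base t"
proof -
  obtain A p X B q Y where x: "x = (A, p, X)" and y: "y = (B, q, Y)" by (metis prod_cases3)
  obtain \<sigma> h where t: "t = Arrow (A, p, X) (\<sigma>, h) (B, q, Y)" and \<sigma>: "Arrow A \<sigma> B \<in> Hom fin_inj A B"
      and fin: "finite A" "finite B" and X: "X \<in> Obj (Grp R' A)" and Y: "Y \<in> Obj (Grp R' B)"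
      and h: "h \<in> Hom (Grp R' A) X (FO (Pull R' (Arrow A \<sigma> B)) Y)"
    using assms by (auto simp: x y elim: S.total_homE)
  interpret A: groupoid "Grp R A" by (rule T.groupoid_at[OF fin(1)])
  have "Cell \<phi> (Arrow A \<sigma> B) Y \<in> Hom (Grp R A) (FO (Cmpt \<phi> A) (FO (Pull R' (Arrow A \<sigma> B)) Y))
      (FO (Pull R (Arrow A \<sigma> B)) (FO (Cmpt \<phi> B) Y))"
    using cell_arr[OF \<phi> \<sigma> Y] by (simp add: Hom_def)
  note c = A.cmp_hom[OF functor_hom[OF ftr\<phi>[OF fin(1)] h] this]
  note Ft = map_arr[OF HomD(1)[OF assms, unfolded t]]
  have obj: "(A, p, X) \<in> Obj (total R')" "(B, q, Y) \<in> Obj (total R')" using fin X Y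
    by (simp_all add: total_obj)
  show "FA \<Phi> t \<in> Hom (total R) (FO \<Phi> x) (FO \<Phi> y)"
    unfolding x y t Ft map_obj[OF obj(1)] map_obj[OF obj(2)] total_hom
    using \<sigma> c functor_arr(1)[OF ftr\<phi>[OF fin(1)] X] functor_arr(1)[OF ftr\<phi>[OF fin(2)] Y] by blast
  show "base (FA \<Phi> t) = base t" by (simp add: t Ft)
qed

lemma map_ide:
  assumes "x \<in> Obj (total R')"
  shows "FA \<Phi> (Ide (total R') x) = Ide (total R) (FO \<Phi> x)"
proof -
  obtain A p X where x: "x = (A, p, X)" by (metis prod_cases3)
  have fin: "finite A" and X: "X \<in> Obj (Grp R' A)" using assms by (simp_all add: x total_obj)
  have "Ide (total R') x \<in> Arr (total R')" by (rule HomD(1)[OF S.total_ide_hom[OF assms]])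
  then show ?thesis
    using pseudonatural_unt[OF \<phi>, of A X] fin X assms by (simp add: x total_ide map_arr map_obj)
qed

text \<open>The coherence law of \<phi> splits the cell at the composite injection into the cells at
  its factors, and naturality of the cell at \<sigma> moves it past \<open>k\<close>.\<close>

lemma map_cmp:
  assumes t: "t \<in> Hom (total R') x y" and u: "u \<in> Hom (total R') y z"
  shows "FA \<Phi> (Cmp (total R') u t) = Cmp (total R) (FA \<Phi> u) (FA \<Phi> t)"
proof -
  obtain A p X B q Y D r Z where x: "x = (A, p, X)" and y: "y = (B, q, Y)" and z: "z = (D, r, Z)"
    by (metis prod_cases3)
  obtain \<sigma> h where t1: "t = Arrow (A, p, X) (\<sigma>, h) (B, q, Y)" and \<sigma>: "Arrow A \<sigma> B \<in> Hom fin_inj A B"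
      and fin: "finite A" "finite B" and Y: "Y \<in> Obj (Grp R' B)"
      and h: "h \<in> Hom (Grp R' A) X (FO (Pull R' (Arrow A \<sigma> B)) Y)"
    using t by (auto simp: x y elim: S.total_homE)
  obtain \<tau> k where u1: "u = Arrow (B, q, Y) (\<tau>, k) (D, r, Z)" and \<tau>: "Arrow B \<tau> D \<in> Hom fin_inj B D"
      and finD: "finite D" and Z: "Z \<in> Obj (Grp R' D)"
        and k: "k \<in> Hom (Grp R' B) Y (FO (Pull R' (Arrow B \<tau> D)) Z)"
    using u by (auto simp: y z elim: S.total_homE)
  interpret A: groupoid "Grp R A" by (rule T.groupoid_at[OF fin(1)])
  interpret B: groupoid "Grp R B" by (rule T.groupoid_at[OF fin(2)])
  interpret A': groupoid "Grp R' A" by (rule S.groupoid_at[OF fin(1)])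
  let ?s = "Arrow A \<sigma> B" and ?t = "Arrow B \<tau> D" and ?C = "Cmp (Grp R A)"
  note \<tau>\<sigma> = S.cmp_hom[OF \<sigma> \<tau>, simplified]
  note \<phi>A = functor_arr[OF ftr\<phi>[OF fin(1)]] and \<phi>B = functor_arr[OF ftr\<phi>[OF fin(2)]]
    and \<phi>D = functor_arr[OF ftr\<phi>[OF finD]]
    and s' = functor_arr[OF S.pull[OF \<sigma>]] and s = functor_arr[OF T.pull[OF \<sigma>]]
    and t' = functor_arr[OF S.pull[OF \<tau>]] and tt = functor_arr[OF T.pull[OF \<tau>]]
  note simps = \<phi>A(1-4) \<phi>B(1-4) \<phi>D(1-4) s'(1-4) s(1-4) t'(1-4) tt(1-4) cell_arr[OF \<phi> \<sigma>]
    cell_arr[OF \<phi> \<tau>]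
    cell_arr[OF \<phi> \<tau>\<sigma>] S.cpr_arr[OF \<sigma> \<tau>, simplified] T.cpr_arr[OF \<sigma> \<tau>, simplified] HomD[OF h]
      HomD[OF k] Y Z
    A.arr_simps B.arr_simps A'.arr_simps
  have "?C (Cell \<phi> (Arrow A (compose A \<tau> \<sigma>) D) Z)
      (FA (Cmpt \<phi> A) (Cmp (Grp R' A) (Cpr R' ?s ?t Z) (Cmp (Grp R' A) (FA (Pull R' ?s) k) h))) =
    ?C (?C (Cell \<phi> (Arrow A (compose A \<tau> \<sigma>) D) Z) (FA (Cmpt \<phi> A) (Cpr R' ?s ?t Z)))
      (?C (FA (Cmpt \<phi> A) (FA (Pull R' ?s) k)) (FA (Cmpt \<phi> A) h))"
    by (simp add: simps \<phi>A(6))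
  also have "\<dots> = ?C (Cpr R ?s ?t (FO (Cmpt \<phi> D) Z)) (?C (FA (Pull R ?s) (Cell \<phi> ?t Z))
      (?C (?C (Cell \<phi> ?s (FO (Pull R' ?t) Z)) (FA (Cmpt \<phi> A) (FA (Pull R' ?s) k)))
        (FA (Cmpt \<phi> A) h)))"
    using pseudonatural_cpr[OF \<phi> \<sigma> \<tau> Z] by (simp add: simps)
  also have "\<dots> = ?C (Cpr R ?s ?t (FO (Cmpt \<phi> D) Z))
    (?C (FA (Pull R ?s) (Cmp (Grp R B) (Cell \<phi> ?t Z) (FA (Cmpt \<phi> B) k)))
      (?C (Cell \<phi> ?s Y) (FA (Cmpt \<phi> A) h)))"
    unfolding cell_nat[OF \<phi> \<sigma> k, symmetric] by (simp add: simps s(6))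
  finally have eq: "?C (Cell \<phi> (Arrow A (compose A \<tau> \<sigma>) D) Z)
      (FA (Cmpt \<phi> A) (Cmp (Grp R' A) (Cpr R' ?s ?t Z) (Cmp (Grp R' A) (FA (Pull R' ?s) k) h))) =
    ?C (Cpr R ?s ?t (FO (Cmpt \<phi> D) Z)) (?C (FA (Pull R ?s)
      (Cmp (Grp R B) (Cell \<phi> ?t Z) (FA (Cmpt \<phi> B) k)))
      (?C (Cell \<phi> ?s Y) (FA (Cmpt \<phi> A) h)))" .
  note arr = HomD(1)[OF S.total_cmp_hom[OF t u]] HomD(1)[OF t] HomD(1)[OF u]
  show ?thesis
    using arr unfolding t1 u1 total_cmp by (simp only: map_arr total_cmp eq)
qed

lemma is_functor_total_map: "is_functor (total R') (total R) \<Phi>"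
  by (rule functorI[OF S.total.category_axioms T.total.category_axioms map_in_total map_hom(1)
      map_ide map_cmp])
    (simp_all add: total_map_def)

lemma map_relabel:
  assumes t: "t \<in> Hom (total R') (A, p, X) (B, q, Y)"
  shows "FA \<Phi> (Arrow (A, p', X) (via t) (B, q', Y)) =
    Arrow (A, p', FO (Cmpt \<phi> A) X) (via (FA \<Phi> t)) (B, q', FO (Cmpt \<phi> B) Y)"
proof -
  obtain \<sigma> h where t1: "t = Arrow (A, p, X) (\<sigma>, h) (B, q, Y)" using t by (auto simp: total_hom)
  show ?thesis
    using HomD(1)[OF t] HomD(1)[OF S.relabel_hom[OF t, of p' q']] by (simp add: t1 map_arr)
qed

section \<open>The induced simplicial map\<close>

abbreviation M where "M \<equiv> layered_map R' R \<phi>"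

lemma map_layers_obj: "x \<in> Obj (layers R' n) \<Longrightarrow> FO \<Phi> x \<in> Obj (layers R n)"
  using functor_arr(1)[OF ftr\<phi>] by (cases x) (simp add: map_obj total_obj S.layers_obj T.layers_obj)

lemma fst_map: "x \<in> Obj (total R') \<Longrightarrow> fst (FO \<Phi> x) = fst x \<and> fst (snd (FO \<Phi> x)) = fst (snd x)"
  by (cases x) (simp add: map_obj)

lemma map_layers_hom:
  assumes t: "t \<in> Hom (layers R' n) x y"
  shows "FA \<Phi> t \<in> Hom (layers R n) (FO \<Phi> x) (FO \<Phi> y)"
proof -
  note ts = S.layers_homD[OF t]
  note xy = S.layers_total_obj[OF ts(1)] S.layers_total_obj[OF ts(2)]
  show ?thesis
    by (rule T.layers_homI[OF map_layers_obj[OF ts(1)] map_layers_obj[OF ts(2)]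
        map_hom(1)[OF ts(3)]])
      (simp_all add: map_hom(2)[OF ts(3)] fst_map[OF xy(1)] fst_map[OF xy(2)] ts(4,5))
qed

lemma layered_cmpt_obj: "x \<in> Obj (layers R' n) \<Longrightarrow> FO (Cmpt M n) x = FO \<Phi> x"
  using S.layers_total_obj[of x n] by (cases x) (simp add: layered_map_def Let_def map_obj)

lemma layered_cmpt_hom:
  assumes t: "t \<in> Hom (layers R' n) x y"
  shows "FA (Cmpt M n) t = FA \<Phi> t"
proof -
  note ts = S.layers_homD[OF t]
  obtain A p X B q Y where x: "x = (A, p, X)" and y: "y = (B, q, Y)" by (metis prod_cases3)
  obtain \<sigma> h where t1: "t = Arrow (A, p, X) (\<sigma>, h) (B, q, Y)" using ts(3)
    by (auto simp: x y total_hom)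
  show ?thesis
    using HomD(1)[OF t] HomD(1)[OF ts(3)] by (simp add: layered_map_def Let_def t1 map_arr)
qed

text \<open>After passing to structure components, the factorization of the image of an inclusion is
  one equation in the groupoid over \<open>A'\<close>, relating the \<open>to_restriction\<close>
  arrows of both species through \<phi>.\<close>

lemma layered_cell:
  assumes a: "a \<in> Hom Delta m n" and w: "w \<in> Obj (layers R' n)"
  shows "Cell M a w \<in> Hom (layers R m) (FO \<Phi> (FO (layers_pull R' a) w))
    (FO (layers_pull R a) (FO \<Phi> w))"
    and "Cmp (total R) (inclusion R a (FO \<Phi> w)) (Cell M a w) = FA \<Phi> (inclusion R' a w)"
proof -
  obtain A p X where ww: "w = (A, p, X)" by (metis prod_cases3)
  note w = w[unfolded ww]
  have fin: "finite A" and X: "X \<in> Obj (Grp R' A)" using w by (simp_all add: S.layers_obj)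
  define A' p' where "A' = layer_set a A p" and "p' = layer_map a A p"
  define X' Y where "X' = layer_str R' a A p X" and "Y = layer_str R a A p (FO (Cmpt \<phi> A) X)"
  have sub: "A' \<subseteq> A" unfolding A'_def by (rule layer_set_subset)
  note i = incl_hom[OF fin sub]
  have finA': "finite A'" using fin sub finite_subset by blast
  interpret G: groupoid "Grp R A'" by (rule T.groupoid_at[OF finA'])
  interpret G': groupoid "Grp R' A'" by (rule S.groupoid_at[OF finA'])
  have \<Phi>w: "FO \<Phi> (A, p, X) = (A, p, FO (Cmpt \<phi> A) X)" by (rule map_obj[OF S.layers_total_obj[OF w]])
  note \<Phi>wl = map_layers_obj[OF w, unfolded \<Phi>w]
  have pw: "FO (layers_pull R' a) (A, p, X) = (A', p', X')"
    unfolding A'_def p'_def X'_def by (rule S.layers_pull_obj[OF a w])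
  have p\<Phi>w: "FO (layers_pull R a) (A, p, FO (Cmpt \<phi> A) X) = (A', p', Y)"
    unfolding A'_def p'_def Y_def by (rule T.layers_pull_obj[OF a \<Phi>wl])
  note pwl = S.layers_pull_in_layers[OF a w, unfolded pw]
  have \<Phi>pw: "FO \<Phi> (A', p', X') = (A', p', FO (Cmpt \<phi> A') X')"
    by (rule map_obj[OF S.layers_total_obj[OF pwl]])
  define kk where "kk = (if generic a then Ide (Grp R A) (FO (Cmpt \<phi> A) X) else Cell \<phi> (incl A' A)
    X)"
  have cell: "Cell M a w = lift_arr R A' p' (FO (Cmpt \<phi> A') X') kk Y"
    using w HomD(1)[OF a] Delta_homD(2)[OF a]
    by (simp add: layered_map_def Let_def ww pw p\<Phi>w kk_def)
  have A'gen: "A' = A" if "generic a" using S.layer_set_generic_obj[OF that a w]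
    by (simp add: A'_def)
  define \<rho> \<rho>' where "\<rho> = to_restriction R a (A, p, FO (Cmpt \<phi> A) X)"
    and "\<rho>' = to_restriction R' a (A, p, X)"
  have \<rho>: "\<rho> \<in> Hom (Grp R A') Y (FO (Pull R (incl A' A)) (FO (Cmpt \<phi> A) X))"
    unfolding \<rho>_def Y_def A'_def by (rule T.to_restriction_hom[OF a \<Phi>wl])
  have \<rho>': "\<rho>' \<in> Hom (Grp R' A') X' (FO (Pull R' (incl A' A)) X)"
    unfolding \<rho>'_def X'_def A'_def by (rule S.to_restriction_hom[OF a w])
  note \<phi>X = functor_arr(1)[OF ftr\<phi>[OF fin] X]
  have kk: "kk \<in> Hom (Grp R A') (FO (Cmpt \<phi> A') X') Y"
  proof (cases "generic a")
    case True
    then show ?thesis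
      using G.ide_hom \<phi>X unfolding kk_def X'_def Y_def layer_str_def A'gen[OF True] by simp
  next
    case False
    then show ?thesis
      using cell_arr[OF \<phi> i X] by (simp add: kk_def X'_def Y_def layer_str_def Hom_def flip: A'_def)
  qed
  \<comment> \<open>For generic \<open>a\<close> both \<open>to_restriction\<close> arrows are
    units, and the equation is the unit law of \<phi>. Otherwise both are identities, and each side
    reduces to the cell of \<phi> at the inclusion of \<open>A'\<close>.\<close>
  have eq: "Cmp (Grp R A') \<rho> kk = Cmp (Grp R A') (Cell \<phi> (incl A' A) X) (FA (Cmpt \<phi> A') \<rho>')"
  proof (cases "generic a")
    case True
    have "\<rho> = Unt R A (FO (Cmpt \<phi> A) X)" "\<rho>' = Unt R' A X"
      using True by (simp_all add: \<rho>_def \<rho>'_def to_restriction_def)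
    then show ?thesis
      using pseudonatural_unt[OF \<phi>, of A X] fin X T.unt_arr[OF _ \<phi>X] G.ide_right[of \<rho>]
      by (simp add: kk_def True A'gen incl_def)
  next
    case False
    have "\<rho> = Ide (Grp R A') (FO (Pull R (incl A' A)) (FO (Cmpt \<phi> A) X))"
      "\<rho>' = Ide (Grp R' A') (FO (Pull R' (incl A' A)) X)"
      using False by (simp_all add: \<rho>_def \<rho>'_def to_restriction_def free_set_free_part A'_def
          Let_def)
    then show ?thesis
      using False cell_arr[OF \<phi> i X] functor_arr(1)[OF S.pull[OF i] X]
      by (simp add: kk_def G.ide_left G.ide_right functor_arr(5)[OF ftr\<phi>[OF finA']])
  qed
  have "p' \<in> A' \<rightarrow>\<^sub>E {1..m}" unfolding A'_def p'_def by (rule layer_map_funcset[OF a])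
  then show "Cell M a w \<in> Hom (layers R m) (FO \<Phi> (FO (layers_pull R' a) w))
    (FO (layers_pull R a) (FO \<Phi> w))"
    unfolding cell unfolding ww pw \<Phi>w p\<Phi>w \<Phi>pw by (rule T.lift_arr_layers[OF _ finA' kk])
  have incR: "inclusion R a (A, p, FO (Cmpt \<phi> A) X) =
      Arrow (A', p', Y) (\<lambda>x \<in> A'. x, \<rho>) (A, p, FO (Cmpt \<phi> A) X)"
    by (simp add: inclusion_def p\<Phi>w \<rho>_def)
  have incR': "inclusion R' a (A, p, X) = Arrow (A', p', X') (\<lambda>x \<in> A'. x, \<rho>') (A, p, X)"
    by (simp add: inclusion_def pw \<rho>'_def)
  have "Cmp (total R) (inclusion R a (FO \<Phi> w)) (Cell M a w) =
      Arrow (A', p', FO (Cmpt \<phi> A') X') (\<lambda>x \<in> A'. x, Cmp (Grp R A') \<rho> kk) (A, p, FO (Cmpt \<phi> A) X)"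
    unfolding cell unfolding ww \<Phi>w incR
    by (rule T.cmp_lift_arr[OF finA' kk]) (use T.inclusion_hom[OF a \<Phi>wl] in \<open>simp add: incR p\<Phi>w\<close>)
  also have "\<dots> = FA \<Phi> (inclusion R' a w)"
    unfolding eq ww incR' using map_arr[OF HomD(1)[OF S.inclusion_hom[OF a w], unfolded incR']]
    by (simp add: incl_def)
  finally show "Cmp (total R) (inclusion R a (FO \<Phi> w)) (Cell M a w) = FA \<Phi> (inclusion R' a w)" .
qed

sublocale M: restriction_transformation Delta "total R'" "layered R'" "inclusion R'"
  "total R" "layered R" "inclusion R" \<Phi> M
proof (intro restriction_transformation.intro S.layered.restriction_system_axioms
    T.layered.restriction_system_axioms restriction_transformation_axioms.intro,
    unfold S.layered_simps T.layered_simps)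
  show "is_functor (total R') (total R) \<Phi>" by (rule is_functor_total_map)
  show "Cmpt M \<in> extensional (Obj Delta)" by simp
  show "Cell M \<in> extensional (Arr Delta)" by (simp add: layered_map_def Let_def)
  show "FO (Cmpt M c) x = FO \<Phi> x \<and> FO \<Phi> x \<in> Obj (layers R c)" if "x \<in> Obj (layers R' c)" for c x
    using layered_cmpt_obj[OF that] map_layers_obj[OF that] by blast
  show "FA (Cmpt M c) f = FA \<Phi> f \<and> FA \<Phi> f \<in> Hom (layers R c) (FO \<Phi> x) (FO \<Phi> y)"
    if "f \<in> Hom (layers R' c) x y" for c f x y
    using layered_cmpt_hom[OF that] map_layers_hom[OF that] by blast
  show "FO (Cmpt M c) \<in> extensional (Obj (layers R' c))" "FA (Cmpt M c) \<in> extensional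
    (Arr (layers R' c))" for c
    by (simp_all add: layered_map_def Let_def)
  show "Cell M u \<in> extensional (Obj (layers R' c))" if "u \<in> Hom Delta b c" for u b c
    using HomD(1)[OF that] Delta_homD(2)[OF that] by (simp add: layered_map_def Let_def)
  show "Cell M u x \<in> Hom (layers R b) (FO \<Phi> (FO (layers_pull R' u) x))
    (FO (layers_pull R u) (FO \<Phi> x))"
    if "u \<in> Hom Delta b c" "x \<in> Obj (layers R' c)" for u b c x
    using that by (rule layered_cell(1))
  show "Cmp (total R) (inclusion R u (FO \<Phi> x)) (Cell M u x) = FA \<Phi> (inclusion R' u x)"
    if "u \<in> Hom Delta b c" "x \<in> Obj (layers R' c)" for u b c x
    using that by (rule layered_cell(2))
qed

text \<open>A generic map changes only the layering and \<phi> changes only the structure, so the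
  naturality square commutes strictly.\<close>

lemma generic_cell:
  assumes a: "generic a" "a \<in> Hom Delta m n" and w: "w \<in> Obj (layers R' n)"
  shows "FO \<Phi> (FO (layers_pull R' a) w) = FO (layers_pull R a) (FO \<Phi> w)"
    and "Cell M a w = Ide (total R) (FO (layers_pull R a) (FO \<Phi> w))"
proof -
  obtain A p X where ww: "w = (A, p, X)" by (metis prod_cases3)
  note w = w[unfolded ww]
  have fin: "finite A" and X: "X \<in> Obj (Grp R' A)" using w by (simp_all add: S.layers_obj)
  have \<Phi>w: "FO \<Phi> (A, p, X) = (A, p, FO (Cmpt \<phi> A) X)" by (rule map_obj[OF S.layers_total_obj[OF w]])
  note \<Phi>wl = map_layers_obj[OF w, unfolded \<Phi>w]
  note pw = S.generic_pull_obj[OF a w] and p\<Phi>w = T.generic_pull_obj[OF a \<Phi>wl]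
  note pwl = S.layers_pull_in_layers[OF a(2) w, unfolded pw]
  show "FO \<Phi> (FO (layers_pull R' a) w) = FO (layers_pull R a) (FO \<Phi> w)"
    unfolding ww pw \<Phi>w p\<Phi>w by (rule map_obj[OF S.layers_total_obj[OF pwl]])
  interpret G: groupoid "Grp R A" by (rule T.groupoid_at[OF fin])
  note \<phi>X = functor_arr(1)[OF ftr\<phi>[OF fin] X]
  have "Cell M a w = lift_arr R A (layer_map a A p) (FO (Cmpt \<phi> A) X)
    (Ide (Grp R A) (FO (Cmpt \<phi> A) X)) (FO (Cmpt \<phi> A) X)"
    using w HomD(1)[OF a(2)] Delta_homD(2)[OF a(2)] a(1)
    by (simp add: layered_map_def Let_def ww pw p\<Phi>w)
  also have "\<dots> = Ide (total R) (FO (layers_pull R a) (FO \<Phi> w))"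
    using T.unt_arr[of A, OF _ \<phi>X] fin by (simp add: lift_arr_def ww \<Phi>w p\<Phi>w total_ide G.ide_right)
  finally show "Cell M a w = Ide (total R) (FO (layers_pull R a) (FO \<Phi> w))" .
qed

text \<open>With identity cells, compatibility of \<open>a\<close> and \<open>b\<close> says that
  they have the same image. The structure component of a lift is then that of \<open>a\<close>,
  while \<open>b\<close> shows that the fine layers are preserved. For essential surjectivity, the
  fine layering is pulled back along the bijection underlying \<open>\<zeta>\<close>.\<close>

lemma culf_layered_map: "culf (layered R') (layered R) M"
  unfolding culf_iff[OF M.pseudonatural] S.layered_simps T.layered_simps
proof (intro allI impI)
  fix g assume gen: "generic g"
  define n m where "n = src g" and "m = tgt g"
  have g: "g \<in> Hom Delta n m" unfolding n_def m_def by (rule generic_hom[OF gen])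
  interpret S': groupoid "layers R' n" by (rule S.groupoid_layers)
  interpret T': groupoid "layers R n" by (rule T.groupoid_layers)
  have "pullback_conditions (layers R' m) (layers R' n) (layers R m) (layers R n) (layers_pull R' g)
      (Cmpt M m) (Cmpt M n) (layers_pull R g) (Cell M g)"
    unfolding pullback_conditions_def
  proof (intro conjI ballI impI)
    fix w w' a b
    assume w: "w \<in> Obj (layers R' m)" and w': "w' \<in> Obj (layers R' m)"
      and a: "a \<in> Hom (layers R' n) (FO (layers_pull R' g) w) (FO (layers_pull R' g) w')"
      and b: "b \<in> Hom (layers R m) (FO (Cmpt M m) w) (FO (Cmpt M m) w')"
      and eq: "Cmp (layers R n) (Cell M g w') (FA (Cmpt M n) a) =
        Cmp (layers R n) (FA (layers_pull R g) b) (Cell M g w)"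
    have b: "b \<in> Hom (layers R m) (FO \<Phi> w) (FO \<Phi> w')"
      using b by (simp add: layered_cmpt_obj w w')
    note gc = generic_cell[OF gen g w] and gc' = generic_cell[OF gen g w']
    note \<Phi>a = map_layers_hom[OF a, unfolded gc(1) gc'(1)] and gb = T.layers_pull_hom[OF g b]
    have \<Phi>a_gb: "FA \<Phi> a = FA (layers_pull R g) b"
      using eq T'.cmp_ide_left[OF \<Phi>a] T'.cmp_ide_right[OF gb]
      by (simp add: layered_cmpt_hom[OF a] gc(2) gc'(2) T.layers_ops)
    obtain A p X B q Y where ww: "w = (A, p, X)" "w' = (B, q, Y)" by (metis prod_cases3)
    note gw = S.generic_pull_obj[OF gen g w[unfolded ww]]
      S.generic_pull_obj[OF gen g w'[unfolded ww]]
    have \<Phi>w: "FO \<Phi> w = (A, p, FO (Cmpt \<phi> A) X)" "FO \<Phi> w' = (B, q, FO (Cmpt \<phi> B) Y)"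
      unfolding ww by (rule map_obj S.layers_total_obj w[unfolded ww] w'[unfolded ww])+
    note aE = S.layers_homD(3)[OF a, unfolded ww gw]
    note bE = T.layers_homD(3)[OF b]
    \<comment> \<open>Forced by the condition for the generic map \<open>g\<close>, which acts on
      arrows by relabelling.\<close>
    define t where "t = Arrow w (via a) w'"
    have tE: "t \<in> Hom (total R') w w'" using S.relabel_hom[OF aE] by (simp add: t_def ww)
    \<comment> \<open>Relabelling leaves the \<open>via\<close> part untouched, so equality after
      \<open>g\<close> already gives the image of \<open>t\<close> under \<open>\<Phi>\<close> as
      \<open>b\<close>.\<close>
    have via: "via (FA \<Phi> a) = via b" unfolding \<Phi>a_gb T.generic_pull_arr[OF gen g b] by simp
    have \<Phi>t: "FA \<Phi> t = b"
      using map_relabel[OF aE, of p q] total_homD(3)[OF bE] unfolding via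
      by (simp add: t_def ww \<Phi>w[unfolded ww])
    have base: "base t = base b" unfolding \<Phi>t[symmetric] by (rule map_hom(2)[OF tE, symmetric])
    have tl: "t \<in> Hom (layers R' m) w w'"
      by (rule S.layers_homI[OF w w' tE])
        (use T.layers_homD(4,5)[OF b] in \<open>simp_all add: base \<Phi>w, simp_all add: ww\<close>)
    have gt: "FA (layers_pull R' g) t = a"
      unfolding S.generic_pull_arr[OF gen g tl]
      by (simp add: t_def total_homD(3)[OF S.layers_homD(3)[OF a], symmetric])
    have unique: "t' = t" if "t' \<in> Hom (layers R' m) w w'" "FA (layers_pull R' g) t' = a" for t'
      using that(2) total_homD(3)[OF S.layers_homD(3)[OF that(1)]]
      unfolding S.generic_pull_arr[OF gen g that(1)] t_def by (metis arrow.sel(2))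
    show "\<exists>!t. t \<in> Hom (layers R' m) w w' \<and> FA (layers_pull R' g) t = a \<and> FA (Cmpt M m) t = b"
      using tl gt \<Phi>t unique layered_cmpt_hom[OF tl] by metis
  next
    fix x y \<zeta>
    assume x: "x \<in> Obj (layers R' n)" and y: "y \<in> Obj (layers R m)"
      and \<zeta>: "\<zeta> \<in> Hom (layers R n) (FO (Cmpt M n) x) (FO (layers_pull R g) y)"
    have \<zeta>: "\<zeta> \<in> Hom (layers R n) (FO \<Phi> x) (FO (layers_pull R g) y)"
      using \<zeta> by (simp add: layered_cmpt_obj x)
    obtain A p X B s Y where xy: "x = (A, p, X)" "y = (B, s, Y)" by (metis prod_cases3)
    note \<zeta>E = T.layers_homD(3)[OF \<zeta>]
    have \<Phi>x: "FO \<Phi> (A, q, X) = (A, q, FO (Cmpt \<phi> A) X)" for q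
      using S.layers_total_obj[OF x] by (intro map_obj) (simp add: xy total_obj)
    note gy = T.generic_pull_obj[OF gen g y[unfolded xy]]
    have \<sigma>: "bij_betw (base \<zeta>) A B" using T.layers_homD(4)[OF \<zeta>] by (simp add: xy \<Phi>x gy)
    \<comment> \<open>The only layering of \<open>A\<close> for which \<open>\<zeta>\<close> becomes
      an arrow over the fine layers. It coarsens to \<open>p\<close> because \<open>\<zeta>\<close>
      respects the coarse layers.\<close>
    define r where "r = (\<lambda>a \<in> A. s (base \<zeta> a))"
    define w where "w = (A, r, X)"
    have s: "s \<in> B \<rightarrow>\<^sub>E {1..m}" using y unfolding xy T.layers_obj by blast
    have "r \<in> A \<rightarrow>\<^sub>E {1..m}"
      unfolding r_def restrict_PiE_iff using PiE_mem[OF s] bij_betwE[OF \<sigma>] by blast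
    then have w: "w \<in> Obj (layers R' m)" using x unfolding xy w_def S.layers_obj by blast
    note w0 = w[unfolded w_def]
    note sets = S.layer_set_generic_obj[OF gen g w0]
      T.layer_set_generic_obj[OF gen g y[unfolded xy]]
    have "layer_map g A r = p"
    proof (rule extensionalityI[of _ A])
      show "layer_map g A r \<in> extensional A" by (simp add: layer_map_def sets)
      show "p \<in> extensional A" using x by (simp add: xy S.layers_obj PiE_def)
      fix a assume a: "a \<in> A"
      have "base \<zeta> a \<in> B" using bij_betwE[OF \<sigma>] a by blast
      moreover have "layer_map g B s (base \<zeta> a) = p a"
        using T.layers_homD(5)[OF \<zeta>, of a] a by (simp add: xy \<Phi>x gy)
      moreover have "r a = s (base \<zeta> a)" using a by (simp add: r_def)
      ultimately show "layer_map g A r a = p a" using a by (simp add: layer_map_def sets)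
    qed
    then have gw: "FO (layers_pull R' g) w = x"
      by (simp add: w_def xy S.generic_pull_obj[OF gen g w0])
    note gc = generic_cell[OF gen g w, unfolded gw]
    \<comment> \<open>The arrow \<open>\<zeta>\<close> itself between the fine layerings; its image
      under \<open>g\<close> is \<open>\<zeta>\<close> again, so the other coordinate can be an
      identity.\<close>
    define b where "b = Arrow (FO \<Phi> w) (via \<zeta>) y"
    have bE: "b \<in> Hom (total R) (FO \<Phi> w) y"
      using T.relabel_hom[OF \<zeta>E[unfolded xy \<Phi>x gy]] by (simp add: b_def w_def xy \<Phi>x)
    have b: "b \<in> Hom (layers R m) (FO \<Phi> w) y"
      by (rule T.layers_homI[OF map_layers_obj[OF w] y bE])
        (use \<sigma> in \<open>simp_all add: b_def w_def \<Phi>x xy r_def\<close>)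
    have gb: "FA (layers_pull R g) b = \<zeta>"
      unfolding T.generic_pull_arr[OF gen g b] gc(1)[symmetric]
      by (simp add: b_def total_homD(3)[OF \<zeta>E, symmetric])
    note idx = S'.ide_hom[OF x]
    have "FA (Cmpt M n) (Ide (layers R' n) x) = Ide (layers R n) (FO \<Phi> x)"
      using layered_cmpt_hom[OF idx] map_ide[OF S.layers_total_obj[OF x]]
      by (simp add: S.layers_ops T.layers_ops)
    then have eq: "Cmp (layers R n) \<zeta> (FA (Cmpt M n) (Ide (layers R' n) x)) =
        Cmp (layers R n) (FA (layers_pull R g) b) (Cell M g w)"
      unfolding gb gc(2) gc(1)[symmetric] by (simp add: T.layers_ops)
    show "\<exists>w\<in>Obj (layers R' m). \<exists>a\<in>Hom (layers R' n) (FO (layers_pull R' g) w) x.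
        \<exists>b\<in>Hom (layers R m) (FO (Cmpt M m) w) y.
          Cmp (layers R n) \<zeta> (FA (Cmpt M n) a) =
            Cmp (layers R n) (FA (layers_pull R g) b) (Cell M g w)"
    proof (rule bexI[OF _ w], rule bexI)
      show "Ide (layers R' n) x \<in> Hom (layers R' n) (FO (layers_pull R' g) w) x" unfolding gw
        by (rule idx)
      show "\<exists>b\<in>Hom (layers R m) (FO (Cmpt M m) w) y. Cmp (layers R n) \<zeta>
        (FA (Cmpt M n) (Ide (layers R' n) x)) =
          Cmp (layers R n) (FA (layers_pull R g) b) (Cell M g w)"
        using b eq by (auto simp: layered_cmpt_obj[OF w])
    qed
  qed
  then show "pullback_conditions (layers R' (tgt g)) (layers R' (src g)) (layers R (tgt g))
    (layers R (src g))
      (layers_pull R' g) (Cmpt M (tgt g)) (Cmpt M (src g)) (layers_pull R g) (Cell M g)"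
    by (simp add: n_def m_def)
qed

end

section \<open>Functoriality\<close>

lemma (in species) species_map_id: "species_map R R (pnt_id fin_inj R)"
  by (intro species_map.intro species_map_axioms.intro species_axioms
      pseudonatural_id[OF pseudofunctor_axioms])

lemma (in species) total_map_id:
  assumes t: "t \<in> Hom E x y"
  shows "FA (total_map R R (pnt_id fin_inj R)) t = t"
proof -
  obtain A p X B q Y where x: "x = (A, p, X)" and y: "y = (B, q, Y)" by (metis prod_cases3)
  obtain \<sigma> h where t1: "t = Arrow (A, p, X) (\<sigma>, h) (B, q, Y)" and \<sigma>: "Arrow A \<sigma> B \<in> Hom fin_inj A B"
      and fin: "finite A" "finite B" and X: "X \<in> Obj (Grp R A)" and Y: "Y \<in> Obj (Grp R B)"
      and h: "h \<in> Hom (Grp R A) X (FO (Pull R (Arrow A \<sigma> B)) Y)"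
    using t by (auto simp: x y elim: total_homE)
  interpret A: groupoid "Grp R A" by (rule groupoid_at[OF fin(1)])
  interpret species_map R R "pnt_id fin_inj R" by (rule species_map_id)
  show ?thesis
    using map_arr[OF HomD(1)[OF t, unfolded t1]] HomD(1)[OF h] fin X Y A.cmp_ide_left[OF h]
    by (simp add: t1 pnt_id_simps(1) pnt_id_simps(2)[OF \<sigma>])
qed

text \<open>The cells are compared after the inclusion for \<open>a\<close>: the functor induced by
  the identity fixes every arrow, so the cell factors the inclusion through itself and must be an
  identity.\<close>

lemma (in species) layered_map_id:
  "layered_map R R (pnt_id fin_inj R) = pnt_id Delta (layered R)"
proof -
  interpret species_map R R "pnt_id fin_inj R" by (rule species_map_id)
  have obj: "FO \<Phi> x = x" if "x \<in> Obj E" for x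
    using that by (cases x) (simp add: map_obj total_obj pnt_id_simps(1))
  show ?thesis
  proof (rule pseudonatural_eqI[OF M.pseudonatural pseudonatural_id[OF layered.pseudofunctor]],
      unfold layered_simps)
    show "FO (Cmpt M n) x = FO (Cmpt (pnt_id Delta (layered R)) n) x" if x: "x \<in> Obj (layers R n)"
      for n x
      using layered_cmpt_obj[OF x] obj[OF layers_total_obj[OF x]] x
      by (simp add: pnt_id_simps(1) layered_simps)
    show "FA (Cmpt M n) t = FA (Cmpt (pnt_id Delta (layered R)) n) t" if t: "t \<in> Arr (layers R n)"
      for n t
    proof -
      note th = Arr_in_Hom[OF t]
      show ?thesis
        using layered_cmpt_hom[OF th] total_map_id[OF layers_homD(3)[OF th]] t
        by (simp add: pnt_id_simps(1) layered_simps)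
    qed
    fix a m n x assume a: "a \<in> Hom Delta m n" and x: "x \<in> Obj (layers R n)"
    interpret L: groupoid "layers R m" by (rule groupoid_layers)
    have px: "FO (layers_pull R a) x \<in> Obj (layers R m)" by (rule layers_pull_in_layers[OF a x])
    note ob = obj[OF layers_total_obj[OF x]] obj[OF layers_total_obj[OF px]]
    have "Cell M a x = Ide (layers R m) (FO (layers_pull R a) x)"
      using layered_cell[OF a x] total_cmp_ide_right[OF inclusion_hom[OF a x]]
          total_map_id[OF inclusion_hom[OF a x]]
      by (intro inclusion_eqI[OF a x _ L.ide_hom[OF px]]) (simp_all add: ob layers_ops)
    then show "Cell M a x = Cell (pnt_id Delta (layered R)) a x"
      using pnt_id_simps(2)[OF a, of x "layered R"] x by (simp add: layered_simps)
  qed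
qed

section \<open>Composites of morphisms of restriction species\<close>

locale species_map_pair = F: species_map R R' \<phi> + G: species_map R' R'' \<psi>
  for R :: "('u, 'o, 'm) species" and R' :: "('u, 'p, 'q) species" and R'' :: "('u, 'r, 's) species"
    and \<phi> and \<psi>
begin

abbreviation comp where "comp \<equiv> pnt_comp fin_inj R R'' \<psi> \<phi>"

sublocale H: species_map R R'' comp
  by (intro species_map.intro species_map_axioms.intro F.S.species_axioms G.T.species_axioms
      pseudonatural_comp[OF F.\<phi> G.\<phi>])

lemma comp_obj:
  assumes "x \<in> Obj (total R)"
  shows "FO H.\<Phi> x = FO G.\<Phi> (FO F.\<Phi> x)"
  using assms F.map_in_total[OF assms]
  by (cases x) (simp add: H.map_obj F.map_obj G.map_obj total_obj pnt_comp_simps(1))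

text \<open>On structure components this is the pasting formula for the cells of a composite
  transformation, with the functor at \<open>A\<close> applied to the inner composite.\<close>

lemma comp_hom:
  assumes t: "t \<in> Hom (total R) x y"
  shows "FA H.\<Phi> t = FA G.\<Phi> (FA F.\<Phi> t)"
proof -
  obtain A p X B q Y where x: "x = (A, p, X)" and y: "y = (B, q, Y)" by (metis prod_cases3)
  obtain \<sigma> h where t1: "t = Arrow (A, p, X) (\<sigma>, h) (B, q, Y)" and \<sigma>: "Arrow A \<sigma> B \<in> Hom fin_inj A B"
      and fin: "finite A" "finite B" and X: "X \<in> Obj (Grp R A)" and Y: "Y \<in> Obj (Grp R B)"
      and h: "h \<in> Hom (Grp R A) X (FO (Pull R (Arrow A \<sigma> B)) Y)"
    using t by (auto simp: x y elim: F.S.total_homE)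
  interpret A: groupoid "Grp R' A" by (rule F.T.groupoid_at[OF fin(1)])
  interpret A'': groupoid "Grp R'' A" by (rule G.T.groupoid_at[OF fin(1)])
  note \<phi>A = functor_arr[OF F.ftr\<phi>[OF fin(1)]] and \<phi>B = functor_arr[OF F.ftr\<phi>[OF fin(2)]]
    and \<psi>A = functor_arr[OF G.ftr\<phi>[OF fin(1)]]
  note c\<phi> = cell_arr[OF F.\<phi> \<sigma> Y] and c\<psi> = cell_arr[OF G.\<phi> \<sigma> \<phi>B(1)[OF Y]]
  note tF = F.map_arr[OF HomD(1)[OF t, unfolded t1]]
  note tG = G.map_arr[OF HomD(1)[OF F.map_hom(1)[OF t], unfolded t1 tF]]
  have "Cmp (Grp R'' A) (Cell comp (Arrow A \<sigma> B) Y) (FA (Cmpt comp A) h) =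
      Cmp (Grp R'' A) (Cell \<psi> (Arrow A \<sigma> B) (FO (Cmpt \<phi> B) Y))
        (FA (Cmpt \<psi> A) (Cmp (Grp R' A) (Cell \<phi> (Arrow A \<sigma> B) Y) (FA (Cmpt \<phi> A) h)))"
    using fin X Y HomD[OF h]
    by (simp add: pnt_comp_simps(1) pnt_comp_simps(2)[OF \<sigma>] \<psi>A \<phi>A c\<phi> c\<psi> A''.arr_simps)
  then show ?thesis
    using H.map_arr[OF HomD(1)[OF t, unfolded t1]] fin X Y
    by (simp add: t1 tF tG pnt_comp_simps(1))
qed

text \<open>Both cells are factorizations of the doubly transported inclusion through the inclusion
  over the last species, which is monic. No separate treatment of generic maps is required.\<close>

lemma layered_map_comp:
  "layered_map R R'' comp = pnt_comp Delta (layered R) (layered R'') (layered_map R' R'' \<psi>)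
    (layered_map R R' \<phi>)"
proof (rule pseudonatural_eqI[OF H.M.pseudonatural
  pseudonatural_comp[OF F.M.pseudonatural G.M.pseudonatural]],
    unfold F.S.layered_simps)
  let ?c = "pnt_comp Delta (layered R) (layered R'') G.M F.M"
  show "FO (Cmpt H.M n) x = FO (Cmpt ?c n) x" if x: "x \<in> Obj (layers R n)" for n x
    using x by (simp add: pnt_comp_simps(1) F.S.layered_simps H.layered_cmpt_obj F.layered_cmpt_obj
        G.layered_cmpt_obj F.map_layers_obj comp_obj F.S.layers_total_obj)
  show "FA (Cmpt H.M n) t = FA (Cmpt ?c n) t" if t: "t \<in> Arr (layers R n)" for n t
  proof -
    note th = Arr_in_Hom[OF t]
    show ?thesis
      using t by (simp add: pnt_comp_simps(1) F.S.layered_simps H.layered_cmpt_hom[OF th]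
          F.layered_cmpt_hom[OF th] G.layered_cmpt_hom[OF F.map_layers_hom[OF th]]
          comp_hom[OF F.S.layers_homD(3)[OF th]])
  qed
  fix a m n x assume a: "a \<in> Hom Delta m n" and x: "x \<in> Obj (layers R n)"
  interpret L: groupoid "layers R'' m" by (rule G.T.groupoid_layers)
  note Fx = F.map_layers_obj[OF x]
  note GFx = G.map_layers_obj[OF Fx]
  note px = F.S.layers_pull_in_layers[OF a x]
  note cF = F.layered_cell[OF a x] and cG = G.layered_cell[OF a Fx] and cH = H.layered_cell[OF a x]
  note ob = comp_obj[OF F.S.layers_total_obj[OF x]] comp_obj[OF F.S.layers_total_obj[OF px]]
  note GcF = G.map_layers_hom[OF cF(1)]
  note E = G.T.layers_homD(3)[OF GcF] G.T.layers_homD(3)[OF cG(1)]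
  have cell: "Cell ?c a x = Cmp (layers R'' m) (Cell G.M a (FO F.\<Phi> x)) (FA G.\<Phi> (Cell F.M a x))"
    using pnt_comp_simps(2)[OF a, of x "layered R" "layered R''" G.M F.M] x
    by (simp add: F.S.layered_simps G.T.layered_simps F.layered_cmpt_obj
        G.layered_cmpt_hom[OF cF(1)])
  have "Cmp (total R'') (inclusion R'' a (FO G.\<Phi> (FO F.\<Phi> x))) (Cell ?c a x) =
      Cmp (total R'') (FA G.\<Phi> (inclusion R' a (FO F.\<Phi> x))) (FA G.\<Phi> (Cell F.M a x))"
    by (simp add: cell G.T.layers_ops G.T.total_cmp_assoc[OF E G.T.inclusion_hom[OF a GFx]] cG(2))
  also have "\<dots> = FA G.\<Phi> (FA F.\<Phi> (inclusion R a x))"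
    by (simp add: G.map_cmp[OF F.T.layers_homD(3)[OF cF(1)] F.T.inclusion_hom[OF a Fx], symmetric]
        cF(2))
  also have "\<dots> = Cmp (total R'') (inclusion R'' a (FO G.\<Phi> (FO F.\<Phi> x))) (Cell H.M a x)"
    using cH(2) by (simp add: ob comp_hom[OF F.S.inclusion_hom[OF a x]])
  finally have eq: "Cmp (total R'') (inclusion R'' a (FO G.\<Phi> (FO F.\<Phi> x))) (Cell H.M a x) =
      Cmp (total R'') (inclusion R'' a (FO G.\<Phi> (FO F.\<Phi> x))) (Cell ?c a x)" ..
  show "Cell H.M a x = Cell ?c a x"
    by (rule G.T.inclusion_eqI[OF a GFx cH(1)[unfolded ob] L.cmp_hom[OF GcF cG(1), folded cell] eq])
qed

end

section \<open>Assembly of the functor from restriction species to decomposition spaces\<close>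

lemma species_iff: "species R \<longleftrightarrow> pseudofunctor fin_inj R"
  by (simp add: species_def)

lemma species_mapI: "species_morphism R' R \<phi> \<Longrightarrow> species_map R' R \<phi>"
  by (simp add: species_morphism_def restriction_species_def species_map_def species_map_axioms_def
      species_iff)

lemma decomposition_layered: "restriction_species R \<Longrightarrow> decomposition_space (layered R)"
  by (intro species.decomposition_space_layered) (simp add: species_iff restriction_species_def)

lemma is_functor_layering:
  "is_functor (RSp :: (('u, 'o, 'm) species, _) cat) Dcmp layering_ftr"
proof (rule functorI[OF category_RSp category_Dcmp])
  have rsp_hom: "h \<in> Hom RSp P Q \<longleftrightarrow> (\<exists>\<phi>. h = Arrow P \<phi> Q \<and> restriction_species P \<and>
    restriction_species Q \<and>
      species_morphism P Q \<phi>)" for h and P Q :: "('u, 'o, 'm) species"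
    by (auto simp: psf_cat_def Hom_def)
  have rsp_obj: "R \<in> Obj RSp \<longleftrightarrow> restriction_species R" for R :: "('u, 'o, 'm) species"
    by (simp add: psf_cat_def)
  have FO: "FO layering_ftr R = layered R" if "restriction_species R"
    for R :: "('u, 'o, 'm) species"
    using that by (simp add: layering_ftr_def rsp_obj)
  have FA: "FA layering_ftr (Arrow P \<phi> Q) = Arrow (layered P) (layered_map P Q \<phi>) (layered Q)"
    if "species_morphism P Q \<phi>" for P Q :: "('u, 'o, 'm) species" and \<phi>
  proof -
    have "Arrow P \<phi> Q \<in> Arr RSp" using that by (simp add: psf_cat_def species_morphism_def)
    then show ?thesis by (simp add: layering_ftr_def)
  qed
  show "FO layering_ftr R \<in> Obj Dcmp" if "R \<in> Obj RSp" for R :: "('u, 'o, 'm) species"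
    using that decomposition_layered[of R] by (simp add: rsp_obj FO) (simp add: psf_cat_def)
  show "FA layering_ftr h \<in> Hom Dcmp (FO layering_ftr P) (FO layering_ftr Q)"
    if hom: "h \<in> Hom RSp P Q" for h and P Q :: "('u, 'o, 'm) species"
  proof -
    obtain \<phi> where h: "h = Arrow P \<phi> Q" "restriction_species P" "restriction_species Q"
      "species_morphism P Q \<phi>"
      using hom by (auto simp: rsp_hom)
    show ?thesis
      using decomposition_layered[OF h(2)] decomposition_layered[OF h(3)]
        species_map.culf_layered_map[OF species_mapI[OF h(4)]]
      by (simp add: h FO FA) (simp add: psf_cat_def Hom_def)
  qed
  show "FA layering_ftr (Ide RSp R) = Ide Dcmp (FO layering_ftr R)" if "R \<in> Obj RSp"
    for R :: "('u, 'o, 'm) species"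
  proof -
    have R: "restriction_species R" using that by (simp add: rsp_obj)
    then interpret species R by (simp add: species_iff restriction_species_def)
    have "species_morphism R R (pnt_id fin_inj R)"
      using R pseudonatural_id[OF pseudofunctor_axioms] by (simp add: species_morphism_def)
    note FA[OF this]
    then show ?thesis by (simp add: FO[OF R] layered_map_id) (simp add: psf_cat_def)
  qed
  show "FA layering_ftr (Cmp RSp k h) = Cmp Dcmp (FA layering_ftr k) (FA layering_ftr h)"
    if hk: "h \<in> Hom RSp P Q" "k \<in> Hom RSp Q S" for h k and P Q S :: "('u, 'o, 'm) species"
  proof -
    obtain \<phi> where h: "h = Arrow P \<phi> Q" "species_morphism P Q \<phi>" using hk by (auto simp: rsp_hom)
    obtain \<psi> where k: "k = Arrow Q \<psi> S" "species_morphism Q S \<psi>" using hk by (auto simp: rsp_hom)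
    interpret species_map_pair P Q S \<phi> \<psi>
      by (intro species_map_pair.intro species_mapI h k)
    have "species_morphism P S comp"
      using h k pseudonatural_comp by (simp add: species_morphism_def H.\<phi>)
    then show ?thesis
      by (simp add: h k FA layered_map_comp psf_cat_def[of Delta]) (simp add:
          psf_cat_def FA layered_map_comp)
  qed
qed (simp_all add: layering_ftr_def)

theorem theorem5p8:
  fixes R :: "('u, 'o, 'm) species" and R' :: "('u, 'p, 'q) species"
    and \<phi> :: "('u set, ('u set, 'u \<Rightarrow> 'u) arrow, 'p, 'q, 'o, 'm) pnt"
  shows "(restriction_species R \<longrightarrow> simplicial_groupoid (layered R) \<and> decomposition_space (layered R))
    \<and>
    (species_morphism R' R \<phi> \<longrightarrow> culf (layered R') (layered R) (layered_map R' R \<phi>)) \<and>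
    is_functor (RSp :: (('u, 'o, 'm) species, _) cat) Dcmp layering_ftr"
  using decomposition_layered[of R] species_map.culf_layered_map[OF species_mapI, of R' R \<phi>]
      is_functor_layering
  by (auto simp: decomposition_space_def)

end
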